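(* Let $Q$ be a finite quiver on $k$ vertices, $\Pi_0$ its preprojective algebra, and let $\alpha=(a_1,\dots,a_k)\in S_{\underline{0}}$, $n=\sum_ia_i$. Let $\xi\in\mathrm{iss}_\alpha\,\Pi_0$ and let $M_\xi$ be the corresponding semisimple $\alpha$-dimensional representation. Then $\xi\in\mathrm{Sm}_\alpha\,\Pi_0$ if and only if $M_\xi$ is a simple $n$-dimensional representation of $\Pi_0$. That is, the smooth locus of $\Pi_0$ (in $\mathrm{iss}_\alpha\,\Pi_0$) coincides with the Azumaya locus.
   Context: A quiver $Q$ is a finite directed graph with vertices $v_1,\dots,v_k$ and finite arrow set $Q_a$ (loops and multiple arrows allowed). The double quiver $\overline{Q}$ is obtained by adjoining, for every $a\in Q_a$ from $v_i$ to $v_j$, an arrow $a^*$ from $v_j$ to $v_i$. The preprojective algebra is $\Pi_0=\mathbb{C}\overline{Q}/(\sum_{a\in Q_a}(aa^*-a^*a))$, where $\mathbb{C}\overline Q$ is the path algebra. For $\alpha\in\mathbb{N}^k$, $\mathrm{rep}_\alpha\Pi_0$ denotes the affine scheme of $\alpha$-dimensional representations of $\Pi_0$: the closed subscheme of $\mathrm{rep}_\alpha\overline{Q}=\bigoplus_b\mathrm{Hom}(\mathbb{C}^{a_{s(b)}},\mathbb{C}^{a_{t(b)}})$ (sum over arrows $b$ of $\overline{Q}$) defined by $\sum_{a\in Q_a}[V_a,V_{a^*}]=0$. $GL(\alpha)=\prod_iGL_{a_i}(\mathbb{C})$ acts by base change, and $\pi:\mathrm{rep}_\alpha\Pi_0\to\mathrm{iss}_\alpha\Pi_0=\mathrm{rep}_\alpha\Pi_0/GL(\alpha)$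 is the affine quotient, whose geometric points correspond to isomorphism classes of semisimple $\alpha$-dimensional representations. The $\alpha$-smooth locus $\mathrm{Sm}_\alpha\Pi_0$ is the set of $\xi\in\mathrm{iss}_\alpha\Pi_0$ such that the scheme $\mathrm{rep}_\alpha\Pi_0$ is smooth along $\pi^{-1}(\xi)$ (equivalently, along the closed orbit of $M_\xi$). The Azumaya locus is the set of $\xi$ over which the algebra of $GL(\alpha)$-equivariant polynomial maps $\mathrm{rep}_\alpha\Pi_0\to M_n(\mathbb{C})$ is Azumaya, i.e. the set of $\xi$ for which $M_\xi$ is simple. Euler form: $\chi_Q$ is the bilinear form on $\mathbb{Z}^k$ with matrix $\chi_{ij}=\delta_{ij}-\#\{a\in Q_a:a\text{ goes from }v_i\text{ to }v_j\}$. A root of $Q$ is a dimension vector for which $Q$ has an indecomposable representation over $\mathbb{C}$. $S_{\underline0}$ is the set of roots $\alpha$ of $Q$ such that $1-\chi_Q(\alpha,\alpha)\ge r-\chi_Q(\beta_1,\beta_1)-\cdots-\chi_Q(\beta_r,\beta_r)$ for all decompositions $\alpha=\beta_1+\cdots+\beta_r$ with all $\beta_i$ roots of $Q$. *)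

theory Defs
  imports
    Complex_Main
    "HOL-Library.Poly_Mapping"
    "Graph_Theory.Digraph"
    "Jordan_Normal_Form.VS_Connect"
begin

section \<open>Polynomials and affine schemes over the complex numbers\<close>

text \<open>Monomials are finitely supported exponent functions on the index type of the variables.
  That type may be infinite; the polynomial ring of affine space with coordinate set \<open>C\<close> is
  the subring \<open>poly_ring C\<close> of polynomials in the variables from \<open>C\<close>.\<close>

type_synonym 'c cpoly = "('c \<Rightarrow>\<^sub>0 nat) \<Rightarrow>\<^sub>0 complex"

definition Const :: "complex \<Rightarrow> 'c cpoly" where
  "Const c = Poly_Mapping.single 0 c"

definition Var :: "'c \<Rightarrow> 'c cpoly" where
  "Var z = Poly_Mapping.single (Poly_Mapping.single z 1) 1"

definition poly_ring :: "'c set \<Rightarrow> 'c cpoly set" where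
  "poly_ring C = {p. \<forall>m\<in>Poly_Mapping.keys p. Poly_Mapping.keys m \<subseteq> C}"

text \<open>Evaluation in a commutative ring, with \<open>\<phi>\<close> the structure map on the coefficients:
  \<open>\<phi> = id\<close> gives the value at a point, \<open>\<phi> = Const\<close> gives substitution of polynomials.\<close>

definition poly_eval :: "(complex \<Rightarrow> 'r::comm_ring_1) \<Rightarrow> ('c \<Rightarrow> 'r) \<Rightarrow> 'c cpoly \<Rightarrow> 'r" where
  "poly_eval \<phi> x p =
     (\<Sum>m\<in>Poly_Mapping.keys p. \<phi> (Poly_Mapping.lookup p m) *
        (\<Prod>z\<in>Poly_Mapping.keys m. x z ^ Poly_Mapping.lookup m z))"

definition partial_deriv :: "'c \<Rightarrow> 'c cpoly \<Rightarrow> 'c cpoly" where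
  "partial_deriv z p =
     (\<Sum>m\<in>Poly_Mapping.keys p.
        Poly_Mapping.single (m - Poly_Mapping.single z 1)
          (of_nat (Poly_Mapping.lookup m z) * Poly_Mapping.lookup p m))"

definition ideal_gen :: "'c set \<Rightarrow> 'c cpoly set \<Rightarrow> 'c cpoly set" where
  "ideal_gen C F =
     {f. \<exists>S q. finite S \<and> S \<subseteq> F \<and> (\<forall>s\<in>S. q s \<in> poly_ring C) \<and> f = (\<Sum>s\<in>S. q s * s)}"

text \<open>Smoothness over the complex numbers, at the closed point \<open>x\<close>, of the closed subscheme of
  affine space (with coordinate set \<open>C\<close>) defined by the ideal \<open>I\<close>, which need not be radical.
  This is the definition in Bosch, Luetkebohmert, Raynaud, Neron Models, 2.2, Definition 3
  (for the given immersion): locally at \<open>x\<close> the sheaf of ideals is generated by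
  sections whose differentials at \<open>x\<close> are linearly independent. The second condition says that
  the \<open>g k\<close> generate the extension of \<open>I\<close> to the local ring of the affine space at \<open>x\<close>; taking
  the \<open>g k\<close> in \<open>I\<close> itself rather than in this extension is no restriction, as denominators are
  units at \<open>x\<close>.\<close>

definition scheme_smooth_at :: "'c set \<Rightarrow> 'c cpoly set \<Rightarrow> ('c \<Rightarrow> complex) \<Rightarrow> bool" where
  "scheme_smooth_at C I x \<longleftrightarrow>
     (\<forall>f\<in>I. poly_eval id x f = 0) \<and>
     (\<exists>(r::nat) g.
        (\<forall>k<r. g k \<in> I) \<and>
        (\<forall>f\<in>I. \<exists>h\<in>poly_ring C. poly_eval id x h \<noteq> 0 \<and> h * f \<in> ideal_gen C (g ` {..<r})) \<and>
        (\<forall>c::nat \<Rightarrow> complex.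
           (\<forall>z\<in>C. (\<Sum>k<r. c k * poly_eval id x (partial_deriv z (g k))) = 0) \<longrightarrow>
           (\<forall>k<r. c k = 0)))"

section \<open>Representations of quivers\<close>

text \<open>A quiver is a \<open>fin_digraph\<close>: loops and multiple arrows are allowed. A representation of
  dimension vector \<open>\<alpha>\<close> is a family of matrices indexed by the arrows; the arrow \<open>b\<close> acts as a
  linear map from the space at \<open>tail R b\<close> to the space at \<open>head R b\<close>.\<close>

definition rep_space :: "('v, 'b) pre_digraph \<Rightarrow> ('v \<Rightarrow> nat) \<Rightarrow> ('b \<Rightarrow> complex mat) set" where
  "rep_space R \<alpha> = (\<Pi>\<^sub>E b\<in>arcs R. carrier_mat (\<alpha> (head R b)) (\<alpha> (tail R b)))"

definition subrep ::
  "('v, 'b) pre_digraph \<Rightarrow> ('v \<Rightarrow> nat) \<Rightarrow> ('b \<Rightarrow> complex mat) \<Rightarrow> ('v \<Rightarrow> complex vec set) \<Rightarrow> bool" where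
  "subrep R \<alpha> V U \<longleftrightarrow>
     (\<forall>v\<in>verts R. VectorSpace.subspace class_ring (U v) (module_vec TYPE(complex) (\<alpha> v))) \<and>
     (\<forall>b\<in>arcs R. \<forall>u\<in>U (tail R b). V b *\<^sub>v u \<in> U (head R b))"

definition zero_subrep ::
  "('v, 'b) pre_digraph \<Rightarrow> ('v \<Rightarrow> nat) \<Rightarrow> ('v \<Rightarrow> complex vec set) \<Rightarrow> bool" where
  "zero_subrep R \<alpha> U \<longleftrightarrow> (\<forall>v\<in>verts R. U v = {0\<^sub>v (\<alpha> v)})"

definition simple_subrep ::
  "('v, 'b) pre_digraph \<Rightarrow> ('v \<Rightarrow> nat) \<Rightarrow> ('b \<Rightarrow> complex mat) \<Rightarrow> ('v \<Rightarrow> complex vec set) \<Rightarrow> bool" where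
  "simple_subrep R \<alpha> V S \<longleftrightarrow>
     subrep R \<alpha> V S \<and> \<not> zero_subrep R \<alpha> S \<and>
     (\<forall>U. subrep R \<alpha> V U \<and> (\<forall>v\<in>verts R. U v \<subseteq> S v) \<longrightarrow>
        zero_subrep R \<alpha> U \<or> (\<forall>v\<in>verts R. U v = S v))"

definition simple_rep ::
  "('v, 'b) pre_digraph \<Rightarrow> ('v \<Rightarrow> nat) \<Rightarrow> ('b \<Rightarrow> complex mat) \<Rightarrow> bool" where
  "simple_rep R \<alpha> V \<longleftrightarrow> simple_subrep R \<alpha> V (\<lambda>v. carrier_vec (\<alpha> v))"

definition direct_sum_decomp ::
  "('v, 'b) pre_digraph \<Rightarrow> ('v \<Rightarrow> nat) \<Rightarrow> ('b \<Rightarrow> complex mat) \<Rightarrow> nat \<Rightarrow>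
     (nat \<Rightarrow> 'v \<Rightarrow> complex vec set) \<Rightarrow> bool" where
  "direct_sum_decomp R \<alpha> V r S \<longleftrightarrow>
     (\<forall>k<r. subrep R \<alpha> V (S k)) \<and>
     (\<forall>v\<in>verts R. \<forall>x\<in>carrier_vec (\<alpha> v).
        \<exists>!u. u \<in> (\<Pi>\<^sub>E k\<in>{..<r}. S k v) \<and> x = finsum_vec TYPE(complex) (\<alpha> v) u {..<r})"

definition semisimple_rep ::
  "('v, 'b) pre_digraph \<Rightarrow> ('v \<Rightarrow> nat) \<Rightarrow> ('b \<Rightarrow> complex mat) \<Rightarrow> bool" where
  "semisimple_rep R \<alpha> V \<longleftrightarrow>
     (\<exists>r S. direct_sum_decomp R \<alpha> V r S \<and> (\<forall>k<r. simple_subrep R \<alpha> V (S k)))"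

definition indecomposable_rep ::
  "('v, 'b) pre_digraph \<Rightarrow> ('v \<Rightarrow> nat) \<Rightarrow> ('b \<Rightarrow> complex mat) \<Rightarrow> bool" where
  "indecomposable_rep R \<alpha> V \<longleftrightarrow>
     (\<exists>v\<in>verts R. \<alpha> v \<noteq> 0) \<and>
     (\<forall>S. direct_sum_decomp R \<alpha> V 2 S \<longrightarrow> zero_subrep R \<alpha> (S 0) \<or> zero_subrep R \<alpha> (S 1))"

section \<open>Roots, the Euler form and the set of dimension vectors of the theorem\<close>

text \<open>Dimension vectors vanish outside the vertex set, so that equality of dimension vectors is
  equality of functions.\<close>

definition quiver_roots :: "('v, 'a) pre_digraph \<Rightarrow> ('v \<Rightarrow> nat) set" where
  "quiver_roots Q =
     {\<beta>. (\<forall>v. v \<notin> verts Q \<longrightarrow> \<beta> v = 0) \<and> (\<exists>V\<in>rep_space Q \<beta>. indecomposable_rep Q \<beta> V)}"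

definition euler_form :: "('v, 'a) pre_digraph \<Rightarrow> ('v \<Rightarrow> int) \<Rightarrow> ('v \<Rightarrow> int) \<Rightarrow> int" where
  "euler_form Q \<alpha> \<beta> =
     (\<Sum>v\<in>verts Q. \<Sum>w\<in>verts Q.
        ((if v = w then 1 else 0) - int (card {a\<in>arcs Q. tail Q a = v \<and> head Q a = w})) *
        \<alpha> v * \<beta> w)"

abbreviation euler_q :: "('v, 'a) pre_digraph \<Rightarrow> ('v \<Rightarrow> nat) \<Rightarrow> int" where
  "euler_q Q \<alpha> \<equiv> euler_form Q (\<lambda>v. int (\<alpha> v)) (\<lambda>v. int (\<alpha> v))"

definition S_zero :: "('v, 'a) pre_digraph \<Rightarrow> ('v \<Rightarrow> nat) set" where
  "S_zero Q =
     {\<alpha>\<in>quiver_roots Q.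
        \<forall>\<beta>s. set \<beta>s \<subseteq> quiver_roots Q \<and> \<alpha> = (\<lambda>v. \<Sum>\<beta>\<leftarrow>\<beta>s. \<beta> v) \<longrightarrow>
          1 - euler_q Q \<alpha> \<ge> int (length \<beta>s) - (\<Sum>\<beta>\<leftarrow>\<beta>s. euler_q Q \<beta>)}"

section \<open>The scheme of representations of the preprojective algebra\<close>

text \<open>In the double quiver the arrow \<open>a\<close> is \<open>Inl a\<close> and the adjoined arrow \<open>a*\<close> is \<open>Inr a\<close>.\<close>

definition double_quiver :: "('v, 'a) pre_digraph \<Rightarrow> ('v, 'a + 'a) pre_digraph" where
  "double_quiver Q =
     \<lparr> verts = verts Q, arcs = Inl ` arcs Q \<union> Inr ` arcs Q,
       tail = case_sum (tail Q) (head Q), head = case_sum (head Q) (tail Q) \<rparr>"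

text \<open>The \<open>(i, j)\<close> entry, at the vertex \<open>v\<close>, of the sum of the commutators \<open>[V_a, V_a*]\<close>:
  \<open>V_a V_a*\<close> is an endomorphism of the space at \<open>head Q a\<close>, and \<open>V_a* V_a\<close> of the space at
  \<open>tail Q a\<close>. It is used both for complex matrices and for generic matrices, whose entries are
  variables.\<close>

definition preproj_entry ::
  "('v, 'a) pre_digraph \<Rightarrow> ('a + 'a \<Rightarrow> 'r::comm_ring_1 mat) \<Rightarrow> 'v \<Rightarrow> nat \<Rightarrow> nat \<Rightarrow> 'r" where
  "preproj_entry Q V v i j =
     (\<Sum>a\<in>{a\<in>arcs Q. head Q a = v}. (V (Inl a) * V (Inr a)) $$ (i, j)) -
     (\<Sum>a\<in>{a\<in>arcs Q. tail Q a = v}. (V (Inr a) * V (Inl a)) $$ (i, j))"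

type_synonym 'b coord = "'b \<times> nat \<times> nat"

definition rep_coords :: "('v, 'b) pre_digraph \<Rightarrow> ('v \<Rightarrow> nat) \<Rightarrow> 'b coord set" where
  "rep_coords R \<alpha> = {(b, i, j). b \<in> arcs R \<and> i < \<alpha> (head R b) \<and> j < \<alpha> (tail R b)}"

definition coords_of :: "('b \<Rightarrow> 'r mat) \<Rightarrow> 'b coord \<Rightarrow> 'r" where
  "coords_of V = (\<lambda>(b, i, j). V b $$ (i, j))"

definition generic_rep ::
  "('v, 'b) pre_digraph \<Rightarrow> ('v \<Rightarrow> nat) \<Rightarrow> 'b \<Rightarrow> 'b coord cpoly mat" where
  "generic_rep R \<alpha> b = mat (\<alpha> (head R b)) (\<alpha> (tail R b)) (\<lambda>(i, j). Var (b, i, j))"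

abbreviation preproj_coords :: "('v, 'a) pre_digraph \<Rightarrow> ('v \<Rightarrow> nat) \<Rightarrow> ('a + 'a) coord set" where
  "preproj_coords Q \<alpha> \<equiv> rep_coords (double_quiver Q) \<alpha>"

definition preproj_ideal ::
  "('v, 'a) pre_digraph \<Rightarrow> ('v \<Rightarrow> nat) \<Rightarrow> ('a + 'a) coord cpoly set" where
  "preproj_ideal Q \<alpha> =
     ideal_gen (preproj_coords Q \<alpha>)
       {preproj_entry Q (generic_rep (double_quiver Q) \<alpha>) v i j | v i j.
          v \<in> verts Q \<and> i < \<alpha> v \<and> j < \<alpha> v}"

text \<open>The closed points of the scheme \<open>rep\<^sub>\<alpha> \<Pi>\<^sub>0\<close>, i.e. the \<open>\<alpha>\<close>-dimensional representations of the
  preprojective algebra.\<close>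

definition preproj_reps ::
  "('v, 'a) pre_digraph \<Rightarrow> ('v \<Rightarrow> nat) \<Rightarrow> ('a + 'a \<Rightarrow> complex mat) set" where
  "preproj_reps Q \<alpha> =
     {V\<in>rep_space (double_quiver Q) \<alpha>.
        \<forall>v\<in>verts Q. \<forall>i<\<alpha> v. \<forall>j<\<alpha> v. preproj_entry Q V v i j = 0}"

section \<open>The affine quotient, the smooth locus and the Azumaya locus\<close>

definition GL_group :: "('v, 'b) pre_digraph \<Rightarrow> ('v \<Rightarrow> nat) \<Rightarrow> ('v \<Rightarrow> complex mat) set" where
  "GL_group R \<alpha> = (\<Pi>\<^sub>E v\<in>verts R. Units (ring_mat TYPE(complex) (\<alpha> v) ()))"

text \<open>The polynomial function \<open>V \<mapsto> f (g \<cdot> V)\<close>, where \<open>g\<close> acts by base change: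
  \<open>(g \<cdot> V) b = g (head b) V b g (tail b)\<inverse>\<close>.\<close>

definition GL_subst ::
  "('v, 'b) pre_digraph \<Rightarrow> ('v \<Rightarrow> nat) \<Rightarrow> ('v \<Rightarrow> complex mat) \<Rightarrow>
     'b coord cpoly \<Rightarrow> 'b coord cpoly" where
  "GL_subst R \<alpha> g =
     poly_eval Const
       (coords_of (\<lambda>b.
          map_mat Const (g (head R b)) * generic_rep R \<alpha> b *
          map_mat Const (m_inv (ring_mat TYPE(complex) (\<alpha> (tail R b)) ()) (g (tail R b)))))"

text \<open>Polynomials whose class in the coordinate ring of \<open>rep\<^sub>\<alpha> \<Pi>\<^sub>0\<close> is invariant under \<open>GL(\<alpha>)\<close>.\<close>

definition preproj_invariants ::
  "('v, 'a) pre_digraph \<Rightarrow> ('v \<Rightarrow> nat) \<Rightarrow> ('a + 'a) coord cpoly set" where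
  "preproj_invariants Q \<alpha> =
     {f\<in>poly_ring (preproj_coords Q \<alpha>).
        \<forall>g\<in>GL_group Q \<alpha>. GL_subst (double_quiver Q) \<alpha> g f - f \<in> preproj_ideal Q \<alpha>}"

text \<open>The (geometric) points of the affine quotient \<open>iss\<^sub>\<alpha> \<Pi>\<^sub>0\<close>, the spectrum of the ring of
  invariants of the coordinate ring: algebra homomorphisms from that ring to the complex numbers,
  given as functions on the representing polynomials that vanish on the ideal.\<close>

definition preproj_iss ::
  "('v, 'a) pre_digraph \<Rightarrow> ('v \<Rightarrow> nat) \<Rightarrow> (('a + 'a) coord cpoly \<Rightarrow> complex) set" where
  "preproj_iss Q \<alpha> =
     {\<xi>\<in>extensional (preproj_invariants Q \<alpha>).
        (\<forall>f\<in>preproj_invariants Q \<alpha>. \<forall>f'\<in>preproj_invariants Q \<alpha>.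
           \<xi> (f + f') = \<xi> f + \<xi> f' \<and> \<xi> (f * f') = \<xi> f * \<xi> f') \<and>
        (\<forall>c. \<xi> (Const c) = c) \<and>
        (\<forall>f\<in>preproj_ideal Q \<alpha>. \<xi> f = 0)}"

definition preproj_proj ::
  "('v, 'a) pre_digraph \<Rightarrow> ('v \<Rightarrow> nat) \<Rightarrow> ('a + 'a \<Rightarrow> complex mat) \<Rightarrow>
     ('a + 'a) coord cpoly \<Rightarrow> complex" where
  "preproj_proj Q \<alpha> V = restrict (poly_eval id (coords_of V)) (preproj_invariants Q \<alpha>)"

text \<open>\<open>M\<close> is (a member of the isomorphism class) \<open>M\<^sub>\<xi>\<close>: the semisimple representation, unique up
  to isomorphism, lying over \<open>\<xi>\<close>.\<close>

definition corresponding_semisimple ::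
  "('v, 'a) pre_digraph \<Rightarrow> ('v \<Rightarrow> nat) \<Rightarrow> (('a + 'a) coord cpoly \<Rightarrow> complex) \<Rightarrow>
     ('a + 'a \<Rightarrow> complex mat) \<Rightarrow> bool" where
  "corresponding_semisimple Q \<alpha> \<xi> M \<longleftrightarrow>
     M \<in> preproj_reps Q \<alpha> \<and> semisimple_rep (double_quiver Q) \<alpha> M \<and> preproj_proj Q \<alpha> M = \<xi>"

definition smooth_locus ::
  "('v, 'a) pre_digraph \<Rightarrow> ('v \<Rightarrow> nat) \<Rightarrow> (('a + 'a) coord cpoly \<Rightarrow> complex) set" where
  "smooth_locus Q \<alpha> =
     {\<xi>\<in>preproj_iss Q \<alpha>.
        \<forall>V\<in>preproj_reps Q \<alpha>. preproj_proj Q \<alpha> V = \<xi> \<longrightarrow>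
          scheme_smooth_at (preproj_coords Q \<alpha>) (preproj_ideal Q \<alpha>) (coords_of V)}"

text \<open>The points \<open>\<xi>\<close> for which \<open>M\<^sub>\<xi>\<close> is simple. Existence of \<open>M\<^sub>\<xi>\<close> and its uniqueness up to
  isomorphism make the quantification over all choices of \<open>M\<^sub>\<xi>\<close> immaterial.\<close>

definition azumaya_locus ::
  "('v, 'a) pre_digraph \<Rightarrow> ('v \<Rightarrow> nat) \<Rightarrow> (('a + 'a) coord cpoly \<Rightarrow> complex) set" where
  "azumaya_locus Q \<alpha> =
     {\<xi>\<in>preproj_iss Q \<alpha>.
        \<forall>M. corresponding_semisimple Q \<alpha> \<xi> M \<longrightarrow> simple_rep (double_quiver Q) \<alpha> M}"

end

(*
  Representations are finitely supported block matrices X, with moment map mu X = sum [X_a, X_a*] and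
  symplectic form omega, so that tr (theta * dmu_X Y) = omega [theta, X] Y.

  If the scheme is smooth at M, then tr (theta * mu Y) vanishes for every endomorphism theta of M and
  every tangent vector Y, because the function tr (theta * mu) lies in the ideal and has no linear term
  at M. Polarising and using that omega is nondegenerate, [theta, Y] is tangent to the orbit of M. When
  M is semisimple but not simple, take for theta the projection onto a summand; comparing dimensions of
  off-diagonal blocks yields a decomposition alpha = beta + gamma whose symmetrised Euler form
  (beta, gamma) is nonnegative. This contradicts alpha in S_0, as every nonzero dimension
  vector beta is a sum of roots gamma_i for which the sum of 1 - chi(gamma_i, gamma_i) is at least
  1 - chi(beta, beta): otherwise a representation whose orbit has maximal dimension would decompose, and
  the same count of off-diagonal blocks applies to it.

  If M is simple, then by Schur's lemma the differentials of all but one of the entries of mu are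
  independent at M, and the remaining entry is a combination of the others since tr mu = 0.

  Traces of elements of the path algebra are invariants. By Burnside's theorem they decide simplicity, so
  all representations over the point of a simple representation are simple. Finally, over every point
  with a representation there is a semisimple one: among the representations over the point choose one
  with a decomposition into as many summands as possible; if a summand has a proper
  subrepresentation, the limit of a one-parameter subgroup has more summands.
*)
theory Submission
  imports Defs "Jordan_Normal_Form.Spectral_Radius"
begin

section \<open>Finitely supported vectors\<close>

text \<open>Let p be an idempotent endomorphism of M with summands p M and (1 - p) M. A family Y of
  maps from (1 - p) M to p M satisfies [p, Y] = Y, so the tangency of [p, Y] to the orbit is
  tangency of Y itself. Hence the complex block of gl -> block of representations -> block of gl,
  given by the bracket with M followed by dmu_M, is exact in the middle. It stands in for the
  complex that computes Hom and Ext^1 between the summands; only one numerical consequence is drawn,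
  namely that the middle dimension is at most the sum of the outer two. With the third term this is
  the sign of the symmetrised Euler form. For a quiver without relations the third term is absent,
  and the inequality concerns the Euler form itself, one order of the summands at a time. The ideal
  of the scheme need not be radical. Smoothness is therefore exploited through the second-order
  terms of elements of the ideal, not through the dimension of a variety.\<close>

type_synonym 'k cvec = "'k \<Rightarrow>\<^sub>0 complex"

definition fscale :: "complex \<Rightarrow> 'k cvec \<Rightarrow> 'k cvec" where
  "fscale c f = Poly_Mapping.map ((*) c) f"

lemma lookup_fscale [simp]: "Poly_Mapping.lookup (fscale c f) k = c * Poly_Mapping.lookup f k"
  by (simp add: fscale_def Poly_Mapping.map.rep_eq when_def)

global_interpretation fs: vector_space "fscale :: complex \<Rightarrow> 'k cvec \<Rightarrow> _"
  defines fspan = fs.span and fsubspace = fs.subspace and fdependent = fs.dependent and fdim = fs.dim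
  by unfold_locales (auto intro!: poly_mapping_eqI simp: lookup_add algebra_simps)

global_interpretation fsp: vector_space_pair "fscale :: complex \<Rightarrow> 'k cvec \<Rightarrow> _"
    "fscale :: complex \<Rightarrow> 'l cvec \<Rightarrow> _"
  by unfold_locales

abbreviation flinear :: "('k cvec \<Rightarrow> 'l cvec) \<Rightarrow> bool" where
  "flinear \<equiv> Vector_Spaces.linear fscale fscale"

lemma flinearI:
  assumes "\<And>x y. f (x + y) = f x + f y" "\<And>c x. f (fscale c x) = fscale c (f x)"
  shows "flinear f"
  unfolding Vector_Spaces.linear_iff
  using assms fs.vector_space_axioms[where 'k='a] fs.vector_space_axioms[where 'k='b] by blast

lemma flinear_add: "flinear f \<Longrightarrow> f (x + y) = f x + f y"
  and flinear_scale: "flinear f \<Longrightarrow> f (fscale c x) = fscale c (f x)"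
  by (auto simp: Vector_Spaces.linear_iff)

lemma flinear_sum_scale:
  assumes "flinear f"
  shows "f (\<Sum>a\<in>A. fscale (c a) (x a)) = (\<Sum>a\<in>A. fscale (c a) (f (x a)))"
  by (simp only: fsp.linear_sum[OF assms] flinear_scale[OF assms])

text \<open>All finite-dimensional spaces of the proof are coordinate subspaces
  \<open>funs_on S\<close> of one type, with \<open>S\<close> finite. Dimensions that depend on
  terms, such as \<alpha> or the number of entries in a block, are thereby cardinalities of
  sets.\<close>

definition funs_on :: "'k set \<Rightarrow> 'k cvec set" where
  "funs_on S = {f. \<forall>k. k \<notin> S \<longrightarrow> Poly_Mapping.lookup f k = 0}"

abbreviation unit_fun :: "'k \<Rightarrow> 'k cvec" where
  "unit_fun k \<equiv> Poly_Mapping.single k 1"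

definition vec_on :: "'k set \<Rightarrow> ('k \<Rightarrow> complex) \<Rightarrow> 'k cvec" where
  "vec_on S f = (\<Sum>k\<in>S. Poly_Mapping.single k (f k))"

lemma lookup_vec_on: "finite S \<Longrightarrow> Poly_Mapping.lookup (vec_on S f) k = (if k \<in> S then f k else 0)"
  by (simp add: vec_on_def lookup_sum lookup_single when_def)

lemma vec_on_in_funs_on [simp]: "finite S \<Longrightarrow> vec_on S f \<in> funs_on S"
  by (simp add: funs_on_def lookup_vec_on)

lemma fsubspace_funs_on [simp]: "fsubspace (funs_on S)"
  by (auto simp: fs.subspace_def funs_on_def lookup_add)

lemma funs_on_add [simp]: "f \<in> funs_on S \<Longrightarrow> g \<in> funs_on S \<Longrightarrow> f + g \<in> funs_on S"
  and funs_on_scale [simp]: "f \<in> funs_on S \<Longrightarrow> fscale c f \<in> funs_on S"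
  and funs_on_diff [simp]: "f \<in> funs_on S \<Longrightarrow> g \<in> funs_on S \<Longrightarrow> f - g \<in> funs_on S"
  by (auto simp: funs_on_def lookup_add lookup_minus)

lemma funs_on_sum: "(\<And>a. a \<in> A \<Longrightarrow> f a \<in> funs_on S) \<Longrightarrow> sum f A \<in> funs_on S"
  by (rule fs.subspace_sum) auto

lemma funs_on_expand:
  assumes "finite S" "f \<in> funs_on S"
  shows "f = (\<Sum>k\<in>S. fscale (Poly_Mapping.lookup f k) (unit_fun k))"
proof (rule poly_mapping_eqI)
  fix x
  have "(\<Sum>k\<in>S. Poly_Mapping.lookup f k * Poly_Mapping.lookup (unit_fun k) x) = (\<Sum>k\<in>S. if k = x then Poly_Mapping.lookup f x else 0)"
    by (rule sum.cong) (auto simp: lookup_single)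
  also have "\<dots> = Poly_Mapping.lookup f x"
    using assms by (auto simp: funs_on_def)
  finally show "Poly_Mapping.lookup f x = Poly_Mapping.lookup (\<Sum>k\<in>S. fscale (Poly_Mapping.lookup f k) (unit_fun k)) x"
    by (simp add: lookup_sum)
qed

lemma inj_unit_fun: "inj unit_fun"
proof (rule injI)
  fix j k :: 'a assume "unit_fun j = unit_fun k"
  then have "Poly_Mapping.lookup (unit_fun j) j = Poly_Mapping.lookup (unit_fun k) j" by simp
  then show "j = k" by (simp add: lookup_single when_def split: if_splits)
qed

lemma funs_on_eq_span:
  assumes "finite S"
  shows "funs_on S = fspan (unit_fun ` S)"
proof
  show "funs_on S \<subseteq> fspan (unit_fun ` S)"
  proof
    fix f assume f: "f \<in> funs_on S"
    have "(\<Sum>k\<in>S. fscale (Poly_Mapping.lookup f k) (unit_fun k)) \<in> fspan (unit_fun ` S)"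
      by (intro fs.span_sum fs.span_scale fs.span_base) auto
    then show "f \<in> fspan (unit_fun ` S)"
      by (simp only: funs_on_expand[OF assms f, symmetric])
  qed
  show "fspan (unit_fun ` S) \<subseteq> funs_on S"
    by (rule fs.span_minimal[OF _ fsubspace_funs_on]) (auto simp: funs_on_def lookup_single when_def)
qed

lemma independent_unit_fun:
  assumes "finite S"
  shows "\<not> fdependent (unit_fun ` S)"
proof (rule fs.independent_if_scalars_zero)
  fix c x assume *: "(\<Sum>x\<in>unit_fun ` S. fscale (c x) x) = 0" and "x \<in> unit_fun ` S"
  then obtain k where k: "k \<in> S" "x = unit_fun k" by auto
  have "Poly_Mapping.lookup (\<Sum>x\<in>unit_fun ` S. fscale (c x) x) k = (\<Sum>j\<in>S. c (unit_fun j) * Poly_Mapping.lookup (unit_fun j) k)"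
    by (subst sum.reindex) (auto intro: inj_on_subset[OF inj_unit_fun] simp: lookup_sum)
  also have "\<dots> = (\<Sum>j\<in>S. if j = k then c (unit_fun k) else 0)"
    by (rule sum.cong) (auto simp: lookup_single)
  also have "\<dots> = c x" using k assms by simp
  finally show "c x = 0" using * by simp
qed (use assms in auto)

lemma card_unit_fun: "card (unit_fun ` S) = card S"
  by (rule card_image) (rule inj_on_subset[OF inj_unit_fun], auto)

lemma independent_funs_on_bound:
  assumes "finite S" "\<not> fdependent B" "B \<subseteq> funs_on S"
  shows "finite B \<and> card B \<le> card S"
  using fs.independent_span_bound[of "unit_fun ` S" B] assms
  by (simp add: funs_on_eq_span card_unit_fun)

lemma dim_funs_on:
  assumes "finite S" shows "fdim (funs_on S) = card S"
  using assms by (simp add: funs_on_eq_span fs.dim_eq_card_independent independent_unit_fun card_unit_fun)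

lemma independent_card_le_dim:
  assumes "finite S" "W \<subseteq> funs_on S" "\<not> fdependent B" "B \<subseteq> fspan W"
  shows "card B \<le> fdim W"
proof -
  obtain C where C: "C \<subseteq> W" "\<not> fdependent C" "W \<subseteq> fspan C" "card C = fdim W"
    by (rule fs.basis_exists)
  then have "finite C" using independent_funs_on_bound[of S C] assms by auto
  moreover have "B \<subseteq> fspan C" using assms(4) C(3) by (metis fs.span_mono fs.span_span subset_trans)
  ultimately show ?thesis using fs.independent_span_bound[of C B] assms C by auto
qed

lemma independent_spanning:
  assumes "finite S" "\<not> fdependent B" "B \<subseteq> funs_on S" "card B = card S"
  shows "fspan B = funs_on S"
proof (rule ccontr)
  have sub: "fspan B \<subseteq> funs_on S" using assms by (intro fs.span_minimal) auto
  have fin: "finite B" using independent_funs_on_bound assms by blast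
  assume "fspan B \<noteq> funs_on S"
  then obtain w where w: "w \<in> funs_on S" "w \<notin> fspan B" using sub by auto
  then have "\<not> fdependent (insert w B)" "w \<notin> B"
    using assms fs.independent_insert[of w B] by (auto intro: fs.span_base)
  then have "card (insert w B) \<le> card S"
    using independent_funs_on_bound[of S "insert w B"] assms w by auto
  then show False using \<open>w \<notin> B\<close> assms fin by simp
qed

section \<open>Projections, exactness and perturbation of independent vectors\<close>

lemma linear_projection_exists:
  assumes "fsubspace U"
  obtains g where "flinear g" "\<And>x. g x \<in> U" "\<And>x. x \<in> U \<Longrightarrow> g x = x"
proof -
  have "\<exists>g. g ` UNIV \<subseteq> U \<and> flinear g \<and> (\<forall>v\<in>U. g (id v) = v)"
    using assms by (intro fsp.linear_exists_left_inverse_on) (auto simp: flinearI)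
  then obtain g where "g ` UNIV \<subseteq> U" "flinear g" "\<forall>v\<in>U. g (id v) = v" by (elim exE conjE)
  then show ?thesis by (intro that[of g]) auto
qed

text \<open>If \<open>g\<close> projects onto \<open>B\<close>, some coordinate j of
  \<open>w - g w\<close> is nonzero, and the functional taking f to the coordinate j of
  \<open>f - g f\<close> vanishes on \<open>B\<close>. It is returned by its coefficients
  \<open>z\<close>, the form in which \<open>omega_dual\<close> later represents it by the
  symplectic form.\<close>

lemma separating_vector:
  assumes "finite S" "fsubspace B" "B \<subseteq> funs_on S" "w \<in> funs_on S" "w \<notin> B"
  obtains z where "\<And>b. b \<in> B \<Longrightarrow> (\<Sum>k\<in>S. z k * Poly_Mapping.lookup b k) = 0" "(\<Sum>k\<in>S. z k * Poly_Mapping.lookup w k) \<noteq> 0"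
proof -
  obtain g where g: "flinear g" "\<And>x. g x \<in> B" "\<And>x. x \<in> B \<Longrightarrow> g x = x"
    using linear_projection_exists[OF assms(2)] by blast
  have "w \<noteq> g w" using g(2)[of w] assms(5) by auto
  then obtain j where j: "Poly_Mapping.lookup w j \<noteq> Poly_Mapping.lookup (g w) j" by (metis poly_mapping_eqI)
  define z where "z = (\<lambda>k. Poly_Mapping.lookup (unit_fun k) j - Poly_Mapping.lookup (g (unit_fun k)) j)"
  have *: "(\<Sum>k\<in>S. z k * Poly_Mapping.lookup f k) = Poly_Mapping.lookup f j - Poly_Mapping.lookup (g f) j" if "f \<in> funs_on S" for f
  proof -
    have "Poly_Mapping.lookup f j = (\<Sum>k\<in>S. Poly_Mapping.lookup f k * Poly_Mapping.lookup (unit_fun k) j)"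
      by (subst funs_on_expand[OF assms(1) that]) (simp add: lookup_sum)
    moreover have "g f = (\<Sum>k\<in>S. fscale (Poly_Mapping.lookup f k) (g (unit_fun k)))"
      using flinear_sum_scale[OF g(1), of "Poly_Mapping.lookup f" unit_fun S] funs_on_expand[OF assms(1) that] by simp
    then have "Poly_Mapping.lookup (g f) j = (\<Sum>k\<in>S. Poly_Mapping.lookup f k * Poly_Mapping.lookup (g (unit_fun k)) j)"
      by (simp add: lookup_sum)
    ultimately show ?thesis by (simp add: z_def algebra_simps sum_subtractf)
  qed
  show ?thesis
    by (rule that[of z]) (use * assms(3,4) j g(3) in auto)
qed

text \<open>A basis of the image of \<open>d1\<close>, lifted to \<open>funs_on K\<close>, together
  with the \<open>d0\<close>-images of the unit vectors spans \<open>funs_on K\<close>: subtracting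
  from \<open>y\<close> a lift of \<open>d1 y\<close> lands in the kernel of \<open>d1\<close>,
  hence in the image of \<open>d0\<close>.\<close>

lemma card_exact_le:
  fixes d0 :: "'e cvec \<Rightarrow> 'k cvec" and d1 :: "'k cvec \<Rightarrow> 'f cvec"
  assumes fin: "finite E" "finite K" "finite F" and lin: "flinear d0" "flinear d1"
    and d1: "\<And>y. y \<in> funs_on K \<Longrightarrow> d1 y \<in> funs_on F"
    and exact: "\<And>y. y \<in> funs_on K \<Longrightarrow> d1 y = 0 \<Longrightarrow> y \<in> d0 ` funs_on E"
  shows "card K \<le> card E + card F"
proof -
  obtain B where B: "B \<subseteq> d1 ` funs_on K" "\<not> fdependent B" "d1 ` funs_on K \<subseteq> fspan B"
    by (rule fs.basis_exists[of "d1 ` funs_on K"])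
  have "B \<subseteq> funs_on F" using B(1) d1 by blast
  then have finB: "finite B" "card B \<le> card F"
    using independent_funs_on_bound[OF fin(3) B(2)] by blast+
  have "\<forall>b\<in>B. \<exists>y. y \<in> funs_on K \<and> d1 y = b" using B(1) by blast
  from bchoice[OF this] obtain s where s: "\<And>b. b \<in> B \<Longrightarrow> s b \<in> funs_on K \<and> d1 (s b) = b" by blast
  let ?G = "s ` B \<union> d0 ` unit_fun ` E"
  have "funs_on K \<subseteq> fspan ?G"
  proof
    fix y assume y: "y \<in> funs_on K"
    then have "d1 y \<in> fspan B" using B(3) by blast
    then obtain c where c: "d1 y = (\<Sum>b\<in>B. fscale (c b) b)"
      unfolding fs.span_finite[OF finB(1)] by blast
    define y' where "y' = (\<Sum>b\<in>B. fscale (c b) (s b))"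
    have y': "y' \<in> funs_on K"
      unfolding y'_def by (rule funs_on_sum) (simp add: s)
    have y'': "y' \<in> fspan ?G"
      unfolding y'_def by (intro fs.span_sum fs.span_scale fs.span_base) blast
    have "d1 y' = (\<Sum>b\<in>B. fscale (c b) (d1 (s b)))"
      unfolding y'_def by (rule flinear_sum_scale[OF lin(2)])
    also have "\<dots> = d1 y"
      unfolding c by (rule sum.cong) (simp_all add: s)
    finally have "d1 y' = d1 y" .
    then have "d1 (y - y') = 0" by (simp add: fsp.linear_diff[OF lin(2)])
    from exact[OF funs_on_diff[OF y y'] this]
    obtain e where e: "e \<in> funs_on E" "y - y' = d0 e" by (rule imageE)
    have "d0 e = (\<Sum>k\<in>E. fscale (Poly_Mapping.lookup e k) (d0 (unit_fun k)))"
      using flinear_sum_scale[OF lin(1), of "Poly_Mapping.lookup e" unit_fun E]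
      by (simp only: funs_on_expand[OF fin(1) e(1), symmetric])
    moreover have "(\<Sum>k\<in>E. fscale (Poly_Mapping.lookup e k) (d0 (unit_fun k))) \<in> fspan ?G"
      by (intro fs.span_sum fs.span_scale fs.span_base) auto
    ultimately have "d0 e \<in> fspan ?G" by (simp only:)
    then have "y' + d0 e \<in> fspan ?G" by (rule fs.span_add[OF y''])
    moreover have "y = y' + d0 e" using e(2) by (simp add: algebra_simps)
    ultimately show "y \<in> fspan ?G" by simp
  qed
  then have "fdim (funs_on K) \<le> card ?G"
    using finB fin by (intro fs.dim_le_card) auto
  also have "\<dots> \<le> card B + card E"
    using card_image_le[OF finB(1), of s] card_image_le[OF fin(1), of "\<lambda>k. d0 (unit_fun k)"]
      card_Un_le[of "s ` B" "d0 ` unit_fun ` E"] by (simp add: image_image)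
  finally show ?thesis using finB fin dim_funs_on[of K] by simp
qed

text \<open>Two equal members would satisfy the relation with coefficients 1 and -1, so injectivity
  comes with independence; with it, cardinalities pass to the image.\<close>

lemma independent_family:
  assumes "finite F" "\<And>c. (\<Sum>i\<in>F. fscale (c i) (h i)) = 0 \<Longrightarrow> \<forall>i\<in>F. c i = 0"
  shows "inj_on h F \<and> \<not> fdependent (h ` F)"
proof
  show inj: "inj_on h F"
  proof (rule inj_onI, rule ccontr)
    fix i j assume ij: "i \<in> F" "j \<in> F" "h i = h j" "i \<noteq> j"
    let ?c = "\<lambda>k. if k = i then 1 else if k = j then - 1 else (0::complex)"
    have "(\<Sum>k\<in>F. fscale (?c k) (h k)) = (\<Sum>k\<in>{i,j}. fscale (?c k) (h k))"
      using assms(1) ij by (intro sum.mono_neutral_right) auto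
    also have "\<dots> = 0" using ij by (auto intro!: poly_mapping_eqI simp: lookup_add)
    finally have "\<forall>i\<in>F. ?c i = 0" by (rule assms(2))
    from bspec[OF this ij(1)] show False by simp
  qed
  show "\<not> fdependent (h ` F)"
  proof (rule fs.independent_if_scalars_zero)
    fix c x assume "(\<Sum>x\<in>h ` F. fscale (c x) x) = 0" "x \<in> h ` F"
    then obtain i where i: "i \<in> F" "x = h i" and "(\<Sum>i\<in>F. fscale (c (h i)) (h i)) = 0"
      by (auto simp: sum.reindex[OF inj] comp_def)
    from assms(2)[OF this(3)] i show "c x = 0" by blast
  qed (use assms(1) in auto)
qed

text \<open>Linear independence is an open condition. Applying the functionals dual to
  \<open>F\<close> to a relation among the perturbed vectors bounds the sum of the |c_f| by |t| m
  times itself, which forces it to vanish as soon as |t| m < 1.\<close>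

lemma independent_perturb:
  assumes fin: "finite F" and ind: "\<not> fdependent (F :: 'a cvec set)"
  obtains t where "t \<noteq> 0" "inj_on (\<lambda>f. f + fscale t (g f)) F" "\<not> fdependent ((\<lambda>f. f + fscale t (g f)) ` F)"
proof -
  obtain \<Phi> :: "'a cvec \<Rightarrow> 'a cvec cvec" where lin: "flinear \<Phi>" and \<Phi>: "\<And>x. x \<in> F \<Longrightarrow> \<Phi> x = unit_fun x"
    using fsp.linear_independent_extend[OF ind, of unit_fun] by blast
  define \<phi> where "\<phi> f x = Poly_Mapping.lookup (\<Phi> x) f" for f x
  define m where "m = (\<Sum>f\<in>F. \<Sum>f'\<in>F. cmod (\<phi> f (g f')))"
  \<comment> \<open>The denominator is m + 1 rather than m so that |t| m < 1 holds also when m =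
    0.\<close>
  define t where "t = complex_of_real (1 / (m + 1))"
  have m: "m \<ge> 0" unfolding m_def by (intro sum_nonneg) auto
  have "inj_on (\<lambda>f. f + fscale t (g f)) F \<and> \<not> fdependent ((\<lambda>f. f + fscale t (g f)) ` F)"
  proof (rule independent_family[OF fin])
    fix c assume *: "(\<Sum>f\<in>F. fscale (c f) (f + fscale t (g f))) = 0"
    have c: "c j = - (\<Sum>f\<in>F. c f * t * \<phi> j (g f))" if "j \<in> F" for j
    proof -
      have eq: "c f * \<phi> j (f + fscale t (g f)) = (if f = j then c j else 0) + c f * t * \<phi> j (g f)"
        if "f \<in> F" for f
        using \<Phi>[OF that]
        by (simp add: \<phi>_def lookup_add flinear_add[OF lin] flinear_scale[OF lin] algebra_simps lookup_single)
      have "(\<Sum>f\<in>F. c f * \<phi> j (f + fscale t (g f))) =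
          Poly_Mapping.lookup (\<Phi> (\<Sum>f\<in>F. fscale (c f) (f + fscale t (g f)))) j"
        unfolding flinear_sum_scale[OF lin] by (simp add: \<phi>_def lookup_sum)
      also have "\<dots> = 0"
        unfolding * by (simp add: fsp.linear_0[OF lin])
      finally have "(\<Sum>f\<in>F. c f * \<phi> j (f + fscale t (g f))) = 0" .
      then have "(\<Sum>f\<in>F. (if f = j then c j else 0) + c f * t * \<phi> j (g f)) = 0"
        by (simp only: eq cong: sum.cong)
      then have "c j + (\<Sum>f\<in>F. c f * t * \<phi> j (g f)) = 0"
        using that fin by (simp add: sum.distrib)
      then show ?thesis by (metis eq_neg_iff_add_eq_0)
    qed
    have "(\<Sum>j\<in>F. cmod (c j)) \<le> (\<Sum>j\<in>F. \<Sum>f\<in>F. cmod (c f) * cmod t * cmod (\<phi> j (g f)))"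
    proof (rule sum_mono)
      fix j assume "j \<in> F"
      then have "cmod (c j) = cmod (\<Sum>f\<in>F. c f * t * \<phi> j (g f))"
        using c[of j] norm_minus_cancel by metis
      also have "\<dots> \<le> (\<Sum>f\<in>F. cmod (c f * t * \<phi> j (g f)))" by (rule norm_sum)
      finally show "cmod (c j) \<le> (\<Sum>f\<in>F. cmod (c f) * cmod t * cmod (\<phi> j (g f)))"
        by (simp add: norm_mult)
    qed
    also have "\<dots> \<le> (\<Sum>j\<in>F. \<Sum>f\<in>F. (\<Sum>f\<in>F. cmod (c f)) * cmod t * cmod (\<phi> j (g f)))"
      by (intro sum_mono mult_right_mono member_le_sum) (auto simp: fin)
    also have "\<dots> = (\<Sum>f\<in>F. cmod (c f)) * cmod t * m"
      by (simp add: m_def sum_distrib_left)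
    finally have "(\<Sum>f\<in>F. cmod (c f)) \<le> (\<Sum>f\<in>F. cmod (c f)) * cmod t * m" .
    moreover have "cmod t = 1 / (m + 1)"
      unfolding t_def norm_of_real using m by simp
    ultimately have "(\<Sum>f\<in>F. cmod (c f)) * (m + 1) \<le> (\<Sum>f\<in>F. cmod (c f)) * m"
      using m by (simp add: field_simps)
    then have "(\<Sum>f\<in>F. cmod (c f)) \<le> 0" by (simp add: algebra_simps)
    then have "(\<Sum>f\<in>F. cmod (c f)) = 0" by (meson antisym sum_nonneg norm_ge_zero)
    then show "\<forall>f\<in>F. c f = 0" using fin by (simp add: sum_nonneg_eq_0_iff)
  qed
  moreover have "t \<noteq> 0"
    unfolding t_def of_real_eq_0_iff using m by simp
  ultimately show thesis using that[of t] by blast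
qed

text \<open>Rank is lower semicontinuous. If \<open>B u0\<close> lay outside the span of the image
  of \<open>A\<close>, then \<open>u0\<close> and preimages of a basis of that span would, for a
  suitable t, have images under A + t B whose span contains more independent vectors than the rank
  of \<open>A\<close>.\<close>

lemma maximal_rank_first_order:
  fixes A B :: "'u \<Rightarrow> 'k cvec"
  assumes fin: "finite S" and AB: "\<And>u. A u \<in> funs_on S" "\<And>u. B u \<in> funs_on S"
    and max: "\<And>t. fdim ((\<lambda>u. A u + fscale t (B u)) ` U) \<le> fdim (A ` U)"
    and u0: "u0 \<in> U" "A u0 = 0"
  shows "B u0 \<in> fspan (A ` U)"
proof (rule ccontr)
  define w where "w = B u0"
  assume "B u0 \<notin> fspan (A ` U)"
  then have w: "w \<notin> fspan (A ` U)" by (simp add: w_def)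
  obtain C where C: "C \<subseteq> A ` U" "\<not> fdependent C" "A ` U \<subseteq> fspan C" "card C = fdim (A ` U)"
    by (rule fs.basis_exists)
  have finC: "finite C" using independent_funs_on_bound[of S C] C fin AB by blast
  have wC: "w \<notin> fspan C" using w fs.span_mono[OF C(1)] by blast
  have ind: "\<not> fdependent (insert w C)" and wC': "w \<notin> C"
    using wC C(2) fs.independent_insert[of w C] fs.span_base[of w C] by auto
  have "\<forall>b\<in>C. \<exists>u. u \<in> U \<and> A u = b" using C(1) by blast
  from bchoice[OF this] obtain h where h: "\<And>b. b \<in> C \<Longrightarrow> h b \<in> U \<and> A (h b) = b" by blast
  \<comment> \<open>\<open>w\<close> is left unperturbed: since \<open>A u0 = 0\<close>, the vector
    A u0 + t B u0 divided by t equals \<open>w\<close> for every nonzero t.\<close>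
  define g where "g b = (if b = w then 0 else B (h b))" for b
  obtain t where t: "t \<noteq> 0" "inj_on (\<lambda>f. f + fscale t (g f)) (insert w C)"
      "\<not> fdependent ((\<lambda>f. f + fscale t (g f)) ` insert w C)"
    by (rule independent_perturb[OF finite.insertI[OF finC] ind, of g])
  let ?W = "(\<lambda>u. A u + fscale t (B u)) ` U"
  have "(\<lambda>f. f + fscale t (g f)) ` insert w C \<subseteq> fspan ?W"
  proof (clarify)
    fix f assume f: "f \<in> insert w C"
    show "f + fscale t (g f) \<in> fspan ?W"
    proof (cases "f = w")
      case True
      have "fscale (1 / t) (A u0 + fscale t (B u0)) \<in> fspan ?W"
        using u0(1) by (intro fs.span_scale fs.span_base imageI)
      moreover have "fscale (1 / t) (A u0 + fscale t (B u0)) = B u0"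
        by (rule poly_mapping_eqI) (simp add: u0(2) t(1))
      moreover have "f + fscale t (g f) = B u0"
        unfolding True g_def by (simp add: w_def)
      ultimately show ?thesis by (simp only:)
    next
      case False
      then have hf: "h f \<in> U" "A (h f) = f" and "g f = B (h f)"
        using f h by (auto simp: g_def)
      then have "f + fscale t (g f) = A (h f) + fscale t (B (h f))" by simp
      then show ?thesis using hf(1) fs.span_base[of _ ?W] by blast
    qed
  qed
  moreover have "?W \<subseteq> funs_on S"
    using AB by auto
  ultimately have "card ((\<lambda>f. f + fscale t (g f)) ` insert w C) \<le> fdim ?W"
    by (intro independent_card_le_dim[OF fin _ t(3)])
  then have "card (insert w C) \<le> fdim (A ` U)"
    unfolding card_image[OF t(2)] by (rule le_trans[OF _ max])
  then show False using C(4) finC wC' by simp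
qed

section \<open>Finitely supported matrices\<close>

text \<open>Finite support puts the matrices of all sizes into one ring, without unit; \<open>diag I\<close> below is the
  identity of the matrices indexed by \<open>I\<close>.\<close>

typedef (overloaded) ('i, 'r) fmat = "UNIV :: ('i \<times> 'i \<Rightarrow>\<^sub>0 'r::comm_ring_1) set"
  morphisms coeffs Fmat
  by simp

definition ent :: "('i, 'r::comm_ring_1) fmat \<Rightarrow> 'i \<Rightarrow> 'i \<Rightarrow> 'r" where
  "ent X p q = Poly_Mapping.lookup (coeffs X) (p, q)"

lemma coeffs_Fmat [simp]: "coeffs (Fmat x) = x"
  by (simp add: Fmat_inverse)

lemma fmat_eqI: "(\<And>p q. ent X p q = ent Y p q) \<Longrightarrow> X = Y"
  unfolding ent_def by (metis coeffs_inject poly_mapping_eqI surj_pair)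

definition mat_on :: "'i set \<Rightarrow> ('i \<Rightarrow> 'i \<Rightarrow> 'r) \<Rightarrow> ('i, 'r::comm_ring_1) fmat" where
  "mat_on I f = Fmat (\<Sum>k\<in>I \<times> I. Poly_Mapping.single k (f (fst k) (snd k)))"

lemma ent_mat_on: "finite I \<Longrightarrow> ent (mat_on I f) p q = (if p \<in> I \<and> q \<in> I then f p q else 0)"
  by (simp add: ent_def mat_on_def lookup_sum lookup_single when_def)

definition idx :: "('i, 'r::comm_ring_1) fmat \<Rightarrow> 'i set" where
  "idx X = fst ` Poly_Mapping.keys (coeffs X) \<union> snd ` Poly_Mapping.keys (coeffs X)"

lemma finite_idx [simp]: "finite (idx X)"
  by (simp add: idx_def)

lemma ent_not_idx: "p \<notin> idx X \<Longrightarrow> ent X p q = 0" "q \<notin> idx X \<Longrightarrow> ent X p q = 0"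
proof -
  have "ent X p q \<noteq> 0 \<Longrightarrow> (p, q) \<in> Poly_Mapping.keys (coeffs X)"
    by (simp add: ent_def in_keys_iff)
  then show "p \<notin> idx X \<Longrightarrow> ent X p q = 0" "q \<notin> idx X \<Longrightarrow> ent X p q = 0"
    by (force simp: idx_def)+
qed

instantiation fmat :: (type, comm_ring_1) ring
begin

definition "0 = Fmat 0"
definition "X + Y = Fmat (coeffs X + coeffs Y)"
definition "X - Y = Fmat (coeffs X - coeffs Y)"
definition "- X = Fmat (- coeffs X)"
definition "X * Y = mat_on (idx X \<union> idx Y) (\<lambda>p q. \<Sum>r\<in>idx X. ent X p r * ent Y r q)"

lemma ent_0 [simp]: "ent 0 p q = 0"
  and ent_add [simp]: "ent (X + Y) p q = ent X p q + ent Y p q"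
  and ent_diff [simp]: "ent (X - Y) p q = ent X p q - ent Y p q"
  and ent_uminus [simp]: "ent (- X) p q = - ent X p q"
  by (simp_all add: ent_def zero_fmat_def plus_fmat_def minus_fmat_def uminus_fmat_def lookup_add lookup_minus)

lemma ent_mult_on:
  assumes "finite S" "\<And>r. r \<notin> S \<Longrightarrow> ent X p r * ent Y r q = 0"
  shows "ent (X * Y) p q = (\<Sum>r\<in>S. ent X p r * ent Y r q)"
proof -
  have "ent (X * Y) p q = (\<Sum>r\<in>idx X. ent X p r * ent Y r q)"
    by (auto simp: times_fmat_def ent_mat_on ent_not_idx)
  also have "\<dots> = (\<Sum>r\<in>S. ent X p r * ent Y r q)"
    by (rule sum.mono_neutral_cong) (use assms in \<open>auto simp: ent_not_idx\<close>)
  finally show ?thesis .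
qed

lemma ent_mult_left:
  assumes "finite S" "idx X \<subseteq> S"
  shows "ent (X * Y) p q = (\<Sum>r\<in>S. ent X p r * ent Y r q)"
proof (rule ent_mult_on[OF assms(1)])
  fix r assume "r \<notin> S"
  then have "r \<notin> idx X" using assms(2) by blast
  then show "ent X p r * ent Y r q = 0" by (simp add: ent_not_idx)
qed

lemma ent_mult_right:
  assumes "finite S" "idx Y \<subseteq> S"
  shows "ent (X * Y) p q = (\<Sum>r\<in>S. ent X p r * ent Y r q)"
proof (rule ent_mult_on[OF assms(1)])
  fix r assume "r \<notin> S"
  then have "r \<notin> idx Y" using assms(2) by blast
  then show "ent X p r * ent Y r q = 0" by (simp add: ent_not_idx)
qed

instance
proof
  fix X Y Z :: "('a, 'b) fmat"
  show "X + Y + Z = X + (Y + Z)" by (rule fmat_eqI) (simp add: algebra_simps)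
  show "X + Y = Y + X" by (rule fmat_eqI) (simp add: algebra_simps)
  show "0 + X = X" by (rule fmat_eqI) (simp add: algebra_simps)
  show "- X + X = 0" by (rule fmat_eqI) (simp add: algebra_simps)
  show "X - Y = X + - Y" by (rule fmat_eqI) (simp add: algebra_simps)
  let ?S = "idx X \<union> idx Y \<union> idx Z"
  have S: "finite ?S" and sub: "idx X \<subseteq> ?S" "idx Y \<subseteq> ?S" "idx Z \<subseteq> ?S" by auto
  show "X * Y * Z = X * (Y * Z)"
  proof (rule fmat_eqI)
    fix p q
    have "ent (X * Y * Z) p q = (\<Sum>r\<in>?S. (\<Sum>s\<in>?S. ent X p s * ent Y s r) * ent Z r q)"
      by (simp add: ent_mult_right[OF S sub(3)] ent_mult_left[OF S sub(1)])
    also have "\<dots> = (\<Sum>s\<in>?S. ent X p s * (\<Sum>r\<in>?S. ent Y s r * ent Z r q))"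
      unfolding sum_distrib_left sum_distrib_right by (subst sum.swap) (simp add: mult.assoc)
    also have "\<dots> = ent (X * (Y * Z)) p q"
      by (simp add: ent_mult_left[OF S sub(1)] ent_mult_left[OF S sub(2)])
    finally show "ent (X * Y * Z) p q = ent (X * (Y * Z)) p q" .
  qed
  show "(X + Y) * Z = X * Z + Y * Z"
    by (rule fmat_eqI) (simp add: ent_mult_right[OF S sub(3)] distrib_right sum.distrib)
  show "X * (Y + Z) = X * Y + X * Z"
    by (rule fmat_eqI) (simp add: ent_mult_left[OF S sub(1)] distrib_left sum.distrib)
qed

end

lemma ent_sum: "ent (\<Sum>a\<in>A. f a) p q = (\<Sum>a\<in>A. ent (f a) p q)"
  by (induction A rule: infinite_finite_induct) auto

definition on :: "'i set \<Rightarrow> ('i, 'r::comm_ring_1) fmat \<Rightarrow> bool" where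
  "on I X \<longleftrightarrow> (\<forall>p q. ent X p q \<noteq> 0 \<longrightarrow> p \<in> I \<and> q \<in> I)"

lemma on_ent: "on I X \<Longrightarrow> p \<notin> I \<Longrightarrow> ent X p q = 0" "on I X \<Longrightarrow> q \<notin> I \<Longrightarrow> ent X p q = 0"
  by (auto simp: on_def)

lemma ent_mult: "finite I \<Longrightarrow> on I X \<or> on I Y \<Longrightarrow> ent (X * Y) p q = (\<Sum>r\<in>I. ent X p r * ent Y r q)"
  by (rule ent_mult_on) (auto simp: on_ent)

definition diag :: "'i set \<Rightarrow> ('i, 'r::comm_ring_1) fmat" where
  "diag J = mat_on J (\<lambda>p q. if p = q then 1 else 0)"

lemma ent_diag: "finite J \<Longrightarrow> ent (diag J) p q = (if p = q \<and> p \<in> J then 1 else 0)"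
  by (simp add: diag_def ent_mat_on)

lemma on_mat_on [simp]: "finite I \<Longrightarrow> on I (mat_on I f)"
  by (simp add: on_def ent_mat_on)

lemma on_diag [simp]: "finite I \<Longrightarrow> J \<subseteq> I \<Longrightarrow> on I (diag J)"
  by (auto simp: on_def ent_diag finite_subset)

lemma ent_diag_mult [simp]: "finite J \<Longrightarrow> ent (diag J * X) p q = (if p \<in> J then ent X p q else 0)"
  by (simp add: ent_mult[of J] ent_diag if_distrib[of "\<lambda>x. x * _"] cong: if_cong)

lemma ent_mult_diag [simp]: "finite J \<Longrightarrow> ent (X * diag J) p q = (if q \<in> J then ent X p q else 0)"
  by (simp add: ent_mult[of J] ent_diag if_distrib[of "\<lambda>x. _ * x"] cong: if_cong)

lemma diag_mult_diag: "finite J \<Longrightarrow> finite K \<Longrightarrow> diag J * diag K = diag (J \<inter> K)"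
  by (rule fmat_eqI) (auto simp: ent_diag)

lemma diag_diff: "finite I \<Longrightarrow> J \<subseteq> I \<Longrightarrow> diag (I - J) = diag I - diag J"
  by (rule fmat_eqI) (auto simp: ent_diag finite_subset)

lemma on_diag_left [simp]: "finite I \<Longrightarrow> on I X \<Longrightarrow> diag I * X = X"
  and on_diag_right [simp]: "finite I \<Longrightarrow> on I X \<Longrightarrow> X * diag I = X"
  by (auto intro!: fmat_eqI simp: on_ent)

lemma on_0 [simp]: "on I 0"
  and on_add [simp]: "on I X \<Longrightarrow> on I Y \<Longrightarrow> on I (X + Y)"
  and on_diff [simp]: "on I X \<Longrightarrow> on I Y \<Longrightarrow> on I (X - Y)"
  unfolding on_def ent_add ent_diff ent_0 by (metis add_0 diff_zero)+

lemma on_mult: "on I X \<Longrightarrow> on I Y \<Longrightarrow> on I (X * Y)"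
proof (unfold on_def[of I "X * Y"], intro allI impI, rule ccontr)
  fix p q assume *: "on I X" "on I Y" "ent (X * Y) p q \<noteq> 0" "\<not> (p \<in> I \<and> q \<in> I)"
  have "ent (X * Y) p q = (\<Sum>r\<in>idx X. ent X p r * ent Y r q)"
    by (rule ent_mult_on) (auto simp: ent_not_idx)
  also have "\<dots> = 0"
    by (rule sum.neutral) (use * in \<open>auto simp: on_ent\<close>)
  finally show False using * by simp
qed

lemma on_sum: "(\<And>a. a \<in> A \<Longrightarrow> on I (f a)) \<Longrightarrow> on I (\<Sum>a\<in>A. f a)"
  by (induction A rule: infinite_finite_induct) auto

section \<open>The trace, matrix units and scalar multiples\<close>

definition tr :: "('i, 'r::comm_ring_1) fmat \<Rightarrow> 'r" where
  "tr X = (\<Sum>p\<in>idx X. ent X p p)"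

lemma tr_on: "finite S \<Longrightarrow> (\<And>p. p \<notin> S \<Longrightarrow> ent X p p = 0) \<Longrightarrow> tr X = (\<Sum>p\<in>S. ent X p p)"
  unfolding tr_def by (rule sum.mono_neutral_cong) (auto simp: ent_not_idx)

lemma tr_add: "tr (X + Y) = tr X + tr Y"
  using tr_on[of "idx X \<union> idx Y" X] tr_on[of "idx X \<union> idx Y" Y] tr_on[of "idx X \<union> idx Y" "X + Y"]
  by (simp add: ent_not_idx sum.distrib)

lemma tr_uminus: "tr (- X) = - tr X"
  using tr_on[of "idx X" X] tr_on[of "idx X" "- X"] by (simp add: ent_not_idx sum_negf)

lemma tr_diff: "tr (X - Y) = tr X - tr Y"
  using tr_add[of X "- Y"] by (simp add: tr_uminus)

lemma tr_0 [simp]: "tr 0 = 0"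
  by (simp add: tr_def)

lemma tr_sum: "tr (\<Sum>a\<in>A. f a) = (\<Sum>a\<in>A. tr (f a))"
  by (induction A rule: infinite_finite_induct) (auto simp: tr_add)

lemma tr_mult: "finite S \<Longrightarrow> on S X \<Longrightarrow> tr (X * Y) = (\<Sum>p\<in>S. \<Sum>q\<in>S. ent X p q * ent Y q p)"
proof -
  assume S: "finite S" "on S X"
  have "tr (X * Y) = (\<Sum>p\<in>S. ent (X * Y) p p)"
    by (rule tr_on) (use S in \<open>auto simp: ent_mult on_ent\<close>)
  then show ?thesis using S by (simp add: ent_mult)
qed

lemma tr_mult_comm: "tr (X * Y) = tr (Y * X)"
proof -
  let ?S = "idx X \<union> idx Y"
  have "on ?S X" "on ?S Y" by (auto simp: on_def) (use ent_not_idx in fastforce)+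
  then show ?thesis
    by (simp add: tr_mult[of ?S]) (subst sum.swap, simp add: mult.commute)
qed

definition eu :: "'i \<Rightarrow> 'i \<Rightarrow> ('i, 'r::comm_ring_1) fmat" where
  "eu p q = Fmat (Poly_Mapping.single (p, q) 1)"

lemma ent_eu: "ent (eu p q) r s = (if r = p \<and> s = q then 1 else 0)"
  by (auto simp: eu_def ent_def lookup_single when_def)

lemma on_eu [simp]: "p \<in> I \<Longrightarrow> q \<in> I \<Longrightarrow> on I (eu p q)"
  by (simp add: on_def ent_eu)

lemma tr_eu_mult: "tr (eu p q * X) = ent X q p"
proof -
  have "tr (eu p q * X) = (\<Sum>r\<in>{p,q}. \<Sum>s\<in>{p,q}. ent (eu p q) r s * ent X s r)"
    by (rule tr_mult) auto
  then show ?thesis by (cases "p = q") (auto simp: ent_eu)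
qed

definition smul :: "'r \<Rightarrow> ('i, 'r::comm_ring_1) fmat \<Rightarrow> ('i, 'r) fmat" where
  "smul c X = mat_on (idx X) (\<lambda>p q. c * ent X p q)"

lemma ent_smul [simp]: "ent (smul c X) p q = c * ent X p q"
  by (auto simp: smul_def ent_mat_on ent_not_idx)

lemma on_smul [simp]: "on I X \<Longrightarrow> on I (smul c X)"
  unfolding on_def ent_smul by (metis mult_zero_right)

lemma smul_mult_left: "smul c X * Y = smul c (X * Y)"
  and smul_mult_right: "X * smul c Y = smul c (X * Y)"
proof -
  let ?S = "idx X \<union> idx Y"
  have S: "finite ?S" by simp
  show "smul c X * Y = smul c (X * Y)" "X * smul c Y = smul c (X * Y)"
    by (auto intro!: fmat_eqI sum.cong simp: ent_mult_right[OF S, of Y] ent_mult_left[OF S, of X] sum_distrib_left algebra_simps)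
qed

lemma smul_add: "smul c (X + Y) = smul c X + smul c Y"
  and smul_diff: "smul c (X - Y) = smul c X - smul c Y"
  and smul_smul: "smul c (smul d X) = smul (c * d) X"
  and smul_1 [simp]: "smul 1 X = X"
  and smul_0 [simp]: "smul 0 X = 0"
  by (auto intro!: fmat_eqI simp: algebra_simps)

lemma tr_smul: "tr (smul c X) = c * tr X"
  using tr_on[of "idx X" "smul c X"] by (simp add: ent_not_idx tr_def sum_distrib_left)

section \<open>Entrywise change of the coefficient ring\<close>

definition map_fm :: "('r \<Rightarrow> 's) \<Rightarrow> ('i, 'r::comm_ring_1) fmat \<Rightarrow> ('i, 's::comm_ring_1) fmat" where
  "map_fm h X = mat_on (idx X) (\<lambda>p q. h (ent X p q))"

lemma ent_map_fm: "h 0 = 0 \<Longrightarrow> ent (map_fm h X) p q = h (ent X p q)"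
  by (auto simp: map_fm_def ent_mat_on ent_not_idx)

text \<open>The moment map is computed once with polynomial entries. Its values at points, its base
  changes and its restrictions to lines then arise by applying unital ring homomorphisms to the
  entries.\<close>

locale comm_ring_map =
  fixes h :: "'r::comm_ring_1 \<Rightarrow> 's::comm_ring_1"
  assumes h_add: "h (x + y) = h x + h y" and h_mult: "h (x * y) = h x * h y" and h_1: "h 1 = 1"
begin

lemma h_0: "h 0 = 0"
  using h_add[of 0 0] by simp

lemma h_sum: "h (\<Sum>a\<in>A. f a) = (\<Sum>a\<in>A. h (f a))"
  by (induction A rule: infinite_finite_induct) (auto simp: h_add h_0)

lemma h_uminus: "h (- x) = - h x"
  using h_add[of x "- x"] by (simp add: h_0 eq_neg_iff_add_eq_0 add.commute)

lemma h_diff: "h (x - y) = h x - h y"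
  using h_add[of x "- y"] by (simp add: h_uminus)

lemma h_power: "h (x ^ n) = h x ^ n"
  by (induction n) (auto simp: h_mult h_1)

lemma h_prod: "h (\<Prod>a\<in>A. f a) = (\<Prod>a\<in>A. h (f a))"
  by (induction A rule: infinite_finite_induct) (auto simp: h_mult h_1)

lemma map_fm_mult: "map_fm h (X * Y) = map_fm h X * map_fm h Y"
proof (rule fmat_eqI)
  fix p q
  have S: "finite (idx X)" by simp
  show "ent (map_fm h (X * Y)) p q = ent (map_fm h X * map_fm h Y) p q"
    by (simp add: ent_map_fm h_0 ent_mult_left[OF S, of X] ent_mult_on[OF S, of "map_fm h X"] ent_not_idx h_sum h_mult)
qed

lemma tr_map_fm: "tr (map_fm h X) = h (tr X)"
  using tr_on[of "idx X" "map_fm h X"] by (simp add: ent_not_idx ent_map_fm h_0 tr_def h_sum)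

lemma map_fm_diag: "finite J \<Longrightarrow> map_fm h (diag J) = diag J"
  by (rule fmat_eqI) (auto simp: ent_map_fm h_0 ent_diag h_1)

end

section \<open>Matrices acting on vectors\<close>

definition app :: "('i, complex) fmat \<Rightarrow> 'i cvec \<Rightarrow> 'i cvec" where
  "app X u = vec_on (idx X) (\<lambda>p. \<Sum>q\<in>idx X. ent X p q * Poly_Mapping.lookup u q)"

lemma lookup_app_on:
  assumes "finite S" "\<And>q. q \<notin> S \<Longrightarrow> ent X p q * Poly_Mapping.lookup u q = 0"
  shows "Poly_Mapping.lookup (app X u) p = (\<Sum>q\<in>S. ent X p q * Poly_Mapping.lookup u q)"
proof -
  have "Poly_Mapping.lookup (app X u) p = (\<Sum>q\<in>idx X. ent X p q * Poly_Mapping.lookup u q)"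
    by (auto simp: app_def lookup_vec_on ent_not_idx)
  also have "\<dots> = (\<Sum>q\<in>S. ent X p q * Poly_Mapping.lookup u q)"
    by (rule sum.mono_neutral_cong) (use assms in \<open>auto simp: ent_not_idx\<close>)
  finally show ?thesis .
qed

lemma lookup_app_left:
  assumes "finite S" "idx X \<subseteq> S"
  shows "Poly_Mapping.lookup (app X u) p = (\<Sum>q\<in>S. ent X p q * Poly_Mapping.lookup u q)"
proof (rule lookup_app_on[OF assms(1)])
  fix q assume "q \<notin> S"
  then have "q \<notin> idx X" using assms(2) by blast
  then show "ent X p q * Poly_Mapping.lookup u q = 0" by (simp add: ent_not_idx)
qed

lemma lookup_app: "finite I \<Longrightarrow> on I X \<Longrightarrow> Poly_Mapping.lookup (app X u) p = (\<Sum>q\<in>I. ent X p q * Poly_Mapping.lookup u q)"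
  by (rule lookup_app_on) (auto simp: on_ent)

lemma lookup_app_idx: "Poly_Mapping.lookup (app X u) p = (\<Sum>q\<in>idx X. ent X p q * Poly_Mapping.lookup u q)"
  by (rule lookup_app_on) (auto simp: ent_not_idx)

lemma ent_mult_not_idx: "q \<notin> idx Y \<Longrightarrow> ent (X * Y) p q = 0"
  by (simp add: ent_mult_right[OF finite_idx[of Y]] ent_not_idx)

lemma app_mult: "app (X * Y) u = app X (app Y u)"
proof (rule poly_mapping_eqI)
  fix p
  let ?S = "idx X \<union> idx Y"
  have S: "finite ?S" by simp
  have "Poly_Mapping.lookup (app (X * Y) u) p = (\<Sum>q\<in>?S. (\<Sum>r\<in>?S. ent X p r * ent Y r q) * Poly_Mapping.lookup u q)"
    by (subst lookup_app_on[OF S])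
      (simp_all add: ent_mult_not_idx, simp add: ent_mult_left[OF S, of X])
  also have "\<dots> = (\<Sum>r\<in>?S. ent X p r * (\<Sum>q\<in>?S. ent Y r q * Poly_Mapping.lookup u q))"
    unfolding sum_distrib_left sum_distrib_right by (subst sum.swap) (simp add: mult.assoc)
  also have "\<dots> = Poly_Mapping.lookup (app X (app Y u)) p"
    by (simp add: lookup_app_left[OF S])
  finally show "Poly_Mapping.lookup (app (X * Y) u) p = Poly_Mapping.lookup (app X (app Y u)) p" .
qed

lemma app_add: "app (X + Y) u = app X u + app Y u"
  and app_diff: "app (X - Y) u = app X u - app Y u"
proof -
  let ?S = "idx X \<union> idx Y"
  have S: "finite ?S" by simp
  have *: "Poly_Mapping.lookup (app (X + Y) u) k = (\<Sum>q\<in>?S. ent (X + Y) k q * Poly_Mapping.lookup u q)"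
    "Poly_Mapping.lookup (app (X - Y) u) k = (\<Sum>q\<in>?S. ent (X - Y) k q * Poly_Mapping.lookup u q)" for k
    by (rule lookup_app_on[OF S]; simp add: ent_not_idx)+
  show "app (X + Y) u = app X u + app Y u" "app (X - Y) u = app X u - app Y u"
    by (auto intro!: poly_mapping_eqI simp: lookup_app_left[OF S, of X] lookup_app_left[OF S, of Y]
        * lookup_add lookup_minus distrib_right left_diff_distrib sum.distrib sum_subtractf)
qed

lemma app_0 [simp]: "app 0 u = 0"
  by (rule poly_mapping_eqI) (simp add: lookup_app_idx)

lemma app_smul: "app (smul c X) u = fscale c (app X u)"
  by (rule poly_mapping_eqI)
    (simp add: lookup_app_idx[of X] lookup_app_on[OF finite_idx[of X], of "smul c X"] ent_not_idx sum_distrib_left mult.assoc)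

lemma flinear_app: "flinear (app X)"
  by (rule flinearI) (auto intro!: poly_mapping_eqI
      simp: lookup_app_idx lookup_add distrib_left sum.distrib sum_distrib_left mult.left_commute)

lemma app_in_funs_on: "on I X \<Longrightarrow> app X u \<in> funs_on I"
  by (simp add: funs_on_def lookup_app_idx on_ent)

lemma app_diag: "finite J \<Longrightarrow> Poly_Mapping.lookup (app (diag J) u) p = (if p \<in> J then Poly_Mapping.lookup u p else 0)"
proof -
  assume J: "finite J"
  have "Poly_Mapping.lookup (app (diag J) u) p = (\<Sum>q\<in>J. if q = p then Poly_Mapping.lookup u p else 0)"
    unfolding lookup_app[OF J on_diag[OF J subset_refl]] by (rule sum.cong) (auto simp: ent_diag J)
  then show ?thesis using J by simp
qed

lemma app_diag_funs_on: "finite J \<Longrightarrow> u \<in> funs_on J \<Longrightarrow> app (diag J) u = u"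
  by (rule poly_mapping_eqI) (auto simp: app_diag funs_on_def)

lemma lookup_app_unit: "Poly_Mapping.lookup (app X (unit_fun q)) p = ent X p q"
proof -
  have "Poly_Mapping.lookup (app X (unit_fun q)) p = (\<Sum>r\<in>{q}. ent X p r * Poly_Mapping.lookup (unit_fun q) r)"
    by (rule lookup_app_on) (auto simp: lookup_single)
  then show ?thesis by simp
qed

lemma unit_in_funs_on: "q \<in> I \<Longrightarrow> unit_fun q \<in> funs_on I"
  by (auto simp: funs_on_def lookup_single when_def)

lemma fmat_eqI_app:
  assumes "on I X" "on I Y" "\<And>u. u \<in> funs_on I \<Longrightarrow> app X u = app Y u"
  shows "X = Y"
proof (rule fmat_eqI)
  fix p q
  show "ent X p q = ent Y p q"
  proof (cases "q \<in> I")
    case True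
    from assms(3)[OF unit_in_funs_on[OF this]] show ?thesis by (metis lookup_app_unit)
  qed (use assms in \<open>auto simp: on_ent\<close>)
qed

definition mat_of :: "'i set \<Rightarrow> ('i cvec \<Rightarrow> 'i cvec) \<Rightarrow> ('i, complex) fmat" where
  "mat_of I g = mat_on I (\<lambda>p q. Poly_Mapping.lookup (g (unit_fun q)) p)"

lemma on_mat_of [simp]: "finite I \<Longrightarrow> on I (mat_of I g)"
  by (simp add: mat_of_def)

text \<open>Linearity is asked for on \<open>funs_on I\<close> because the maps to be represented
  are built with a choice, such as the components of a vector in a direct sum, and are linear on
  that domain only.\<close>

lemma app_mat_of:
  assumes "finite I" "u \<in> funs_on I"
    and add: "\<And>x y. x \<in> funs_on I \<Longrightarrow> y \<in> funs_on I \<Longrightarrow> g (x + y) = g x + g y"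
    and scale: "\<And>c x. x \<in> funs_on I \<Longrightarrow> g (fscale c x) = fscale c (g x)"
    and range: "\<And>x. x \<in> funs_on I \<Longrightarrow> g x \<in> funs_on I"
  shows "app (mat_of I g) u = g u"
proof -
  have g0: "g 0 = 0" using scale[of 0 0] by (simp add: funs_on_def)
  have sum: "g (\<Sum>q\<in>A. fscale (c q) (unit_fun q)) = (\<Sum>q\<in>A. fscale (c q) (g (unit_fun q)))"
    if "finite A" "A \<subseteq> I" for c A
    using that
  proof (induction A rule: finite_induct)
    case (insert a A)
    have "(\<Sum>q\<in>A. fscale (c q) (unit_fun q)) \<in> funs_on I"
      using insert by (intro funs_on_sum funs_on_scale unit_in_funs_on) auto
    then show ?case using insert by (simp add: add scale unit_in_funs_on)
  qed (simp add: g0)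
  show ?thesis
  proof (rule poly_mapping_eqI)
    fix p
    have "Poly_Mapping.lookup (g u) p = (\<Sum>q\<in>I. Poly_Mapping.lookup u q * Poly_Mapping.lookup (g (unit_fun q)) p)"
      using sum[OF assms(1) subset_refl, of "Poly_Mapping.lookup u"] funs_on_expand[OF assms(1,2)]
      by (simp add: lookup_sum)
    moreover have "Poly_Mapping.lookup (g (unit_fun q)) p = 0" if "p \<notin> I" "q \<in> I" for q
      using range[OF unit_in_funs_on[OF that(2)]] that by (simp add: funs_on_def)
    ultimately show "Poly_Mapping.lookup (app (mat_of I g) u) p = Poly_Mapping.lookup (g u) p"
      unfolding mat_of_def lookup_app[OF assms(1) on_mat_on[OF assms(1)]] ent_mat_on[OF assms(1)]
      by (cases "p \<in> I") (simp_all add: mult.commute cong: sum.cong)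
  qed
qed

lemma ent_mult_nonzero:
  assumes "ent (X * Y) p q \<noteq> 0"
  obtains r where "ent X p r \<noteq> 0" "ent Y r q \<noteq> 0"
proof -
  have "ent (X * Y) p q = (\<Sum>r\<in>idx X. ent X p r * ent Y r q)"
    by (rule ent_mult_left) auto
  then have "(\<Sum>r\<in>idx X. ent X p r * ent Y r q) \<noteq> 0"
    using assms by simp
  then obtain r where r: "ent X p r * ent Y r q \<noteq> 0"
    by (rule sum.not_neutral_contains_not_neutral)
  show ?thesis
    by (rule that[of r]) (use r in auto)
qed

lemma onD: "on I X \<Longrightarrow> ent X p q \<noteq> 0 \<Longrightarrow> p \<in> I \<and> q \<in> I"
  unfolding on_def by blast

lemma onI: "(\<And>p q. ent X p q \<noteq> 0 \<Longrightarrow> p \<in> I \<and> q \<in> I) \<Longrightarrow> on I X"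
  unfolding on_def by blast

lemma app_eq_on_span:
  assumes "\<And>b. b \<in> B \<Longrightarrow> app X b = app Y b" "u \<in> fspan B"
  shows "app X u = app Y u"
  by (rule fsp.linear_eq_on[OF flinear_app flinear_app assms(2)]) (rule assms(1))

lemma app_add_right: "app X (u + w) = app X u + app X w"
  and app_scale: "app X (fscale c u) = fscale c (app X u)"
  and app_diff_right: "app X (u - w) = app X u - app X w"
  by (rule flinear_add[OF flinear_app], rule flinear_scale[OF flinear_app], rule fsp.linear_diff[OF flinear_app])

lemma app_zero_right [simp]: "app X 0 = 0"
  by (rule fsp.linear_0[OF flinear_app])

lemma app_sum: "app (\<Sum>a\<in>A. f a) u = (\<Sum>a\<in>A. app (f a) u)"
  by (induction A rule: infinite_finite_induct) (auto simp: app_add)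

lemma app_sum_right: "app X (\<Sum>a\<in>A. f a) = (\<Sum>a\<in>A. app X (f a))"
  by (rule fsp.linear_sum[OF flinear_app])

section \<open>Diagonalisation of idempotent matrices\<close>

lemma idempotent_bases:
  fixes P :: "('i, complex) fmat"
  assumes C: "finite C" and P: "on C P" "P * P = P"
  obtains B1 B2 where "\<not> fdependent (B1 \<union> B2)" "B1 \<inter> B2 = {}" "B1 \<union> B2 \<subseteq> funs_on C"
    "card (B1 \<union> B2) = card C" "\<And>b. b \<in> B1 \<Longrightarrow> app P b = b" "\<And>b. b \<in> B2 \<Longrightarrow> app P b = 0"
proof -
  let ?U1 = "{u \<in> funs_on C. app P u = u}" and ?U2 = "{u \<in> funs_on C. app P u = 0}"
  obtain B1 where B1: "B1 \<subseteq> ?U1" "\<not> fdependent B1" "?U1 \<subseteq> fspan B1"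
    by (rule fs.basis_exists[of ?U1])
  obtain B2 where B2: "B2 \<subseteq> ?U2" "\<not> fdependent B2" "?U2 \<subseteq> fspan B2"
    by (rule fs.basis_exists[of ?U2])
  have fix1: "app P b = b" if "b \<in> B1" for b using B1(1) that by blast
  have fix2: "app P b = 0" if "b \<in> B2" for b using B2(1) that by blast
  have "B1 \<subseteq> funs_on C" "B2 \<subseteq> funs_on C" using B1(1) B2(1) by blast+
  then have fin: "finite B1" "finite B2"
    using independent_funs_on_bound[OF C B1(2)] independent_funs_on_bound[OF C B2(2)] by blast+
  have ne: "0 \<notin> B1" using B1(2) fs.dependent_zero by blast
  then have disj: "B1 \<inter> B2 = {}" using fix1 fix2 by fastforce
  have ind: "\<not> fdependent (B1 \<union> B2)"
  proof (rule fs.independent_if_scalars_zero)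
    show "finite (B1 \<union> B2)" using fin by simp
    fix c x assume *: "(\<Sum>x\<in>B1 \<union> B2. fscale (c x) x) = 0" and x: "x \<in> B1 \<union> B2"
    let ?s1 = "\<Sum>x\<in>B1. fscale (c x) x" and ?s2 = "\<Sum>x\<in>B2. fscale (c x) x"
    have s: "?s1 + ?s2 = 0"
      using * fin disj by (simp add: sum.union_disjoint)
    have "app P ?s1 = (\<Sum>x\<in>B1. fscale (c x) (app P x))" "app P ?s2 = (\<Sum>x\<in>B2. fscale (c x) (app P x))"
      by (rule flinear_sum_scale[OF flinear_app])+
    then have "app P ?s1 = ?s1" "app P ?s2 = 0"
      by (simp_all add: fix1 fix2 cong: sum.cong)
    then have "app P (?s1 + ?s2) = ?s1" by (simp add: app_add_right)
    then have s1: "?s1 = 0" using s by simp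
    then have s2: "?s2 = 0" using s by simp
    show "c x = 0"
      using x fs.independentD[OF B1(2) fin(1) subset_refl s1] fs.independentD[OF B2(2) fin(2) subset_refl s2] by blast
  qed
  have "funs_on C \<subseteq> fspan (B1 \<union> B2)"
  proof
    fix u assume u: "u \<in> funs_on C"
    have PP: "app P (app P u) = app P u" using P(2) app_mult[of P P u] by simp
    then have "app P u \<in> fspan B1" using B1(3) app_in_funs_on[OF P(1)] by blast
    moreover have "u - app P u \<in> fspan B2"
      using B2(3) u app_in_funs_on[OF P(1)] PP by (auto simp: app_diff_right)
    ultimately have "app P u + (u - app P u) \<in> fspan (B1 \<union> B2)"
      by (intro fs.span_add) (use fs.span_mono[of B1 "B1 \<union> B2"] fs.span_mono[of B2 "B1 \<union> B2"] in blast)+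
    then show "u \<in> fspan (B1 \<union> B2)" by simp
  qed
  then have "card C \<le> card (B1 \<union> B2)"
    using fs.dim_le_card[of "funs_on C" "B1 \<union> B2"] fin dim_funs_on[OF C] by simp
  moreover have "card (B1 \<union> B2) \<le> card C"
    using independent_funs_on_bound[OF C ind] B1(1) B2(1) by blast
  ultimately show ?thesis
    using that[OF ind disj _ _ fix1 fix2] B1(1) B2(1) by auto
qed

text \<open>Column j of \<open>g\<close> is the j-th vector of a basis of eigenvectors for the
  eigenvalues 1 and 0, \<open>g'\<close> is the matrix of the map that sends this vector to the unit
  vector j, and \<open>J\<close> collects the j whose vector is fixed by \<open>P\<close>.\<close>

lemma idempotent_diagonalizable:
  fixes P :: "('i, complex) fmat"
  assumes C: "finite C" and P: "on C P" "P * P = P"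
  obtains g g' J where "on C g" "on C g'" "g * g' = diag C" "g' * g = diag C" "J \<subseteq> C" "P = g * diag J * g'"
proof -
  obtain B1 B2 where B: "\<not> fdependent (B1 \<union> B2)" "B1 \<inter> B2 = {}" "B1 \<union> B2 \<subseteq> funs_on C"
    "card (B1 \<union> B2) = card C" "\<And>b. b \<in> B1 \<Longrightarrow> app P b = b" "\<And>b. b \<in> B2 \<Longrightarrow> app P b = 0"
    using idempotent_bases[OF assms] by blast
  let ?B = "B1 \<union> B2"
  have finB: "finite ?B" using independent_funs_on_bound[OF C B(1,3)] by blast
  have span: "fspan ?B = funs_on C" by (rule independent_spanning[OF C B(1,3,4)])
  obtain f where f: "bij_betw f C ?B"
    using finite_same_card_bij[OF C finB] B(4) by auto
  have fim: "f ` C = ?B" using f by (simp add: bij_betw_def)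
  define J where "J = {j \<in> C. f j \<in> B1}"
  have J: "J \<subseteq> C" "finite J" using C by (auto simp: J_def)
  obtain G where G: "flinear G" "\<And>b. b \<in> ?B \<Longrightarrow> G b = unit_fun (inv_into C f b)"
    using fsp.linear_independent_extend[OF B(1), of "\<lambda>b. unit_fun (inv_into C f b)"] by blast
  have Gf: "G (f j) = unit_fun j" if "j \<in> C" for j
    using G(2)[of "f j"] f that by (auto simp: bij_betw_def)
  have Grange: "G u \<in> funs_on C" if "u \<in> funs_on C" for u
  proof -
    have "fsubspace {u. G u \<in> funs_on C}"
      by (rule fsp.linear_subspace_linear_preimage[OF G(1)]) simp
    moreover have "?B \<subseteq> {u. G u \<in> funs_on C}"
      unfolding fim[symmetric] using Gf unit_in_funs_on by auto
    ultimately show ?thesis using fs.span_minimal[of ?B] span that by blast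
  qed
  define g where "g = mat_on C (\<lambda>i j. Poly_Mapping.lookup (f j) i)"
  define g' where "g' = mat_of C G"
  have on: "on C g" "on C g'" using C by (auto simp: g_def g'_def)
  have fC: "f j \<in> funs_on C" "f j \<in> ?B" if "j \<in> C" for j using f that B(3) by (auto simp: bij_betw_def)
  have appg: "app g (unit_fun j) = f j" if "j \<in> C" for j
    by (rule poly_mapping_eqI)
      (use fC[OF that] that C in \<open>auto simp: lookup_app_unit g_def ent_mat_on funs_on_def\<close>)
  have appg': "app g' u = G u" if "u \<in> funs_on C" for u
    unfolding g'_def using that C Grange
    by (intro app_mat_of) (auto simp: flinear_add[OF G(1)] flinear_scale[OF G(1)])
  have appg'f: "app g' (f j) = unit_fun j" if "j \<in> C" for j
    using appg'[OF fC(1)] Gf that by simp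
  have eqI: "X = Y" if "on C X" "on C Y" "\<And>j. j \<in> C \<Longrightarrow> app X (f j) = app Y (f j)" for X Y
  proof (rule fmat_eqI_app[OF that(1,2)])
    fix u assume "u \<in> funs_on C"
    then have "u \<in> fspan ?B" by (simp add: span)
    moreover have "app X b = app Y b" if "b \<in> ?B" for b
      using that \<open>\<And>j. j \<in> C \<Longrightarrow> app X (f j) = app Y (f j)\<close> unfolding fim[symmetric] by blast
    ultimately show "app X u = app Y u" using app_eq_on_span[of ?B X Y u] by blast
  qed
  have gg': "g * g' = diag C"
  proof (rule eqI)
    show "on C (g * g')" using on by (simp add: on_mult)
    show "on C (diag C :: ('i, complex) fmat)" using C by simp
    fix j assume j: "j \<in> C"
    show "app (g * g') (f j) = app (diag C) (f j)"
      by (simp add: app_mult appg'f[OF j] appg[OF j] app_diag_funs_on[OF C fC(1)[OF j]])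
  qed
  have g'g: "g' * g = diag C"
  proof (rule fmat_eqI)
    fix p q
    show "ent (g' * g) p q = ent (diag C) p q"
    proof (cases "q \<in> C")
      case True
      have "ent (g' * g) p q = Poly_Mapping.lookup (app (g' * g) (unit_fun q)) p"
        by (simp only: lookup_app_unit)
      also have "app (g' * g) (unit_fun q) = unit_fun q"
        by (simp only: app_mult appg[OF True] appg'f[OF True])
      finally show ?thesis using True C by (auto simp: ent_diag lookup_single when_def)
    next
      case False
      then show ?thesis using on_ent(2)[OF on_mult[OF on(2,1)], of q] C by (simp add: ent_diag)
    qed
  qed
  have dJ: "app (diag J) (unit_fun j) = (if j \<in> J then unit_fun j else 0)" for j
    by (rule poly_mapping_eqI) (auto simp: app_diag J lookup_single when_def)
  have "P = g * diag J * g'"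
  proof (rule eqI)
    show "on C (g * diag J * g')" using on C J by (simp add: on_mult)
    fix j assume j: "j \<in> C"
    then have "app (g * diag J * g') (f j) = (if j \<in> J then f j else 0)"
      by (simp add: app_mult appg'f dJ appg)
    moreover have "app P (f j) = (if j \<in> J then f j else 0)"
      using fC(2)[OF j] B(2,5,6) j by (auto simp: J_def)
    ultimately show "app P (f j) = app (g * diag J * g') (f j)" by simp
  qed (rule P)
  then show ?thesis using that on gg' g'g J by blast
qed

section \<open>Block matrices over a quiver R, applied to Q and to its double\<close>

locale quiver_dim = fin_digraph R for R :: "('v, 'b) pre_digraph" +
  fixes \<alpha> :: "'v \<Rightarrow> nat"
begin

definition cell :: "'v \<Rightarrow> ('v \<times> nat) set" where
  "cell v = {v} \<times> {..<\<alpha> v}"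

definition I :: "('v \<times> nat) set" where
  "I = (SIGMA v:verts R. {..<\<alpha> v})"

text \<open>The product of the matrix algebras at the vertices, which is the Lie algebra of
  \<open>GL(alpha)\<close>. Elements of the group itself enter as pairs \<open>g\<close>,
  \<open>g'\<close> in \<open>gl\<close> with both products equal to \<open>diag I\<close>.\<close>

definition gl :: "('v \<times> nat, 'r::comm_ring_1) fmat set" where
  "gl = {\<theta>. \<forall>p q. ent \<theta> p q \<noteq> 0 \<longrightarrow> p \<in> I \<and> q \<in> I \<and> fst p = fst q}"

text \<open>The condition concerns arrows of the quiver only; a member may take any value elsewhere.
  Equality of representations is therefore always expressed arrow by arrow.\<close>

definition reps :: "('b \<Rightarrow> ('v \<times> nat, 'r::comm_ring_1) fmat) set" where
  "reps = {X. \<forall>b\<in>arcs R. \<forall>p q. ent (X b) p q \<noteq> 0 \<longrightarrow> p \<in> cell (head R b) \<and> q \<in> cell (tail R b)}"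

definition commute :: "('v \<times> nat, 'r::comm_ring_1) fmat \<Rightarrow> ('b \<Rightarrow> ('v \<times> nat, 'r) fmat) \<Rightarrow> bool" where
  "commute \<theta> X \<longleftrightarrow> (\<forall>b\<in>arcs R. \<theta> * X b = X b * \<theta>)"

lemma finite_cell [simp]: "finite (cell v)" by (simp add: cell_def)

lemma finite_I [simp]: "finite I" by (simp add: I_def)

lemma cell_subset_I: "v \<in> verts R \<Longrightarrow> cell v \<subseteq> I" by (auto simp: cell_def I_def)

lemma in_cell_iff: "p \<in> I \<Longrightarrow> p \<in> cell v \<longleftrightarrow> fst p = v" by (auto simp: cell_def I_def)

lemma fst_in_verts: "p \<in> I \<Longrightarrow> fst p \<in> verts R" by (auto simp: I_def)

lemma in_cellD: "p \<in> cell v \<Longrightarrow> fst p = v" by (auto simp: cell_def)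

lemma I_eq_cells: "I = (\<Union>v\<in>verts R. cell v)" by (auto simp: cell_def I_def)

lemma gl_on: "\<theta> \<in> gl \<Longrightarrow> on I \<theta>" by (auto simp: gl_def on_def)

lemma reps_on: "X \<in> reps \<Longrightarrow> b \<in> arcs R \<Longrightarrow> on I (X b)"
  using cell_subset_I unfolding reps_def on_def by (auto dest!: bspec) (metis in_mono head_in_verts tail_in_verts)+

lemma gl_0 [simp]: "0 \<in> gl" by (simp add: gl_def)

lemma gl_add: "\<theta> \<in> gl \<Longrightarrow> \<eta> \<in> gl \<Longrightarrow> \<theta> + \<eta> \<in> gl"
  and gl_diff: "\<theta> \<in> gl \<Longrightarrow> \<eta> \<in> gl \<Longrightarrow> \<theta> - \<eta> \<in> gl"
  unfolding gl_def mem_Collect_eq ent_add ent_diff by (metis add_0 diff_zero)+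

lemma gl_smul: "\<theta> \<in> gl \<Longrightarrow> smul c \<theta> \<in> gl"
  unfolding gl_def mem_Collect_eq ent_smul by (metis mult_zero_right)

lemma gl_mult: "\<theta> \<in> gl \<Longrightarrow> \<eta> \<in> gl \<Longrightarrow> \<theta> * \<eta> \<in> gl"
  unfolding gl_def by (auto elim!: ent_mult_nonzero) metis+

lemma gl_sum: "(\<And>a. a \<in> A \<Longrightarrow> f a \<in> gl) \<Longrightarrow> (\<Sum>a\<in>A. f a) \<in> gl"
  by (induction A rule: infinite_finite_induct) (auto simp: gl_add)

lemma gl_diag [simp]: "J \<subseteq> I \<Longrightarrow> diag J \<in> gl"
  by (auto simp: gl_def ent_diag finite_subset[OF _ finite_I])

lemma gl_on_cell: "v \<in> verts R \<Longrightarrow> on (cell v) \<theta> \<Longrightarrow> \<theta> \<in> gl"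
  unfolding gl_def mem_Collect_eq
proof (intro allI impI)
  fix p q assume "v \<in> verts R" "on (cell v) \<theta>" "ent \<theta> p q \<noteq> 0"
  then have "p \<in> cell v" "q \<in> cell v" "cell v \<subseteq> I"
    using cell_subset_I[of v] onD[of "cell v" \<theta> p q] by simp_all
  then show "p \<in> I \<and> q \<in> I \<and> fst p = fst q" using in_cellD[of p v] in_cellD[of q v] by auto
qed

lemma reps_ent: "X \<in> reps \<Longrightarrow> b \<in> arcs R \<Longrightarrow> ent (X b) p q \<noteq> 0 \<Longrightarrow> p \<in> cell (head R b) \<and> q \<in> cell (tail R b)"
  unfolding reps_def by blast

lemma gl_ent: "\<theta> \<in> gl \<Longrightarrow> ent \<theta> p q \<noteq> 0 \<Longrightarrow> p \<in> I \<and> q \<in> I \<and> fst p = fst q"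
  unfolding gl_def by blast

lemma gl_ent_cell: "\<theta> \<in> gl \<Longrightarrow> ent \<theta> p q \<noteq> 0 \<Longrightarrow> p \<in> cell v \<longleftrightarrow> q \<in> cell v"
  using gl_ent[of \<theta> p q] in_cell_iff[of p v] in_cell_iff[of q v] by simp

lemma reps_add: "X \<in> reps \<Longrightarrow> Y \<in> reps \<Longrightarrow> (\<lambda>b. X b + Y b) \<in> reps"
  and reps_diff: "X \<in> reps \<Longrightarrow> Y \<in> reps \<Longrightarrow> (\<lambda>b. X b - Y b) \<in> reps"
  unfolding reps_def mem_Collect_eq ent_add ent_diff by (metis add_0 diff_zero)+

lemma reps_smul: "X \<in> reps \<Longrightarrow> (\<lambda>b. smul c (X b)) \<in> reps"
  unfolding reps_def mem_Collect_eq ent_smul by (metis mult_zero_right)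

lemma reps_mult_left: "\<theta> \<in> gl \<Longrightarrow> X \<in> reps \<Longrightarrow> (\<lambda>b. \<theta> * X b) \<in> reps"
  unfolding reps_def[of] mem_Collect_eq
  by (intro ballI allI impI, erule ent_mult_nonzero) (use gl_ent_cell in blast)

lemma reps_mult_right: "\<theta> \<in> gl \<Longrightarrow> X \<in> reps \<Longrightarrow> (\<lambda>b. X b * \<theta>) \<in> reps"
  unfolding reps_def[of] mem_Collect_eq
  by (intro ballI allI impI, erule ent_mult_nonzero) (use gl_ent_cell in blast)

lemma reps_conj: "g \<in> gl \<Longrightarrow> g' \<in> gl \<Longrightarrow> X \<in> reps \<Longrightarrow> (\<lambda>b. g * X b * g') \<in> reps"
  by (rule reps_mult_right[OF _ reps_mult_left])

lemma reps_comm: "\<theta> \<in> gl \<Longrightarrow> X \<in> reps \<Longrightarrow> (\<lambda>b. \<theta> * X b - X b * \<theta>) \<in> reps"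
  by (rule reps_diff[OF reps_mult_left reps_mult_right])

text \<open>The diagonalisation takes place in each vertex space separately, where
  \<open>P v\<close> is the restriction of \<open>p\<close>. Matrices supported on different cells
  multiply to 0, so the sums over the vertices of the changes of basis are again mutually inverse,
  and they lie in \<open>gl\<close>.\<close>

lemma gl_idempotent_diagonalizable:
  fixes p :: "('v \<times> nat, complex) fmat"
  assumes p: "p \<in> gl" "p * p = p"
  obtains g g' J where "g \<in> gl" "g' \<in> gl" "g * g' = diag I" "g' * g = diag I" "J \<subseteq> I" "p = g * diag J * g'"
proof -
  define P where "P v = diag (cell v) * p" for v
  have onP: "on (cell v) (P v)" for v
  proof (rule onI)
    fix x y assume "ent (P v) x y \<noteq> 0"
    then show "x \<in> cell v \<and> y \<in> cell v"
      using gl_ent_cell[OF p(1), of x y v] by (simp add: P_def split: if_splits)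
  qed
  have pd: "diag (cell v) * p = p * diag (cell v)" for v
  proof (rule fmat_eqI)
    fix x y
    show "ent (diag (cell v) * p) x y = ent (p * diag (cell v)) x y"
      using gl_ent_cell[OF p(1), of x y v] by (cases "ent p x y = 0") simp_all
  qed
  have PP: "P v * P v = P v" for v
  proof -
    have "P v * P v = diag (cell v) * ((p * diag (cell v)) * p)" by (simp only: P_def mult.assoc)
    also have "\<dots> = diag (cell v) * ((diag (cell v) * p) * p)" by (simp only: pd)
    also have "\<dots> = (diag (cell v) * diag (cell v)) * (p * p)" by (simp only: mult.assoc)
    also have "\<dots> = P v"
      by (simp only: P_def p(2) diag_mult_diag[OF finite_cell finite_cell] Int_absorb)
    finally show ?thesis .
  qed
  have "\<exists>g g' J. on (cell v) g \<and> on (cell v) g' \<and> g * g' = diag (cell v) \<and> g' * g = diag (cell v)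
      \<and> J \<subseteq> cell v \<and> P v = g * diag J * g'" for v
    using idempotent_diagonalizable[OF finite_cell onP PP, of v] by metis
  then obtain g g' :: "'v \<Rightarrow> ('v \<times> nat, complex) fmat" and J
    where *: "\<And>v. on (cell v) (g v)" "\<And>v. on (cell v) (g' v)" "\<And>v. g v * g' v = diag (cell v)"
      "\<And>v. g' v * g v = diag (cell v)" "\<And>v. J v \<subseteq> cell v" "\<And>v. P v = g v * diag (J v) * g' v"
    by metis
  have diagI: "(diag I :: ('v \<times> nat, complex) fmat) = (\<Sum>v\<in>verts R. diag (cell v))"
  proof (rule fmat_eqI)
    fix x y
    have "(\<Sum>v\<in>verts R. ent (diag (cell v)) x y :: complex) = (\<Sum>v\<in>verts R. if v = fst x then ent (diag I) x y else 0)"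
      by (rule sum.cong) (auto simp: ent_diag I_def cell_def)
    then show "ent (diag I :: ('v \<times> nat, complex) fmat) x y = ent (\<Sum>v\<in>verts R. diag (cell v)) x y"
      using fst_in_verts[of x] by (auto simp: ent_sum ent_diag)
  qed
  have prod: "(\<Sum>v\<in>verts R. x v) * (\<Sum>v\<in>verts R. y v) = (\<Sum>v\<in>verts R. x v * y v)"
    if "\<And>v. on (cell v) (x v)" "\<And>v. on (cell v) (y v)" for x y :: "'v \<Rightarrow> ('v \<times> nat, complex) fmat"
  proof -
    have z: "x v * y w = 0" if "v \<noteq> w" for v w
    proof (rule fmat_eqI, rule ccontr)
      fix p q assume "ent (x v * y w) p q \<noteq> ent 0 p q"
      then obtain r where "ent (x v) p r \<noteq> 0" "ent (y w) r q \<noteq> 0"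
        by (metis ent_0 ent_mult_nonzero)
      then show False using \<open>\<And>v. on (cell v) (x v)\<close> \<open>\<And>v. on (cell v) (y v)\<close> that
        unfolding on_def by (metis in_cellD)
    qed
    have "(\<Sum>v\<in>verts R. x v) * (\<Sum>v\<in>verts R. y v) = (\<Sum>v\<in>verts R. \<Sum>w\<in>verts R. x v * y w)"
      by (simp add: sum_product)
    also have "\<dots> = (\<Sum>v\<in>verts R. \<Sum>w\<in>verts R. if w = v then x v * y v else 0)"
      by (intro sum.cong refl) (auto simp: z)
    finally show ?thesis by simp
  qed
  let ?g = "\<Sum>v\<in>verts R. g v" and ?g' = "\<Sum>v\<in>verts R. g' v" and ?J = "\<Union>v\<in>verts R. J v"
  have g: "?g \<in> gl" "?g' \<in> gl" using *(1,2) by (auto intro!: gl_sum gl_on_cell)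
  have gg: "?g * ?g' = diag I" "?g' * ?g = diag I"
    using prod[of g g'] prod[of g' g] *(1-4) by (simp_all add: diagI)
  have J: "?J \<subseteq> I" using *(5) by (auto simp: I_eq_cells)
  have finJ: "finite (J v)" for v using finite_subset[OF *(5)] by simp
  have dJ: "diag ?J = (\<Sum>v\<in>verts R. diag (J v) :: ('v \<times> nat, complex) fmat)"
  proof (rule fmat_eqI)
    fix x y
    have J_iff: "x \<in> J v \<longleftrightarrow> v = fst x \<and> x \<in> J (fst x)" for v
      using *(5)[of v] in_cellD[of x v] by (cases "v = fst x") auto
    have "(\<Sum>v\<in>verts R. ent (diag (J v)) x y :: complex) =
        (\<Sum>v\<in>verts R. if v = fst x then (if x = y \<and> x \<in> J (fst x) then 1 else 0) else 0)"
    proof (rule sum.cong[OF refl])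
      fix v
      show "ent (diag (J v)) x y = (if v = fst x then (if x = y \<and> x \<in> J (fst x) then 1 else (0::complex)) else 0)"
        unfolding ent_diag[OF finJ] using J_iff[of v] by simp
    qed
    moreover have "x \<in> ?J \<longleftrightarrow> fst x \<in> verts R \<and> x \<in> J (fst x)"
    proof
      assume "x \<in> ?J"
      then obtain v where v: "v \<in> verts R" "x \<in> J v" by blast
      then show "fst x \<in> verts R \<and> x \<in> J (fst x)" using J_iff[of v] by simp
    qed blast
    moreover have "finite ?J" by (simp add: finJ)
    ultimately show "ent (diag ?J) x y = ent (\<Sum>v\<in>verts R. diag (J v) :: ('v \<times> nat, complex) fmat) x y"
      by (simp add: ent_sum ent_diag)
  qed
  have onJ: "on (cell v) (diag (J v) :: ('v \<times> nat, complex) fmat)" for v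
    by (rule on_diag[OF finite_cell *(5)])
  have "?g * diag ?J * ?g' = (\<Sum>v\<in>verts R. g v * diag (J v)) * ?g'"
    unfolding dJ by (simp only: prod[OF *(1) onJ])
  also have "\<dots> = (\<Sum>v\<in>verts R. g v * diag (J v) * g' v)"
    by (rule prod[OF on_mult[OF *(1) onJ] *(2)])
  also have "\<dots> = (\<Sum>v\<in>verts R. diag (cell v)) * p"
    by (simp only: *(6)[symmetric] P_def sum_distrib_right)
  also have "\<dots> = p" unfolding diagI[symmetric] by (simp add: gl_on[OF p(1)])
  finally show ?thesis using that[OF g gg J] by simp
qed

section \<open>Representations as coordinate vectors, tangent spaces of orbits\<close>

definition K :: "('b \<times> ('v \<times> nat) \<times> ('v \<times> nat)) set" where
  "K = (SIGMA b:arcs R. cell (head R b) \<times> cell (tail R b))"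

lemma finite_K [simp]: "finite K" by (simp add: K_def)

definition rvec :: "('b \<Rightarrow> ('v \<times> nat, complex) fmat) \<Rightarrow> ('b \<times> ('v \<times> nat) \<times> ('v \<times> nat)) cvec" where
  "rvec X = vec_on K (\<lambda>(b, p, q). ent (X b) p q)"

lemma lookup_rvec: "Poly_Mapping.lookup (rvec X) (b, p, q) = (if (b, p, q) \<in> K then ent (X b) p q else 0)"
  by (simp add: rvec_def lookup_vec_on)

lemma rvec_in_funs_on [simp]: "rvec X \<in> funs_on K"
  by (simp add: rvec_def)

lemma rvec_add: "rvec (\<lambda>b. X b + Y b) = rvec X + rvec Y"
  and rvec_diff: "rvec (\<lambda>b. X b - Y b) = rvec X - rvec Y"
  and rvec_smul: "rvec (\<lambda>b. smul c (X b)) = fscale c (rvec X)"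
  by (rule poly_mapping_eqI; auto simp: rvec_def lookup_vec_on lookup_add lookup_minus)+

lemma rvec_eq_iff:
  assumes "X \<in> reps" "Y \<in> reps"
  shows "rvec X = rvec Y \<longleftrightarrow> (\<forall>b\<in>arcs R. X b = Y b)"
proof
  assume eq: "rvec X = rvec Y"
  show "\<forall>b\<in>arcs R. X b = Y b"
  proof (intro ballI fmat_eqI)
    fix b p q assume b: "b \<in> arcs R"
    show "ent (X b) p q = ent (Y b) p q"
    proof (cases "p \<in> cell (head R b) \<and> q \<in> cell (tail R b)")
      case True
      then have "(b, p, q) \<in> K" using b by (simp add: K_def)
      then show ?thesis using eq lookup_rvec[of X b p q] lookup_rvec[of Y b p q] by simp
    qed (use assms b reps_ent in metis)
  qed
next
  assume "\<forall>b\<in>arcs R. X b = Y b"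
  then show "rvec X = rvec Y"
    by (intro poly_mapping_eqI) (auto simp: rvec_def lookup_vec_on K_def)
qed

text \<open>The velocity at \<open>X\<close> of base change by 1 + t \<theta>. Letting \<theta> run
  through \<open>gl\<close> gives the tangent space of the orbit of \<open>X\<close>; the \<theta>
  in \<open>gl\<close> with zero velocity at every arrow are the endomorphisms of
  \<open>X\<close>.\<close>

definition commr :: "('v \<times> nat, 'r::comm_ring_1) fmat \<Rightarrow> ('b \<Rightarrow> ('v \<times> nat, 'r) fmat) \<Rightarrow> 'b \<Rightarrow> ('v \<times> nat, 'r) fmat" where
  "commr \<theta> X = (\<lambda>b. \<theta> * X b - X b * \<theta>)"

lemma commr_reps: "\<theta> \<in> gl \<Longrightarrow> X \<in> reps \<Longrightarrow> commr \<theta> X \<in> reps"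
  unfolding commr_def by (rule reps_comm)

lemma fsubspace_commr: "fsubspace ((\<lambda>\<theta>. rvec (commr \<theta> X)) ` gl)"
proof -
  have "rvec (commr \<theta> X) + rvec (commr \<eta> X) = rvec (commr (\<theta> + \<eta>) X)" for \<theta> \<eta>
    unfolding rvec_add[symmetric] commr_def by (simp add: algebra_simps)
  moreover have "fscale c (rvec (commr \<theta> X)) = rvec (commr (smul c \<theta>) X)" for c \<theta>
    unfolding rvec_smul[symmetric] commr_def by (simp add: smul_mult_left smul_mult_right smul_diff)
  moreover have "0 = rvec (commr 0 X)"
    by (rule poly_mapping_eqI) (auto simp: rvec_def lookup_vec_on commr_def)
  ultimately show ?thesis
    unfolding fs.subspace_def by (auto intro!: image_eqI gl_add gl_smul)
qed

text \<open>At a representation whose orbit has maximal dimension, endomorphisms act trivially on the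
  self-extensions: otherwise a first-order deformation would raise the rank of
  \<^term>\<open>\<lambda>\<theta>. commr \<theta> X\<close>.\<close>

lemma maximal_orbit_exists:
  obtains X :: "'b \<Rightarrow> ('v \<times> nat, complex) fmat" where "X \<in> reps"
    "\<And>\<theta> Y. \<theta> \<in> gl \<Longrightarrow> commute \<theta> X \<Longrightarrow> Y \<in> reps \<Longrightarrow> \<exists>\<eta>\<in>gl. \<forall>b\<in>arcs R. commr \<theta> Y b = commr \<eta> X b"
proof -
  let ?r = "\<lambda>X :: 'b \<Rightarrow> ('v \<times> nat, complex) fmat. fdim ((\<lambda>\<theta>. rvec (commr \<theta> X)) ` gl)"
  have bound: "?r X < Suc (card K)" for X
  proof -
    have "?r X \<le> card (unit_fun ` K)"
      by (rule fs.dim_le_card) (auto simp: funs_on_eq_span[symmetric])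
    then show ?thesis using card_unit_fun[of K] by simp
  qed
  have "(\<lambda>b. 0) \<in> reps" by (simp add: reps_def)
  then obtain X :: "'b \<Rightarrow> ('v \<times> nat, complex) fmat"
    where X: "X \<in> reps" "\<And>Y. Y \<in> reps \<Longrightarrow> ?r Y \<le> ?r X"
    using ex_has_greatest_nat[of "\<lambda>X. X \<in> reps" "\<lambda>b. 0" ?r "Suc (card K)"] bound by (metis less_imp_le)
  have "\<exists>\<eta>\<in>gl. \<forall>b\<in>arcs R. commr \<theta> Y b = commr \<eta> X b"
    if \<theta>: "\<theta> \<in> gl" "commute \<theta> X" and Y: "Y \<in> reps" for \<theta> Y
  proof -
    have "rvec (commr \<theta> Y) \<in> fspan ((\<lambda>\<theta>. rvec (commr \<theta> X)) ` gl)"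
    proof (rule maximal_rank_first_order[OF finite_K, of "\<lambda>\<theta>. rvec (commr \<theta> X)" "\<lambda>\<theta>. rvec (commr \<theta> Y)"])
      fix t
      have "rvec (commr u X) + fscale t (rvec (commr u Y)) = rvec (commr u (\<lambda>b. X b + smul t (Y b)))" for u
        unfolding rvec_smul[symmetric] rvec_add[symmetric] commr_def
        by (simp add: algebra_simps smul_mult_left smul_mult_right smul_diff)
      then show "fdim ((\<lambda>u. rvec (commr u X) + fscale t (rvec (commr u Y))) ` gl) \<le> ?r X"
        using X(2)[OF reps_add[OF X(1) reps_smul[OF Y]], of t] by simp
    next
      show "rvec (commr \<theta> X) = 0"
        using \<theta>(2) by (intro poly_mapping_eqI) (auto simp: rvec_def lookup_vec_on commute_def commr_def K_def)
    qed (use \<theta> in auto)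
    then have "rvec (commr \<theta> Y) \<in> (\<lambda>\<theta>. rvec (commr \<theta> X)) ` gl"
      unfolding fs.span_eq_iff[THEN iffD2, OF fsubspace_commr] .
    then obtain \<eta> where "\<eta> \<in> gl" "rvec (commr \<theta> Y) = rvec (commr \<eta> X)" by blast
    then show ?thesis
      using rvec_eq_iff commr_reps \<theta>(1) X(1) Y by blast
  qed
  then show ?thesis using that[OF X(1)] by blast
qed

text \<open>The set \<open>J\<close> splits every vertex space into two coordinate parts, both
  preserved by \<open>X\<close>. Maps from the part outside \<open>J\<close> to the part in
  \<open>J\<close> have the entries \<open>?E\<close> in \<open>gl\<close> and \<open>?K\<close> in
  the representation space; the bracket with \<open>X\<close> and then \<open>D\<close> form a
  complex with third index set \<open>F\<close>, and the last hypothesis is exactness at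
  \<open>?K\<close>. For roots \<open>D\<close> is 0 and \<open>F\<close> is empty; for the
  preprojective algebra \<open>D\<close> is \<open>dmu X\<close>.\<close>

lemma off_diagonal_count:
  fixes X :: "'b \<Rightarrow> ('v \<times> nat, complex) fmat"
    and D :: "('b \<Rightarrow> ('v \<times> nat, complex) fmat) \<Rightarrow> ('v \<times> nat, complex) fmat"
  assumes X: "X \<in> reps" and J: "J \<subseteq> I" and com: "commute (diag J) X"
    and D_add: "\<And>Y Z. D (\<lambda>b. Y b + Z b) = D Y + D Z"
    and D_smul: "\<And>c Y. D (\<lambda>b. smul c (Y b)) = smul c (D Y)"
    and D_F: "\<And>Y p q. Y \<in> reps \<Longrightarrow> \<forall>b\<in>arcs R. diag J * Y b * diag (I - J) = Y b \<Longrightarrow> ent (D Y) p q \<noteq> 0 \<Longrightarrow> (p, q) \<in> F"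
    and fin: "finite F"
    and ext: "\<And>Y. Y \<in> reps \<Longrightarrow> \<forall>b\<in>arcs R. diag J * Y b * diag (I - J) = Y b \<Longrightarrow> D Y = 0 \<Longrightarrow>
        \<exists>\<eta>\<in>gl. \<forall>b\<in>arcs R. Y b = commr \<eta> X b"
  shows "(\<Sum>b\<in>arcs R. card (cell (head R b) \<inter> J) * card (cell (tail R b) - J))
    \<le> (\<Sum>v\<in>verts R. card (cell v \<inter> J) * card (cell v - J)) + card F"
proof -
  let ?K = "SIGMA b:arcs R. (cell (head R b) \<inter> J) \<times> (cell (tail R b) - J)"
  let ?E = "\<Union>v\<in>verts R. (cell v \<inter> J) \<times> (cell v - J)"
  have finKE: "finite ?K" "finite ?E" by auto
  have cardK: "card ?K = (\<Sum>b\<in>arcs R. card (cell (head R b) \<inter> J) * card (cell (tail R b) - J))"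
    by (simp add: card_SigmaI card_cartesian_product)
  have cardE: "card ?E = (\<Sum>v\<in>verts R. card (cell v \<inter> J) * card (cell v - J))"
    by (subst card_UN_disjoint) (auto simp: card_cartesian_product dest: in_cellD)
  have KI: "p \<in> I" "q \<in> I" if "(b, p, q) \<in> ?K" for b p q
    using that cell_subset_I[OF head_in_verts[of b]] cell_subset_I[OF tail_in_verts[of b]] by blast+
  have EI: "p \<in> I" "q \<in> I" if "(p, q) \<in> ?E" for p q
    using that cell_subset_I by blast+
  define mE where "mE e = mat_on I (\<lambda>p q. if (p, q) \<in> ?E then Poly_Mapping.lookup e (p, q) else 0)"
    for e :: "(('v \<times> nat) \<times> ('v \<times> nat)) cvec"
  define rK where "rK y b = mat_on I (\<lambda>p q. if (b, p, q) \<in> ?K then Poly_Mapping.lookup y (b, p, q) else 0)"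
    for y :: "('b \<times> ('v \<times> nat) \<times> ('v \<times> nat)) cvec" and b
  have ent_mE: "ent (mE e) p q = (if (p, q) \<in> ?E then Poly_Mapping.lookup e (p, q) else 0)" for e p q
    by (cases "(p, q) \<in> ?E") (use EI[of p q] in \<open>simp_all only: mE_def ent_mat_on[OF finite_I] if_True if_False if_cancel simp_thms\<close>)
  have ent_rK: "ent (rK y b) p q = (if (b, p, q) \<in> ?K then Poly_Mapping.lookup y (b, p, q) else 0)" for y b p q
    by (cases "(b, p, q) \<in> ?K") (use KI[of b p q] in \<open>simp_all only: rK_def ent_mat_on[OF finite_I] if_True if_False if_cancel simp_thms\<close>)
  have mE_add: "mE (x + y) = mE x + mE y" and mE_scale: "mE (fscale c x) = smul c (mE x)" for x y c
    by (auto intro!: fmat_eqI simp: ent_mE lookup_add)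
  have rK_add: "rK (x + y) = (\<lambda>b. rK x b + rK y b)" and rK_scale: "rK (fscale c x) = (\<lambda>b. smul c (rK x b))" for x y c
    by (auto intro!: fmat_eqI simp: ent_rK lookup_add fun_eq_iff)
  define d0 where "d0 e = vec_on ?K (\<lambda>(b, p, q). ent (commr (mE e) X b) p q)" for e
  define d1 where "d1 y = vec_on F (\<lambda>(p, q). ent (D (rK y)) p q)" for y
  have finJ: "finite J" "finite (I - J)" using finite_subset[OF J] by auto
  have dIJ: "(diag (I - J) :: ('v \<times> nat, complex) fmat) = diag I - diag J"
    by (rule diag_diff[OF finite_I J])
  have rK_K: "(b, p, q) \<in> ?K" if "ent (rK y b) p q \<noteq> 0" for y b p q
  proof (rule ccontr)
    assume "(b, p, q) \<notin> ?K"
    then have "ent (rK y b) p q = 0" unfolding ent_rK by (rule if_not_P)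
    then show False using that by simp
  qed
  have rK_reps: "rK y \<in> reps" for y
    unfolding reps_def mem_Collect_eq by (intro ballI allI impI, drule rK_K) blast
  have rK_off: "\<forall>b\<in>arcs R. diag J * rK y b * diag (I - J) = rK y b" for y
  proof (intro ballI fmat_eqI)
    fix b p q assume "b \<in> arcs R"
    have "p \<in> J \<and> q \<in> I - J" if "ent (rK y b) p q \<noteq> 0"
      using rK_K[OF that] KI[OF rK_K[OF that]] by blast
    then show "ent (diag J * rK y b * diag (I - J)) p q = ent (rK y b) p q"
      using finJ by (cases "ent (rK y b) p q = 0") simp_all
  qed
  have "card ?K \<le> card ?E + card F"
  proof (rule card_exact_le[OF finKE(2,1) fin, of d0 d1])
    have 1: "commr (mE x + mE y) X b = commr (mE x) X b + commr (mE y) X b"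
      "commr (smul c (mE x)) X b = smul c (commr (mE x) X b)" for x y c b
      by (simp_all add: commr_def algebra_simps smul_mult_left smul_mult_right smul_diff)
    show "flinear d0"
      by (rule flinearI; rule poly_mapping_eqI)
        (auto simp: d0_def lookup_vec_on[OF finKE(1)] lookup_add mE_add mE_scale 1)
    show "flinear d1"
      by (rule flinearI; rule poly_mapping_eqI)
        (auto simp: d1_def lookup_vec_on[OF fin] lookup_add rK_add rK_scale D_add D_smul)
    fix y :: "('b \<times> ('v \<times> nat) \<times> ('v \<times> nat)) cvec"
    show "d1 y \<in> funs_on F" by (simp add: d1_def fin)
    assume y: "y \<in> funs_on ?K" "d1 y = 0"
    have "D (rK y) = 0"
    proof (rule fmat_eqI)
      fix p q
      have "Poly_Mapping.lookup (d1 y) (p, q) = 0" using y(2) by simp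
      then show "ent (D (rK y)) p q = ent 0 p q"
        using D_F[OF rK_reps rK_off, of y p q]
        by (cases "(p, q) \<in> F"; cases "ent (D (rK y)) p q = 0") (simp_all add: d1_def lookup_vec_on[OF fin])
    qed
    from ext[OF rK_reps rK_off this] obtain \<eta> where \<eta>: "\<eta> \<in> gl" "\<And>b. b \<in> arcs R \<Longrightarrow> rK y b = commr \<eta> X b" by blast
    \<comment> \<open>Only the block of \<eta> of the right shape matters: \<open>diag J\<close>
      commutes with \<open>X\<close>, so compressing the bracket of \<eta> with \<open>X\<close> to
      this block gives the bracket of the compressed \<eta>, while \<open>rK y\<close> is its own
      compression.\<close>
    define \<eta>' where "\<eta>' = diag J * \<eta> * diag (I - J)"
    define e where "e = vec_on ?E (\<lambda>(p, q). ent \<eta>' p q)"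
    have "mE e = \<eta>'"
    proof (rule fmat_eqI)
      fix p q
      have "(p, q) \<in> ?E" if "ent \<eta>' p q \<noteq> 0"
      proof -
        have 1: "p \<in> J" "q \<notin> J" "ent \<eta> p q \<noteq> 0"
          using that finJ by (simp_all add: \<eta>'_def split: if_splits)
        have "p \<in> cell (fst p)" "q \<in> cell (fst p)" "fst p \<in> verts R"
          using gl_ent[OF \<eta>(1) 1(3)] in_cell_iff[of p "fst p"] in_cell_iff[of q "fst p"] fst_in_verts[of p] by simp_all
        then show ?thesis using 1 by blast
      qed
      then show "ent (mE e) p q = ent \<eta>' p q"
        unfolding ent_mE e_def lookup_vec_on[OF finKE(2)]
        by (cases "(p, q) \<in> ?E"; cases "ent \<eta>' p q = 0") (simp_all only: if_True if_False case_prod_conv if_cancel simp_thms)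
    qed
    moreover have "commr \<eta>' X b = rK y b" if b: "b \<in> arcs R" for b
    proof -
      have c1: "diag J * X b = X b * diag J" using com b by (simp add: commute_def)
      have c2: "diag (I - J) * X b = X b * diag (I - J)"
        using c1 reps_on[OF X b] by (simp add: dIJ algebra_simps)
      have "commr \<eta>' X b = diag J * (\<eta> * (diag (I - J) * X b)) - (X b * diag J) * \<eta> * diag (I - J)"
        by (simp add: commr_def \<eta>'_def mult.assoc)
      also have "\<dots> = diag J * commr \<eta> X b * diag (I - J)"
        unfolding c1[symmetric] c2 by (simp add: commr_def algebra_simps)
      also have "\<dots> = rK y b" using \<eta>(2)[OF b] rK_off b by metis
      finally show ?thesis .
    qed
    ultimately have com': "commr (mE e) X b = rK y b" if "b \<in> arcs R" for b using that by simp
    have "d0 e = y"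
    proof (rule poly_mapping_eqI)
      fix k :: "'b \<times> ('v \<times> nat) \<times> ('v \<times> nat)"
      obtain b p q where k: "k = (b, p, q)" by (rule prod_cases3)
      show "Poly_Mapping.lookup (d0 e) k = Poly_Mapping.lookup y k"
      proof (cases "(b, p, q) \<in> ?K")
        case True
        then have "b \<in> arcs R" by blast
        then show ?thesis
          unfolding k d0_def lookup_vec_on[OF finKE(1)] using True
          by (simp only: com' ent_rK if_True case_prod_conv)
      next
        case False
        then have "Poly_Mapping.lookup y (b, p, q) = 0" using y(1) unfolding funs_on_def by blast
        then show ?thesis
          unfolding k d0_def lookup_vec_on[OF finKE(1)] using False by (simp only: if_False)
      qed
    qed
    then show "y \<in> d0 ` funs_on ?E"
      using vec_on_in_funs_on[OF finKE(2)] unfolding e_def by blast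
  qed
  then show ?thesis by (simp only: cardK cardE)
qed

end

section \<open>Representations as block matrices\<close>

lemma funs_onD: "u \<in> funs_on S \<Longrightarrow> p \<notin> S \<Longrightarrow> Poly_Mapping.lookup u p = 0"
  unfolding funs_on_def by blast

lemma subspace_vec_iff:
  "VectorSpace.subspace class_ring W (module_vec TYPE(complex) n) \<longleftrightarrow>
    W \<subseteq> carrier_vec n \<and> 0\<^sub>v n \<in> W \<and> (\<forall>x\<in>W. \<forall>y\<in>W. x + y \<in> W) \<and> (\<forall>c. \<forall>x\<in>W. c \<cdot>\<^sub>v x \<in> W)"
  unfolding VectorSpace.subspace_def submodule_def module_vec_simps class_ring_simps
  using vec_vs[of n, where ?'a = complex] vec_module[of n, where ?'a = complex]
  by (simp only: class_ring_simps simp_thms UNIV_I) blast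

context quiver_dim
begin

lemma funs_on_mono: "A \<subseteq> B \<Longrightarrow> u \<in> funs_on A \<Longrightarrow> u \<in> funs_on B"
  by (auto simp: funs_on_def)

lemma cells_expand:
  assumes "u \<in> funs_on I"
  shows "u = (\<Sum>v\<in>verts R. app (diag (cell v)) u)"
proof (rule poly_mapping_eqI)
  fix p
  have "(\<Sum>v\<in>verts R. Poly_Mapping.lookup (app (diag (cell v)) u) p) =
      (\<Sum>v\<in>verts R. if v = fst p then Poly_Mapping.lookup u p else 0)"
  proof (rule sum.cong[OF refl])
    fix v
    show "Poly_Mapping.lookup (app (diag (cell v)) u) p = (if v = fst p then Poly_Mapping.lookup u p else 0)"
      using funs_onD[OF assms, of p] in_cell_iff[of p v] in_cellD[of p v] by (cases "p \<in> I") (auto simp: app_diag)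
  qed
  also have "\<dots> = Poly_Mapping.lookup u p"
    using funs_onD[OF assms, of p] fst_in_verts[of p] by (cases "p \<in> I") simp_all
  finally show "Poly_Mapping.lookup u p = Poly_Mapping.lookup (\<Sum>v\<in>verts R. app (diag (cell v)) u) p"
    by (simp add: lookup_sum)
qed

lemma app_diag_cell: "app (diag (cell v)) u \<in> funs_on (cell v)"
  by (simp add: app_in_funs_on)

lemma fmat_eqI_cells:
  assumes "on I X" "on I Y" "\<And>v u. v \<in> verts R \<Longrightarrow> u \<in> funs_on (cell v) \<Longrightarrow> app X u = app Y u"
  shows "X = Y"
proof (rule fmat_eqI_app[OF assms(1,2)])
  fix u assume u: "u \<in> funs_on I"
  have "app X (\<Sum>v\<in>verts R. app (diag (cell v)) u) = app Y (\<Sum>v\<in>verts R. app (diag (cell v)) u)"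
    unfolding app_sum_right by (rule sum.cong) (use assms(3) app_diag_cell in auto)
  then show "app X u = app Y u" by (simp only: cells_expand[OF u, symmetric])
qed

lemma gl_app_cell:
  assumes "\<theta> \<in> gl" "u \<in> funs_on (cell v)"
  shows "app \<theta> u \<in> funs_on (cell v)"
  unfolding funs_on_def mem_Collect_eq
proof (intro allI impI)
  fix p assume p: "p \<notin> cell v"
  show "Poly_Mapping.lookup (app \<theta> u) p = 0"
    unfolding lookup_app_idx
  proof (rule sum.neutral, rule ballI)
    fix q
    show "ent \<theta> p q * Poly_Mapping.lookup u q = 0"
      using p gl_ent_cell[OF assms(1), of p q v] funs_onD[OF assms(2), of q] by (cases "ent \<theta> p q = 0") simp_all
  qed
qed

lemma reps_app_other:
  assumes "X \<in> reps" "b \<in> arcs R" "u \<in> funs_on (cell v)" "v \<noteq> tail R b"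
  shows "app (X b) u = 0"
proof (rule poly_mapping_eqI)
  fix p
  show "Poly_Mapping.lookup (app (X b) u) p = Poly_Mapping.lookup 0 p"
    unfolding lookup_app_idx lookup_zero
  proof (rule sum.neutral, rule ballI)
    fix q
    have "q \<in> cell (tail R b) \<Longrightarrow> q \<notin> cell v" using assms(4) in_cellD by blast
    then show "ent (X b) p q * Poly_Mapping.lookup u q = 0"
      using reps_ent[OF assms(1,2), of p q] funs_onD[OF assms(3), of q] by (cases "ent (X b) p q = 0") simp_all
  qed
qed

definition glmat :: "('v \<Rightarrow> ('v \<times> nat) cvec \<Rightarrow> ('v \<times> nat) cvec) \<Rightarrow> ('v \<times> nat, complex) fmat" where
  "glmat g = (\<Sum>v\<in>verts R. mat_of (cell v) (g v))"

lemma glmat_gl: "glmat g \<in> gl"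
  unfolding glmat_def by (intro gl_sum gl_on_cell) auto

lemma app_glmat:
  assumes v: "v \<in> verts R" and u: "u \<in> funs_on (cell v)"
    and add: "\<And>x y. x \<in> funs_on (cell v) \<Longrightarrow> y \<in> funs_on (cell v) \<Longrightarrow> g v (x + y) = g v x + g v y"
    and scale: "\<And>c x. x \<in> funs_on (cell v) \<Longrightarrow> g v (fscale c x) = fscale c (g v x)"
    and range: "\<And>x. x \<in> funs_on (cell v) \<Longrightarrow> g v x \<in> funs_on (cell v)"
  shows "app (glmat g) u = g v u"
proof -
  have "app (mat_of (cell w) (g w)) u = 0" if "w \<noteq> v" for w
  proof (rule poly_mapping_eqI)
    fix p
    show "Poly_Mapping.lookup (app (mat_of (cell w) (g w)) u) p = Poly_Mapping.lookup 0 p"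
      unfolding lookup_app[OF finite_cell on_mat_of[OF finite_cell]] lookup_zero
    proof (rule sum.neutral, rule ballI)
      fix q assume "q \<in> cell w"
      then have "q \<notin> cell v" using that in_cellD by blast
      then show "ent (mat_of (cell w) (g w)) p q * Poly_Mapping.lookup u q = 0"
        using funs_onD[OF u] by simp
    qed
  qed
  then have "app (glmat g) u = (\<Sum>w\<in>verts R. if w = v then app (mat_of (cell v) (g v)) u else 0)"
    unfolding glmat_def app_sum by (intro sum.cong) auto
  also have "\<dots> = app (mat_of (cell v) (g v)) u" using v by simp
  also have "\<dots> = g v u" by (rule app_mat_of[OF finite_cell u add scale range])
  finally show ?thesis .
qed

section \<open>Translation between families of matrices and block matrices\<close>

definition blk :: "('b \<Rightarrow> 'r mat) \<Rightarrow> 'b \<Rightarrow> ('v \<times> nat, 'r::comm_ring_1) fmat" where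
  "blk V b = mat_on I (\<lambda>p q. if p \<in> cell (head R b) \<and> q \<in> cell (tail R b) then V b $$ (snd p, snd q) else 0)"

lemma ent_blk:
  assumes "b \<in> arcs R"
  shows "ent (blk V b) p q = (if p \<in> cell (head R b) \<and> q \<in> cell (tail R b) then V b $$ (snd p, snd q) else 0)"
  using cell_subset_I[OF head_in_verts[OF assms]] cell_subset_I[OF tail_in_verts[OF assms]]
  by (auto simp: blk_def ent_mat_on)

lemma blk_reps: "blk V \<in> reps"
  unfolding reps_def mem_Collect_eq by (intro ballI allI impI) (simp add: ent_blk split: if_splits)

definition unblk :: "('b \<Rightarrow> ('v \<times> nat, complex) fmat) \<Rightarrow> 'b \<Rightarrow> complex mat" where
  "unblk X = (\<lambda>b\<in>arcs R. mat (\<alpha> (head R b)) (\<alpha> (tail R b)) (\<lambda>(i, j). ent (X b) (head R b, i) (tail R b, j)))"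

lemma unblk_rep_space: "unblk X \<in> rep_space R \<alpha>"
  by (auto simp: unblk_def rep_space_def)

lemma rep_space_carrier: "V \<in> rep_space R \<alpha> \<Longrightarrow> b \<in> arcs R \<Longrightarrow> V b \<in> carrier_mat (\<alpha> (head R b)) (\<alpha> (tail R b))"
  by (auto simp: rep_space_def)

lemma blk_unblk:
  assumes "X \<in> reps" "b \<in> arcs R"
  shows "blk (unblk X) b = X b"
proof (rule fmat_eqI)
  fix p q
  show "ent (blk (unblk X) b) p q = ent (X b) p q"
    using reps_ent[OF assms, of p q]
    by (cases "p \<in> cell (head R b) \<and> q \<in> cell (tail R b)")
      (auto simp: ent_blk[OF assms(2)] unblk_def assms(2) cell_def)
qed

definition emb :: "'v \<Rightarrow> complex vec \<Rightarrow> ('v \<times> nat) cvec" where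
  "emb v x = vec_on (cell v) (\<lambda>p. x $ snd p)"

lemma lookup_emb: "Poly_Mapping.lookup (emb v x) p = (if p \<in> cell v then x $ snd p else 0)"
  by (simp add: emb_def lookup_vec_on)

lemma emb_funs_on [simp]: "emb v x \<in> funs_on (cell v)"
  by (simp add: emb_def)

lemma emb_add: "x \<in> carrier_vec (\<alpha> v) \<Longrightarrow> y \<in> carrier_vec (\<alpha> v) \<Longrightarrow> emb v (x + y) = emb v x + emb v y"
  and emb_smult: "x \<in> carrier_vec (\<alpha> v) \<Longrightarrow> emb v (c \<cdot>\<^sub>v x) = fscale c (emb v x)"
  and emb_0: "emb v (0\<^sub>v (\<alpha> v)) = 0"
  by (rule poly_mapping_eqI; auto simp: lookup_emb lookup_add cell_def)+

lemma emb_eq_iff: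
  assumes "x \<in> carrier_vec (\<alpha> v)" "y \<in> carrier_vec (\<alpha> v)"
  shows "emb v x = emb v y \<longleftrightarrow> x = y"
proof
  assume eq: "emb v x = emb v y"
  show "x = y"
  proof (rule eq_vecI)
    fix i assume "i < dim_vec y"
    then have "(v, i) \<in> cell v" using assms by (simp add: cell_def)
    then show "x $ i = y $ i"
      using arg_cong[OF eq, of "\<lambda>f. Poly_Mapping.lookup f (v, i)"] by (simp add: lookup_emb)
  qed (use assms in auto)
qed simp

definition unemb :: "'v \<Rightarrow> ('v \<times> nat) cvec \<Rightarrow> complex vec" where
  "unemb v u = vec (\<alpha> v) (\<lambda>i. Poly_Mapping.lookup u (v, i))"

lemma unemb_carrier [simp]: "unemb v u \<in> carrier_vec (\<alpha> v)"
  by (simp add: unemb_def)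

lemma emb_unemb: "u \<in> funs_on (cell v) \<Longrightarrow> emb v (unemb v u) = u"
proof (rule poly_mapping_eqI)
  fix p assume "u \<in> funs_on (cell v)"
  then show "Poly_Mapping.lookup (emb v (unemb v u)) p = Poly_Mapping.lookup u p"
    using funs_onD[of u "cell v" p] by (cases "p \<in> cell v") (auto simp: lookup_emb unemb_def cell_def)
qed

lemma unemb_emb:
  assumes "x \<in> carrier_vec (\<alpha> v)"
  shows "unemb v (emb v x) = x"
  using emb_unemb[OF emb_funs_on, of v x] emb_eq_iff[OF unemb_carrier assms, of "emb v x"] by blast

lemma app_blk_emb:
  assumes V: "V \<in> rep_space R \<alpha>" and b: "b \<in> arcs R" and x: "x \<in> carrier_vec (\<alpha> (tail R b))"
  shows "app (blk V b) (emb (tail R b) x) = emb (head R b) (V b *\<^sub>v x)"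
proof (rule poly_mapping_eqI)
  fix p
  let ?C = "cell (tail R b)"
  have "Poly_Mapping.lookup (app (blk V b) (emb (tail R b) x)) p =
      (\<Sum>q\<in>?C. ent (blk V b) p q * Poly_Mapping.lookup (emb (tail R b) x) q)"
    by (rule lookup_app_on) (auto simp: lookup_emb)
  also have "\<dots> = (\<Sum>q\<in>Pair (tail R b) ` {..<\<alpha> (tail R b)}. ent (blk V b) p q * Poly_Mapping.lookup (emb (tail R b) x) q)"
    by (rule sum.cong) (auto simp: cell_def)
  also have "\<dots> = (\<Sum>j<\<alpha> (tail R b). ent (blk V b) p (tail R b, j) * x $ j)"
    by (subst sum.reindex) (auto simp: inj_on_def lookup_emb cell_def)
  also have "\<dots> = Poly_Mapping.lookup (emb (head R b) (V b *\<^sub>v x)) p"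
  proof (cases "p \<in> cell (head R b)")
    case True
    then have p: "snd p < \<alpha> (head R b)" by (auto simp: cell_def)
    have "(V b *\<^sub>v x) $ snd p = (\<Sum>j<\<alpha> (tail R b). V b $$ (snd p, j) * x $ j)"
      using rep_space_carrier[OF V b] x p by (auto simp: scalar_prod_def atLeast0LessThan)
    then show ?thesis using True by (simp add: lookup_emb ent_blk[OF b]) (simp add: cell_def)
  qed (simp add: lookup_emb ent_blk[OF b])
  finally show "Poly_Mapping.lookup (app (blk V b) (emb (tail R b) x)) p = Poly_Mapping.lookup (emb (head R b) (V b *\<^sub>v x)) p" .
qed

section \<open>Subrepresentations and invariant subspaces\<close>

lemma subrep_iff:
  "subrep R \<alpha> V U \<longleftrightarrow>
     (\<forall>v\<in>verts R. U v \<subseteq> carrier_vec (\<alpha> v) \<and> 0\<^sub>v (\<alpha> v) \<in> U v \<and>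
        (\<forall>x\<in>U v. \<forall>y\<in>U v. x + y \<in> U v) \<and> (\<forall>c. \<forall>x\<in>U v. c \<cdot>\<^sub>v x \<in> U v)) \<and>
     (\<forall>b\<in>arcs R. \<forall>x\<in>U (tail R b). V b *\<^sub>v x \<in> U (head R b))"
  by (simp add: subrep_def subspace_vec_iff)

lemma subrep_carrier: "subrep R \<alpha> V U \<Longrightarrow> v \<in> verts R \<Longrightarrow> x \<in> U v \<Longrightarrow> x \<in> carrier_vec (\<alpha> v)"
  by (simp add: subrep_iff subset_iff)

lemma subrep_invariant:
  assumes V: "V \<in> rep_space R \<alpha>" and W: "fsubspace W"
    and inv: "\<And>b w. b \<in> arcs R \<Longrightarrow> w \<in> W \<Longrightarrow> app (blk V b) w \<in> W"
  shows "subrep R \<alpha> V (\<lambda>v. {x \<in> carrier_vec (\<alpha> v). emb v x \<in> W})"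
  unfolding subrep_iff
proof (intro conjI ballI)
  fix b x assume b: "b \<in> arcs R" and "x \<in> {x \<in> carrier_vec (\<alpha> (tail R b)). emb (tail R b) x \<in> W}"
  then have x: "x \<in> carrier_vec (\<alpha> (tail R b))" "emb (tail R b) x \<in> W" by auto
  show "V b *\<^sub>v x \<in> {x \<in> carrier_vec (\<alpha> (head R b)). emb (head R b) x \<in> W}"
    using inv[OF b x(2)] app_blk_emb[OF V b x(1)] rep_space_carrier[OF V b] x(1) by simp
qed (use W in \<open>auto simp: emb_0 emb_add emb_smult fs.subspace_def\<close>)

text \<open>Stability under the vertex projections makes \<open>W\<close> graded: up to vectors
  outside \<open>funs_on I\<close> it is the sum of its intersections with the vertex spaces, and
  these form a subrepresentation.\<close>

lemma simple_invariant:
  assumes V: "V \<in> rep_space R \<alpha>" and simple: "simple_rep R \<alpha> V" and W: "fsubspace W"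
    and inv: "\<And>b w. b \<in> arcs R \<Longrightarrow> w \<in> W \<Longrightarrow> app (blk V b) w \<in> W"
    and cell: "\<And>v w. v \<in> verts R \<Longrightarrow> w \<in> W \<Longrightarrow> app (diag (cell v)) w \<in> W"
  shows "W \<inter> funs_on I \<subseteq> {0} \<or> funs_on I \<subseteq> W"
proof -
  let ?U = "\<lambda>v. {x \<in> carrier_vec (\<alpha> v). emb v x \<in> W}"
  have "zero_subrep R \<alpha> ?U \<or> (\<forall>v\<in>verts R. ?U v = carrier_vec (\<alpha> v))"
    using simple subrep_invariant[OF V W inv] unfolding simple_rep_def simple_subrep_def by blast
  then show ?thesis
  proof
    assume z: "zero_subrep R \<alpha> ?U"
    have "w = 0" if w: "w \<in> W" "w \<in> funs_on I" for w
    proof -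
      have "app (diag (cell v)) w = 0" if v: "v \<in> verts R" for v
      proof -
        have "unemb v (app (diag (cell v)) w) \<in> ?U v"
          using cell[OF v w(1)] by (simp add: emb_unemb app_diag_cell)
        then have "unemb v (app (diag (cell v)) w) = 0\<^sub>v (\<alpha> v)"
          using z v unfolding zero_subrep_def by blast
        then show ?thesis using emb_unemb[OF app_diag_cell] emb_0 by metis
      qed
      then have "(\<Sum>v\<in>verts R. app (diag (cell v)) w) = 0" by simp
      then show ?thesis by (simp only: cells_expand[OF w(2), symmetric])
    qed
    then show ?thesis by blast
  next
    assume f: "\<forall>v\<in>verts R. ?U v = carrier_vec (\<alpha> v)"
    have "w \<in> W" if w: "w \<in> funs_on I" for w
    proof -
      have "app (diag (cell v)) w \<in> W" if "v \<in> verts R" for v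
      proof -
        have "unemb v (app (diag (cell v)) w) \<in> ?U v" using f that by simp
        then show ?thesis by (simp add: emb_unemb app_diag_cell)
      qed
      then have "(\<Sum>v\<in>verts R. app (diag (cell v)) w) \<in> W"
        using W by (intro fs.subspace_sum) auto
      then show ?thesis by (simp only: cells_expand[OF w, symmetric])
    qed
    then show ?thesis by blast
  qed
qed

lemma subrep_emb_subspace:
  assumes "subrep R \<alpha> V U" "v \<in> verts R"
  shows "fsubspace (emb v ` U v)"
proof -
  have U: "U v \<subseteq> carrier_vec (\<alpha> v)" "0\<^sub>v (\<alpha> v) \<in> U v" "\<And>x y. x \<in> U v \<Longrightarrow> y \<in> U v \<Longrightarrow> x + y \<in> U v"
    "\<And>c x. x \<in> U v \<Longrightarrow> c \<cdot>\<^sub>v x \<in> U v"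
    using assms unfolding subrep_iff by blast+
  have "0 \<in> emb v ` U v" using emb_0[of v] U(2) by (metis imageI)
  moreover have "emb v x + emb v y \<in> emb v ` U v" if "x \<in> U v" "y \<in> U v" for x y
    using emb_add[of x v y] U(1,3) that by (metis imageI subsetD)
  moreover have "fscale c (emb v x) \<in> emb v ` U v" if "x \<in> U v" for x c
    using emb_smult[of x v c] U(1,4) that by (metis imageI subsetD)
  ultimately show ?thesis unfolding fs.subspace_def by blast
qed

text \<open>A linear projection is chosen at each vertex without regard to the arrows, so
  \<open>P\<close> lies in \<open>gl\<close> but need not be an endomorphism of the
  representation.\<close>

lemma projection_onto_subrep:
  assumes U: "subrep R \<alpha> V U"
  obtains P where "P \<in> gl" "\<And>v x. v \<in> verts R \<Longrightarrow> x \<in> U v \<Longrightarrow> app P (emb v x) = emb v x"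
    "\<And>v u. v \<in> verts R \<Longrightarrow> u \<in> funs_on (cell v) \<Longrightarrow> app P u \<in> emb v ` U v"
proof -
  have "\<exists>g. v \<in> verts R \<longrightarrow> flinear g \<and> (\<forall>x. g x \<in> emb v ` U v) \<and> (\<forall>x\<in>emb v ` U v. g x = x)" for v
  proof (cases "v \<in> verts R")
    case True
    show ?thesis
      by (rule linear_projection_exists[OF subrep_emb_subspace[OF U True]]) blast
  qed simp
  then obtain g :: "'v \<Rightarrow> ('v \<times> nat) cvec \<Rightarrow> ('v \<times> nat) cvec" where g: "\<And>v. v \<in> verts R \<Longrightarrow> flinear (g v)" "\<And>v x. v \<in> verts R \<Longrightarrow> g v x \<in> emb v ` U v"
      "\<And>v x. v \<in> verts R \<Longrightarrow> x \<in> emb v ` U v \<Longrightarrow> g v x = x"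
    by metis
  have gr: "g v x \<in> funs_on (cell v)" if "v \<in> verts R" for v x
    using g(2)[OF that, of x] by auto
  have app: "app (glmat g) u = g v u" if "v \<in> verts R" "u \<in> funs_on (cell v)" for v u
    using that gr flinear_add[OF g(1)] flinear_scale[OF g(1)] by (intro app_glmat) auto
  show ?thesis
    by (rule that[of "glmat g"]) (use glmat_gl app g(2,3) in auto)
qed

section \<open>Direct sum decompositions and idempotent endomorphisms\<close>

lemma emb_finsum:
  fixes r :: nat
  assumes "u \<in> {..<r} \<rightarrow> carrier_vec (\<alpha> v)"
  shows "emb v (finsum_vec TYPE(complex) (\<alpha> v) u {..<r}) = (\<Sum>k<r. emb v (u k))"
proof (rule poly_mapping_eqI)
  fix p
  show "Poly_Mapping.lookup (emb v (finsum_vec TYPE(complex) (\<alpha> v) u {..<r})) p =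
      Poly_Mapping.lookup (\<Sum>k<r. emb v (u k)) p"
  proof (cases "p \<in> cell v")
    case True
    then have "snd p < \<alpha> v" by (auto simp: cell_def)
    then show ?thesis
      using index_finsum_vec[OF finite_lessThan \<open>snd p < \<alpha> v\<close> assms] True by (simp add: lookup_emb lookup_sum)
  qed (simp add: lookup_emb lookup_sum)
qed

text \<open>Uniqueness of the decomposition of a vector makes its j-th component a linear function
  of the vector, and invariance of the summands makes this function commute with the arrows.\<close>

lemma component_idempotent:
  assumes V: "V \<in> rep_space R \<alpha>" and S: "direct_sum_decomp R \<alpha> V r S" and j: "j < r"
  shows "\<exists>p\<in>gl. p * p = p \<and> commute p (blk V) \<and>
    (\<forall>v\<in>verts R. \<forall>k<r. \<forall>x\<in>S k v. app p (emb v x) = (if k = j then emb v x else 0))"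
proof -
  have sub: "subrep R \<alpha> V (S k)" if "k < r" for k
    using S that unfolding direct_sum_decomp_def by blast
  have Sc: "S k v \<subseteq> carrier_vec (\<alpha> v)" if "k < r" "v \<in> verts R" for k v
    using sub[OF that(1)] that(2) unfolding subrep_iff by blast
  have subsp: "fsubspace (emb v ` S k v)" if "k < r" "v \<in> verts R" for k v
    by (rule subrep_emb_subspace[OF sub[OF that(1)] that(2)])
  have un: "\<exists>!u. u \<in> (\<Pi>\<^sub>E k\<in>{..<r}. S k v) \<and> x = finsum_vec TYPE(complex) (\<alpha> v) u {..<r}"
    if "v \<in> verts R" "x \<in> carrier_vec (\<alpha> v)" for v x
    using S that unfolding direct_sum_decomp_def by blast
  have ex: "\<exists>u. (\<forall>k<r. u k \<in> emb v ` S k v) \<and> w = (\<Sum>k<r. u k)"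
    if v: "v \<in> verts R" and w: "w \<in> funs_on (cell v)" for v w
  proof -
    obtain u where u: "u \<in> (\<Pi>\<^sub>E k\<in>{..<r}. S k v)" "unemb v w = finsum_vec TYPE(complex) (\<alpha> v) u {..<r}"
      using un[OF v unemb_carrier, of w] by blast
    have uS: "u k \<in> S k v" if "k < r" for k using PiE_mem[OF u(1), of k] that by simp
    then have "u \<in> {..<r} \<rightarrow> carrier_vec (\<alpha> v)" using Sc v by (auto simp: Pi_def)
    from emb_finsum[OF this] have "w = (\<Sum>k<r. emb v (u k))"
      unfolding u(2)[symmetric] emb_unemb[OF w] .
    then show ?thesis using uS by (intro exI[of _ "\<lambda>k. emb v (u k)"]) simp
  qed
  have uniq: "u k = 0"
    if v: "v \<in> verts R" and u: "\<And>k. k < r \<Longrightarrow> u k \<in> emb v ` S k v" "(\<Sum>k<r. u k) = 0" and k: "k < r" for u :: "nat \<Rightarrow> ('v \<times> nat) cvec" and v k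
  proof -
    \<comment> \<open>The decompositions in \<open>direct_sum_decomp\<close> are extensional
      functions. The given family is compared with the zero family, both restricted to the indices
      below r.\<close>
    let ?u = "\<lambda>k\<in>{..<r}. unemb v (u k)" and ?z = "\<lambda>k\<in>{..<r}. 0\<^sub>v (\<alpha> v)"
    have um: "unemb v (u k) \<in> S k v" if "k < r" for k
      using u(1)[OF that] Sc[OF that v] unemb_emb by auto
    have eu: "emb v (unemb v (u k)) = u k" if "k < r" for k
      using u(1)[OF that] by (intro emb_unemb) auto
    have z: "0\<^sub>v (\<alpha> v) \<in> S k v" if "k < r" for k
      using sub[OF that] v unfolding subrep_iff by blast
    have 1: "?u \<in> (\<Pi>\<^sub>E k\<in>{..<r}. S k v)" "?z \<in> (\<Pi>\<^sub>E k\<in>{..<r}. S k v)" using um z by auto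
    have 2: "?u \<in> {..<r} \<rightarrow> carrier_vec (\<alpha> v)" "?z \<in> {..<r} \<rightarrow> carrier_vec (\<alpha> v)"
      by auto
    have c: "finsum_vec TYPE(complex) (\<alpha> v) f {..<r} \<in> carrier_vec (\<alpha> v)"
      if "f \<in> {..<r} \<rightarrow> carrier_vec (\<alpha> v)" for f
      using that by (rule finsum_vec_closed)
    have "emb v (finsum_vec TYPE(complex) (\<alpha> v) ?u {..<r}) = emb v (finsum_vec TYPE(complex) (\<alpha> v) ?z {..<r})"
      unfolding emb_finsum[OF 2(1)] emb_finsum[OF 2(2)] using u(2) eu by (simp add: emb_0)
    then have "finsum_vec TYPE(complex) (\<alpha> v) ?u {..<r} = finsum_vec TYPE(complex) (\<alpha> v) ?z {..<r}"
      using emb_eq_iff[OF c[OF 2(1)] c[OF 2(2)]] by blast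
    then have "?u = ?z" using un[OF v c[OF 2(1)]] 1 by blast
    then have "unemb v (u k) = 0\<^sub>v (\<alpha> v)" using k by (metis lessThan_iff restrict_apply')
    then show ?thesis using eu[OF k] emb_0 by metis
  qed
  \<comment> \<open>The components of \<open>w\<close> are obtained by choice; \<open>c_eq\<close>
    shows that any other decomposition of \<open>w\<close> has the same ones, and this yields
    additivity and homogeneity of the chosen components.\<close>
  define c where "c v w = (SOME u. (\<forall>k<r. u k \<in> emb v ` S k v) \<and> w = (\<Sum>k<r. u k))" for v w
  have c: "(\<forall>k<r. c v w k \<in> emb v ` S k v) \<and> w = (\<Sum>k<r. c v w k)"
    if "v \<in> verts R" "w \<in> funs_on (cell v)" for v w
    unfolding c_def by (rule someI_ex[OF ex[OF that]])
  have c_eq: "c v w k = u k"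
    if v: "v \<in> verts R" and w: "w \<in> funs_on (cell v)" and u: "\<And>k. k < r \<Longrightarrow> u k \<in> emb v ` S k v" "w = (\<Sum>k<r. u k)"
      and k: "k < r" for v w u k
  proof -
    have "c v w k - u k = 0"
    proof (rule uniq[of v "\<lambda>k. c v w k - u k" k])
      show "(\<Sum>k<r. c v w k - u k) = 0"
        using conjunct2[OF c[OF v w]] u(2) by (simp add: sum_subtractf)
      fix k assume "k < r"
      then show "c v w k - u k \<in> emb v ` S k v"
        using conjunct1[OF c[OF v w]] u(1) v by (intro fs.subspace_diff[OF subsp]) auto
    qed (use v k in auto)
    then show ?thesis by simp
  qed
  have c_in: "c v w k \<in> emb v ` S k v" if "v \<in> verts R" "w \<in> funs_on (cell v)" "k < r" for v w k
    using c[OF that(1,2)] that(3) by blast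
  have c_sum: "w = (\<Sum>k<r. c v w k)" if "v \<in> verts R" "w \<in> funs_on (cell v)" for v w
    using c[OF that] by blast
  define p where "p = glmat (\<lambda>v w. c v w j)"
  have app: "app p w = c v w j" if v: "v \<in> verts R" and w: "w \<in> funs_on (cell v)" for v w
    unfolding p_def
  proof (rule app_glmat[OF v w])
    fix x y assume x: "x \<in> funs_on (cell v)"
    show "c v x j \<in> funs_on (cell v)" using c_in[OF v x j] by auto
    show "c v (fscale a x) j = fscale a (c v x j)" for a
    proof (rule c_eq[of v "fscale a x" "\<lambda>k. fscale a (c v x k)" j])
      show "fscale a x = (\<Sum>k<r. fscale a (c v x k))"
        unfolding fs.scale_sum_right[symmetric] by (simp only: c_sum[OF v x, symmetric])
      show "fscale a (c v x k) \<in> emb v ` S k v" if "k < r" for k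
        by (rule fs.subspace_scale[OF subsp[OF that v] c_in[OF v x that]])
    qed (use v x j in simp_all)
    assume y: "y \<in> funs_on (cell v)"
    show "c v (x + y) j = c v x j + c v y j"
    proof (rule c_eq[of v "x + y" "\<lambda>k. c v x k + c v y k" j])
      show "x + y = (\<Sum>k<r. c v x k + c v y k)"
        unfolding sum.distrib by (simp only: c_sum[OF v x, symmetric] c_sum[OF v y, symmetric])
      show "c v x k + c v y k \<in> emb v ` S k v" if "k < r" for k
        by (rule fs.subspace_add[OF subsp[OF that v] c_in[OF v x that] c_in[OF v y that]])
    qed (use v x y j in simp_all)
  qed
  have fix_k: "app p (emb v x) = (if k = j then emb v x else 0)"
    if v: "v \<in> verts R" and k: "k < r" and x: "x \<in> S k v" for v k x
  proof -
    have "c v (emb v x) j = (if j = k then emb v x else 0)"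
    proof (rule c_eq[of v "emb v x" "\<lambda>i. if i = k then emb v x else 0" j])
      show "emb v x = (\<Sum>i<r. if i = k then emb v x else 0)" using k by simp
      fix i assume "i < r"
      then show "(if i = k then emb v x else 0) \<in> emb v ` S i v"
        using x fs.subspace_0[OF subsp[OF _ v]] by auto
    qed (use v j in simp_all)
    then show ?thesis by (simp add: app[OF v])
  qed
  have p_gl: "p \<in> gl" unfolding p_def by (rule glmat_gl)
  have pp: "p * p = p"
  proof (rule fmat_eqI_cells)
    fix v w assume v: "v \<in> verts R" and w: "w \<in> funs_on (cell v)"
    obtain x where "x \<in> S j v" "c v w j = emb v x" using c_in[OF v w j] by auto
    then show "app (p * p) w = app p w"
      using fix_k[OF v j] by (simp add: app_mult app[OF v w])
  qed (use gl_on[OF gl_mult[OF p_gl p_gl]] gl_on[OF p_gl] in auto)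
  have "commute p (blk V)"
    unfolding commute_def
  proof
    fix b assume b: "b \<in> arcs R"
    show "p * blk V b = blk V b * p"
    proof (rule fmat_eqI_cells)
      show "on I (p * blk V b)" "on I (blk V b * p)"
        using gl_on[OF p_gl] reps_on[OF blk_reps[of V] b] by (simp_all add: on_mult)
      fix v w assume v: "v \<in> verts R" and w: "w \<in> funs_on (cell v)"
      show "app (p * blk V b) w = app (blk V b * p) w"
      proof (cases "v = tail R b")
        case False
        then show ?thesis
          by (simp add: app_mult reps_app_other[OF blk_reps b w] reps_app_other[OF blk_reps b gl_app_cell[OF p_gl w]])
      next
        case True
        let ?h = "head R b"
        have h: "?h \<in> verts R" using b by simp
        have im: "app (blk V b) (c v w k) \<in> emb ?h ` S k ?h" if k: "k < r" for k
        proof -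
          obtain x where x: "x \<in> S k v" "c v w k = emb v x" using c_in[OF v w k] by auto
          then have "V b *\<^sub>v x \<in> S k ?h" using sub[OF k] b True unfolding subrep_iff by blast
          moreover have "app (blk V b) (emb v x) = emb ?h (V b *\<^sub>v x)"
            using app_blk_emb[OF V b, of x] x(1) Sc[OF k v] True by auto
          ultimately show ?thesis using x(2) by simp
        qed
        have pk: "app p (app (blk V b) (c v w k)) = (if k = j then app (blk V b) (c v w j) else 0)" if k: "k < r" for k
        proof -
          obtain y where "y \<in> S k ?h" "app (blk V b) (c v w k) = emb ?h y" using im[OF k] by auto
          then show ?thesis using fix_k[OF h k, of y] by auto
        qed
        have "app p (app (blk V b) w) = app p (app (blk V b) (\<Sum>k<r. c v w k))"
          by (simp only: c_sum[OF v w, symmetric])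
        also have "\<dots> = (\<Sum>k<r. app p (app (blk V b) (c v w k)))" by (simp only: app_sum_right)
        also have "\<dots> = (\<Sum>k<r. if k = j then app (blk V b) (c v w j) else 0)"
          by (rule sum.cong) (simp_all add: pk)
        also have "\<dots> = app (blk V b) (c v w j)" using j by simp
        finally show ?thesis by (simp add: app_mult app[OF v w])
      qed
    qed
  qed
  then show ?thesis
    using p_gl pp fix_k by (intro bexI[of _ p] conjI ballI allI impI)
qed

lemma zero_subrep_iff:
  assumes "subrep R \<alpha> V U"
  shows "\<not> zero_subrep R \<alpha> U \<longleftrightarrow> (\<exists>v\<in>verts R. \<exists>x\<in>U v. x \<noteq> 0\<^sub>v (\<alpha> v))"
proof
  assume "\<not> zero_subrep R \<alpha> U"
  then obtain v where v: "v \<in> verts R" "U v \<noteq> {0\<^sub>v (\<alpha> v)}" unfolding zero_subrep_def by blast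
  then have "0\<^sub>v (\<alpha> v) \<in> U v" using assms unfolding subrep_iff by simp
  then show "\<exists>v\<in>verts R. \<exists>x\<in>U v. x \<noteq> 0\<^sub>v (\<alpha> v)" using v by blast
next
  assume "\<exists>v\<in>verts R. \<exists>x\<in>U v. x \<noteq> 0\<^sub>v (\<alpha> v)"
  then obtain v x where "v \<in> verts R" "x \<in> U v" "x \<noteq> 0\<^sub>v (\<alpha> v)" by blast
  then show "\<not> zero_subrep R \<alpha> U" unfolding zero_subrep_def by blast
qed

lemma decomposition_idempotent:
  assumes V: "V \<in> rep_space R \<alpha>" and S: "direct_sum_decomp R \<alpha> V r S"
    and jk: "j < r" "k < r" "j \<noteq> k" "\<not> zero_subrep R \<alpha> (S j)" "\<not> zero_subrep R \<alpha> (S k)"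
  obtains p where "p \<in> gl" "p * p = p" "commute p (blk V)" "p \<noteq> 0" "p \<noteq> diag I"
proof -
  obtain p where p: "p \<in> gl" "p * p = p" "commute p (blk V)"
    "\<forall>v\<in>verts R. \<forall>k<r. \<forall>x\<in>S k v. app p (emb v x) = (if k = j then emb v x else 0)"
    using component_idempotent[OF V S jk(1)] by (elim bexE conjE)
  have sub: "subrep R \<alpha> V (S i)" if "i < r" for i
    using S that by (simp add: direct_sum_decomp_def)
  have nz: "emb v x \<noteq> 0" if "i < r" "v \<in> verts R" "x \<in> S i v" "x \<noteq> 0\<^sub>v (\<alpha> v)" for i v x
  proof -
    have "x \<in> carrier_vec (\<alpha> v)" by (rule subrep_carrier[OF sub[OF that(1)] that(2,3)])
    then show ?thesis using emb_eq_iff[of x v "0\<^sub>v (\<alpha> v)"] that(4) by (simp add: emb_0)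
  qed
  obtain v x where vx: "v \<in> verts R" "x \<in> S j v" "x \<noteq> 0\<^sub>v (\<alpha> v)"
    using jk(4) zero_subrep_iff[OF sub[OF jk(1)]] by blast
  obtain w y where wy: "w \<in> verts R" "y \<in> S k w" "y \<noteq> 0\<^sub>v (\<alpha> w)"
    using jk(5) zero_subrep_iff[OF sub[OF jk(2)]] by blast
  have "p \<noteq> 0"
    using p(4)[rule_format, OF vx(1) jk(1) vx(2)] nz[OF jk(1) vx] by auto
  moreover have "app (diag I) (emb w y) = emb w y"
    by (rule app_diag_funs_on[OF finite_I funs_on_mono[OF cell_subset_I[OF wy(1)] emb_funs_on]])
  then have "p \<noteq> diag I"
    using p(4)[rule_format, OF wy(1) jk(2) wy(2)] jk(3) nz[OF jk(2) wy] by auto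
  ultimately show ?thesis using that[OF p(1-3)] by blast
qed

lemma idempotent_split:
  fixes p :: "('v \<times> nat, complex) fmat"
  assumes p: "p \<in> gl" "p * p = p" "commute p X" "p \<noteq> 0" "p \<noteq> diag I" and X: "X \<in> reps"
  obtains g g' J where "g \<in> gl" "g' \<in> gl" "g * g' = diag I" "g' * g = diag I" "J \<subseteq> I" "J \<noteq> {}" "J \<noteq> I"
    "p = g * diag J * g'"
proof -
  obtain g g' J where g: "g \<in> gl" "g' \<in> gl" "g * g' = diag I" "g' * g = diag I" "J \<subseteq> I" "p = g * diag J * g'"
    by (rule gl_idempotent_diagonalizable[OF p(1,2)])
  have "diag {} = (0 :: ('v \<times> nat, complex) fmat)" by (rule fmat_eqI) (simp add: ent_diag)
  then have "J \<noteq> {}" using p(4) g(6) by auto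
  moreover have "J \<noteq> I" using p(5) g(6) gl_on[OF g(1)] g(3) by auto
  ultimately show ?thesis using that g by blast
qed

lemma conj_cancel:
  assumes "g' * g = diag I" "on I Z" "on I g'" "on I g"
  shows "g' * (g * Z * g') * g = Z"
proof -
  have "g' * (g * Z * g') * g = (g' * g) * Z * (g' * g)" by (simp only: mult.assoc)
  then show ?thesis using assms by simp
qed

lemma conj_commute:
  fixes p :: "('v \<times> nat, complex) fmat"
  assumes g: "g \<in> gl" "g' \<in> gl" "g' * g = diag I" "g * g' = diag I" and J: "J \<subseteq> I"
    and p: "p = g * diag J * g'" "commute p X" and X: "X \<in> reps"
  shows "commute (diag J) (\<lambda>b. g' * X b * g)"
  unfolding commute_def
proof
  fix b assume b: "b \<in> arcs R"
  have on: "on I g" "on I g'" "on I (X b)" "on I (diag J :: ('v \<times> nat, complex) fmat)"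
    using g X b J gl_on reps_on by auto
  have dJ: "diag J = g' * p * g"
    unfolding p(1) by (rule conj_cancel[OF g(3) on(4,2,1), symmetric])
  have "g' * p * g * (g' * X b * g) = g' * p * (g * g') * X b * g" by (simp only: mult.assoc)
  also have "\<dots> = g' * (p * X b) * g" using on unfolding g(4) by (simp add: mult.assoc)
  also have "\<dots> = g' * (X b * p) * g" using p(2) b by (simp add: commute_def)
  also have "\<dots> = g' * X b * (g * g') * p * g"
    unfolding g(4) using on by (simp add: mult.assoc)
  finally show "diag J * (g' * X b * g) = g' * X b * g * diag J"
    unfolding dJ by (simp only: mult.assoc)
qed

text \<open>For off-diagonal \<open>Y\<close> the conjugate g Y g' is fixed by left multiplication
  with \<open>p\<close> and killed by right multiplication with it, so its bracket with
  \<open>p\<close> is itself. Hypothesis \<open>ex\<close> thus makes it tangent to the orbit of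
  \<open>X\<close>; conjugating back gives the claim for \<open>Y\<close>.\<close>

lemma off_diagonal_ext:
  fixes p :: "('v \<times> nat, complex) fmat"
  assumes g: "g \<in> gl" "g' \<in> gl" "g' * g = diag I" "g * g' = diag I" and J: "J \<subseteq> I"
    and p: "p = g * diag J * g'" and Y: "Y \<in> reps" "\<forall>b\<in>arcs R. diag J * Y b * diag (I - J) = Y b"
    and X: "X \<in> reps"
    and ex: "\<exists>\<eta>\<in>gl. \<forall>b\<in>arcs R. commr p (\<lambda>b. g * Y b * g') b = commr \<eta> X b"
  shows "\<exists>\<eta>\<in>gl. \<forall>b\<in>arcs R. Y b = commr \<eta> (\<lambda>b. g' * X b * g) b"
proof -
  obtain \<eta> where \<eta>: "\<eta> \<in> gl" "\<forall>b\<in>arcs R. commr p (\<lambda>b. g * Y b * g') b = commr \<eta> X b" using ex by blast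
  show ?thesis
  proof (intro bexI ballI)
    show "g' * \<eta> * g \<in> gl" using g \<eta> by (simp add: gl_mult)
    fix b assume b: "b \<in> arcs R"
    have fin: "finite J" "finite (I - J)" using finite_subset[OF J] by auto
    have on: "on I g" "on I g'" "on I (X b)" "on I (Y b)" "on I \<eta>" "on I (diag J :: ('v \<times> nat, complex) fmat)"
      using g X Y b J \<eta> gl_on reps_on by auto
    have Yb: "diag J * Y b = Y b" "Y b * diag J = 0"
    proof -
      have "diag J * (diag J * Y b * diag (I - J)) = diag J * diag J * Y b * diag (I - J)" by (simp only: mult.assoc)
      then show "diag J * Y b = Y b" using Y(2) b fin by (simp add: diag_mult_diag)
      have z: "diag (I - J) * diag J = (0 :: ('v \<times> nat, complex) fmat)"
        using fin by (intro fmat_eqI) (auto simp: ent_diag)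
      have "diag J * Y b * diag (I - J) * diag J = diag J * Y b * (diag (I - J) * diag J)" by (simp only: mult.assoc)
      then show "Y b * diag J = 0" using Y(2) b z by simp
    qed
    have "p * (g * Y b * g') = g * diag J * (g' * g) * Y b * g'" by (simp only: p mult.assoc)
    also have "\<dots> = g * (diag J * Y b) * g'" unfolding g(3) using on by (simp add: mult.assoc)
    finally have 1: "p * (g * Y b * g') = g * Y b * g'" by (simp only: Yb)
    have "g * Y b * g' * p = g * Y b * (g' * g) * diag J * g'" by (simp only: p mult.assoc)
    also have "\<dots> = g * (Y b * diag J) * g'"
      unfolding g(3) using on by (simp add: mult.assoc)
    finally have 2: "g * Y b * g' * p = 0" by (simp only: Yb mult_zero_left mult_zero_right)
    have "commr \<eta> X b = p * (g * Y b * g') - g * Y b * g' * p"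
      using bspec[OF \<eta>(2) b] by (simp only: commr_def)
    then have "commr \<eta> X b = g * Y b * g'" by (simp only: 1 2 diff_zero)
    then have "Y b = g' * commr \<eta> X b * g"
      using conj_cancel[OF g(3) on(4,2,1)] by simp
    then have Y': "Y b = g' * \<eta> * X b * g - g' * X b * \<eta> * g"
      by (simp add: commr_def algebra_simps)
    have 3: "g' * \<eta> * (g * g') * X b * g = g' * \<eta> * X b * g"
      unfolding g(4) using on by (simp add: mult.assoc)
    have 4: "g' * X b * (g * g') * \<eta> * g = g' * X b * \<eta> * g"
      unfolding g(4) using on by (simp add: mult.assoc)
    have "commr (g' * \<eta> * g) (\<lambda>b. g' * X b * g) b =
        g' * \<eta> * (g * g') * X b * g - g' * X b * (g * g') * \<eta> * g"
      by (simp only: commr_def mult.assoc)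
    then show "Y b = commr (g' * \<eta> * g) (\<lambda>b. g' * X b * g) b"
      by (simp only: 3 4 Y')
  qed
qed

lemma card_cell: "card (cell v) = \<alpha> v"
  by (simp add: cell_def card_cartesian_product)

lemma card_cell_split: "card (cell v \<inter> J) + card (cell v - J) = \<alpha> v"
  using card_Int_Diff[of "cell v" J] card_cell[of v] finite_cell by simp

lemma card_cell_Int_nonzero:
  assumes "J \<subseteq> I" "J \<noteq> {}"
  shows "(\<lambda>v. card (cell v \<inter> J)) \<noteq> (\<lambda>_. 0)"
proof -
  obtain x where x: "x \<in> J" using assms(2) by (meson ex_in_conv)
  have "x \<in> cell (fst x) \<inter> J" using in_cell_iff[OF subsetD[OF assms(1) x], of "fst x"] x by simp
  then have "card (cell (fst x) \<inter> J) \<noteq> 0" using finite_Int[OF disjI1[OF finite_cell]] card_0_eq by (metis empty_iff)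
  then show ?thesis by (metis (no_types))
qed

lemma card_cell_Diff_nonzero:
  assumes "J \<subseteq> I" "J \<noteq> I"
  shows "(\<lambda>v. card (cell v - J)) \<noteq> (\<lambda>_. 0)"
proof -
  obtain x where x: "x \<in> I" "x \<notin> J" using assms by (meson subsetI subset_antisym)
  have "x \<in> cell (fst x) - J" using in_cell_iff[OF x(1), of "fst x"] x(2) by simp
  then have "card (cell (fst x) - J) \<noteq> 0" using finite_Diff[OF finite_cell] card_0_eq by (metis empty_iff)
  then show ?thesis by (metis (no_types))
qed

end

section \<open>The Euler form and decompositions into roots\<close>

definition dims_form :: "('v, 'a) pre_digraph \<Rightarrow> ('v \<Rightarrow> nat) \<Rightarrow> ('v \<Rightarrow> nat) \<Rightarrow> int" where
  "dims_form Q \<beta> \<gamma> = (\<Sum>v\<in>verts Q. int (\<beta> v * \<gamma> v)) - (\<Sum>a\<in>arcs Q. int (\<beta> (tail Q a) * \<gamma> (head Q a)))"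

text \<open>\<open>euler_form\<close> groups the arrows by their pair of ends;
  \<open>dims_form\<close> counts them one at a time, which is how numbers of matrix entries present
  themselves.\<close>

lemma (in fin_digraph) euler_q_eq: "euler_q G \<beta> = dims_form G \<beta> \<beta>"
proof -
  have c: "int (card {a \<in> arcs G. tail G a = v \<and> head G a = w}) =
      (\<Sum>a\<in>arcs G. if tail G a = v \<and> head G a = w then 1 else 0)" for v w
  proof -
    have "(\<Sum>a\<in>arcs G. if tail G a = v \<and> head G a = w then 1 else 0) =
        (\<Sum>a\<in>{a \<in> arcs G. tail G a = v \<and> head G a = w}. (1::int))"
      by (rule sum.inter_filter[symmetric]) simp
    then show ?thesis by simp
  qed
  have if_mult: "(if P then 1 else 0) * x * y = (if P then x * y else 0)" for P and x y :: int
    by simp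
  have "(\<Sum>v\<in>verts G. \<Sum>w\<in>verts G. int (card {a \<in> arcs G. tail G a = v \<and> head G a = w}) * int (\<beta> v) * int (\<beta> w)) =
      (\<Sum>v\<in>verts G. \<Sum>w\<in>verts G. \<Sum>a\<in>arcs G. if tail G a = v \<and> head G a = w then int (\<beta> v) * int (\<beta> w) else 0)"
    by (simp only: c sum_distrib_right if_mult)
  also have "\<dots> = (\<Sum>v\<in>verts G. \<Sum>a\<in>arcs G. \<Sum>w\<in>verts G. if tail G a = v \<and> head G a = w then int (\<beta> v) * int (\<beta> w) else 0)"
    by (rule sum.cong[OF refl], rule sum.swap)
  also have "\<dots> = (\<Sum>a\<in>arcs G. \<Sum>v\<in>verts G. \<Sum>w\<in>verts G. if tail G a = v \<and> head G a = w then int (\<beta> v) * int (\<beta> w) else 0)"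
    by (rule sum.swap)
  also have "\<dots> = (\<Sum>a\<in>arcs G. \<Sum>v\<in>verts G. if tail G a = v then (\<Sum>w\<in>verts G. if head G a = w then int (\<beta> v) * int (\<beta> w) else 0) else 0)"
    by (rule sum.cong[OF refl], rule sum.cong[OF refl]) simp
  also have "\<dots> = (\<Sum>a\<in>arcs G. int (\<beta> (tail G a)) * int (\<beta> (head G a)))"
    by (rule sum.cong[OF refl]) simp
  finally have "(\<Sum>v\<in>verts G. \<Sum>w\<in>verts G. int (card {a \<in> arcs G. tail G a = v \<and> head G a = w}) * int (\<beta> v) * int (\<beta> w)) =
    (\<Sum>a\<in>arcs G. int (\<beta> (tail G a)) * int (\<beta> (head G a)))" .
  moreover have "(\<Sum>v\<in>verts G. \<Sum>w\<in>verts G. (if v = w then 1 else 0) * int (\<beta> v) * int (\<beta> w)) =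
      (\<Sum>v\<in>verts G. \<Sum>w\<in>verts G. if v = w then int (\<beta> v) * int (\<beta> w) else 0)"
    by (simp only: if_mult)
  ultimately show ?thesis
    by (simp add: euler_form_def dims_form_def left_diff_distrib sum_subtractf)
qed

lemma dims_form_add:
  "dims_form Q (\<lambda>v. \<beta> v + \<gamma> v) (\<lambda>v. \<beta> v + \<gamma> v) =
    dims_form Q \<beta> \<beta> + dims_form Q \<gamma> \<gamma> + dims_form Q \<beta> \<gamma> + dims_form Q \<gamma> \<beta>"
proof -
  have eq: "int ((\<beta> v + \<gamma> v) * (\<beta> w + \<gamma> w)) = int (\<beta> v * \<beta> w) + int (\<gamma> v * \<gamma> w) + int (\<beta> v * \<gamma> w) + int (\<gamma> v * \<beta> w)" for v w
    by (simp add: algebra_simps)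
  show ?thesis unfolding dims_form_def eq sum.distrib by linarith
qed

context quiver_dim
begin

text \<open>By maximality of the orbit, every family of maps from the summand outside
  \<open>J\<close> to the summand in \<open>J\<close> is a bracket with \<open>X\<close>, so there
  are no extensions in this direction. The Euler form of the two dimension vectors is then the
  dimension of a Hom space; the count gives its sign.\<close>

lemma maximal_orbit_dims_form:
  fixes X :: "'b \<Rightarrow> ('v \<times> nat, complex) fmat"
  assumes X: "X \<in> reps"
    and max: "\<And>\<theta> Y. \<theta> \<in> gl \<Longrightarrow> commute \<theta> X \<Longrightarrow> Y \<in> reps \<Longrightarrow> \<exists>\<eta>\<in>gl. \<forall>b\<in>arcs R. commr \<theta> Y b = commr \<eta> X b"
    and g: "g \<in> gl" "g' \<in> gl" "g' * g = diag I" "g * g' = diag I" and J: "J \<subseteq> I"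
    and com: "commute (g * diag J * g') X"
  shows "dims_form R (\<lambda>v. card (cell v - J)) (\<lambda>v. card (cell v \<inter> J)) \<ge> 0"
proof -
  let ?p = "g * diag J * g'"
  have p: "?p \<in> gl" using g J by (simp add: gl_mult)
  have "(\<Sum>b\<in>arcs R. card (cell (head R b) \<inter> J) * card (cell (tail R b) - J))
      \<le> (\<Sum>v\<in>verts R. card (cell v \<inter> J) * card (cell v - J)) + card ({} :: (('v \<times> nat) \<times> ('v \<times> nat)) set)"
  proof (rule off_diagonal_count[where D = "\<lambda>_. 0" and X = "\<lambda>b. g' * X b * g"])
    show "(\<lambda>b. g' * X b * g) \<in> reps" by (rule reps_conj[OF g(2,1) X])
    show "commute (diag J) (\<lambda>b. g' * X b * g)" by (rule conj_commute[OF g J refl com X])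
    fix Y :: "'b \<Rightarrow> ('v \<times> nat, complex) fmat"
    assume Y: "Y \<in> reps" "\<forall>b\<in>arcs R. diag J * Y b * diag (I - J) = Y b"
    show "\<exists>\<eta>\<in>gl. \<forall>b\<in>arcs R. Y b = commr \<eta> (\<lambda>b. g' * X b * g) b"
      by (rule off_diagonal_ext[OF g J refl Y X max[OF p com reps_conj[OF g(1,2) Y(1)]]])
  next
    show "0 = smul c (0 :: ('v \<times> nat, complex) fmat)" for c by (rule fmat_eqI) simp
  qed (use J in simp_all)
  then have le: "(\<Sum>b\<in>arcs R. card (cell (head R b) \<inter> J) * card (cell (tail R b) - J))
      \<le> (\<Sum>v\<in>verts R. card (cell v \<inter> J) * card (cell v - J))" by simp
  have "dims_form R (\<lambda>v. card (cell v - J)) (\<lambda>v. card (cell v \<inter> J)) =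
      int (\<Sum>v\<in>verts R. card (cell v \<inter> J) * card (cell v - J)) -
      int (\<Sum>b\<in>arcs R. card (cell (head R b) \<inter> J) * card (cell (tail R b) - J))"
    by (simp add: dims_form_def mult.commute)
  then show ?thesis using of_nat_mono[OF le, where ?'a = int] by linarith
qed

end

text \<open>If \<beta> is not a root, even a representation with orbit of maximal dimension
  decomposes. Its two summands have nonnegative Euler forms in both orders, and these are the mixed
  terms of the quadratic form at \<beta>.\<close>

lemma non_root_splits:
  fixes Q :: "('v, 'a) pre_digraph"
  assumes Q: "fin_digraph Q" and supp: "\<forall>v. v \<notin> verts Q \<longrightarrow> \<beta> v = 0" and nz: "\<beta> \<noteq> (\<lambda>_. 0)" and nr: "\<beta> \<notin> quiver_roots Q"
  obtains \<beta>1 \<beta>2 where "\<beta> = (\<lambda>v. \<beta>1 v + \<beta>2 v)" "\<beta>1 \<noteq> (\<lambda>_. 0)" "\<beta>2 \<noteq> (\<lambda>_. 0)"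
    "euler_q Q \<beta>1 + euler_q Q \<beta>2 \<le> euler_q Q \<beta>"
proof -
  interpret fin_digraph Q by (rule Q)
  interpret quiver_dim Q \<beta> by unfold_locales
  have "\<exists>X :: 'a \<Rightarrow> ('v \<times> nat, complex) fmat. X \<in> reps \<and> (\<forall>\<theta> Y. \<theta> \<in> gl \<longrightarrow> commute \<theta> X \<longrightarrow> Y \<in> reps \<longrightarrow>
      (\<exists>\<eta>\<in>gl. \<forall>b\<in>arcs Q. commr \<theta> Y b = commr \<eta> X b))"
  proof (rule maximal_orbit_exists)
    fix X :: "'a \<Rightarrow> ('v \<times> nat, complex) fmat"
    assume "X \<in> reps" "\<And>\<theta> Y. \<theta> \<in> gl \<Longrightarrow> commute \<theta> X \<Longrightarrow> Y \<in> reps \<Longrightarrow>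
      \<exists>\<eta>\<in>gl. \<forall>b\<in>arcs Q. commr \<theta> Y b = commr \<eta> X b"
    then show ?thesis by (intro exI[of _ X] conjI allI impI)
  qed
  then obtain X :: "'a \<Rightarrow> ('v \<times> nat, complex) fmat" where X1: "X \<in> reps"
    and X2: "\<forall>\<theta> Y. \<theta> \<in> gl \<longrightarrow> commute \<theta> X \<longrightarrow> Y \<in> reps \<longrightarrow> (\<exists>\<eta>\<in>gl. \<forall>b\<in>arcs Q. commr \<theta> Y b = commr \<eta> X b)"
    by (elim exE conjE)
  note X = X1 X2[rule_format]
  have V: "unblk X \<in> rep_space Q \<beta>" by (rule unblk_rep_space)
  have "\<exists>v\<in>verts Q. \<beta> v \<noteq> 0" using nz supp by (auto simp: fun_eq_iff)
  then obtain S where S: "direct_sum_decomp Q \<beta> (unblk X) 2 S" "\<not> zero_subrep Q \<beta> (S 0)" "\<not> zero_subrep Q \<beta> (S 1)"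
    using nr supp V unfolding quiver_roots_def indecomposable_rep_def by blast
  obtain p where p: "p \<in> gl" "p * p = p" "commute p (blk (unblk X))" "p \<noteq> 0" "p \<noteq> diag I"
    by (rule decomposition_idempotent[OF V S(1), of 0 1]) (use S(2,3) in simp_all)
  have pX: "commute p X" using p(3) blk_unblk[OF X(1)] by (simp add: commute_def)
  obtain g g' J where g: "g \<in> gl" "g' \<in> gl" "g * g' = diag I" "g' * g = diag I" and J: "J \<subseteq> I" "J \<noteq> {}" "J \<noteq> I"
    and pg: "p = g * diag J * g'"
    by (rule idempotent_split[OF p(1,2) pX p(4,5) X(1)])
  let ?b1 = "\<lambda>v. card (cell v \<inter> J)" and ?b2 = "\<lambda>v. card (cell v - J)"
  have f1: "dims_form Q ?b2 ?b1 \<ge> 0"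
    by (rule maximal_orbit_dims_form[OF X g(1,2,4,3) J(1)]) (use pX pg in simp_all)
  \<comment> \<open>The complementary idempotent exchanges the two summands and supplies the second
    mixed term.\<close>
  have "g * diag (I - J) * g' = diag I - p"
    unfolding diag_diff[OF finite_I J(1)] pg using gl_on[OF g(1)] g(3) by (simp add: algebra_simps)
  moreover have "commute (diag I - p) X"
    using pX reps_on[OF X(1)] by (simp add: commute_def algebra_simps)
  ultimately have "dims_form Q (\<lambda>v. card (cell v - (I - J))) (\<lambda>v. card (cell v \<inter> (I - J))) \<ge> 0"
    by (intro maximal_orbit_dims_form[OF X g(1,2,4,3)]) simp_all
  moreover have "cell v - (I - J) = cell v \<inter> J" "cell v \<inter> (I - J) = cell v - J" if "v \<in> verts Q" for v
    using cell_subset_I[OF that] by blast+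
  ultimately have f2: "dims_form Q ?b1 ?b2 \<ge> 0"
    by (simp add: dims_form_def)
  have sum: "\<beta> = (\<lambda>v. ?b1 v + ?b2 v)" by (simp add: card_cell_split)
  have "euler_q Q \<beta> = euler_q Q ?b1 + euler_q Q ?b2 + dims_form Q ?b1 ?b2 + dims_form Q ?b2 ?b1"
    unfolding euler_q_eq dims_form_add[symmetric] by (rule arg_cong2[where f = "dims_form Q", OF sum sum])
  with f1 f2 have "euler_q Q ?b1 + euler_q Q ?b2 \<le> euler_q Q \<beta>" by linarith
  moreover have "?b1 \<noteq> (\<lambda>_. 0)" by (rule card_cell_Int_nonzero[OF J(1,2)])
  moreover have "?b2 \<noteq> (\<lambda>_. 0)" by (rule card_cell_Diff_nonzero[OF J(1,3)])
  ultimately show ?thesis by (intro that[OF sum])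
qed

text \<open>Splitting a vector into two that do not increase the sum of the quadratic forms can only
  increase the sum of the 1 - q over the parts, since there is one more part. The process ends
  because the total dimension drops.\<close>

lemma root_decomposition:
  fixes Q :: "('v, 'a) pre_digraph"
  assumes Q: "fin_digraph Q" and "\<forall>v. v \<notin> verts Q \<longrightarrow> \<beta> v = 0" and "\<beta> \<noteq> (\<lambda>_. 0)"
  shows "\<exists>\<beta>s. set \<beta>s \<subseteq> quiver_roots Q \<and> \<beta> = (\<lambda>v. \<Sum>\<gamma>\<leftarrow>\<beta>s. \<gamma> v) \<and>
    1 - euler_q Q \<beta> \<le> int (length \<beta>s) - (\<Sum>\<gamma>\<leftarrow>\<beta>s. euler_q Q \<gamma>)"
  using assms(2,3)
proof (induction "\<Sum>v\<in>verts Q. \<beta> v" arbitrary: \<beta> rule: less_induct)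
  case less
  interpret fin_digraph Q by (rule Q)
  show ?case
  proof (cases "\<beta> \<in> quiver_roots Q")
    case True
    then show ?thesis by (intro exI[of _ "[\<beta>]"]) simp
  next
    case False
    obtain \<beta>1 \<beta>2 where b: "\<beta> = (\<lambda>v. \<beta>1 v + \<beta>2 v)" "\<beta>1 \<noteq> (\<lambda>_. 0)" "\<beta>2 \<noteq> (\<lambda>_. 0)"
      "euler_q Q \<beta>1 + euler_q Q \<beta>2 \<le> euler_q Q \<beta>"
        by (rule non_root_splits[OF Q less.prems False])
    have supp: "\<forall>v. v \<notin> verts Q \<longrightarrow> \<beta>1 v = 0" "\<forall>v. v \<notin> verts Q \<longrightarrow> \<beta>2 v = 0"
      using less.prems(1) b(1) by auto
    have pos: "0 < (\<Sum>v\<in>verts Q. \<gamma> v)" if nz: "\<gamma> \<noteq> (\<lambda>_. 0)" and sp: "\<forall>v. v \<notin> verts Q \<longrightarrow> \<gamma> v = 0" for \<gamma> :: "'v \<Rightarrow> nat"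
    proof -
      obtain v where "\<gamma> v \<noteq> 0" using nz by auto
      then have "v \<in> verts Q" "0 < \<gamma> v" using sp by (metis, simp)
      then show ?thesis by (intro sum_pos2[of _ v]) auto
    qed
    have "(\<Sum>v\<in>verts Q. \<beta> v) = (\<Sum>v\<in>verts Q. \<beta>1 v) + (\<Sum>v\<in>verts Q. \<beta>2 v)"
      by (simp add: b(1) sum.distrib)
    then have lt: "(\<Sum>v\<in>verts Q. \<beta>1 v) < (\<Sum>v\<in>verts Q. \<beta> v)" "(\<Sum>v\<in>verts Q. \<beta>2 v) < (\<Sum>v\<in>verts Q. \<beta> v)"
      using pos[OF b(2) supp(1)] pos[OF b(3) supp(2)] by auto
    obtain l1 where l1: "set l1 \<subseteq> quiver_roots Q" "\<beta>1 = (\<lambda>v. \<Sum>\<gamma>\<leftarrow>l1. \<gamma> v)"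
      "1 - euler_q Q \<beta>1 \<le> int (length l1) - (\<Sum>\<gamma>\<leftarrow>l1. euler_q Q \<gamma>)"
      using less.hyps[OF lt(1) supp(1) b(2)] by blast
    obtain l2 where l2: "set l2 \<subseteq> quiver_roots Q" "\<beta>2 = (\<lambda>v. \<Sum>\<gamma>\<leftarrow>l2. \<gamma> v)"
      "1 - euler_q Q \<beta>2 \<le> int (length l2) - (\<Sum>\<gamma>\<leftarrow>l2. euler_q Q \<gamma>)"
      using less.hyps[OF lt(2) supp(2) b(3)] by blast
    have "\<beta> = (\<lambda>v. \<Sum>\<gamma>\<leftarrow>l1 @ l2. \<gamma> v)"
      unfolding b(1) by (subst l1(2), subst l2(2)) simp
    then show ?thesis
      using l1(1,3) l2(1,3) b(4) by (intro exI[of _ "l1 @ l2"]) auto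
  qed
qed

text \<open>Strictness comes from counting summands: concatenated root decompositions of the two
  parts contribute at least (1 - q(\<beta>1)) + (1 - q(\<beta>2)), with two units, while membership
  of \<alpha> bounds this by 1 - q(\<alpha>), with one.\<close>

lemma S_zero_no_split:
  assumes Q: "fin_digraph Q" and \<alpha>: "\<alpha> \<in> S_zero Q" and b: "\<alpha> = (\<lambda>v. \<beta>1 v + \<beta>2 v)" "\<beta>1 \<noteq> (\<lambda>_. 0)" "\<beta>2 \<noteq> (\<lambda>_. 0)"
  shows "euler_q Q \<alpha> < euler_q Q \<beta>1 + euler_q Q \<beta>2"
proof -
  have supp: "\<forall>v. v \<notin> verts Q \<longrightarrow> \<beta>1 v = 0" "\<forall>v. v \<notin> verts Q \<longrightarrow> \<beta>2 v = 0"
    using \<alpha> b(1) unfolding S_zero_def quiver_roots_def by auto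
  obtain l1 where l1: "set l1 \<subseteq> quiver_roots Q" "\<beta>1 = (\<lambda>v. \<Sum>\<gamma>\<leftarrow>l1. \<gamma> v)"
    "1 - euler_q Q \<beta>1 \<le> int (length l1) - (\<Sum>\<gamma>\<leftarrow>l1. euler_q Q \<gamma>)"
    using root_decomposition[OF Q supp(1) b(2)] by blast
  obtain l2 where l2: "set l2 \<subseteq> quiver_roots Q" "\<beta>2 = (\<lambda>v. \<Sum>\<gamma>\<leftarrow>l2. \<gamma> v)"
    "1 - euler_q Q \<beta>2 \<le> int (length l2) - (\<Sum>\<gamma>\<leftarrow>l2. euler_q Q \<gamma>)"
    using root_decomposition[OF Q supp(2) b(3)] by blast
  have "\<alpha> = (\<lambda>v. \<Sum>\<gamma>\<leftarrow>l1 @ l2. \<gamma> v)"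
    unfolding b(1) by (subst l1(2), subst l2(2)) simp
  moreover have "set (l1 @ l2) \<subseteq> quiver_roots Q" using l1(1) l2(1) by simp
  ultimately have "1 - euler_q Q \<alpha> \<ge> int (length (l1 @ l2)) - (\<Sum>\<gamma>\<leftarrow>l1 @ l2. euler_q Q \<gamma>)"
    using \<alpha> unfolding S_zero_def by blast
  then show ?thesis using l1(3) l2(3) by simp
qed

section \<open>Polynomials and smoothness\<close>

definition mono_eval :: "('c \<Rightarrow> 'r::comm_ring_1) \<Rightarrow> ('c \<Rightarrow>\<^sub>0 nat) \<Rightarrow> 'r" where
  "mono_eval x m = (\<Prod>z\<in>Poly_Mapping.keys m. x z ^ Poly_Mapping.lookup m z)"

lemma mono_eval_superset:
  assumes "finite S" "Poly_Mapping.keys m \<subseteq> S"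
  shows "mono_eval x m = (\<Prod>z\<in>S. x z ^ Poly_Mapping.lookup m z)"
  unfolding mono_eval_def
  by (rule prod.mono_neutral_left) (use assms in \<open>auto simp: in_keys_iff\<close>)

lemma mono_eval_add: "mono_eval x (m + n) = mono_eval x m * mono_eval x n"
proof -
  let ?S = "Poly_Mapping.keys m \<union> Poly_Mapping.keys n"
  have S: "finite ?S" by simp
  have "mono_eval x (m + n) = (\<Prod>z\<in>?S. x z ^ Poly_Mapping.lookup (m + n) z)"
    by (rule mono_eval_superset[OF S keys_add])
  also have "\<dots> = (\<Prod>z\<in>?S. x z ^ Poly_Mapping.lookup m z) * (\<Prod>z\<in>?S. x z ^ Poly_Mapping.lookup n z)"
    by (simp add: lookup_add power_add prod.distrib)
  also have "\<dots> = mono_eval x m * mono_eval x n"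
    using mono_eval_superset[OF S, of m x] mono_eval_superset[OF S, of n x] by simp
  finally show ?thesis .
qed

lemma mono_eval_0 [simp]: "mono_eval x 0 = 1"
  by (simp add: mono_eval_def)

lemma cpoly_expand: "p = (\<Sum>m\<in>Poly_Mapping.keys p. Poly_Mapping.single m (Poly_Mapping.lookup p m))"
proof (rule poly_mapping_eqI)
  fix k
  show "Poly_Mapping.lookup p k =
      Poly_Mapping.lookup (\<Sum>m\<in>Poly_Mapping.keys p. Poly_Mapping.single m (Poly_Mapping.lookup p m)) k"
    by (simp add: lookup_sum lookup_single when_def in_keys_iff)
qed

lemma poly_eval_superset:
  assumes "finite S" "Poly_Mapping.keys p \<subseteq> S" "h 0 = 0"
  shows "poly_eval h x p = (\<Sum>m\<in>S. h (Poly_Mapping.lookup p m) * mono_eval x m)"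
  unfolding poly_eval_def mono_eval_def[symmetric]
  by (rule sum.mono_neutral_left) (use assms in \<open>auto simp: in_keys_iff\<close>)

context comm_ring_map
begin

lemma comp_poly_eval: "h (poly_eval k x p) = poly_eval (\<lambda>c. h (k c)) (\<lambda>z. h (x z)) p"
  by (simp add: poly_eval_def h_sum h_mult h_prod h_power)

end

lemma comm_ring_map_poly_eval:
  fixes h :: "complex \<Rightarrow> 'r::comm_ring_1" and x :: "'c \<Rightarrow> 'r"
  assumes "comm_ring_map h"
  shows "comm_ring_map (poly_eval h x)"
proof -
  interpret comm_ring_map h by (rule assms)
  note sup = poly_eval_superset[where h = h, OF _ _ h_0]
  have add: "poly_eval h x (p + q) = poly_eval h x p + poly_eval h x q" for p q :: "'c cpoly"
  proof -
    let ?S = "Poly_Mapping.keys p \<union> Poly_Mapping.keys q"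
    have S: "finite ?S" by simp
    have "poly_eval h x (p + q) = (\<Sum>m\<in>?S. h (Poly_Mapping.lookup (p + q) m) * mono_eval x m)"
      by (rule sup[OF S keys_add])
    also have "\<dots> = poly_eval h x p + poly_eval h x q"
      using sup[OF S, of p x] sup[OF S, of q x] by (simp add: lookup_add h_add distrib_right sum.distrib)
    finally show ?thesis .
  qed
  have single: "poly_eval h x (Poly_Mapping.single m c) = h c * mono_eval x m" for m c
    using sup[of "{m}" "Poly_Mapping.single m c" x] by simp
  have sum: "poly_eval h x (\<Sum>a\<in>A. f a) = (\<Sum>a\<in>A. poly_eval h x (f a))" for f :: "('c \<Rightarrow>\<^sub>0 nat) \<Rightarrow> 'c cpoly" and A
  proof (induction A rule: infinite_finite_induct)
    case (insert a A)
    then show ?case by (simp add: add)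
  qed (simp_all add: poly_eval_def)
  have "poly_eval h x (p * q) = poly_eval h x p * poly_eval h x q" for p q :: "'c cpoly"
  proof -
    let ?p = "Poly_Mapping.lookup p" and ?q = "Poly_Mapping.lookup q"
    have "p * q = (\<Sum>m\<in>Poly_Mapping.keys p. Poly_Mapping.single m (?p m)) * (\<Sum>n\<in>Poly_Mapping.keys q. Poly_Mapping.single n (?q n))"
      by (simp only: cpoly_expand[symmetric])
    also have "\<dots> = (\<Sum>m\<in>Poly_Mapping.keys p. \<Sum>n\<in>Poly_Mapping.keys q. Poly_Mapping.single (m + n) (?p m * ?q n))"
      by (simp add: sum_product mult_single)
    finally have "poly_eval h x (p * q) =
        (\<Sum>m\<in>Poly_Mapping.keys p. \<Sum>n\<in>Poly_Mapping.keys q. h (?p m) * mono_eval x m * (h (?q n) * mono_eval x n))"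
      by (simp only: sum single h_mult mono_eval_add mult.assoc mult.left_commute)
    also have "\<dots> = poly_eval h x p * poly_eval h x q"
      by (simp add: poly_eval_def mono_eval_def sum_product)
    finally show ?thesis .
  qed
  moreover have "poly_eval h x 1 = 1"
    using single[of 0 1] by (simp add: h_1)
  ultimately show ?thesis using add by unfold_locales
qed

lemma comm_ring_map_id: "comm_ring_map (id :: complex \<Rightarrow> complex)"
  and comm_ring_map_Const: "comm_ring_map Const"
  and comm_ring_map_pCons: "comm_ring_map (\<lambda>c :: complex. [:c:])"
  by (unfold_locales; simp add: Const_def single_add mult_single)+

global_interpretation ev: comm_ring_map "poly_eval id x" for x :: "'c \<Rightarrow> complex"
  by (rule comm_ring_map_poly_eval[OF comm_ring_map_id])

global_interpretation evC: comm_ring_map "poly_eval Const x" for x :: "'c \<Rightarrow> 'd cpoly"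
  by (rule comm_ring_map_poly_eval[OF comm_ring_map_Const])

lemma poly_eval_Const: "h 0 = 0 \<Longrightarrow> poly_eval h x (Const c) = h c"
  by (simp add: poly_eval_def Const_def)

lemma poly_eval_Var: "h 0 = 0 \<Longrightarrow> h 1 = 1 \<Longrightarrow> poly_eval h x (Var z) = x z"
  by (simp add: poly_eval_def Var_def)

lemma poly_eval_cong:
  assumes "p \<in> poly_ring C" "\<And>z. z \<in> C \<Longrightarrow> x z = y z"
  shows "poly_eval h x p = poly_eval h y p"
  unfolding poly_eval_def
proof (rule sum.cong[OF refl])
  fix m assume "m \<in> Poly_Mapping.keys p"
  then have "Poly_Mapping.keys m \<subseteq> C" using assms(1) by (auto simp: poly_ring_def)
  then have "(\<Prod>z\<in>Poly_Mapping.keys m. x z ^ Poly_Mapping.lookup m z) = (\<Prod>z\<in>Poly_Mapping.keys m. y z ^ Poly_Mapping.lookup m z)"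
    by (intro prod.cong refl) (use assms(2) in auto)
  then show "h (Poly_Mapping.lookup p m) * (\<Prod>z\<in>Poly_Mapping.keys m. x z ^ Poly_Mapping.lookup m z) =
      h (Poly_Mapping.lookup p m) * (\<Prod>z\<in>Poly_Mapping.keys m. y z ^ Poly_Mapping.lookup m z)" by simp
qed

lemma poly_ring_0 [simp]: "0 \<in> poly_ring C"
  and poly_ring_1 [simp]: "1 \<in> poly_ring C"
  and poly_ring_Const [simp]: "Const c \<in> poly_ring C"
  by (simp_all add: poly_ring_def Const_def)

lemma poly_ring_Var: "z \<in> C \<Longrightarrow> Var z \<in> poly_ring C"
  by (simp add: poly_ring_def Var_def)

lemma poly_ring_add: "p \<in> poly_ring C \<Longrightarrow> q \<in> poly_ring C \<Longrightarrow> p + q \<in> poly_ring C"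
  using keys_add[of p q] by (auto simp: poly_ring_def)

lemma poly_ring_uminus: "p \<in> poly_ring C \<Longrightarrow> - p \<in> poly_ring C"
  by (simp add: poly_ring_def)

lemma poly_ring_diff: "p \<in> poly_ring C \<Longrightarrow> q \<in> poly_ring C \<Longrightarrow> p - q \<in> poly_ring C"
  using poly_ring_add[of p C "- q"] poly_ring_uminus[of q C] by simp

lemma poly_ring_mult:
  assumes "p \<in> poly_ring C" "q \<in> poly_ring C"
  shows "p * q \<in> poly_ring C"
  unfolding poly_ring_def mem_Collect_eq
proof
  fix m assume "m \<in> Poly_Mapping.keys (p * q)"
  then obtain a b where ab: "a \<in> Poly_Mapping.keys p" "b \<in> Poly_Mapping.keys q" "m = a + b"
    using keys_mult[of p q] by blast
  then have "Poly_Mapping.keys a \<subseteq> C" "Poly_Mapping.keys b \<subseteq> C" using assms by (auto simp: poly_ring_def)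
  then show "Poly_Mapping.keys m \<subseteq> C" using keys_add[of a b] ab(3) by auto
qed

lemma poly_ring_sum: "(\<And>a. a \<in> A \<Longrightarrow> f a \<in> poly_ring C) \<Longrightarrow> (\<Sum>a\<in>A. f a) \<in> poly_ring C"
  by (induction A rule: infinite_finite_induct) (auto simp: poly_ring_add)

text \<open>The restriction of a polynomial to the affine line through \<open>x\<close> in direction
  \<open>y\<close>, as a polynomial in the parameter. Its coefficients 0, 1 and 2 are the value at
  \<open>x\<close>, the differential at \<open>x\<close> applied to \<open>y\<close>, and half the
  Hessian on \<open>y\<close>.\<close>

definition line :: "('c \<Rightarrow> complex) \<Rightarrow> ('c \<Rightarrow> complex) \<Rightarrow> 'c cpoly \<Rightarrow> complex poly" where
  "line x y = poly_eval (\<lambda>c. [:c:]) (\<lambda>z. [:x z, y z:])"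

global_interpretation ln: comm_ring_map "line x y" for x y :: "'c \<Rightarrow> complex"
  unfolding line_def by (rule comm_ring_map_poly_eval[OF comm_ring_map_pCons])

lemma poly_line: "poly (line x y p) t = poly_eval id (\<lambda>z. x z + t * y z) p"
proof -
  interpret comm_ring_map "\<lambda>q. poly q t" by unfold_locales auto
  show ?thesis unfolding line_def comp_poly_eval by (simp add: id_def)
qed

lemma coeff_line_0: "poly.coeff (line x y p) 0 = poly_eval id x p"
  using poly_line[of x y p 0] by (simp add: poly_0_coeff_0)

lemma coeff_1_eq_pderiv: "poly.coeff q 1 = poly (pderiv q) 0" for q :: "complex poly"
  by (simp add: poly_0_coeff_0 coeff_pderiv)

lemma line_mono_deriv:
  fixes x y :: "'c \<Rightarrow> complex"
  assumes C: "finite C" "Poly_Mapping.keys m \<subseteq> C"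
  shows "poly.coeff (mono_eval (\<lambda>z. [:x z, y z:]) m) 1 =
    (\<Sum>z\<in>C. y z * (of_nat (Poly_Mapping.lookup m z) * mono_eval x (m - Poly_Mapping.single z 1)))"
proof -
  let ?k = "Poly_Mapping.keys m" and ?l = "Poly_Mapping.lookup m"
  have p: "poly [:x z, y z:] 0 = x z" for z by simp
  have "poly.coeff (mono_eval (\<lambda>z. [:x z, y z:]) m) 1 =
      (\<Sum>z\<in>?k. (\<Prod>w\<in>?k - {z}. x w ^ ?l w) * (of_nat (?l z) * x z ^ (?l z - 1) * y z))"
    unfolding coeff_1_eq_pderiv mono_eval_def pderiv_prod poly_sum poly_mult poly_prod poly_power p
    by (rule sum.cong) (simp_all add: pderiv_power pderiv_pCons mult_ac)
  also have "\<dots> = (\<Sum>z\<in>?k. y z * (of_nat (?l z) * mono_eval x (m - Poly_Mapping.single z 1)))"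
  proof (rule sum.cong[OF refl])
    fix z assume z: "z \<in> ?k"
    let ?n = "m - Poly_Mapping.single z 1"
    have "Poly_Mapping.keys ?n \<subseteq> ?k"
      by (auto simp: in_keys_iff lookup_minus)
    then have "mono_eval x ?n = (\<Prod>w\<in>?k. x w ^ Poly_Mapping.lookup ?n w)"
      by (intro mono_eval_superset) auto
    also have "\<dots> = x z ^ Poly_Mapping.lookup ?n z * (\<Prod>w\<in>?k - {z}. x w ^ Poly_Mapping.lookup ?n w)"
      by (rule prod.remove) (use z in auto)
    also have "(\<Prod>w\<in>?k - {z}. x w ^ Poly_Mapping.lookup ?n w) = (\<Prod>w\<in>?k - {z}. x w ^ ?l w)"
      by (rule prod.cong) (auto simp: lookup_minus lookup_single)
    finally have "mono_eval x ?n = x z ^ (?l z - 1) * (\<Prod>w\<in>?k - {z}. x w ^ ?l w)"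
      by (simp add: lookup_minus)
    then show "(\<Prod>w\<in>?k - {z}. x w ^ ?l w) * (of_nat (?l z) * x z ^ (?l z - 1) * y z) =
        y z * (of_nat (?l z) * mono_eval x ?n)"
      by (simp only: mult_ac)
  qed
  also have "\<dots> = (\<Sum>z\<in>C. y z * (of_nat (?l z) * mono_eval x (m - Poly_Mapping.single z 1)))"
    by (rule sum.mono_neutral_left) (use C in \<open>auto simp: in_keys_iff\<close>)
  finally show ?thesis .
qed

text \<open>The bridge between the partial derivatives in \<open>scheme_smooth_at\<close> and
  derivatives along lines, along which the moment map expands directly.\<close>

lemma coeff_line_1:
  assumes C: "finite C" and p: "p \<in> poly_ring C"
  shows "poly.coeff (line x y p) 1 = (\<Sum>z\<in>C. y z * poly_eval id x (partial_deriv z p))"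
proof -
  let ?c = "Poly_Mapping.lookup p"
  have single: "poly_eval id x (Poly_Mapping.single m c) = c * mono_eval x m" for m c
    using poly_eval_superset[of "{m}" "Poly_Mapping.single m c" id x] by simp
  have d: "poly_eval id x (partial_deriv z p) = (\<Sum>m\<in>Poly_Mapping.keys p. of_nat (Poly_Mapping.lookup m z) * ?c m * mono_eval x (m - Poly_Mapping.single z 1))" for z
    unfolding partial_deriv_def by (simp only: ev.h_sum single)
  have "poly.coeff (line x y p) 1 = (\<Sum>m\<in>Poly_Mapping.keys p. ?c m * poly.coeff (mono_eval (\<lambda>z. [:x z, y z:]) m) 1)"
    unfolding line_def poly_eval_def mono_eval_def[symmetric] coeff_sum by simp
  also have "\<dots> = (\<Sum>m\<in>Poly_Mapping.keys p. ?c m * (\<Sum>z\<in>C. y z * (of_nat (Poly_Mapping.lookup m z) * mono_eval x (m - Poly_Mapping.single z 1))))"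
    by (rule sum.cong[OF refl], subst line_mono_deriv[OF C]) (use p in \<open>auto simp: poly_ring_def\<close>)
  also have "\<dots> = (\<Sum>z\<in>C. \<Sum>m\<in>Poly_Mapping.keys p. y z * (of_nat (Poly_Mapping.lookup m z) * ?c m * mono_eval x (m - Poly_Mapping.single z 1)))"
    unfolding sum_distrib_left by (subst sum.swap) (simp only: mult_ac)
  also have "\<dots> = (\<Sum>z\<in>C. y z * poly_eval id x (partial_deriv z p))"
    by (simp only: d sum_distrib_left)
  finally show ?thesis .
qed

section \<open>Ideals of polynomials\<close>

lemma ideal_gen_add:
  assumes "f \<in> ideal_gen C F" "f' \<in> ideal_gen C F"
  shows "f + f' \<in> ideal_gen C F"
proof -
  obtain S q where S: "finite S" "S \<subseteq> F" "\<forall>s\<in>S. q s \<in> poly_ring C" "f = (\<Sum>s\<in>S. q s * s)"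
    using assms(1) by (auto simp: ideal_gen_def)
  obtain S' q' where S': "finite S'" "S' \<subseteq> F" "\<forall>s\<in>S'. q' s \<in> poly_ring C" "f' = (\<Sum>s\<in>S'. q' s * s)"
    using assms(2) by (auto simp: ideal_gen_def)
  let ?q = "\<lambda>s. (if s \<in> S then q s else 0) + (if s \<in> S' then q' s else 0)"
  have "(\<Sum>s\<in>S \<union> S'. ?q s * s) = (\<Sum>s\<in>S \<union> S'. (if s \<in> S then q s else 0) * s) + (\<Sum>s\<in>S \<union> S'. (if s \<in> S' then q' s else 0) * s)"
    by (simp only: distrib_right sum.distrib)
  also have "(\<Sum>s\<in>S \<union> S'. (if s \<in> S then q s else 0) * s) = f"
    unfolding S(4) by (rule sum.mono_neutral_cong_right) (use S(1) S'(1) in auto)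
  also have "(\<Sum>s\<in>S \<union> S'. (if s \<in> S' then q' s else 0) * s) = f'"
    unfolding S'(4) by (rule sum.mono_neutral_cong_right) (use S(1) S'(1) in auto)
  finally have eq: "f + f' = (\<Sum>s\<in>S \<union> S'. ?q s * s)" by simp
  show ?thesis
    unfolding ideal_gen_def mem_Collect_eq
    by (rule exI[of _ "S \<union> S'"], rule exI[of _ ?q]) (use S S' eq in \<open>auto intro: poly_ring_add\<close>)
qed

lemma ideal_gen_mult:
  assumes "f \<in> ideal_gen C F" "p \<in> poly_ring C"
  shows "p * f \<in> ideal_gen C F"
proof -
  obtain S q where S: "finite S" "S \<subseteq> F" "\<forall>s\<in>S. q s \<in> poly_ring C" "f = (\<Sum>s\<in>S. q s * s)"
    using assms(1) by (auto simp: ideal_gen_def)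
  have "p * f = (\<Sum>s\<in>S. p * q s * s)" unfolding S(4) sum_distrib_left by (simp only: mult.assoc)
  then show ?thesis
    unfolding ideal_gen_def mem_Collect_eq
    by (intro exI[of _ S] exI[of _ "\<lambda>s. p * q s"]) (use S assms(2) in \<open>auto intro: poly_ring_mult\<close>)
qed

lemma ideal_gen_0 [simp]: "0 \<in> ideal_gen C F"
  unfolding ideal_gen_def mem_Collect_eq by (intro exI[of _ "{}"]) simp

lemma ideal_gen_base: "s \<in> F \<Longrightarrow> s \<in> ideal_gen C F"
  unfolding ideal_gen_def mem_Collect_eq by (intro exI[of _ "{s}"] exI[of _ "\<lambda>_. 1"]) simp

lemma ideal_gen_sum: "(\<And>a. a \<in> A \<Longrightarrow> f a \<in> ideal_gen C F) \<Longrightarrow> (\<Sum>a\<in>A. f a) \<in> ideal_gen C F"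
  by (induction A rule: infinite_finite_induct) (auto simp: ideal_gen_add)

lemma ideal_gen_mono_gen:
  assumes "\<And>s. s \<in> F \<Longrightarrow> s \<in> ideal_gen C F'" "f \<in> ideal_gen C F"
  shows "f \<in> ideal_gen C F'"
proof -
  obtain S q where S: "finite S" "S \<subseteq> F" "\<forall>s\<in>S. q s \<in> poly_ring C" "f = (\<Sum>s\<in>S. q s * s)"
    using assms(2) by (auto simp: ideal_gen_def)
  show ?thesis unfolding S(4) using assms(1) S by (intro ideal_gen_sum ideal_gen_mult) auto
qed

lemma ideal_gen_poly_ring:
  assumes "F \<subseteq> poly_ring C" "f \<in> ideal_gen C F"
  shows "f \<in> poly_ring C"
proof -
  obtain S q where S: "finite S" "S \<subseteq> F" "\<forall>s\<in>S. q s \<in> poly_ring C" "f = (\<Sum>s\<in>S. q s * s)"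
    using assms(2) by (auto simp: ideal_gen_def)
  show ?thesis unfolding S(4) using assms(1) S by (intro poly_ring_sum poly_ring_mult) auto
qed

lemma ideal_gen_eval_0:
  assumes "\<And>s. s \<in> F \<Longrightarrow> poly_eval id x s = 0" "f \<in> ideal_gen C F"
  shows "poly_eval id x f = 0"
proof -
  obtain S q where S: "finite S" "S \<subseteq> F" "f = (\<Sum>s\<in>S. q s * s)"
    using assms(2) by (auto simp: ideal_gen_def)
  show ?thesis unfolding S(3) ev.h_sum ev.h_mult by (rule sum.neutral) (use assms(1) S(2) in auto)
qed

section \<open>First and second order terms at a smooth point\<close>

lemma coeff_mult_1: "poly.coeff (p * q) 1 = poly.coeff p 0 * poly.coeff q 1 + poly.coeff p 1 * poly.coeff q 0"
  and coeff_mult_2: "poly.coeff (p * q) 2 = poly.coeff p 0 * poly.coeff q 2 + poly.coeff p 1 * poly.coeff q 1 + poly.coeff p 2 * poly.coeff q 0"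
  for p q :: "complex poly"
  by (simp_all add: coeff_mult numeral_2_eq_2 atMost_Suc)

text \<open>At a smooth point a function of the ideal whose differential vanishes lies locally in the
  product of the ideal with the maximal ideal, so its Hessian vanishes on the tangent space.\<close>

lemma smooth_second_order:
  assumes C: "finite C" and I: "I \<subseteq> poly_ring C" and smooth: "scheme_smooth_at C I x"
    and tangent: "\<And>s. s \<in> I \<Longrightarrow> poly.coeff (line x y s) 1 = 0"
    and f: "f \<in> I" "\<And>y'. poly.coeff (line x y' f) 1 = 0"
  shows "poly.coeff (line x y f) 2 = 0"
proof -
  have zero: "\<And>s. s \<in> I \<Longrightarrow> poly_eval id x s = 0" using smooth by (simp add: scheme_smooth_at_def)
  obtain r g where g: "\<forall>k<r. g k \<in> I"
    "\<forall>f\<in>I. \<exists>h\<in>poly_ring C. poly_eval id x h \<noteq> 0 \<and> h * f \<in> ideal_gen C (g ` {..<r})"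
    "\<forall>c::nat \<Rightarrow> complex. (\<forall>z\<in>C. (\<Sum>k<r. c k * poly_eval id x (partial_deriv z (g k))) = 0) \<longrightarrow> (\<forall>k<r. c k = 0)"
    using smooth unfolding scheme_smooth_at_def by blast
  obtain h where h: "poly_eval id x h \<noteq> 0" "h * f \<in> ideal_gen C (g ` {..<r})" using g(2) f(1) by blast
  obtain S q where S: "finite S" "S \<subseteq> g ` {..<r}" "h * f = (\<Sum>s\<in>S. q s * s)"
    using h(2) by (auto simp: ideal_gen_def)
  have SI: "s \<in> I" if "s \<in> S" for s using that S(2) g(1) by auto
  \<comment> \<open>Differentiate h f = sum of q_s s at \<open>x\<close>. As f and all s vanish
    there and f has zero differential, what remains is a linear relation among the differentials of
    the s with coefficients q_s(x).\<close>
  have rel: "(\<Sum>s\<in>S. poly_eval id x (q s) * poly_eval id x (partial_deriv z s)) = 0" if z: "z \<in> C" for z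
  proof -
    let ?d = "\<lambda>w. if w = z then 1 else (0::complex)"
    have d: "poly.coeff (line x ?d s) 1 = poly_eval id x (partial_deriv z s)" if "s \<in> I" for s
    proof -
      have "poly.coeff (line x ?d s) 1 = (\<Sum>w\<in>C. if w = z then poly_eval id x (partial_deriv z s) else 0)"
        unfolding coeff_line_1[OF C subsetD[OF I that]] by (rule sum.cong) auto
      then show ?thesis using C z by simp
    qed
    have "poly.coeff (line x ?d (h * f)) 1 = 0"
      unfolding ln.h_mult coeff_mult_1 coeff_line_0 using f zero by simp
    then have "(\<Sum>s\<in>S. poly.coeff (line x ?d (q s * s)) 1) = 0"
      unfolding S(3) ln.h_sum coeff_sum .
    moreover have "poly.coeff (line x ?d (q s * s)) 1 = poly_eval id x (q s) * poly_eval id x (partial_deriv z s)" if "s \<in> S" for s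
      unfolding ln.h_mult coeff_mult_1 coeff_line_0 using zero[OF SI[OF that]] d[OF SI[OF that]] by simp
    ultimately show ?thesis by simp
  qed
  have q0: "poly_eval id x (q s) = 0" if s: "s \<in> S" for s
  proof -
    have "\<forall>s\<in>S. \<exists>k. k < r \<and> g k = s" using S(2) by auto
    \<comment> \<open>\<open>S\<close> is a set of polynomials, whereas independence concerns the
      indexed family \<open>g\<close>. Each s is assigned one index, and the coefficients are 0 at
      all others.\<close>
    from bchoice[OF this] obtain k where k: "\<And>s. s \<in> S \<Longrightarrow> k s < r \<and> g (k s) = s" by blast
    have inj: "inj_on k S" by (rule inj_onI) (metis k)
    define c where "c j = (if j \<in> k ` S then poly_eval id x (q (g j)) else 0)" for j
    have "(\<Sum>j<r. c j * poly_eval id x (partial_deriv z (g j))) = 0" if z: "z \<in> C" for z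
    proof -
      have "(\<Sum>j<r. c j * poly_eval id x (partial_deriv z (g j))) = (\<Sum>j\<in>k ` S. c j * poly_eval id x (partial_deriv z (g j)))"
        by (rule sum.mono_neutral_right) (use k in \<open>auto simp: c_def\<close>)
      also have "\<dots> = (\<Sum>s\<in>S. c (k s) * poly_eval id x (partial_deriv z (g (k s))))"
        by (simp add: sum.reindex[OF inj])
      also have "\<dots> = (\<Sum>s\<in>S. poly_eval id x (q s) * poly_eval id x (partial_deriv z s))"
        by (rule sum.cong) (use k in \<open>auto simp: c_def\<close>)
      finally show ?thesis using rel[OF z] by simp
    qed
    then have "c (k s) = 0" using g(3) k[OF s] by blast
    then show ?thesis using s k[OF s] by (simp add: c_def)
  qed
  \<comment> \<open>In the three products making up the quadratic term of q_s s, the factors q_s(x),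
    the differential of s on \<open>y\<close>, and s(x) vanish respectively.\<close>
  have "poly.coeff (line x y (h * f)) 2 = (\<Sum>s\<in>S. poly.coeff (line x y (q s * s)) 2)"
    unfolding S(3) ln.h_sum coeff_sum ..
  also have "\<dots> = 0"
  proof (rule sum.neutral, rule ballI)
    fix s assume s: "s \<in> S"
    show "poly.coeff (line x y (q s * s)) 2 = 0"
      unfolding ln.h_mult coeff_mult_2 coeff_line_0 using q0[OF s] zero[OF SI[OF s]] tangent[OF SI[OF s]] by simp
  qed
  finally have "poly.coeff (line x y (h * f)) 2 = 0" .
  \<comment> \<open>On the side of h f only h(x) times the quadratic term of f survives, and h(x) is
    nonzero.\<close>
  then show ?thesis
    unfolding ln.h_mult coeff_mult_2 coeff_line_0 using h(1) f zero by simp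
qed

text \<open>The Jacobian criterion for generators of which one, \<open>e0\<close>, is a combination
  of the others. The others then generate the ideal globally, so the denominator \<open>h\<close> at
  every function can be taken to be 1.\<close>

lemma smooth_if_independent:
  fixes \<phi> :: "'e \<Rightarrow> 'c cpoly"
  assumes E: "finite E" "e0 \<in> E" and rel: "\<phi> e0 \<in> ideal_gen C (\<phi> ` (E - {e0}))"
    and zero: "\<And>e. e \<in> E \<Longrightarrow> poly_eval id x (\<phi> e) = 0"
    and ind: "\<And>c. (\<And>z. z \<in> C \<Longrightarrow> (\<Sum>e\<in>E - {e0}. c e * poly_eval id x (partial_deriv z (\<phi> e))) = 0) \<Longrightarrow> \<forall>e\<in>E - {e0}. c e = 0"
  shows "scheme_smooth_at C (ideal_gen C (\<phi> ` E)) x"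
proof -
  let ?E = "E - {e0}"
  obtain e where e: "bij_betw e {..<card ?E} ?E"
    using ex_bij_betw_nat_finite[of ?E] E(1) by (auto simp: atLeast0LessThan)
  let ?g = "\<lambda>k. \<phi> (e k)"
  have im: "?g ` {..<card ?E} = \<phi> ` ?E" using e by (auto simp: bij_betw_def image_image[symmetric])
  have eE: "e k \<in> ?E" if "k < card ?E" for k using e that by (auto simp: bij_betw_def)
  have 1: "\<forall>k<card ?E. ?g k \<in> ideal_gen C (\<phi> ` E)"
    using eE by (auto intro: ideal_gen_base)
  have 2: "\<exists>h\<in>poly_ring C. poly_eval id x h \<noteq> 0 \<and> h * f \<in> ideal_gen C (?g ` {..<card ?E})" if f: "f \<in> ideal_gen C (\<phi> ` E)" for f
  proof (rule bexI[of _ 1])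
    have "s \<in> ideal_gen C (\<phi> ` ?E)" if "s \<in> \<phi> ` E" for s
      using that rel by (cases "s = \<phi> e0") (auto intro: ideal_gen_base)
    from ideal_gen_mono_gen[OF this f] show "poly_eval id x 1 \<noteq> 0 \<and> 1 * f \<in> ideal_gen C (?g ` {..<card ?E})"
      by (simp add: im ev.h_1)
  qed simp
  have 3: "\<forall>c :: nat \<Rightarrow> complex. (\<forall>z\<in>C. (\<Sum>k<card ?E. c k * poly_eval id x (partial_deriv z (?g k))) = 0) \<longrightarrow>
      (\<forall>k<card ?E. c k = 0)"
  proof (rule allI, rule impI)
    fix c :: "nat \<Rightarrow> complex"
    assume c: "\<forall>z\<in>C. (\<Sum>k<card ?E. c k * poly_eval id x (partial_deriv z (?g k))) = 0"
    let ?c = "\<lambda>a. c (the_inv_into {..<card ?E} e a)"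
    have inv: "the_inv_into {..<card ?E} e (e k) = k" if "k < card ?E" for k
      using e that by (intro the_inv_into_f_f) (auto simp: bij_betw_def)
    have "(\<Sum>a\<in>?E. ?c a * poly_eval id x (partial_deriv z (\<phi> a))) = 0" if "z \<in> C" for z
    proof -
      have "(\<Sum>a\<in>?E. ?c a * poly_eval id x (partial_deriv z (\<phi> a))) =
          (\<Sum>k<card ?E. ?c (e k) * poly_eval id x (partial_deriv z (\<phi> (e k))))"
        by (rule sum.reindex_bij_betw[OF e, symmetric])
      also have "\<dots> = (\<Sum>k<card ?E. c k * poly_eval id x (partial_deriv z (?g k)))"
        by (rule sum.cong) (auto simp: inv)
      finally show ?thesis using c that by simp
    qed
    from ind[OF this] have z: "\<forall>a\<in>?E. ?c a = 0" .
    show "\<forall>k<card ?E. c k = 0"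
      using bspec[OF z eE] inv by simp
  qed
  have 4: "\<forall>f\<in>ideal_gen C (\<phi> ` E). poly_eval id x f = 0"
    using ideal_gen_eval_0[of "\<phi> ` E" x _ C] zero by blast
  show ?thesis
    unfolding scheme_smooth_at_def
    by (rule conjI[OF 4], rule exI[of _ "card ?E"], rule exI[of _ ?g], rule conjI[OF 1], rule conjI[OF ballI[OF 2] 3])
qed

section \<open>Density and traces\<close>

text \<open>An enumeration of \<open>I\<close> turns \<open>X\<close> into a square matrix of
  positive size, whose spectrum over the complex numbers is nonempty; the eigenvector is carried
  back along the enumeration.\<close>

lemma eigenvector_exists:
  fixes X :: "('i, complex) fmat"
  assumes I: "finite I" "I \<noteq> {}" and X: "on I X"
  obtains c u where "u \<in> funs_on I" "u \<noteq> 0" "app X u = fscale c u"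
proof -
  let ?n = "card I"
  obtain f where f: "bij_betw f {0..<?n} I" using ex_bij_betw_nat_finite[OF I(1)] by (elim exE)
  define A where "A = mat ?n ?n (\<lambda>(i, j). ent X (f i) (f j))"
  have A: "A \<in> carrier_mat ?n ?n" by (simp add: A_def)
  have "?n > 0" using I by (simp add: card_gt_0_iff)
  then have "spectrum A \<noteq> {}" using spectrum_non_empty[OF A] by simp
  then obtain c v where "eigenvector A v c" unfolding spectrum_def eigenvalue_def by auto
  then have v: "v \<in> carrier_vec ?n" "v \<noteq> 0\<^sub>v ?n" "A *\<^sub>v v = c \<cdot>\<^sub>v v"
    using A by (auto simp: eigenvector_def)
  define u where "u = vec_on I (\<lambda>p. v $ inv_into {0..<?n} f p)"
  have u: "u \<in> funs_on I" using I(1) by (simp add: u_def)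
  have fI: "f i \<in> I" if "i < ?n" for i using f that by (auto simp: bij_betw_def)
  have lu: "Poly_Mapping.lookup u (f i) = v $ i" if "i < ?n" for i
    using f that fI[OF that] I(1) by (simp add: u_def lookup_vec_on bij_betw_inv_into_left)
  have "u \<noteq> 0"
  proof
    assume "u = 0"
    then have "v $ i = 0" if "i < ?n" for i using lu[OF that] by simp
    then have "v = 0\<^sub>v ?n" using v(1) by (intro eq_vecI) auto
    then show False using v(2) by simp
  qed
  moreover have "app X u = fscale c u"
  proof (rule poly_mapping_eqI)
    fix p
    show "Poly_Mapping.lookup (app X u) p = Poly_Mapping.lookup (fscale c u) p"
    proof (cases "p \<in> I")
      case True
      then have "p \<in> f ` {0..<?n}" using f by (simp add: bij_betw_def)
      then obtain i where i: "p = f i" "i < ?n" by (elim imageE) simp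
      have "Poly_Mapping.lookup (app X u) p = (\<Sum>q\<in>I. ent X p q * Poly_Mapping.lookup u q)"
        by (rule lookup_app[OF I(1) X])
      also have "\<dots> = (\<Sum>j\<in>{0..<?n}. ent X p (f j) * Poly_Mapping.lookup u (f j))"
        by (rule sum.reindex_bij_betw[OF f, symmetric])
      also have "\<dots> = (\<Sum>j\<in>{0..<?n}. ent X (f i) (f j) * v $ j)"
        by (rule sum.cong[OF refl]) (simp add: lu i(1))
      also have "\<dots> = (A *\<^sub>v v) $ i"
        using v(1) i(2) by (simp add: A_def scalar_prod_def)
      also have "\<dots> = c * v $ i" using v(1,3) i(2) by simp
      finally show ?thesis by (simp add: i(1) lu[OF i(2)])
    next
      case False
      then show ?thesis using funs_onD[OF app_in_funs_on[OF X] False] funs_onD[OF u False] by simp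
    qed
  qed
  ultimately show ?thesis using that[OF u] by simp
qed

section \<open>Schur's lemma, density and Burnside's theorem\<close>

locale irreducible_algebra =
  fixes I :: "'i set" and A :: "('i, complex) fmat set"
  assumes fin: "finite I" and ne: "I \<noteq> {}"
    and on_A: "\<And>a. a \<in> A \<Longrightarrow> on I a"
    and one_A: "diag I \<in> A"
    and add_A: "\<And>a b. a \<in> A \<Longrightarrow> b \<in> A \<Longrightarrow> a + b \<in> A"
    and mult_A: "\<And>a b. a \<in> A \<Longrightarrow> b \<in> A \<Longrightarrow> a * b \<in> A"
    and smul_A: "\<And>a c. a \<in> A \<Longrightarrow> smul c a \<in> A"
    and irr: "\<And>W. fsubspace W \<Longrightarrow> W \<subseteq> funs_on I \<Longrightarrow> (\<And>a w. a \<in> A \<Longrightarrow> w \<in> W \<Longrightarrow> app a w \<in> W) \<Longrightarrow>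
      W \<subseteq> {0} \<or> W = funs_on I"
begin

lemma diff_A: "a \<in> A \<Longrightarrow> b \<in> A \<Longrightarrow> a - b \<in> A"
proof -
  assume "a \<in> A" "b \<in> A"
  then have "a + smul (- 1) b \<in> A" by (intro add_A smul_A)
  moreover have "a + smul (- 1) b = a - b" by (rule fmat_eqI) simp
  ultimately show ?thesis by simp
qed

lemma schur:
  assumes \<theta>: "on I \<theta>" and com: "\<And>a. a \<in> A \<Longrightarrow> a * \<theta> = \<theta> * a"
  obtains c where "\<theta> = smul c (diag I)"
proof -
  obtain c u where u: "u \<in> funs_on I" "u \<noteq> 0" "app \<theta> u = fscale c u"
    by (rule eigenvector_exists[OF fin ne \<theta>])
  let ?W = "{w \<in> funs_on I. app \<theta> w = fscale c w}"
  have "?W \<subseteq> {0} \<or> ?W = funs_on I"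
  proof (rule irr)
    show "fsubspace ?W"
      using fs.subspace_0[OF fsubspace_funs_on[of I]]
      by (intro fs.subspaceI) (simp_all add: app_add_right app_scale fs.scale_right_distrib fs.scale_left_commute)
    show "app a w \<in> ?W" if "a \<in> A" "w \<in> ?W" for a w
    proof -
      have "app \<theta> (app a w) = app a (app \<theta> w)"
        using com[OF that(1)] by (simp only: app_mult[symmetric])
      then show ?thesis using that(2) app_in_funs_on[OF on_A[OF that(1)]] by (simp add: app_scale)
    qed
  qed blast
  then have W: "?W = funs_on I" using u by blast
  have "\<theta> = smul c (diag I)"
  proof (rule fmat_eqI_app[OF \<theta>])
    show "on I (smul c (diag I))" using fin by simp
    fix w assume w: "w \<in> funs_on I"
    then have "app \<theta> w = fscale c w" using W by blast
    then show "app \<theta> w = app (smul c (diag I)) w" using w fin by (simp add: app_smul app_diag_funs_on)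
  qed
  then show ?thesis by (rule that)
qed

lemma fsubspace_orbit:
  assumes J: "\<And>a b. a \<in> J \<Longrightarrow> b \<in> J \<Longrightarrow> a + b \<in> J" "\<And>a c. a \<in> J \<Longrightarrow> smul c a \<in> J" "J \<noteq> {}"
  shows "fsubspace ((\<lambda>a. app a x) ` J)"
proof (rule fs.subspaceI)
  obtain a where "a \<in> J" using J(3) by blast
  then have "smul 0 a \<in> J" by (rule J(2))
  then show "0 \<in> (\<lambda>a. app a x) ` J" by (rule rev_image_eqI) simp
next
  fix u w assume "u \<in> (\<lambda>a. app a x) ` J" "w \<in> (\<lambda>a. app a x) ` J"
  then obtain a b where "a \<in> J" "b \<in> J" "u = app a x" "w = app b x" by blast
  then show "u + w \<in> (\<lambda>a. app a x) ` J" using J(1)[of a b] by (intro rev_image_eqI[of "a + b"]) (simp_all add: app_add)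
next
  fix c u assume "u \<in> (\<lambda>a. app a x) ` J"
  then obtain a where "a \<in> J" "u = app a x" by blast
  then show "fscale c u \<in> (\<lambda>a. app a x) ` J" using J(2)[of a c] by (intro rev_image_eqI[of "smul c a"]) (simp_all add: app_smul)
qed

text \<open>Jacobson density. If the elements killing \<open>B\<close> and \<open>b\<close> also killed \<open>x\<close>, then \<open>a b \<mapsto> a x\<close>, for
  \<open>a\<close> killing \<open>B\<close>, would be a well-defined endomorphism, hence a scalar \<open>c\<close>, and \<open>x - c b\<close> would
  contradict the induction hypothesis.\<close>

lemma density:
  assumes "finite B" "B \<subseteq> funs_on I" "x \<in> funs_on I" "x \<notin> fspan B"
  shows "\<exists>a\<in>A. (\<forall>b\<in>B. app a b = 0) \<and> app a x \<noteq> 0"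
  using assms
proof (induction B arbitrary: x)
  case empty
  then have "x \<noteq> 0" using fs.span_zero by blast
  then show ?case using empty one_A fin by (intro bexI[of _ "diag I"]) (simp_all add: app_diag_funs_on)
next
  case (insert b B)
  have B: "B \<subseteq> funs_on I" and bI: "b \<in> funs_on I" using insert.prems(1) by simp_all
  note IH = insert.IH[OF B]
  show ?case
  proof (cases "b \<in> fspan B")
    case True
    then have "x \<notin> fspan B" using insert.prems(3) fs.span_mono[of B "insert b B"] by blast
    then obtain a where a: "a \<in> A" "\<forall>b\<in>B. app a b = 0" "app a x \<noteq> 0" using IH insert.prems(2) by blast
    have "app a b = app 0 b" by (rule app_eq_on_span[OF _ True]) (use a(2) in simp)
    then show ?thesis using a by (intro bexI[of _ a]) simp_all
  next
    case False
    show ?thesis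
    proof (rule ccontr)
      assume "\<not> ?thesis"
      then have N: "app a x = 0" if "a \<in> A" "\<And>b'. b' \<in> B \<Longrightarrow> app a b' = 0" "app a b = 0" for a
        using that by blast
      \<comment> \<open>\<open>J\<close> is a left ideal, so J b is an invariant subspace. It is
        nonzero by the induction hypothesis applied to \<open>b\<close>, hence it is the whole
        space.\<close>
      define J where "J = {a \<in> A. \<forall>b'\<in>B. app a b' = 0}"
      have JA: "a \<in> A" if "a \<in> J" for a using that by (simp add: J_def)
      have J_add: "a + a' \<in> J" if "a \<in> J" "a' \<in> J" for a a'
        using that by (simp add: J_def add_A app_add)
      have J_smul: "smul c a \<in> J" if "a \<in> J" for a c
        using that by (simp add: J_def smul_A app_smul)
      have J_left: "a * a' \<in> J" if "a \<in> A" "a' \<in> J" for a a'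
        using that by (simp add: J_def mult_A app_mult)
      obtain a0 where a0: "a0 \<in> J" "app a0 b \<noteq> 0" using IH[OF bI False] unfolding J_def by blast
      have "(\<lambda>a. app a b) ` J \<subseteq> {0} \<or> (\<lambda>a. app a b) ` J = funs_on I"
      proof (rule irr)
        show "fsubspace ((\<lambda>a. app a b) ` J)" by (rule fsubspace_orbit[OF J_add J_smul]) (use a0 in auto)
        show "(\<lambda>a. app a b) ` J \<subseteq> funs_on I" using app_in_funs_on on_A JA by blast
        show "app a w \<in> (\<lambda>a. app a b) ` J" if aA: "a \<in> A" and w: "w \<in> (\<lambda>a. app a b) ` J" for a w
        proof -
          obtain a' where "a' \<in> J" "w = app a' b" using w by blast
          then show ?thesis by (intro rev_image_eqI[OF J_left[OF aA]]) (simp_all add: app_mult)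
        qed
      qed
      then have onto: "(\<lambda>a. app a b) ` J = funs_on I"
      proof (rule disjE)
        assume "(\<lambda>a. app a b) ` J \<subseteq> {0}"
        then have "app a0 b \<in> {0}" by (rule subsetD) (rule imageI[OF a0(1)])
        then show ?thesis using a0(2) by simp
      qed
      \<comment> \<open>A section of the map taking a in \<open>J\<close> to a b. By
        \<open>N\<close> the vector (s u) x does not depend on the choice, which \<open>key\<close>
        records.\<close>
      define s where "s u = (SOME a. a \<in> J \<and> app a b = u)" for u
      have s: "s u \<in> J \<and> app (s u) b = u" if "u \<in> funs_on I" for u
      proof -
        have "u \<in> (\<lambda>a. app a b) ` J" using onto that by simp
        then have "\<exists>a. a \<in> J \<and> app a b = u" by (elim imageE) (intro exI conjI, assumption, simp)
        then show ?thesis unfolding s_def by (rule someI_ex)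
      qed
      define \<theta> where "\<theta> u = app (s u) x" for u
      have key: "app a x = \<theta> (app a b)" if a: "a \<in> J" for a
      proof -
        have u: "app a b \<in> funs_on I" using app_in_funs_on[OF on_A[OF JA[OF a]]] .
        note su = s[OF u, THEN conjunct1] s[OF u, THEN conjunct2]
        have "app (a - s (app a b)) x = 0"
        proof (rule N)
          show "a - s (app a b) \<in> A" by (rule diff_A[OF JA[OF a] JA[OF su(1)]])
          show "app (a - s (app a b)) b' = 0" if "b' \<in> B" for b'
            using a su(1) that by (simp add: J_def app_diff)
          show "app (a - s (app a b)) b = 0" by (simp add: app_diff su(2))
        qed
        then show ?thesis by (simp add: \<theta>_def app_diff)
      qed
      define T where "T = mat_of I \<theta>"
      have T: "app T u = \<theta> u" if "u \<in> funs_on I" for u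
        unfolding T_def
      proof (rule app_mat_of[OF fin that])
        fix u w assume uw: "u \<in> funs_on I" "w \<in> funs_on I"
        show "\<theta> (u + w) = \<theta> u + \<theta> w"
          using key[OF J_add[of "s u" "s w"]] s[OF uw(1)] s[OF uw(2)] by (simp add: app_add \<theta>_def)
      next
        fix c u assume u: "u \<in> funs_on I"
        show "\<theta> (fscale c u) = fscale c (\<theta> u)"
          using key[OF J_smul[of "s u" c]] s[OF u] by (simp add: app_smul \<theta>_def)
      next
        fix u assume u: "u \<in> funs_on I"
        show "\<theta> u \<in> funs_on I" unfolding \<theta>_def using s[OF u] JA on_A app_in_funs_on by blast
      qed
      have onT: "on I T" by (simp add: T_def fin)
      have "a * T = T * a" if a: "a \<in> A" for a
      proof (rule fmat_eqI_app)
        show "on I (a * T)" "on I (T * a)" using on_mult[OF on_A[OF a] onT] on_mult[OF onT on_A[OF a]] .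
        fix u assume u: "u \<in> funs_on I"
        have au: "app a u \<in> funs_on I" by (rule app_in_funs_on[OF on_A[OF a]])
        show "app (a * T) u = app (T * a) u"
          using key[OF J_left[OF a, of "s u"]] s[OF u] by (simp add: app_mult T[OF u] T[OF au] \<theta>_def)
      qed
      then obtain c where c: "T = smul c (diag I)" by (rule schur[OF onT])
      have kill: "app a (x - fscale c b) = 0" if a: "a \<in> J" for a
      proof -
        have ab: "app a b \<in> funs_on I" using app_in_funs_on[OF on_A[OF JA[OF a]]] .
        have "app a x = fscale c (app a b)"
          using key[OF a] T[OF ab] ab fin by (simp add: c app_smul app_diag_funs_on)
        then show ?thesis by (simp add: app_diff_right app_scale)
      qed
      have "x - fscale c b \<in> fspan B"
      proof (rule ccontr)
        assume "x - fscale c b \<notin> fspan B"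
        then have "\<exists>a\<in>A. (\<forall>b\<in>B. app a b = 0) \<and> app a (x - fscale c b) \<noteq> 0"
          using IH insert.prems(2) bI by simp
        then show False using kill unfolding J_def by blast
      qed
      then have "x - fscale c b \<in> fspan (insert b B)" by (rule subsetD[OF fs.span_mono, rotated]) blast
      moreover have "fscale c b \<in> fspan (insert b B)" by (intro fs.span_scale fs.span_base) simp
      ultimately have "x - fscale c b + fscale c b \<in> fspan (insert b B)" by (rule fs.span_add)
      then show False using insert.prems(3) by (simp only: diff_add_cancel)
    qed
  qed
qed

text \<open>Density gives an element of \<open>A\<close> that kills every unit vector of
  \<open>I\<close> except the one at q; by irreducibility a second element moves its value there to
  the unit vector at p. The product is the matrix unit, and matrix units span all matrices on
  \<open>I\<close>.\<close>

lemma burnside: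
  assumes X: "on I X"
  shows "X \<in> A"
proof -
  have eu: "eu p q \<in> A" if pq: "p \<in> I" "q \<in> I" for p q
  proof -
    let ?B = "unit_fun ` (I - {q}) :: 'i cvec set"
    have fB: "finite (I - {q})" using fin by simp
    have nin: "unit_fun q \<notin> fspan ?B"
      unfolding funs_on_eq_span[OF fB, symmetric] by (auto simp: funs_on_def lookup_single)
    have BI: "?B \<subseteq> funs_on I" by (auto intro!: unit_in_funs_on)
    have "\<exists>a\<in>A. (\<forall>b\<in>?B. app a b = 0) \<and> app a (unit_fun q) \<noteq> 0"
      by (rule density[OF finite_imageI[OF fB] BI unit_in_funs_on[OF pq(2)] nin])
    then obtain a where a: "a \<in> A" "\<forall>b\<in>?B. app a b = 0" "app a (unit_fun q) \<noteq> 0"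
      by (elim bexE conjE)
    let ?W = "(\<lambda>c. app c (app a (unit_fun q))) ` A"
    have "?W \<subseteq> {0} \<or> ?W = funs_on I"
    proof (rule irr)
      show "fsubspace ?W" by (rule fsubspace_orbit[OF add_A smul_A]) (use a in auto)
      show "?W \<subseteq> funs_on I" using app_in_funs_on on_A by blast
      show "app c w \<in> ?W" if cA: "c \<in> A" and w: "w \<in> ?W" for c w
      proof -
        obtain d where "d \<in> A" "w = app d (app a (unit_fun q))" using w by blast
        then show ?thesis by (intro rev_image_eqI[OF mult_A[OF cA]]) (simp_all add: app_mult)
      qed
    qed
    then have "?W = funs_on I"
    proof (rule disjE)
      assume W: "?W \<subseteq> {0}"
      have "app (diag I) (app a (unit_fun q)) \<in> {0}" by (rule subsetD[OF W]) (rule imageI[OF one_A])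
      then show ?thesis
        using a(3) app_diag_funs_on[OF fin app_in_funs_on[OF on_A[OF a(1)]]] by simp
    qed
    then have "unit_fun p \<in> ?W" using unit_in_funs_on[OF pq(1)] by simp
    then obtain c where c: "c \<in> A" "app c (app a (unit_fun q)) = unit_fun p" by (elim imageE) simp
    have ca: "c * a \<in> A" by (rule mult_A[OF c(1) a(1)])
    have "c * a = eu p q"
    proof (rule fmat_eqI)
      fix r s
      consider "s = q" | "s \<in> I - {q}" | "s \<notin> I" "s \<noteq> q" using pq(2) by blast
      then show "ent (c * a) r s = ent (eu p q) r s"
      proof cases
        case 1
        then show ?thesis
          using lookup_app_unit[of "c * a" q r] unfolding app_mult c(2) by (auto simp: ent_eu lookup_single when_def)
      next
        case 2
        then show ?thesis
          using lookup_app_unit[of "c * a" s r] a(2) by (simp add: app_mult ent_eu)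
      next
        case 3
        then show ?thesis using on_ent(2)[OF on_A[OF ca]] by (simp add: ent_eu)
      qed
    qed
    then show ?thesis using ca by simp
  qed
  have A_sum: "(\<Sum>k\<in>K. f k) \<in> A" if "\<And>k. k \<in> K \<Longrightarrow> f k \<in> A" for f :: "'i \<times> 'i \<Rightarrow> ('i, complex) fmat" and K :: "('i \<times> 'i) set"
    using that
  proof (induction K rule: infinite_finite_induct)
    case (insert k K)
    then show ?case by (simp add: add_A)
  qed (use smul_A[OF one_A, of 0] in simp_all)
  have "X = (\<Sum>k\<in>I \<times> I. smul (ent X (fst k) (snd k)) (eu (fst k) (snd k)))"
  proof (rule fmat_eqI)
    fix p q
    have "(\<Sum>k\<in>I \<times> I. ent X (fst k) (snd k) * ent (eu (fst k) (snd k)) p q) =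
        (\<Sum>k\<in>I \<times> I. if k = (p, q) then ent X p q else 0)"
      by (rule sum.cong[OF refl]) (auto simp: ent_eu)
    also have "\<dots> = ent X p q" using fin on_ent[OF X] by auto
    finally show "ent X p q = ent (\<Sum>k\<in>I \<times> I. smul (ent X (fst k) (snd k)) (eu (fst k) (snd k))) p q"
      by (simp add: ent_sum)
  qed
  moreover have "(\<Sum>k\<in>I \<times> I. smul (ent X (fst k) (snd k)) (eu (fst k) (snd k))) \<in> A"
    by (rule A_sum) (auto intro!: smul_A eu)
  ultimately show ?thesis by simp
qed

end

text \<open>Elements of the path algebra are represented by terms; in \<open>sig\<close> below the letters are the
  idempotents of the vertices and the arrows.\<close>

datatype 'l nct = Gen 'l | Cst complex | Add "'l nct" "'l nct" | Mul "'l nct" "'l nct"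

text \<open>The map \<open>k\<close> embeds the constants, so that one term has values both over the
  complex numbers and over a polynomial ring; this is what relates the trace of a generic matrix to
  its values.\<close>

primrec nev :: "'i set \<Rightarrow> (complex \<Rightarrow> 'r) \<Rightarrow> ('l \<Rightarrow> ('i, 'r::comm_ring_1) fmat) \<Rightarrow> 'l nct \<Rightarrow> ('i, 'r) fmat" where
  "nev I k \<sigma> (Gen l) = \<sigma> l"
| "nev I k \<sigma> (Cst c) = smul (k c) (diag I)"
| "nev I k \<sigma> (Add s t) = nev I k \<sigma> s + nev I k \<sigma> t"
| "nev I k \<sigma> (Mul s t) = nev I k \<sigma> s * nev I k \<sigma> t"

context comm_ring_map
begin

lemma map_fm_add: "map_fm h (X + Y) = map_fm h X + map_fm h Y"
  by (rule fmat_eqI) (simp add: ent_map_fm h_0 h_add)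

lemma map_fm_smul: "map_fm h (smul c X) = smul (h c) (map_fm h X)"
  by (rule fmat_eqI) (simp add: ent_map_fm h_0 h_mult)

lemma map_fm_nev: "finite I \<Longrightarrow> map_fm h (nev I k \<sigma> t) = nev I (\<lambda>c. h (k c)) (\<lambda>l. map_fm h (\<sigma> l)) t"
  by (induction t) (simp_all add: map_fm_add map_fm_mult map_fm_smul map_fm_diag)

end

section \<open>The action of the path algebra on a representation\<close>

context quiver_dim
begin

definition sig :: "('b \<Rightarrow> ('v \<times> nat, 'r::comm_ring_1) fmat) \<Rightarrow> 'v + 'b \<Rightarrow> ('v \<times> nat, 'r) fmat" where
  "sig X l = (case l of Inl v \<Rightarrow> if v \<in> verts R then diag (cell v) else 0 | Inr b \<Rightarrow> if b \<in> arcs R then X b else 0)"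

lemma sig_on: "X \<in> reps \<Longrightarrow> on I (sig X l)"
  by (cases l) (simp_all add: sig_def reps_on cell_subset_I)

lemma nev_on: "X \<in> reps \<Longrightarrow> on I (nev I k (sig X) t)"
  by (induction t) (simp_all add: sig_on on_mult)

lemma nev_scale: "X \<in> reps \<Longrightarrow> nev I k (sig X) (Mul (Cst c) t) = smul (k c) (nev I k (sig X) t)"
  by (simp only: nev.simps smul_mult_left on_diag_left[OF finite_I nev_on])

lemma sig_cong: "(\<And>b. b \<in> arcs R \<Longrightarrow> X b = Y b) \<Longrightarrow> sig X = sig Y"
  by (rule ext) (simp add: sig_def split: sum.split)

lemma gl_commute_cell: "\<theta> \<in> gl \<Longrightarrow> \<theta> * diag (cell v) = diag (cell v) * \<theta>"
proof (rule fmat_eqI)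
  fix p q assume "\<theta> \<in> gl"
  then show "ent (\<theta> * diag (cell v)) p q = ent (diag (cell v) * \<theta>) p q"
    using gl_ent_cell[of \<theta> p q v] by auto
qed

lemma nev_conj:
  assumes \<theta>: "\<theta> \<in> gl" "\<theta>' \<in> gl" "\<theta>' * \<theta> = diag I" "\<theta> * \<theta>' = diag I" and X: "X \<in> reps"
  shows "nev I k (sig (\<lambda>b. \<theta> * X b * \<theta>')) t = \<theta> * nev I k (sig X) t * \<theta>'"
proof (induction t)
  case (Gen l)
  show ?case
  proof (cases l)
    case (Inl v)
    have "\<theta> * diag (cell v) * \<theta>' = diag (cell v) * (\<theta> * \<theta>')"
      by (simp only: gl_commute_cell[OF \<theta>(1)] mult.assoc)
    then have "v \<in> verts R \<Longrightarrow> \<theta> * diag (cell v) * \<theta>' = diag (cell v)"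
      unfolding \<theta>(4) using on_diag[OF finite_I cell_subset_I] on_diag_right finite_I by metis
    then show ?thesis by (simp add: Inl sig_def)
  next
    case (Inr b)
    then show ?thesis by (simp add: sig_def)
  qed
next
  case (Cst c)
  have "\<theta> * smul (k c) (diag I) * \<theta>' = smul (k c) (\<theta> * diag I * \<theta>')"
    by (simp only: smul_mult_left smul_mult_right)
  then show ?case using \<theta>(4) gl_on[OF \<theta>(1)] by simp
next
  case (Add s t)
  then show ?case by (simp add: distrib_left distrib_right)
next
  case (Mul s t)
  have "\<theta> * nev I k (sig X) s * \<theta>' * (\<theta> * nev I k (sig X) t * \<theta>') =
      \<theta> * (nev I k (sig X) s * (\<theta>' * \<theta>)) * nev I k (sig X) t * \<theta>'" by (simp only: mult.assoc)
  also have "\<dots> = \<theta> * nev I k (sig X) s * nev I k (sig X) t * \<theta>'"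
    unfolding \<theta>(3) by (simp only: on_diag_right[OF finite_I nev_on[OF X]])
  finally show ?case using Mul by (simp add: mult.assoc)
qed

lemma nev_invariant:
  assumes X: "X \<in> reps" and W: "fsubspace W" "W \<subseteq> funs_on I"
    and inv: "\<And>b w. b \<in> arcs R \<Longrightarrow> w \<in> W \<Longrightarrow> app (X b) w \<in> W"
    and cell: "\<And>v w. v \<in> verts R \<Longrightarrow> w \<in> W \<Longrightarrow> app (diag (cell v)) w \<in> W"
    and w: "w \<in> W"
  shows "app (nev I id (sig X) t) w \<in> W"
  using w
proof (induction t arbitrary: w)
  case (Gen l)
  then show ?case using inv cell fs.subspace_0[OF W(1)] by (cases l) (simp_all add: sig_def)
next
  case (Cst c)
  have "app (diag I) w = w" using Cst W(2) by (intro app_diag_funs_on) auto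
  then show ?case using fs.subspace_scale[OF W(1) Cst] by (simp add: app_smul)
next
  case (Add s t)
  then show ?case by (simp add: app_add fs.subspace_add[OF W(1)])
next
  case (Mul s t)
  then show ?case by (simp add: app_mult)
qed

lemma nonempty_I: "v \<in> verts R \<Longrightarrow> \<alpha> v \<noteq> 0 \<Longrightarrow> I \<noteq> {}"
  by (auto simp: I_def)

lemma simple_rep_nonempty: 
  assumes "simple_rep R \<alpha> V"
  shows "I \<noteq> {}"
proof -
  have "\<not> zero_subrep R \<alpha> (\<lambda>v. carrier_vec (\<alpha> v))"
    using assms by (simp add: simple_rep_def simple_subrep_def)
  then obtain v where v: "v \<in> verts R" "carrier_vec (\<alpha> v) \<noteq> {0\<^sub>v (\<alpha> v) :: complex vec}"
    unfolding zero_subrep_def by blast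
  have "\<alpha> v \<noteq> 0"
  proof
    assume 0: "\<alpha> v = 0"
    have "carrier_vec (\<alpha> v) = {0\<^sub>v (\<alpha> v) :: complex vec}" unfolding 0 by auto
    then show False using v(2) by contradiction
  qed
  then show ?thesis using nonempty_I[OF v(1)] by simp
qed

text \<open>The letters are the vertex idempotents and the arrows, so a subspace stable under the
  values of all terms is graded and stable under the arrows, to which
  \<open>simple_invariant\<close> applies.\<close>

lemma simple_irreducible_algebra:
  assumes V: "V \<in> rep_space R \<alpha>" and simple: "simple_rep R \<alpha> V"
  shows "irreducible_algebra I (range (nev I id (sig (blk V))))"
proof
  let ?e = "nev I id (sig (blk V))"
  show "finite I" by simp
  show "I \<noteq> {}" by (rule simple_rep_nonempty[OF simple])
  show "on I a" if "a \<in> range ?e" for a using that nev_on[OF blk_reps] by auto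
  have "?e (Cst 1) = diag I" by simp
  then show "diag I \<in> range ?e" by (metis rangeI)
  fix a b assume "a \<in> range ?e" "b \<in> range ?e"
  then obtain s t where st: "a = ?e s" "b = ?e t" by blast
  have "?e (Add s t) = a + b" "?e (Mul s t) = a * b" by (simp_all add: st)
  then show "a + b \<in> range ?e" "a * b \<in> range ?e" by (metis rangeI)+
next
  let ?e = "nev I id (sig (blk V))"
  fix a c assume "a \<in> range ?e"
  then obtain s where s: "a = ?e s" by blast
  have "smul c a = ?e (Mul (Cst c) s)"
    by (simp only: nev_scale[OF blk_reps] s id_apply)
  then show "smul c a \<in> range ?e" by (rule range_eqI)
next
  let ?e = "nev I id (sig (blk V))"
  fix W :: "('v \<times> nat) cvec set"
  assume W: "fsubspace W" "W \<subseteq> funs_on I" and inv: "\<And>a w. a \<in> range ?e \<Longrightarrow> w \<in> W \<Longrightarrow> app a w \<in> W"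
  have "W \<inter> funs_on I \<subseteq> {0} \<or> funs_on I \<subseteq> W"
  proof (rule simple_invariant[OF V simple W(1)])
    show "app (blk V b) w \<in> W" if "b \<in> arcs R" "w \<in> W" for b w
      using inv[of "?e (Gen (Inr b))", OF rangeI that(2)] that(1) by (simp add: sig_def)
    show "app (diag (cell v)) w \<in> W" if "v \<in> verts R" "w \<in> W" for v w
      using inv[of "?e (Gen (Inl v))", OF rangeI that(2)] that(1) by (simp add: sig_def)
  qed
  then show "W \<subseteq> {0} \<or> W = funs_on I" using W(2) by blast
qed

text \<open>To a subrepresentation \<open>U\<close> belongs the invariant subspace of those vectors
  all of whose vertex components lie in \<open>U\<close>; it determines \<open>U\<close>.\<close>

lemma simple_if_irreducible:
  assumes V: "V \<in> rep_space R \<alpha>" and ne: "I \<noteq> {}"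
    and irr: "\<And>W. fsubspace W \<Longrightarrow> W \<subseteq> funs_on I \<Longrightarrow>
      (\<And>b w. b \<in> arcs R \<Longrightarrow> w \<in> W \<Longrightarrow> app (blk V b) w \<in> W) \<Longrightarrow>
      (\<And>v w. v \<in> verts R \<Longrightarrow> w \<in> W \<Longrightarrow> app (diag (cell v)) w \<in> W) \<Longrightarrow> W \<subseteq> {0} \<or> W = funs_on I"
  shows "simple_rep R \<alpha> V"
  unfolding simple_rep_def simple_subrep_def
proof (intro conjI allI impI)
  show "subrep R \<alpha> V (\<lambda>v. carrier_vec (\<alpha> v))"
  proof -
    have "V b *\<^sub>v x \<in> carrier_vec (\<alpha> (head R b))" if "b \<in> arcs R" "x \<in> carrier_vec (\<alpha> (tail R b))" for b x
      by (rule mult_mat_vec_carrier[OF rep_space_carrier[OF V that(1)] that(2)])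
    then show ?thesis unfolding subrep_iff by simp
  qed
  show "\<not> zero_subrep R \<alpha> (\<lambda>v. carrier_vec (\<alpha> v))"
  proof
    assume z: "zero_subrep R \<alpha> (\<lambda>v. carrier_vec (\<alpha> v))"
    obtain p where p: "p \<in> I" using ne by blast
    then have v: "fst p \<in> verts R" "snd p < \<alpha> (fst p)" by (auto simp: I_def)
    have "unit_vec (\<alpha> (fst p)) (snd p) \<in> {0\<^sub>v (\<alpha> (fst p)) :: complex vec}"
      unfolding bspec[OF z[unfolded zero_subrep_def] v(1), symmetric] by (rule unit_vec_carrier)
    then have "unit_vec (\<alpha> (fst p)) (snd p) = (0\<^sub>v (\<alpha> (fst p)) :: complex vec)" by (rule singletonD)
    then have "(unit_vec (\<alpha> (fst p)) (snd p) :: complex vec) $ snd p = 0" using v(2) by simp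
    then show False using v(2) by simp
  qed
next
  fix U assume "subrep R \<alpha> V U \<and> (\<forall>v\<in>verts R. U v \<subseteq> carrier_vec (\<alpha> v))"
  then have U: "subrep R \<alpha> V U" by blast
  note U' = U[unfolded subrep_iff]
  note U1 = bspec[OF conjunct1[OF U']]
  have U0: "0\<^sub>v (\<alpha> v) \<in> U v" if "v \<in> verts R" for v using U1[OF that] by simp
  have Uadd: "x + y \<in> U v" if "v \<in> verts R" "x \<in> U v" "y \<in> U v" for v x y using U1[OF that(1)] that(2,3) by simp
  have Usmult: "c \<cdot>\<^sub>v x \<in> U v" if "v \<in> verts R" "x \<in> U v" for v x c using U1[OF that(1)] that(2) by simp
  have Uc: "U v \<subseteq> carrier_vec (\<alpha> v)" if "v \<in> verts R" for v using U1[OF that] by simp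
  have Uinv: "V b *\<^sub>v x \<in> U (head R b)" if "b \<in> arcs R" "x \<in> U (tail R b)" for b x
    using conjunct2[OF U'] that by simp
  have unemb_add: "unemb v (u + w) = unemb v u + unemb v w" for v u w
    by (rule eq_vecI) (simp_all add: unemb_def lookup_add)
  have unemb_scale: "unemb v (fscale c u) = c \<cdot>\<^sub>v unemb v u" for v c u
    by (rule eq_vecI) (simp_all add: unemb_def)
  have unemb_0: "unemb v 0 = 0\<^sub>v (\<alpha> v)" for v
    by (rule eq_vecI) (simp_all add: unemb_def)
  have unemb_other: "unemb v (emb w x) = 0\<^sub>v (\<alpha> v)" if "v \<noteq> w" for v w x
    by (rule eq_vecI) (use that in \<open>simp_all add: unemb_def lookup_emb cell_def\<close>)
  have diag_emb: "app (diag (cell v)) w = emb v (unemb v w)" for v w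
    by (rule poly_mapping_eqI) (auto simp: app_diag lookup_emb unemb_def cell_def)
  let ?W = "{u \<in> funs_on I. \<forall>v\<in>verts R. unemb v u \<in> U v}"
  have "?W \<subseteq> {0} \<or> ?W = funs_on I"
  proof (rule irr)
    show "fsubspace ?W"
      using fs.subspace_0[OF fsubspace_funs_on[of I]]
      by (intro fs.subspaceI) (simp_all add: unemb_add unemb_scale unemb_0 U0 Uadd Usmult)
    show "?W \<subseteq> funs_on I" by blast
  next
    fix b w assume b: "b \<in> arcs R" and w: "w \<in> ?W"
    have hv: "head R b \<in> verts R" "tail R b \<in> verts R" using b by auto
    have "blk V b * diag (cell (tail R b)) = blk V b" by (rule fmat_eqI) (simp add: ent_blk[OF b])
    then have "app (blk V b) w = app (blk V b) (app (diag (cell (tail R b))) w)"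
      by (simp only: app_mult[symmetric])
    then have eq: "app (blk V b) w = emb (head R b) (V b *\<^sub>v unemb (tail R b) w)"
      by (simp only: diag_emb app_blk_emb[OF V b unemb_carrier])
    have Vw: "V b *\<^sub>v unemb (tail R b) w \<in> U (head R b)" using Uinv[OF b] w hv by blast
    have "app (blk V b) w \<in> funs_on I" by (rule app_in_funs_on[OF reps_on[OF blk_reps b]])
    moreover have "unemb v (app (blk V b) w) \<in> U v" if v: "v \<in> verts R" for v
    proof (cases "v = head R b")
      case True
      then show ?thesis using Vw Uc[OF hv(1)] unemb_emb[of "V b *\<^sub>v unemb (tail R b) w" v] by (auto simp: eq)
    next
      case False
      then show ?thesis using U0[OF v] by (simp add: eq unemb_other)
    qed
    ultimately show "app (blk V b) w \<in> ?W" by blast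
  next
    fix v w assume v: "v \<in> verts R" and w: "w \<in> ?W"
    have "app (diag (cell v)) w \<in> funs_on I" by (rule app_in_funs_on) (simp add: cell_subset_I[OF v])
    moreover have "unemb v' (app (diag (cell v)) w) \<in> U v'" if v': "v' \<in> verts R" for v'
    proof (cases "v' = v")
      case True
      then show ?thesis using w v by (simp add: diag_emb unemb_emb)
    next
      case False
      then show ?thesis using U0[OF v'] by (simp add: diag_emb unemb_other)
    qed
    ultimately show "app (diag (cell v)) w \<in> ?W" by blast
  qed
  moreover have emb_W: "emb v x \<in> funs_on I" if "v \<in> verts R" for v x
    by (rule funs_on_mono[OF cell_subset_I[OF that] emb_funs_on])
  ultimately show "zero_subrep R \<alpha> U \<or> (\<forall>v\<in>verts R. U v = carrier_vec (\<alpha> v))"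
  proof (elim disjE)
    assume W0: "?W \<subseteq> {0}"
    have "U v = {0\<^sub>v (\<alpha> v)}" if v: "v \<in> verts R" for v
    proof -
      have "x = 0\<^sub>v (\<alpha> v)" if x: "x \<in> U v" for x
      proof -
        have xc: "x \<in> carrier_vec (\<alpha> v)" using x Uc[OF v] by blast
        have "unemb v' (emb v x) \<in> U v'" if "v' \<in> verts R" for v'
          using U0[OF that] x unemb_emb[OF xc] unemb_other[of v' v x] by (cases "v' = v") simp_all
        then have "emb v x \<in> ?W" using emb_W[OF v] by blast
        then have "emb v x \<in> {0}" by (rule subsetD[OF W0])
        then have "emb v x = emb v (0\<^sub>v (\<alpha> v))" by (simp add: emb_0)
        then show ?thesis using emb_eq_iff[OF xc] by simp
      qed
      then show ?thesis using U0[OF v] by blast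
    qed
    then show ?thesis unfolding zero_subrep_def by blast
  next
    assume W: "?W = funs_on I"
    have "U v = carrier_vec (\<alpha> v)" if v: "v \<in> verts R" for v
    proof -
      have "x \<in> U v" if x: "x \<in> carrier_vec (\<alpha> v)" for x
      proof -
        have "emb v x \<in> ?W" by (rule subsetD[OF equalityD2[OF W] emb_W[OF v]])
        then have "unemb v (emb v x) \<in> U v" using v by simp
        then show ?thesis by (simp only: unemb_emb[OF x])
      qed
      then show ?thesis using Uc[OF v] by blast
    qed
    then show ?thesis by blast
  qed
qed

text \<open>The trace form of the path algebra is nondegenerate on the matrix units of a simple
  representation; equality of traces makes the elements representing them independent on \<open>V\<close>.\<close>

lemma simple_if_same_traces:
  assumes V: "V \<in> rep_space R \<alpha>" and M: "M \<in> rep_space R \<alpha>" and simple: "simple_rep R \<alpha> M"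
    and traces: "\<And>t. tr (nev I id (sig (blk V)) t) = tr (nev I id (sig (blk M)) t)"
  shows "simple_rep R \<alpha> V"
proof -
  interpret irreducible_algebra I "range (nev I id (sig (blk M)))"
    by (rule simple_irreducible_algebra[OF M simple])
  let ?eV = "nev I id (sig (blk V))" and ?eM = "nev I id (sig (blk M))"
  \<comment> \<open>Burnside's theorem for \<open>M\<close>: some terms take the matrix units as
    values there.\<close>
  have "\<exists>s. ?eM s = eu p q" if "p \<in> I" "q \<in> I" for p q
    using burnside[OF on_eu[OF that]] by (metis imageE)
  then have "\<forall>k\<in>I \<times> I. \<exists>s. ?eM s = eu (fst k) (snd k)" by simp
  then obtain s where s: "\<forall>k\<in>I \<times> I. ?eM (s k) = eu (fst k) (snd k)" by (rule bchoice[THEN exE])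
  define fvec where "fvec X = vec_on (I \<times> I) (\<lambda>k. ent X (fst k) (snd k))" for X :: "('v \<times> nat, complex) fmat"
  have lf: "Poly_Mapping.lookup (fvec X) k = (if k \<in> I \<times> I then ent X (fst k) (snd k) else 0)" for X k
    unfolding fvec_def by (rule lookup_vec_on) simp
  have fvec_add: "fvec (X + Y) = fvec X + fvec Y" for X Y
    by (rule poly_mapping_eqI) (simp add: lf lookup_add)
  have fvec_smul: "fvec (smul c X) = fscale c (fvec X)" for c X
    by (rule poly_mapping_eqI) (simp add: lf)
  have fvec_0: "fvec 0 = 0" by (rule poly_mapping_eqI) (simp add: lf)
  have fvec_sum: "fvec (\<Sum>k\<in>K. f k) = (\<Sum>k\<in>K. fvec (f k))" for f :: "('v \<times> nat) \<times> ('v \<times> nat) \<Rightarrow> _" and K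
    by (induction K rule: infinite_finite_induct) (simp_all add: fvec_0 fvec_add)
  have fvec_inj: "X = Y" if "on I X" "on I Y" "fvec X = fvec Y" for X Y
  proof (rule fmat_eqI)
    fix p q
    show "ent X p q = ent Y p q"
    proof (cases "p \<in> I \<and> q \<in> I")
      case True
      then show ?thesis using lf[of X "(p, q)"] lf[of Y "(p, q)"] that(3) by simp
    next
      case False
      then show ?thesis using on_ent[OF that(1)] on_ent[OF that(2)] by metis
    qed
  qed
  let ?h = "\<lambda>k. fvec (?eV (s k))"
  have "inj_on ?h (I \<times> I) \<and> \<not> fdependent (?h ` (I \<times> I))"
  proof (rule independent_family)
    show "finite (I \<times> I)" by simp
    fix c :: "('v \<times> nat) \<times> ('v \<times> nat) \<Rightarrow> complex"
    assume sum0: "(\<Sum>k\<in>I \<times> I. fscale (c k) (?h k)) = 0"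
    define Z where "Z = (\<Sum>k\<in>I \<times> I. smul (c k) (?eV (s k)))"
    have "fvec Z = fvec 0" using sum0 by (simp add: Z_def fvec_sum fvec_smul fvec_0)
    moreover have "on I Z" unfolding Z_def by (rule on_sum) (simp add: nev_on[OF blk_reps])
    ultimately have Z: "Z = 0" by (intro fvec_inj) simp_all
    show "\<forall>k\<in>I \<times> I. c k = 0"
    proof
      fix l assume l: "l \<in> I \<times> I"
      \<comment> \<open>The trace form pairs the matrix unit at (p, q) with the one at (q, p) to 1
        and with all others to 0, so multiplying a relation by the term of transposed index isolates
        one coefficient.\<close>
      define l' where "l' = (snd l, fst l)"
      have l': "l' \<in> I \<times> I" using l by (auto simp: l'_def)
      have "tr (?eV (s k) * ?eV (s l')) = (if k = l then 1 else 0)" if k: "k \<in> I \<times> I" for k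
      proof -
        have "tr (?eV (s k) * ?eV (s l')) = tr (?eM (s k) * ?eM (s l'))"
          using traces[of "Mul (s k) (s l')"] by simp
        also have "\<dots> = (if k = l then 1 else 0)"
          using bspec[OF s k] bspec[OF s l'] by (auto simp: tr_eu_mult ent_eu l'_def prod_eq_iff)
        finally show ?thesis .
      qed
      then have "tr (Z * ?eV (s l')) = (\<Sum>k\<in>I \<times> I. c k * (if k = l then 1 else 0))"
        unfolding Z_def sum_distrib_right tr_sum smul_mult_left tr_smul by (intro sum.cong) simp_all
      also have "\<dots> = (\<Sum>k\<in>I \<times> I. if k = l then c k else 0)" by (intro sum.cong) simp_all
      also have "\<dots> = c l" using l by (simp add: sum.delta)
      finally show "c l = 0" by (simp add: Z)
    qed
  qed
  then have inj: "inj_on ?h (I \<times> I)" and ind: "\<not> fdependent (?h ` (I \<times> I))" by blast+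
  \<comment> \<open>There are |I|^2 independent values, so the path algebra acts on \<open>V\<close>
    through all matrices on \<open>I\<close>.\<close>
  have span: "fspan (?h ` (I \<times> I)) = funs_on (I \<times> I)"
  proof (rule independent_spanning)
    show "?h ` (I \<times> I) \<subseteq> funs_on (I \<times> I)" by (auto simp: fvec_def)
    show "card (?h ` (I \<times> I)) = card (I \<times> I)" by (rule card_image[OF inj])
  qed (simp, rule ind)
  have "funs_on (I \<times> I) \<subseteq> range (\<lambda>t. fvec (?eV t))"
    unfolding span[symmetric]
  proof (rule fs.span_minimal)
    show "?h ` (I \<times> I) \<subseteq> range (\<lambda>t. fvec (?eV t))" by blast
    show "fsubspace (range (\<lambda>t. fvec (?eV t)))"
    proof (rule fs.subspaceI)
      have "fvec (?eV (Cst 0)) = 0" by (simp add: fvec_0)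
      then show "0 \<in> range (\<lambda>t. fvec (?eV t))" by (metis rangeI)
    next
      fix x y assume "x \<in> range (\<lambda>t. fvec (?eV t))" "y \<in> range (\<lambda>t. fvec (?eV t))"
      then obtain a b where "x = fvec (?eV a)" "y = fvec (?eV b)" by blast
      then have "x + y = fvec (?eV (Add a b))" by (simp add: fvec_add)
      then show "x + y \<in> range (\<lambda>t. fvec (?eV t))" by blast
    next
      fix c x assume "x \<in> range (\<lambda>t. fvec (?eV t))"
      then obtain a where "x = fvec (?eV a)" by blast
      then have "fscale c x = fvec (?eV (Mul (Cst c) a))"
        by (simp only: nev_scale[OF blk_reps] fvec_smul id_apply)
      then show "fscale c x \<in> range (\<lambda>t. fvec (?eV t))" by blast
    qed
  qed
  then have all: "\<exists>t. ?eV t = X" if "on I X" for X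
  proof -
    have "fvec X \<in> funs_on (I \<times> I)" by (simp add: fvec_def)
    then obtain t where "fvec X = fvec (?eV t)"
      using \<open>funs_on (I \<times> I) \<subseteq> range (\<lambda>t. fvec (?eV t))\<close> by blast
    then have "X = ?eV t" by (rule fvec_inj[OF that nev_on[OF blk_reps]])
    then show ?thesis by blast
  qed
  show ?thesis
  proof (rule simple_if_irreducible[OF V ne])
    fix W :: "('v \<times> nat) cvec set"
    assume W: "fsubspace W" "W \<subseteq> funs_on I"
      and inv: "\<And>b w. b \<in> arcs R \<Longrightarrow> w \<in> W \<Longrightarrow> app (blk V b) w \<in> W"
        "\<And>v w. v \<in> verts R \<Longrightarrow> w \<in> W \<Longrightarrow> app (diag (cell v)) w \<in> W"
    have stable: "app X w \<in> W" if X: "on I X" and w: "w \<in> W" for X w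
    proof -
      obtain t where t: "?eV t = X" using all[OF X] by (elim exE)
      show ?thesis unfolding t[symmetric] by (rule nev_invariant[OF blk_reps W inv w])
    qed
    show "W \<subseteq> {0} \<or> W = funs_on I"
    proof (rule disjCI)
      assume "W \<noteq> funs_on I"
      then obtain u where u: "u \<in> funs_on I" "u \<notin> W" using W(2) by blast
      show "W \<subseteq> {0}"
      proof
        fix w assume w: "w \<in> W"
        show "w \<in> {0}"
        proof (rule ccontr)
          assume "w \<notin> {0}"
          then have "w \<noteq> 0" by simp
          then obtain q where q: "Poly_Mapping.lookup w q \<noteq> 0" by (metis poly_mapping_eqI lookup_zero)
          have "w \<in> funs_on I" using w W(2) by blast
          from funs_onD[OF this, of q] q have qI: "q \<in> I" by blast
          have unit: "unit_fun p \<in> W" if p: "p \<in> I" for p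
          proof -
            \<comment> \<open>Since all matrices on \<open>I\<close> occur, a single nonzero
              coordinate of \<open>w\<close> suffices to reach every unit vector.\<close>
            let ?X = "smul (1 / Poly_Mapping.lookup w q) (eu p q)"
            have "app ?X w = unit_fun p"
            proof (rule poly_mapping_eqI)
              fix r
              have "Poly_Mapping.lookup (app (eu p q) w) r = (\<Sum>x\<in>{q}. ent (eu p q) r x * Poly_Mapping.lookup w x)"
                by (rule lookup_app_on) (auto simp: ent_eu)
              then show "Poly_Mapping.lookup (app ?X w) r = Poly_Mapping.lookup (unit_fun p) r"
                using q by (simp add: app_smul ent_eu lookup_single when_def)
            qed
            then show ?thesis using stable[of ?X, OF on_smul[OF on_eu[OF p qI]] w] by simp
          qed
          have "u = (\<Sum>k\<in>I. fscale (Poly_Mapping.lookup u k) (unit_fun k))"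
            by (rule funs_on_expand[OF finite_I u(1)])
          also have "\<dots> \<in> W" by (intro fs.subspace_sum[OF W(1)] fs.subspace_scale[OF W(1)] unit)
          finally show False using u(2) by simp
        qed
      qed
    qed
  qed
qed

end

section \<open>The moment map\<close>

lemma double_quiver_simps [simp]:
  "verts (double_quiver Q) = verts Q"
  "arcs (double_quiver Q) = Inl ` arcs Q \<union> Inr ` arcs Q"
  "head (double_quiver Q) (Inl a) = head Q a" "tail (double_quiver Q) (Inl a) = tail Q a"
  "head (double_quiver Q) (Inr a) = tail Q a" "tail (double_quiver Q) (Inr a) = head Q a"
  by (simp_all add: double_quiver_def)

lemma (in fin_digraph) fin_digraph_double: "fin_digraph (double_quiver G)"
  by unfold_locales auto

locale preproj = base: fin_digraph Q for Q :: "('v, 'a) pre_digraph" +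
  fixes \<alpha> :: "'v \<Rightarrow> nat"

sublocale preproj \<subseteq> quiver_dim "double_quiver Q" \<alpha>
  by (rule quiver_dim.intro) (rule base.fin_digraph_double)

context preproj
begin

definition mu :: "('a + 'a \<Rightarrow> ('v \<times> nat, 'r::comm_ring_1) fmat) \<Rightarrow> ('v \<times> nat, 'r) fmat" where
  "mu X = (\<Sum>a\<in>arcs Q. X (Inl a) * X (Inr a) - X (Inr a) * X (Inl a))"

text \<open>The differential of \<open>mu\<close> at \<open>X\<close>, applied to \<open>Y\<close>.
  As \<open>mu\<close> is a quadratic map, this is also its polarisation, symmetric in the two
  arguments.\<close>

definition dmu :: "('a + 'a \<Rightarrow> ('v \<times> nat, 'r::comm_ring_1) fmat) \<Rightarrow> ('a + 'a \<Rightarrow> ('v \<times> nat, 'r) fmat) \<Rightarrow> ('v \<times> nat, 'r) fmat" where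
  "dmu X Y = (\<Sum>a\<in>arcs Q. X (Inl a) * Y (Inr a) + Y (Inl a) * X (Inr a) - X (Inr a) * Y (Inl a) - Y (Inr a) * X (Inl a))"

definition omega :: "('a + 'a \<Rightarrow> ('v \<times> nat, 'r::comm_ring_1) fmat) \<Rightarrow> ('a + 'a \<Rightarrow> ('v \<times> nat, 'r) fmat) \<Rightarrow> 'r" where
  "omega Y Z = (\<Sum>a\<in>arcs Q. tr (Y (Inl a) * Z (Inr a)) - tr (Y (Inr a) * Z (Inl a)))"

lemma tr_cyclic: "tr (A * B * C) = tr (C * A * B)"
  using tr_mult_comm[of "A * B" C] by (simp only: mult.assoc)

lemma tr_dmu: "tr (\<theta> * dmu X Y) = omega (commr \<theta> X) Y"
proof -
  have "tr (\<theta> * (X (Inl a) * Y (Inr a) + Y (Inl a) * X (Inr a) - X (Inr a) * Y (Inl a) - Y (Inr a) * X (Inl a))) =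
      tr (commr \<theta> X (Inl a) * Y (Inr a)) - tr (commr \<theta> X (Inr a) * Y (Inl a))" for a
  proof -
    have 1: "tr (\<theta> * (Y (Inl a) * X (Inr a))) = tr (X (Inr a) * \<theta> * Y (Inl a))"
      using tr_cyclic[of \<theta> "Y (Inl a)" "X (Inr a)"] by (simp only: mult.assoc)
    have 2: "tr (\<theta> * (Y (Inr a) * X (Inl a))) = tr (X (Inl a) * \<theta> * Y (Inr a))"
      using tr_cyclic[of \<theta> "Y (Inr a)" "X (Inl a)"] by (simp only: mult.assoc)
    show ?thesis
      unfolding commr_def distrib_left right_diff_distrib left_diff_distrib tr_add tr_diff 1 2
      by (simp add: mult.assoc)
  qed
  then show ?thesis by (simp add: dmu_def omega_def sum_distrib_left tr_sum)
qed

lemma mu_add: "mu (\<lambda>b. Y b + Z b) = mu Y + mu Z + dmu Y Z"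
  unfolding mu_def dmu_def sum.distrib[symmetric] by (rule sum.cong) (simp_all add: algebra_simps)

lemma dmu_add: "dmu X (\<lambda>b. Y b + Z b) = dmu X Y + dmu X Z"
  unfolding dmu_def sum.distrib[symmetric] by (rule sum.cong) (simp_all add: algebra_simps)

lemma smul_sum: "smul c (\<Sum>a\<in>A. f a) = (\<Sum>a\<in>A. smul c (f a))"
  by (rule fmat_eqI) (simp add: ent_sum sum_distrib_left)

lemma dmu_smul: "dmu X (\<lambda>b. smul c (Y b)) = smul c (dmu X Y)"
  unfolding dmu_def smul_sum by (rule sum.cong) (simp_all add: smul_mult_left smul_mult_right smul_add smul_diff)

lemma arc_product_gl:
  assumes "X \<in> reps" "Y \<in> reps" "a \<in> arcs Q"
  shows "X (Inl a) * Y (Inr a) \<in> gl" "X (Inr a) * Y (Inl a) \<in> gl"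
proof -
  have b: "Inl a \<in> arcs (double_quiver Q)" "Inr a \<in> arcs (double_quiver Q)" using assms(3) by auto
  have on: "on I (X (Inl a))" "on I (Y (Inr a))" "on I (X (Inr a))" "on I (Y (Inl a))"
    using reps_on assms b by auto
  show "X (Inl a) * Y (Inr a) \<in> gl"
    unfolding gl_def mem_Collect_eq
  proof (intro allI impI)
    fix p q assume nz: "ent (X (Inl a) * Y (Inr a)) p q \<noteq> 0"
    then obtain r where "ent (X (Inl a)) p r \<noteq> 0" "ent (Y (Inr a)) r q \<noteq> 0" by (rule ent_mult_nonzero)
    then have "p \<in> cell (head Q a)" "q \<in> cell (head Q a)"
      using reps_ent[OF assms(1) b(1), of p r] reps_ent[OF assms(2) b(2), of r q] by auto
    then have "fst p = fst q" using in_cellD by metis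
    then show "p \<in> I \<and> q \<in> I \<and> fst p = fst q"
      using onD[OF on_mult[OF on(1,2)] nz] by simp
  qed
  show "X (Inr a) * Y (Inl a) \<in> gl"
    unfolding gl_def mem_Collect_eq
  proof (intro allI impI)
    fix p q assume nz: "ent (X (Inr a) * Y (Inl a)) p q \<noteq> 0"
    then obtain r where "ent (X (Inr a)) p r \<noteq> 0" "ent (Y (Inl a)) r q \<noteq> 0" by (rule ent_mult_nonzero)
    then have "p \<in> cell (tail Q a)" "q \<in> cell (tail Q a)"
      using reps_ent[OF assms(1) b(2), of p r] reps_ent[OF assms(2) b(1), of r q] by auto
    then have "fst p = fst q" using in_cellD by metis
    then show "p \<in> I \<and> q \<in> I \<and> fst p = fst q"
      using onD[OF on_mult[OF on(3,4)] nz] by simp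
  qed
qed

lemma mu_gl: "X \<in> reps \<Longrightarrow> mu X \<in> gl"
  unfolding mu_def by (intro gl_sum gl_diff arc_product_gl)

lemma dmu_gl: "X \<in> reps \<Longrightarrow> Y \<in> reps \<Longrightarrow> dmu X Y \<in> gl"
  unfolding dmu_def by (intro gl_sum gl_diff gl_add arc_product_gl)

section \<open>The moment map in coordinates\<close>

definition fm_of :: "(('a + 'a) coord \<Rightarrow> 'r) \<Rightarrow> 'a + 'a \<Rightarrow> ('v \<times> nat, 'r::comm_ring_1) fmat" where
  "fm_of x b = mat_on I (\<lambda>p q. if p \<in> cell (head (double_quiver Q) b) \<and> q \<in> cell (tail (double_quiver Q) b) then x (b, snd p, snd q) else 0)"

lemma ent_fm_of:
  "b \<in> arcs (double_quiver Q) \<Longrightarrow> ent (fm_of x b) p q =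
    (if p \<in> cell (head (double_quiver Q) b) \<and> q \<in> cell (tail (double_quiver Q) b) then x (b, snd p, snd q) else 0)"
  using cell_subset_I[OF head_in_verts, of b] cell_subset_I[OF tail_in_verts, of b]
  by (auto simp: fm_of_def ent_mat_on)

lemma fm_of_reps: "fm_of x \<in> reps"
  unfolding reps_def mem_Collect_eq by (intro ballI allI impI) (simp add: ent_fm_of split: if_splits)

lemma blk_eq_fm_of: "blk V = fm_of (coords_of V)"
  unfolding blk_def fm_of_def coords_of_def prod.case ..

text \<open>\<open>fm_of\<close> starts from a coordinate function, so that generic matrices, points
  and lines are the cases of variables, numbers and linear polynomials; ring homomorphisms pass from
  one to another.\<close>

lemma (in comm_ring_map) map_fm_fm_of:
  assumes "preproj Q" "b \<in> arcs (double_quiver Q)"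
  shows "map_fm h (preproj.fm_of Q \<alpha> x b) = preproj.fm_of Q \<alpha> (\<lambda>z. h (x z)) b"
proof -
  interpret preproj Q \<alpha> by (rule assms(1))
  show ?thesis by (rule fmat_eqI) (simp add: ent_map_fm h_0 ent_fm_of[OF assms(2)])
qed

text \<open>The entries of \<open>mu\<close> are polynomials with integer coefficients in the
  coordinates, and such expressions commute with every ring homomorphism.\<close>

lemma (in comm_ring_map) h_ent_mu:
  assumes "preproj Q"
  shows "h (ent (preproj.mu Q (preproj.fm_of Q \<alpha> x)) p q) = ent (preproj.mu Q (preproj.fm_of Q \<alpha> (\<lambda>z. h (x z)))) p q"
proof -
  interpret preproj Q \<alpha> by (rule assms(1))
  have "h (ent (fm_of x b * fm_of x c) p q) = ent (fm_of (\<lambda>z. h (x z)) b * fm_of (\<lambda>z. h (x z)) c) p q"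
    if "b \<in> arcs (double_quiver Q)" "c \<in> arcs (double_quiver Q)" for b c
  proof -
    have "h (ent (fm_of x b * fm_of x c) p q) = ent (map_fm h (fm_of x b * fm_of x c)) p q"
      by (simp add: ent_map_fm h_0)
    then show ?thesis
      by (simp only: map_fm_mult map_fm_fm_of[OF assms that(1)] map_fm_fm_of[OF assms that(2)])
  qed
  then show ?thesis
    by (simp add: mu_def ent_sum h_sum h_diff)
qed

lemma ent_mult_rep:
  assumes V: "\<And>b. b \<in> arcs (double_quiver Q) \<Longrightarrow> V b \<in> carrier_mat (\<alpha> (head (double_quiver Q) b)) (\<alpha> (tail (double_quiver Q) b))"
    and b: "b \<in> arcs (double_quiver Q)" "c \<in> arcs (double_quiver Q)" "tail (double_quiver Q) b = head (double_quiver Q) c"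
    and i: "i < \<alpha> v" "j < \<alpha> w"
  shows "ent (blk V b * blk V c) (v, i) (w, j) =
    (if v = head (double_quiver Q) b \<and> w = tail (double_quiver Q) c then (V b * V c) $$ (i, j) else 0)"
proof -
  let ?t = "tail (double_quiver Q) b"
  have "ent (blk V b * blk V c) (v, i) (w, j) = (\<Sum>r\<in>cell ?t. ent (blk V b) (v, i) r * ent (blk V c) r (w, j))"
    by (rule ent_mult_on) (auto simp: ent_blk[OF b(1)])
  also have "cell ?t = Pair ?t ` {..<\<alpha> ?t}" by (auto simp: cell_def)
  also have "(\<Sum>r\<in>Pair ?t ` {..<\<alpha> ?t}. ent (blk V b) (v, i) r * ent (blk V c) r (w, j)) =
      (\<Sum>k<\<alpha> ?t. ent (blk V b) (v, i) (?t, k) * ent (blk V c) (?t, k) (w, j))"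
    by (subst sum.reindex) (auto simp: inj_on_def)
  also have "\<dots> = (if v = head (double_quiver Q) b \<and> w = tail (double_quiver Q) c then (V b * V c) $$ (i, j) else 0)"
  proof (cases "v = head (double_quiver Q) b \<and> w = tail (double_quiver Q) c")
    case True
    then have "(V b * V c) $$ (i, j) = (\<Sum>k<\<alpha> ?t. V b $$ (i, k) * V c $$ (k, j))"
      using V[OF b(1)] V[OF b(2)] i b(3) by (auto simp: scalar_prod_def atLeast0LessThan)
    moreover have "ent (blk V b) (v, i) (?t, k) = V b $$ (i, k)" "ent (blk V c) (?t, k) (w, j) = V c $$ (k, j)" if "k < \<alpha> ?t" for k
      using True i that b(3) by (auto simp: ent_blk[OF b(1)] ent_blk[OF b(2)] cell_def)
    ultimately show ?thesis using True by simp
  next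
    case False
    have "ent (blk V b) (v, i) (?t, k) * ent (blk V c) (?t, k) (w, j) = 0" for k
      using False by (auto simp: ent_blk[OF b(1)] ent_blk[OF b(2)] cell_def)
    then show ?thesis by (simp only: False if_False sum.neutral_const)
  qed
  finally show ?thesis .
qed

lemma preproj_entry_eq:
  assumes V: "\<And>b. b \<in> arcs (double_quiver Q) \<Longrightarrow> V b \<in> carrier_mat (\<alpha> (head (double_quiver Q) b)) (\<alpha> (tail (double_quiver Q) b))"
    and i: "i < \<alpha> v" "j < \<alpha> v"
  shows "preproj_entry Q V v i j = ent (mu (blk V)) (v, i) (v, j)"
proof -
  have b: "Inl a \<in> arcs (double_quiver Q)" "Inr a \<in> arcs (double_quiver Q)" if "a \<in> arcs Q" for a
    using that by auto
  have r: "ent (blk V b * blk V c) (v, i) (v, j) =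
      (if v = head (double_quiver Q) b \<and> v = tail (double_quiver Q) c then (V b * V c) $$ (i, j) else 0)"
    if "b \<in> arcs (double_quiver Q)" "c \<in> arcs (double_quiver Q)" "tail (double_quiver Q) b = head (double_quiver Q) c" for b c
    by (rule ent_mult_rep) (use V that i in auto)
  have "(\<Sum>a\<in>arcs Q. ent (blk V (Inl a) * blk V (Inr a)) (v, i) (v, j)) =
      (\<Sum>a\<in>arcs Q. if head Q a = v then (V (Inl a) * V (Inr a)) $$ (i, j) else 0)"
    by (rule sum.cong[OF refl]) (auto simp: r)
  also have "\<dots> = (\<Sum>a\<in>{a\<in>arcs Q. head Q a = v}. (V (Inl a) * V (Inr a)) $$ (i, j))"
    by (rule sum.inter_filter[symmetric]) simp
  finally have 1: "(\<Sum>a\<in>arcs Q. ent (blk V (Inl a) * blk V (Inr a)) (v, i) (v, j)) =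
    (\<Sum>a\<in>{a\<in>arcs Q. head Q a = v}. (V (Inl a) * V (Inr a)) $$ (i, j))" .
  have "(\<Sum>a\<in>arcs Q. ent (blk V (Inr a) * blk V (Inl a)) (v, i) (v, j)) =
      (\<Sum>a\<in>arcs Q. if tail Q a = v then (V (Inr a) * V (Inl a)) $$ (i, j) else 0)"
    by (rule sum.cong[OF refl]) (auto simp: r)
  also have "\<dots> = (\<Sum>a\<in>{a\<in>arcs Q. tail Q a = v}. (V (Inr a) * V (Inl a)) $$ (i, j))"
    by (rule sum.inter_filter[symmetric]) simp
  finally have 2: "(\<Sum>a\<in>arcs Q. ent (blk V (Inr a) * blk V (Inl a)) (v, i) (v, j)) =
    (\<Sum>a\<in>{a\<in>arcs Q. tail Q a = v}. (V (Inr a) * V (Inl a)) $$ (i, j))" .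
  show ?thesis by (simp add: preproj_entry_def mu_def ent_sum sum_subtractf 1 2)
qed

lemma preproj_reps_iff:
  assumes V: "V \<in> rep_space (double_quiver Q) \<alpha>"
  shows "V \<in> preproj_reps Q \<alpha> \<longleftrightarrow> mu (blk V) = 0"
proof
  assume V': "V \<in> preproj_reps Q \<alpha>"
  have z: "ent (mu (blk V)) (v, i) (v, j) = 0" if "v \<in> verts Q" "i < \<alpha> v" "j < \<alpha> v" for v i j
    using preproj_entry_eq[where V = V and v = v and i = i and j = j, OF rep_space_carrier[OF V]] that V'
    unfolding preproj_reps_def by simp
  show "mu (blk V) = 0"
  proof (rule fmat_eqI, rule ccontr)
    fix p q assume "ent (mu (blk V)) p q \<noteq> ent 0 p q"
    then have nz: "ent (mu (blk V)) p q \<noteq> 0" by simp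
    from gl_ent[OF mu_gl[OF blk_reps] nz] have "p \<in> I" "q \<in> I" "fst p = fst q" by auto
    then show False using z[of "fst p" "snd p" "snd q"] nz by (cases p; cases q) (auto simp: I_def)
  qed
next
  assume "mu (blk V) = 0"
  then show "V \<in> preproj_reps Q \<alpha>"
    using preproj_entry_eq[OF rep_space_carrier[OF V]] V by (simp add: preproj_reps_def)
qed

text \<open>Indices of the entries of a matrix in \<open>gl\<close>, by vertex, row and column. They
  number the defining equations \<phi> of the scheme.\<close>

definition E :: "('v \<times> nat \<times> nat) set" where
  "E = {(v, i, j). v \<in> verts Q \<and> i < \<alpha> v \<and> j < \<alpha> v}"

definition \<phi> :: "'v \<times> nat \<times> nat \<Rightarrow> ('a + 'a) coord cpoly" where
  "\<phi> = (\<lambda>(v, i, j). preproj_entry Q (generic_rep (double_quiver Q) \<alpha>) v i j)"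

lemma finite_E: "finite E"
proof -
  have "E = (SIGMA v:verts Q. {..<\<alpha> v} \<times> {..<\<alpha> v})" by (auto simp: E_def)
  then show ?thesis by simp
qed

lemma finite_coords: "finite (preproj_coords Q \<alpha>)"
proof -
  have "preproj_coords Q \<alpha> = (SIGMA b:arcs (double_quiver Q). {..<\<alpha> (head (double_quiver Q) b)} \<times> {..<\<alpha> (tail (double_quiver Q) b)})"
    by (auto simp: rep_coords_def)
  then show ?thesis by simp
qed

lemma preproj_ideal_eq: "preproj_ideal Q \<alpha> = ideal_gen (preproj_coords Q \<alpha>) (\<phi> ` E)"
proof -
  have "{preproj_entry Q (generic_rep (double_quiver Q) \<alpha>) v i j | v i j. v \<in> verts Q \<and> i < \<alpha> v \<and> j < \<alpha> v} = \<phi> ` E"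
    by (force simp: \<phi>_def E_def)
  then show ?thesis by (simp add: preproj_ideal_def)
qed

lemma blk_generic:
  assumes "b \<in> arcs (double_quiver Q)"
  shows "blk (generic_rep (double_quiver Q) \<alpha>) b = fm_of Var b"
proof (rule fmat_eqI)
  fix p q
  show "ent (blk (generic_rep (double_quiver Q) \<alpha>) b) p q = ent (fm_of Var b) p q"
    unfolding ent_blk[OF assms] ent_fm_of[OF assms] by (auto simp: generic_rep_def cell_def)
qed

lemma \<phi>_eq:
  assumes "i < \<alpha> v" "j < \<alpha> v"
  shows "\<phi> (v, i, j) = ent (mu (fm_of Var)) (v, i) (v, j)"
proof -
  have "\<phi> (v, i, j) = ent (mu (blk (generic_rep (double_quiver Q) \<alpha>))) (v, i) (v, j)"
    unfolding \<phi>_def case_prod_conv by (rule preproj_entry_eq) (use assms in \<open>auto simp: generic_rep_def\<close>)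
  also have "mu (blk (generic_rep (double_quiver Q) \<alpha>)) = mu (fm_of Var)"
    unfolding mu_def by (rule sum.cong) (auto simp: blk_generic)
  finally show ?thesis .
qed

lemma \<phi>_poly_ring: "e \<in> E \<Longrightarrow> \<phi> e \<in> poly_ring (preproj_coords Q \<alpha>)"
proof -
  assume e: "e \<in> E"
  obtain v i j where eq: "e = (v, i, j)" by (rule prod_cases3)
  have fm: "ent (fm_of Var b) p q \<in> poly_ring (preproj_coords Q \<alpha>)" if "b \<in> arcs (double_quiver Q)" for b p q
    using that unfolding ent_fm_of[OF that] by (auto simp: cell_def rep_coords_def intro!: poly_ring_Var)
  have "ent (fm_of Var b * fm_of Var c) p q \<in> poly_ring (preproj_coords Q \<alpha>)"
    if "b \<in> arcs (double_quiver Q)" "c \<in> arcs (double_quiver Q)" for b c p q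
    unfolding ent_mult_left[OF finite_idx subset_refl] by (intro poly_ring_sum poly_ring_mult fm that)
  note prod = this
  have "ent (mu (fm_of Var)) p q \<in> poly_ring (preproj_coords Q \<alpha>)" for p q
    unfolding mu_def ent_sum ent_diff by (intro poly_ring_sum poly_ring_diff prod) auto
  then show ?thesis
    using e unfolding eq by (simp add: E_def \<phi>_eq)
qed

lemma preproj_ideal_poly_ring: "preproj_ideal Q \<alpha> \<subseteq> poly_ring (preproj_coords Q \<alpha>)"
  unfolding preproj_ideal_eq
  by (rule subsetI, erule ideal_gen_poly_ring[rotated]) (use \<phi>_poly_ring in blast)

lemma preproj_Q: "preproj Q" by unfold_locales

lemma eval_\<phi>:
  assumes "(v, i, j) \<in> E"
  shows "poly_eval id x (\<phi> (v, i, j)) = ent (mu (fm_of x)) (v, i) (v, j)"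
  using assms ev.h_ent_mu[OF preproj_Q, where \<alpha> = \<alpha> and x = Var and xa = x] by (simp add: E_def \<phi>_eq poly_eval_Var)

lemma line_\<phi>:
  assumes "(v, i, j) \<in> E"
  shows "line x y (\<phi> (v, i, j)) = ent (mu (fm_of (\<lambda>z. [:x z, y z:]))) (v, i) (v, j)"
proof -
  have "line x y (Var z) = [:x z, y z:]" for z :: "('a + 'a) coord"
    unfolding line_def by (rule poly_eval_Var) auto
  then show ?thesis
    using assms ln.h_ent_mu[OF preproj_Q, where \<alpha> = \<alpha> and x = Var and xa = x and y = y] by (simp add: E_def \<phi>_eq)
qed

text \<open>A quadratic map expands along a line as mu (X + t Y) = mu X + t dmu X Y + t^2 mu
  Y.\<close>

lemma coeff_ent_mu:
  fixes x y :: "('a + 'a) coord \<Rightarrow> complex"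
  shows "poly.coeff (ent (mu (fm_of (\<lambda>z. [:x z, y z:]))) p q) 1 = ent (dmu (fm_of x) (fm_of y)) p q"
    and "poly.coeff (ent (mu (fm_of (\<lambda>z. [:x z, y z:]))) p q) 2 = ent (mu (fm_of y)) p q"
proof -
  let ?Z = "fm_of (\<lambda>z. [:x z, y z:])" and ?X = "fm_of x" and ?Y = "fm_of y"
  have c: "poly.coeff (ent (?Z b) r s) 0 = ent (?X b) r s" "poly.coeff (ent (?Z b) r s) 1 = ent (?Y b) r s"
    "poly.coeff (ent (?Z b) r s) 2 = 0" if "b \<in> arcs (double_quiver Q)" for b r s
    unfolding ent_fm_of[OF that] by (simp_all add: numeral_2_eq_2)
  have on: "on I (?X b)" "on I (?Y b)" "on I (?Z b)" if "b \<in> arcs (double_quiver Q)" for b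
    using reps_on[OF fm_of_reps that] by blast+
  have m: "poly.coeff (ent (?Z b * ?Z d) p q) 1 = ent (?X b * ?Y d) p q + ent (?Y b * ?X d) p q"
    "poly.coeff (ent (?Z b * ?Z d) p q) 2 = ent (?Y b * ?Y d) p q"
    if b: "b \<in> arcs (double_quiver Q)" "d \<in> arcs (double_quiver Q)" for b d
    using on[OF b(1)] by (simp_all only: ent_mult[OF finite_I] simp_thms coeff_sum coeff_mult_1 coeff_mult_2 c[OF b(1)] c[OF b(2)] sum.distrib
        mult_zero_left mult_zero_right add_0_left add_0_right)
  have a: "Inl a \<in> arcs (double_quiver Q)" "Inr a \<in> arcs (double_quiver Q)" if "a \<in> arcs Q" for a using that by auto
  show "poly.coeff (ent (mu ?Z) p q) 1 = ent (dmu ?X ?Y) p q"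
    unfolding mu_def dmu_def ent_sum coeff_sum
    by (rule sum.cong[OF refl]) (simp add: m[OF a] m[OF a(2,1)] m(1)[simplified] a)
  show "poly.coeff (ent (mu ?Z) p q) 2 = ent (mu ?Y) p q"
    unfolding mu_def ent_sum coeff_sum
    by (rule sum.cong[OF refl]) (simp add: m(2)[OF a] m(2)[OF a(2,1)])
qed

text \<open>The trace pairing with \<theta> becomes a linear combination of entries indexed by
  \<open>E\<close>. With \<open>mu\<close> as second factor this exhibits tr (\<theta> mu) as a
  combination of the defining equations.\<close>

lemma tr_gl_mult:
  assumes "\<theta> \<in> gl"
  shows "tr (\<theta> * A) = (\<Sum>(v, i, j)\<in>E. ent \<theta> (v, j) (v, i) * ent A (v, i) (v, j))"
proof -
  let ?f = "\<lambda>(v, i, j). ((v, j), (v, i))"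
  have "tr (\<theta> * A) = (\<Sum>(p, q)\<in>I \<times> I. ent \<theta> p q * ent A q p)"
    using tr_mult[OF finite_I gl_on[OF assms]] by (simp add: sum.cartesian_product)
  also have "\<dots> = (\<Sum>(p, q)\<in>?f ` E. ent \<theta> p q * ent A q p)"
  proof (rule sum.mono_neutral_right)
    show "finite (I \<times> I)" by simp
    show "?f ` E \<subseteq> I \<times> I" by (auto simp: E_def I_def)
    show "\<forall>k\<in>I \<times> I - ?f ` E. (case k of (p, q) \<Rightarrow> ent \<theta> p q * ent A q p) = 0"
    proof
      fix k assume k: "k \<in> I \<times> I - ?f ` E"
      obtain v i w j where kk: "k = ((v, i), (w, j))" by (metis surj_pair)
      have "ent \<theta> (v, i) (w, j) = 0"
      proof (rule ccontr)
        assume "ent \<theta> (v, i) (w, j) \<noteq> 0"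
        from gl_ent[OF assms this] have "v = w" "(v, j, i) \<in> E" by (auto simp: E_def I_def)
        then have "k \<in> ?f ` E" unfolding kk by force
        then show False using k by blast
      qed
      then show "(case k of (p, q) \<Rightarrow> ent \<theta> p q * ent A q p) = 0" by (simp add: kk)
    qed
  qed
  also have "\<dots> = (\<Sum>(v, i, j)\<in>E. ent \<theta> (v, j) (v, i) * ent A (v, i) (v, j))"
    by (subst sum.reindex) (auto simp: inj_on_def case_prod_beta)
  finally show ?thesis .
qed

definition coords_fm :: "('a + 'a \<Rightarrow> ('v \<times> nat, complex) fmat) \<Rightarrow> ('a + 'a) coord \<Rightarrow> complex" where
  "coords_fm Y = (\<lambda>(b, i, j). ent (Y b) (head (double_quiver Q) b, i) (tail (double_quiver Q) b, j))"

lemma fm_of_coords_fm: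
  assumes "Y \<in> reps" "b \<in> arcs (double_quiver Q)"
  shows "fm_of (coords_fm Y) b = Y b"
proof (rule fmat_eqI)
  fix p q
  show "ent (fm_of (coords_fm Y) b) p q = ent (Y b) p q"
    using reps_ent[OF assms, of p q]
    by (cases "p \<in> cell (head (double_quiver Q) b) \<and> q \<in> cell (tail (double_quiver Q) b)")
      (auto simp: ent_fm_of[OF assms(2)] coords_fm_def cell_def)
qed

lemma mu_cong: "(\<And>b. b \<in> arcs (double_quiver Q) \<Longrightarrow> X b = Y b) \<Longrightarrow> mu X = mu Y"
  unfolding mu_def by (rule sum.cong) auto

lemma dmu_cong: "(\<And>b. b \<in> arcs (double_quiver Q) \<Longrightarrow> Y b = Z b) \<Longrightarrow> dmu X Y = dmu X Z"
  unfolding dmu_def by (rule sum.cong) auto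

section \<open>Consequences of smoothness and duality under the symplectic form\<close>

lemma smooth_quadratic:
  assumes M: "M \<in> preproj_reps Q \<alpha>" and smooth: "scheme_smooth_at (preproj_coords Q \<alpha>) (preproj_ideal Q \<alpha>) (coords_of M)"
    and \<theta>: "\<theta> \<in> gl" "commute \<theta> (blk M)" and Y: "Y \<in> reps" "dmu (blk M) Y = 0"
  shows "tr (\<theta> * mu Y) = 0"
proof -
  let ?C = "preproj_coords Q \<alpha>" and ?x = "coords_of M" and ?X = "blk M"
  have X: "fm_of ?x = ?X" by (simp add: blk_eq_fm_of)
  have zero: "poly_eval id ?x s = 0" if "s \<in> preproj_ideal Q \<alpha>" for s
    using smooth that by (simp add: scheme_smooth_at_def)
  have line0: "poly.coeff (line ?x y (\<phi> e)) 0 = 0" if "e \<in> E" for y e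
    unfolding coeff_line_0 by (rule zero) (use that in \<open>auto simp: preproj_ideal_eq intro: ideal_gen_base\<close>)
  have line1: "poly.coeff (line ?x y (\<phi> (v, i, j))) 1 = ent (dmu ?X (fm_of y)) (v, i) (v, j)" if "(v, i, j) \<in> E" for y v i j
    unfolding line_\<phi>[OF that] coeff_ent_mu X ..
  have line2: "poly.coeff (line ?x y (\<phi> (v, i, j))) 2 = ent (mu (fm_of y)) (v, i) (v, j)" if "(v, i, j) \<in> E" for y v i j
    unfolding line_\<phi>[OF that] coeff_ent_mu ..
  define c where "c = (\<lambda>(v, i, j). ent \<theta> (v, j) (v, i))"
  \<comment> \<open>The function tr (\<theta> mu) as an element of the ideal; \<open>c\<close>
    carries the transposed index that the trace pairing requires. Its linear term at M is the
    pairing with the bracket of \<theta> and M, which is zero.\<close>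
  define f where "f = (\<Sum>e\<in>E. Const (c e) * \<phi> e)"
  have f_ideal: "f \<in> preproj_ideal Q \<alpha>"
    unfolding f_def preproj_ideal_eq by (intro ideal_gen_sum ideal_gen_mult ideal_gen_base) auto
  have line_Const: "line ?x y (Const a) = [:a:]" for a y
    unfolding line_def by (rule poly_eval_Const) simp
  have coeff_f: "poly.coeff (line ?x y f) n = (\<Sum>e\<in>E. c e * poly.coeff (line ?x y (\<phi> e)) n)" for y n
    unfolding f_def ln.h_sum ln.h_mult coeff_sum line_Const by simp
  have f1: "poly.coeff (line ?x y f) 1 = 0" for y
  proof -
    have "poly.coeff (line ?x y f) 1 = (\<Sum>(v, i, j)\<in>E. ent \<theta> (v, j) (v, i) * ent (dmu ?X (fm_of y)) (v, i) (v, j))"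
      unfolding coeff_f by (rule sum.cong[OF refl]) (use line1 in \<open>auto simp: c_def\<close>)
    also have "\<dots> = omega (commr \<theta> ?X) (fm_of y)"
      by (simp only: tr_gl_mult[OF \<theta>(1), symmetric] tr_dmu)
    also have "\<dots> = 0"
      using \<theta>(2) by (simp add: omega_def commr_def commute_def)
    finally show ?thesis .
  qed
  let ?y = "coords_fm Y"
  have "dmu ?X (fm_of ?y) = 0"
    using dmu_cong[of "fm_of ?y" Y ?X] fm_of_coords_fm[OF Y(1)] Y(2) by simp
  then have \<phi>1: "poly.coeff (line ?x ?y (\<phi> e)) 1 = 0" if "e \<in> E" for e
    using line1 that by (cases e) simp
  have tangent: "poly.coeff (line ?x ?y s) 1 = 0" if s: "s \<in> preproj_ideal Q \<alpha>" for s
  proof -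
    obtain S q where S: "S \<subseteq> \<phi> ` E" "s = (\<Sum>s\<in>S. q s * s)"
      using s unfolding preproj_ideal_eq ideal_gen_def by blast
    show ?thesis
      unfolding S(2) ln.h_sum coeff_sum ln.h_mult coeff_mult_1
      by (rule sum.neutral) (use S(1) line0 \<phi>1 in auto)
  qed
  have "poly.coeff (line ?x ?y f) 2 = 0"
    by (rule smooth_second_order[OF finite_coords preproj_ideal_poly_ring smooth tangent f_ideal f1])
  also have "poly.coeff (line ?x ?y f) 2 = (\<Sum>(v, i, j)\<in>E. ent \<theta> (v, j) (v, i) * ent (mu (fm_of ?y)) (v, i) (v, j))"
    unfolding coeff_f by (rule sum.cong[OF refl]) (use line2 in \<open>auto simp: c_def\<close>)
  also have "\<dots> = tr (\<theta> * mu (fm_of ?y))" by (rule tr_gl_mult[OF \<theta>(1), symmetric])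
  also have "mu (fm_of ?y) = mu Y" by (rule mu_cong) (rule fm_of_coords_fm[OF Y(1)])
  finally show ?thesis .
qed

text \<open>Nondegeneracy in the strong form that every linear functional is pairing with some
  \<open>Z\<close>. The trace pairing at a single arrow is dualised by transposed coefficients, and
  the symplectic form couples each arrow with its opposite.\<close>

lemma omega_dual:
  fixes z :: "(('a + 'a) \<times> ('v \<times> nat) \<times> ('v \<times> nat)) \<Rightarrow> complex"
  shows "\<exists>Z\<in>reps. \<forall>W\<in>reps. omega W Z = (\<Sum>k\<in>K. z k * Poly_Mapping.lookup (rvec W) k)"
proof -
  let ?h = "head (double_quiver Q)" and ?t = "tail (double_quiver Q)"
  define T where "T b = mat_on I (\<lambda>q p. if p \<in> cell (?h b) \<and> q \<in> cell (?t b) then z (b, p, q) else 0)" for b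
  \<comment> \<open>The coefficients of an arrow sit at the opposite arrow; the sign at
    \<open>Inl\<close> cancels the one in \<open>omega\<close>.\<close>
  define Z where "Z = case_sum (\<lambda>a. - T (Inr a)) (\<lambda>a. T (Inl a))"
  have arcs: "Inl a \<in> arcs (double_quiver Q)" "Inr a \<in> arcs (double_quiver Q)" if "a \<in> arcs Q" for a using that by auto
  have ent_T: "ent (T b) q p = (if p \<in> cell (?h b) \<and> q \<in> cell (?t b) then z (b, p, q) else 0)"
    if "b \<in> arcs (double_quiver Q)" for b p q
    using cell_subset_I[OF head_in_verts[OF that]] cell_subset_I[OF tail_in_verts[OF that]]
    by (auto simp: T_def ent_mat_on)
  have "Z \<in> reps"
    unfolding reps_def mem_Collect_eq Z_def by (auto simp: ent_T split: if_splits)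
  moreover have "omega W Z = (\<Sum>k\<in>K. z k * Poly_Mapping.lookup (rvec W) k)" if W: "W \<in> reps" for W
  proof -
    have t: "tr (W b * T b) = (\<Sum>(p, q)\<in>cell (?h b) \<times> cell (?t b). z (b, p, q) * ent (W b) p q)"
      if b: "b \<in> arcs (double_quiver Q)" for b
    proof -
      have "tr (W b * T b) = (\<Sum>(p, q)\<in>I \<times> I. ent (W b) p q * ent (T b) q p)"
        using tr_mult[OF finite_I reps_on[OF W b]] by (simp add: sum.cartesian_product)
      also have "\<dots> = (\<Sum>(p, q)\<in>cell (?h b) \<times> cell (?t b). ent (W b) p q * ent (T b) q p)"
      proof (rule sum.mono_neutral_right)
        show "cell (?h b) \<times> cell (?t b) \<subseteq> I \<times> I"
          using cell_subset_I[OF head_in_verts[OF b]] cell_subset_I[OF tail_in_verts[OF b]] by blast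
        show "\<forall>k\<in>I \<times> I - cell (?h b) \<times> cell (?t b). (case k of (p, q) \<Rightarrow> ent (W b) p q * ent (T b) q p) = 0"
        proof
          fix k assume k: "k \<in> I \<times> I - cell (?h b) \<times> cell (?t b)"
          obtain p q where "k = (p, q)" by (rule prod.exhaust)
          with k show "(case k of (p, q) \<Rightarrow> ent (W b) p q * ent (T b) q p) = 0"
            by (simp only: ent_T[OF b] prod.case DiffD2 mem_Times_iff fst_conv snd_conv Diff_iff) simp
        qed
      qed simp
      also have "\<dots> = (\<Sum>(p, q)\<in>cell (?h b) \<times> cell (?t b). z (b, p, q) * ent (W b) p q)"
        by (rule sum.cong[OF refl]) (simp add: ent_T[OF b] case_prod_beta mem_Times_iff)
      finally show ?thesis .
    qed
    have "omega W Z = (\<Sum>a\<in>arcs Q. tr (W (Inl a) * T (Inl a))) + (\<Sum>a\<in>arcs Q. tr (W (Inr a) * T (Inr a)))"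
      unfolding omega_def sum.distrib[symmetric] by (rule sum.cong) (auto simp: Z_def tr_uminus)
    also have "\<dots> = (\<Sum>b\<in>arcs (double_quiver Q). tr (W b * T b))"
      unfolding double_quiver_simps by (subst sum.union_disjoint) (auto simp: sum.reindex)
    also have "\<dots> = (\<Sum>b\<in>arcs (double_quiver Q). \<Sum>(p, q)\<in>cell (?h b) \<times> cell (?t b). z (b, p, q) * ent (W b) p q)"
      by (rule sum.cong[OF refl t])
    also have "\<dots> = (\<Sum>(b, p, q)\<in>K. z (b, p, q) * ent (W b) p q)"
      unfolding K_def by (subst sum.Sigma) (auto intro!: sum.cong simp: double_quiver_def)
    also have "\<dots> = (\<Sum>k\<in>K. z k * Poly_Mapping.lookup (rvec W) k)"
      by (rule sum.cong) (auto simp: lookup_rvec)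
    finally show ?thesis .
  qed
  ultimately show ?thesis by blast
qed

text \<open>The tangent space of the orbit and the kernel of dmu are orthogonal complements under
  the symplectic form. A functional separating the bracket of \<theta> and \<open>Y\<close> from the
  tangent space of the orbit is pairing with some tangent vector \<open>Z\<close> of the scheme, and
  polarising the quadratic form at \<open>Y\<close> and \<open>Z\<close> shows that it cannot
  separate.\<close>

lemma smooth_ext:
  assumes M: "M \<in> preproj_reps Q \<alpha>" and smooth: "scheme_smooth_at (preproj_coords Q \<alpha>) (preproj_ideal Q \<alpha>) (coords_of M)"
    and \<theta>: "\<theta> \<in> gl" "commute \<theta> (blk M)" and Y: "Y \<in> reps" "dmu (blk M) Y = 0"
  shows "\<exists>\<eta>\<in>gl. \<forall>b\<in>arcs (double_quiver Q). commr \<theta> Y b = commr \<eta> (blk M) b"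
proof -
  let ?X = "blk M"
  have X: "?X \<in> reps" by (rule blk_reps)
  have "rvec (commr \<theta> Y) \<in> (\<lambda>\<eta>. rvec (commr \<eta> ?X)) ` gl"
  proof (rule ccontr)
    assume n: "rvec (commr \<theta> Y) \<notin> (\<lambda>\<eta>. rvec (commr \<eta> ?X)) ` gl"
    obtain z where z: "\<And>b. b \<in> (\<lambda>\<eta>. rvec (commr \<eta> ?X)) ` gl \<Longrightarrow> (\<Sum>k\<in>K. z k * Poly_Mapping.lookup b k) = 0"
      "(\<Sum>k\<in>K. z k * Poly_Mapping.lookup (rvec (commr \<theta> Y)) k) \<noteq> 0"
      by (rule separating_vector[OF finite_K fsubspace_commr _ rvec_in_funs_on n]) auto
    obtain Z where Z: "Z \<in> reps" "\<forall>W\<in>reps. omega W Z = (\<Sum>k\<in>K. z k * Poly_Mapping.lookup (rvec W) k)"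
      using omega_dual[of z] by (elim bexE)
    \<comment> \<open>\<open>Z\<close> is orthogonal to the orbit. By the moment map identity its
      image under dmu pairs to zero with all of \<open>gl\<close>, and testing with matrix units
      shows that this image is 0.\<close>
    have "tr (\<eta> * dmu ?X Z) = 0" if "\<eta> \<in> gl" for \<eta>
      unfolding tr_dmu bspec[OF Z(2) commr_reps[OF that X]] by (rule z(1)) (use that in blast)
    note trz = this
    have dz: "dmu ?X Z = 0"
    proof (rule fmat_eqI, rule ccontr)
      fix p q assume "ent (dmu ?X Z) p q \<noteq> ent 0 p q"
      then have nz: "ent (dmu ?X Z) p q \<noteq> 0" by simp
      from gl_ent[OF dmu_gl[OF X Z(1)] nz] have "(eu q p :: ('v \<times> nat, complex) fmat) \<in> gl"
        by (auto simp: gl_def ent_eu split: if_splits)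
      from trz[OF this] nz show False by (simp add: tr_eu_mult)
    qed
    \<comment> \<open>Polarisation: the quadratic form tr (\<theta> mu) vanishes at Y, at Z and at Y
      + Z, hence its polar form vanishes at the pair.\<close>
    have "dmu ?X (\<lambda>b. Y b + Z b) = 0" by (simp add: dmu_add Y dz)
    from smooth_quadratic[OF M smooth \<theta> reps_add[OF Y(1) Z(1)] this]
    have "tr (\<theta> * mu Y) + tr (\<theta> * mu Z) + tr (\<theta> * dmu Y Z) = 0"
      by (simp add: mu_add distrib_left tr_add)
    then have "omega (commr \<theta> Y) Z = 0"
      using smooth_quadratic[OF M smooth \<theta> Y] smooth_quadratic[OF M smooth \<theta> Z(1) dz] by (simp add: tr_dmu)
    then show False using z(2) bspec[OF Z(2) commr_reps[OF \<theta>(1) Y(1)]] by simp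
  qed
  then obtain \<eta> where "\<eta> \<in> gl" "rvec (commr \<theta> Y) = rvec (commr \<eta> ?X)" by blast
  then show ?thesis
    using rvec_eq_iff[OF commr_reps[OF \<theta>(1) Y(1)] commr_reps[OF _ X]] by blast
qed

end

section \<open>Smooth semisimple representations\<close>

context quiver_dim
begin

text \<open>A decomposition into simple summands has at least two of them: none is impossible since
  some vertex space is nonzero, and a single one would be the whole representation. Projection onto
  one of the two is the idempotent.\<close>

lemma semisimple_not_simple:
  assumes V: "V \<in> rep_space R \<alpha>" and ss: "semisimple_rep R \<alpha> V" and ns: "\<not> simple_rep R \<alpha> V"
    and nz: "v0 \<in> verts R" "\<alpha> v0 \<noteq> 0"
  obtains p where "p \<in> gl" "p * p = p" "commute p (blk V)" "p \<noteq> 0" "p \<noteq> diag I"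
proof -
  obtain r S where S: "direct_sum_decomp R \<alpha> V r S" and simple: "\<And>k. k < r \<Longrightarrow> simple_subrep R \<alpha> V (S k)"
    using ss unfolding semisimple_rep_def by blast
  have sub: "subrep R \<alpha> V (S k)" if "k < r" for k using S that unfolding direct_sum_decomp_def by blast
  have dec: "\<exists>u. u \<in> (\<Pi>\<^sub>E k\<in>{..<r}. S k v) \<and> x = finsum_vec TYPE(complex) (\<alpha> v) u {..<r}"
    if "v \<in> verts R" "x \<in> carrier_vec (\<alpha> v)" for v x
    using S that unfolding direct_sum_decomp_def by (metis (no_types, lifting))
  have dec': "\<exists>u. (\<forall>k<r. u k \<in> S k v) \<and> emb v x = (\<Sum>k<r. emb v (u k))"
    if v: "v \<in> verts R" and x: "x \<in> carrier_vec (\<alpha> v)" for v x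
  proof -
    obtain u where u: "u \<in> (\<Pi>\<^sub>E k\<in>{..<r}. S k v)" "x = finsum_vec TYPE(complex) (\<alpha> v) u {..<r}"
      using dec[OF v x] by (elim exE conjE)
    have uk: "u k \<in> S k v" if "k < r" for k using PiE_mem[OF u(1), of k] that by simp
    have "u \<in> {..<r} \<rightarrow> carrier_vec (\<alpha> v)"
      using uk subrep_carrier[OF sub v] by (intro Pi_I) (metis lessThan_iff)
    then have "emb v x = (\<Sum>k<r. emb v (u k))" unfolding u(2) by (rule emb_finsum)
    then show ?thesis using uk by (intro exI[of _ u]) simp
  qed
  have "r \<noteq> 0"
  proof
    assume r: "r = 0"
    have x: "unit_vec (\<alpha> v0) 0 \<in> (carrier_vec (\<alpha> v0) :: complex vec set)" by simp
    from dec'[OF nz(1) x] have "emb v0 (unit_vec (\<alpha> v0) 0) = emb v0 (0\<^sub>v (\<alpha> v0))" by (simp add: r emb_0)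
    then have "unit_vec (\<alpha> v0) 0 = (0\<^sub>v (\<alpha> v0) :: complex vec)" using emb_eq_iff[OF x] by simp
    then have "(unit_vec (\<alpha> v0) 0 :: complex vec) $ 0 = 0" using nz(2) by simp
    then show False using nz(2) by simp
  qed
  moreover have "r \<noteq> 1"
  proof
    assume r: "r = 1"
    have sub0: "subrep R \<alpha> V (S 0)" using sub r by simp
    have eq: "S 0 v = carrier_vec (\<alpha> v)" if v: "v \<in> verts R" for v
    proof
      show "S 0 v \<subseteq> carrier_vec (\<alpha> v)" using subrep_carrier[OF sub0 v] by blast
      show "carrier_vec (\<alpha> v) \<subseteq> S 0 v"
      proof
        fix x :: "complex vec" assume x: "x \<in> carrier_vec (\<alpha> v)"
        obtain u where u: "\<forall>k<r. u k \<in> S k v" "emb v x = (\<Sum>k<r. emb v (u k))"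
          using dec'[OF v x] by (elim exE conjE)
        have u0: "u 0 \<in> S 0 v" "emb v x = emb v (u 0)" using u by (simp_all add: r)
        then have "x = u 0" using emb_eq_iff[OF x subrep_carrier[OF sub0 v u0(1)]] by simp
        then show "x \<in> S 0 v" using u0 by simp
      qed
    qed
    have ht: "head R b \<in> verts R" "tail R b \<in> verts R" if "b \<in> arcs R" for b using that by auto
    have "simple_subrep R \<alpha> V (S 0) \<longleftrightarrow> simple_rep R \<alpha> V"
      unfolding simple_rep_def simple_subrep_def subrep_def zero_subrep_def using eq ht by (simp cong: ball_cong)
    then show False using ns simple[of 0] r by simp
  qed
  ultimately have r: "0 < r" "1 < r" by simp_all
  have z: "\<not> zero_subrep R \<alpha> (S k)" if "k < r" for k using simple[OF that] by (simp add: simple_subrep_def)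
  show ?thesis
    by (rule decomposition_idempotent[OF V S r zero_neq_one z[OF r(1)] z[OF r(2)]]) (rule that)
qed

end

context preproj
begin

lemma dmu_conj:
  assumes g: "g \<in> gl" "g' \<in> gl" "g * g' = diag I" and X: "X \<in> reps"
  shows "dmu X (\<lambda>b. g * Y b * g') = g * dmu (\<lambda>b. g' * X b * g) Y * g'"
proof -
  have 1: "g * (g' * X b * g * Z) * g' = X b * (g * Z * g')" "g * (Z * (g' * X b * g)) * g' = g * Z * g' * X b"
    if b: "b \<in> arcs (double_quiver Q)" for b and Z :: "('v \<times> nat, 'b) fmat"
  proof -
    have "g * (g' * X b * g * Z) * g' = (g * g') * X b * (g * Z * g')" by (simp only: mult.assoc)
    then show "g * (g' * X b * g * Z) * g' = X b * (g * Z * g')"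
      unfolding g(3) using reps_on[OF X b] by simp
    have "g * (Z * (g' * X b * g)) * g' = g * Z * g' * (X b * (g * g'))" by (simp only: mult.assoc)
    then show "g * (Z * (g' * X b * g)) * g' = g * Z * g' * X b"
      unfolding g(3) using reps_on[OF X b] by simp
  qed
  have a: "Inl a \<in> arcs (double_quiver Q)" "Inr a \<in> arcs (double_quiver Q)" if "a \<in> arcs Q" for a using that by auto
  show ?thesis
    unfolding dmu_def sum_distrib_left sum_distrib_right
  proof (rule sum.cong[OF refl])
    fix x assume x: "x \<in> arcs Q"
    show "X (Inl x) * (g * Y (Inr x) * g') + g * Y (Inl x) * g' * X (Inr x) - X (Inr x) * (g * Y (Inl x) * g') - g * Y (Inr x) * g' * X (Inl x) =
      g * (g' * X (Inl x) * g * Y (Inr x) + Y (Inl x) * (g' * X (Inr x) * g) - g' * X (Inr x) * g * Y (Inl x) - Y (Inr x) * (g' * X (Inl x) * g)) * g'"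
      by (simp only: distrib_left distrib_right left_diff_distrib right_diff_distrib 1[OF a(1)[OF x]] 1[OF a(2)[OF x]])
  qed
qed

text \<open>The count of off-diagonal blocks over the double quiver makes the symmetrised Euler form
  of the two summands nonnegative, so the quadratic form at \<alpha> is at least the sum of its
  values at the summands. \<open>S_zero_no_split\<close> says the opposite.\<close>

lemma smooth_no_idempotent:
  assumes \<alpha>: "\<alpha> \<in> S_zero Q" and M: "M \<in> preproj_reps Q \<alpha>"
    and smooth: "scheme_smooth_at (preproj_coords Q \<alpha>) (preproj_ideal Q \<alpha>) (coords_of M)"
    and p: "p \<in> gl" "p * p = p" "commute p (blk M)" "p \<noteq> 0" "p \<noteq> diag I"
  shows False
proof -
  let ?X = "blk M"
  have X: "?X \<in> reps" by (rule blk_reps)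
  obtain g g' J where g: "g \<in> gl" "g' \<in> gl" "g * g' = diag I" "g' * g = diag I" and J: "J \<subseteq> I" "J \<noteq> {}" "J \<noteq> I"
    and pg: "p = g * diag J * g'"
    by (rule idempotent_split[OF p X])
  define X0 where "X0 = (\<lambda>b. g' * ?X b * g)"
  have X0: "X0 \<in> reps" unfolding X0_def by (rule reps_conj[OF g(2,1) X])
  have com: "commute (diag J) X0"
    unfolding X0_def by (rule conj_commute[OF g(1,2,4,3) J(1) pg p(3) X])
  have fin: "finite J" "finite (I - J)" using finite_subset[OF J(1)] by auto
  \<comment> \<open>On maps from the complement of \<open>J\<close> to \<open>J\<close>,
    \<open>dmu X0\<close> takes values of the same shape because \<open>X0\<close> preserves both
    parts. Their entries \<open>?F\<close> are at most as many as those of the block of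
    \<open>gl\<close> in the first term, which doubles the sum over the vertices.\<close>
  let ?F = "\<Union>v\<in>verts Q. (cell v \<inter> J) \<times> (cell v - J)"
  have a: "Inl a \<in> arcs (double_quiver Q)" "Inr a \<in> arcs (double_quiver Q)" if "a \<in> arcs Q" for a using that by auto
  have le: "(\<Sum>b\<in>arcs (double_quiver Q). card (cell (head (double_quiver Q) b) \<inter> J) * card (cell (tail (double_quiver Q) b) - J))
      \<le> (\<Sum>v\<in>verts (double_quiver Q). card (cell v \<inter> J) * card (cell v - J)) + card ?F"
  proof (rule off_diagonal_count[OF X0 J(1) com])
    show "dmu X0 (\<lambda>b. Y b + Z b) = dmu X0 Y + dmu X0 Z" for Y Z by (rule dmu_add)
    show "dmu X0 (\<lambda>b. smul c (Y b)) = smul c (dmu X0 Y)" for c Y by (rule dmu_smul)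
    show "finite ?F" by simp
  next
    fix Y :: "'a + 'a \<Rightarrow> ('v \<times> nat, complex) fmat" and x y
    assume Y: "Y \<in> reps" "\<forall>b\<in>arcs (double_quiver Q). diag J * Y b * diag (I - J) = Y b" and nz: "ent (dmu X0 Y) x y \<noteq> 0"
    have Yl: "diag J * Y b = Y b" and Yr: "Y b * diag J = 0" if b: "b \<in> arcs (double_quiver Q)" for b
    proof -
      have "diag J * (diag J * Y b * diag (I - J)) = diag J * diag J * Y b * diag (I - J)" by (simp only: mult.assoc)
      then show "diag J * Y b = Y b" using Y(2) b fin by (simp add: diag_mult_diag)
      have z: "diag (I - J) * diag J = (0 :: ('v \<times> nat, complex) fmat)"
        using fin by (intro fmat_eqI) (auto simp: ent_diag)
      have "diag J * Y b * diag (I - J) * diag J = diag J * Y b * (diag (I - J) * diag J)" by (simp only: mult.assoc)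
      then show "Y b * diag J = 0" using Y(2) b z by simp
    qed
    have XY: "diag J * (X0 b * Y c) = X0 b * Y c" "diag J * (Y b * X0 c) = Y b * X0 c"
      "X0 b * Y c * diag J = 0" "Y b * X0 c * diag J = 0"
      if b: "b \<in> arcs (double_quiver Q)" "c \<in> arcs (double_quiver Q)" for b c
    proof -
      have cb: "diag J * X0 b = X0 b * diag J" "diag J * X0 c = X0 c * diag J" using com b unfolding commute_def by blast+
      show "diag J * (X0 b * Y c) = X0 b * Y c" by (simp only: mult.assoc[symmetric] cb) (simp only: mult.assoc Yl[OF b(2)])
      show "diag J * (Y b * X0 c) = Y b * X0 c" by (simp only: mult.assoc[symmetric] Yl[OF b(1)])
      show "X0 b * Y c * diag J = 0" by (simp only: mult.assoc Yr[OF b(2)] mult_zero_right)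
      show "Y b * X0 c * diag J = 0" by (simp only: mult.assoc cb(2)[symmetric]) (simp only: mult.assoc[symmetric] Yr[OF b(1)] mult_zero_left)
    qed
    have l: "diag J * dmu X0 Y = dmu X0 Y"
      unfolding dmu_def sum_distrib_left
      by (rule sum.cong[OF refl]) (simp only: distrib_left right_diff_distrib XY[OF a] XY[OF a(2) a(1)])
    have r: "dmu X0 Y * diag J = 0"
      unfolding dmu_def sum_distrib_right
      by (rule sum.neutral, rule ballI) (simp only: distrib_right left_diff_distrib XY[OF a] XY[OF a(2) a(1)] add_0_left diff_0_right)
    have xJ: "x \<in> J"
    proof (rule ccontr)
      assume "x \<notin> J"
      then have "ent (diag J * dmu X0 Y) x y = 0" using fin by simp
      then show False using nz l by simp
    qed
    have yJ: "y \<notin> J"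
    proof
      assume "y \<in> J"
      then have "ent (dmu X0 Y * diag J) x y = ent (dmu X0 Y) x y" using fin by simp
      then show False using nz r by simp
    qed
    from gl_ent[OF dmu_gl[OF X0 Y(1)] nz] have xy: "x \<in> I" "y \<in> I" "fst x = fst y" by simp_all
    then have "x \<in> cell (fst x)" "y \<in> cell (fst x)" "fst x \<in> verts Q"
      using in_cell_iff[of x "fst x"] in_cell_iff[of y "fst x"] fst_in_verts[of x] by simp_all
    then show "(x, y) \<in> ?F" using xJ yJ by blast
  next
    fix Y :: "'a + 'a \<Rightarrow> ('v \<times> nat, complex) fmat"
    assume Y: "Y \<in> reps" "\<forall>b\<in>arcs (double_quiver Q). diag J * Y b * diag (I - J) = Y b" and dz: "dmu X0 Y = 0"
    have "dmu ?X (\<lambda>b. g * Y b * g') = g * dmu X0 Y * g'" unfolding X0_def by (rule dmu_conj[OF g(1-3) X])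
    then have "dmu ?X (\<lambda>b. g * Y b * g') = 0" by (simp add: dz)
    from smooth_ext[OF M smooth p(1,3) reps_conj[OF g(1,2) Y(1)] this]
    show "\<exists>\<eta>\<in>gl. \<forall>b\<in>arcs (double_quiver Q). Y b = commr \<eta> X0 b"
      unfolding X0_def by (rule off_diagonal_ext[OF g(1,2,4,3) J(1) pg Y X])
  qed
  let ?b1 = "\<lambda>v. card (cell v \<inter> J)" and ?b2 = "\<lambda>v. card (cell v - J)"
  have "card ?F \<le> (\<Sum>v\<in>verts Q. card ((cell v \<inter> J) \<times> (cell v - J)))" by (rule card_UN_le) simp
  then have F: "card ?F \<le> (\<Sum>v\<in>verts Q. ?b1 v * ?b2 v)" by (simp add: card_cartesian_product)
  \<comment> \<open>Each arrow of \<open>Q\<close> contributes once in either direction, and this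
    symmetrises the form.\<close>
  have "(\<Sum>b\<in>arcs (double_quiver Q). ?b1 (head (double_quiver Q) b) * ?b2 (tail (double_quiver Q) b)) =
      (\<Sum>a\<in>arcs Q. ?b1 (head Q a) * ?b2 (tail Q a)) + (\<Sum>a\<in>arcs Q. ?b1 (tail Q a) * ?b2 (head Q a))"
    unfolding double_quiver_simps by (subst sum.union_disjoint) (auto simp: sum.reindex)
  with le F have "(\<Sum>a\<in>arcs Q. ?b1 (head Q a) * ?b2 (tail Q a)) + (\<Sum>a\<in>arcs Q. ?b1 (tail Q a) * ?b2 (head Q a)) \<le>
      2 * (\<Sum>v\<in>verts Q. ?b1 v * ?b2 v)" by simp
  from of_nat_mono[OF this, where ?'a = int]
  have "dims_form Q ?b1 ?b2 + dims_form Q ?b2 ?b1 \<ge> 0"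
    by (simp add: dims_form_def mult.commute)
  moreover have sum: "\<alpha> = (\<lambda>v. ?b1 v + ?b2 v)" by (simp add: card_cell_split)
  have "euler_q Q \<alpha> = euler_q Q ?b1 + euler_q Q ?b2 + dims_form Q ?b1 ?b2 + dims_form Q ?b2 ?b1"
    unfolding base.euler_q_eq dims_form_add[symmetric] by (rule arg_cong2[where f = "dims_form Q", OF sum sum])
  moreover have "euler_q Q \<alpha> < euler_q Q ?b1 + euler_q Q ?b2"
    by (rule S_zero_no_split[OF base.fin_digraph_axioms \<alpha> sum card_cell_Int_nonzero[OF J(1,2)] card_cell_Diff_nonzero[OF J(1,3)]])
  ultimately show False by linarith
qed

lemma preproj_reps_rep_space: "M \<in> preproj_reps Q \<alpha> \<Longrightarrow> M \<in> rep_space (double_quiver Q) \<alpha>"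
  by (simp add: preproj_reps_def)

lemma S_zero_support: "\<alpha> \<in> S_zero Q \<Longrightarrow> \<exists>v\<in>verts Q. \<alpha> v \<noteq> 0"
  unfolding S_zero_def quiver_roots_def indecomposable_rep_def by blast

lemma smooth_semisimple_simple:
  assumes \<alpha>: "\<alpha> \<in> S_zero Q" and M: "M \<in> preproj_reps Q \<alpha>" "semisimple_rep (double_quiver Q) \<alpha> M"
    and smooth: "scheme_smooth_at (preproj_coords Q \<alpha>) (preproj_ideal Q \<alpha>) (coords_of M)"
  shows "simple_rep (double_quiver Q) \<alpha> M"
proof (rule ccontr)
  assume ns: "\<not> simple_rep (double_quiver Q) \<alpha> M"
  obtain v where v: "v \<in> verts Q" "\<alpha> v \<noteq> 0" using S_zero_support[OF \<alpha>] by (elim bexE)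
  obtain p where "p \<in> gl" "p * p = p" "commute p (blk M)" "p \<noteq> 0" "p \<noteq> diag I"
    by (rule semisimple_not_simple[OF preproj_reps_rep_space[OF M(1)] M(2) ns, of v]) (use v in simp_all)
  then show False by (rule smooth_no_idempotent[OF \<alpha> M(1) smooth])
qed

section \<open>Smoothness at simple representations\<close>

lemma simple_endomorphism_scalar:
  assumes V: "V \<in> rep_space (double_quiver Q) \<alpha>" and simple: "simple_rep (double_quiver Q) \<alpha> V"
    and \<theta>: "\<theta> \<in> gl" "commute \<theta> (blk V)"
  obtains c where "\<theta> = smul c (diag I)"
proof -
  interpret irr: irreducible_algebra I "range (nev I id (sig (blk V)))"
    by (rule simple_irreducible_algebra[OF V simple])
  have "nev I id (sig (blk V)) t * \<theta> = \<theta> * nev I id (sig (blk V)) t" for t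
  proof (induction t)
    case (Gen l)
    then show ?case
      using \<theta>(2) gl_commute_cell[OF \<theta>(1)] by (cases l) (simp_all add: sig_def commute_def)
  next
    case (Cst c)
    then show ?case using gl_on[OF \<theta>(1)] by (simp add: smul_mult_left smul_mult_right)
  next
    case (Add s t)
    then show ?case by (simp add: distrib_left distrib_right)
  next
    case (Mul s t)
    let ?s = "nev I id (sig (blk V)) s" and ?t = "nev I id (sig (blk V)) t"
    have "?s * ?t * \<theta> = ?s * (?t * \<theta>)" by (rule mult.assoc)
    also have "\<dots> = ?s * \<theta> * ?t" unfolding Mul(2) by (rule mult.assoc[symmetric])
    also have "\<dots> = \<theta> * (?s * ?t)" unfolding Mul(1) by (rule mult.assoc)
    finally show ?case by (simp only: nev.simps)
  qed
  note com = this
  show ?thesis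
  proof (rule irr.schur[OF gl_on[OF \<theta>(1)]])
    fix a assume "a \<in> range (nev I id (sig (blk V)))"
    then show "a * \<theta> = \<theta> * a" by (elim rangeE) (simp only: com)
  next
    fix c assume "\<theta> = smul c (diag I)"
    then show ?thesis by (rule that)
  qed
qed

lemma tr_mu: "tr (mu X) = 0"
  unfolding mu_def tr_sum tr_diff by (rule sum.neutral) (use tr_mult_comm in auto)

lemma \<phi>_relation:
  assumes e0: "(v0, 0, 0) \<in> E"
  shows "\<phi> (v0, 0, 0) \<in> ideal_gen (preproj_coords Q \<alpha>) (\<phi> ` (E - {(v0, 0, 0)}))"
proof -
  let ?e0 = "(v0, 0, 0) :: 'v \<times> nat \<times> nat"
  \<comment> \<open>The coefficients of the trace. The index \<open>?e0\<close> is diagonal, so its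
    equation occurs with coefficient 1 and can be solved for.\<close>
  define c where "c = (\<lambda>(v :: 'v, i :: nat, j :: nat). if i = j then 1 else 0 :: ('a + 'a) coord cpoly)"
  have cP: "c e \<in> poly_ring (preproj_coords Q \<alpha>)" for e by (cases e) (simp add: c_def)
  have reps: "fm_of Var \<in> reps" by (rule fm_of_reps)
  have "diag I * mu (fm_of Var) = mu (fm_of Var)"
    using gl_on[OF mu_gl[OF reps]] by simp
  then have "(\<Sum>(v, i, j)\<in>E. ent (diag I) (v, j) (v, i) * ent (mu (fm_of Var)) (v, i) (v, j)) = 0"
    using tr_gl_mult[of "diag I" "mu (fm_of Var)"] tr_mu[of "fm_of Var"] by simp
  also have "(\<Sum>(v, i, j)\<in>E. ent (diag I) (v, j) (v, i) * ent (mu (fm_of Var)) (v, i) (v, j)) = (\<Sum>e\<in>E. c e * \<phi> e)"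
    by (rule sum.cong[OF refl]) (auto simp: c_def E_def \<phi>_eq ent_diag I_def)
  finally have "c ?e0 * \<phi> ?e0 + (\<Sum>e\<in>E - {?e0}. c e * \<phi> e) = 0"
    by (simp only: sum.remove[OF finite_E e0])
  then have "\<phi> ?e0 = - (\<Sum>e\<in>E - {?e0}. c e * \<phi> e)"
    by (simp add: c_def eq_neg_iff_add_eq_0)
  also have "\<dots> = (\<Sum>e\<in>E - {?e0}. (- c e) * \<phi> e)"
    by (simp add: sum_negf)
  also have "\<dots> \<in> ideal_gen (preproj_coords Q \<alpha>) (\<phi> ` (E - {?e0}))"
    by (intro ideal_gen_sum ideal_gen_mult ideal_gen_base poly_ring_uminus cP imageI)
  finally show ?thesis .
qed

text \<open>Pairing with the representation dual to a single coordinate reads off that coordinate of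
  \<open>W\<close>.\<close>

lemma omega_nondegenerate:
  assumes W: "W \<in> reps" and z: "\<And>Z. Z \<in> reps \<Longrightarrow> omega W Z = 0" and b: "b \<in> arcs (double_quiver Q)"
  shows "W b = (0 :: ('v \<times> nat, complex) fmat)"
proof -
  have "Poly_Mapping.lookup (rvec W) k = 0" for k
  proof (cases "k \<in> K")
    case True
    obtain Z where Z: "Z \<in> reps" "\<forall>W\<in>reps. omega W Z = (\<Sum>l\<in>K. (if l = k then 1 else 0) * Poly_Mapping.lookup (rvec W) l)"
      using omega_dual[of "\<lambda>l. if l = k then 1 else 0"] by (elim bexE)
    have "(\<Sum>l\<in>K. (if l = k then 1 else 0) * Poly_Mapping.lookup (rvec W) l) = (\<Sum>l\<in>K. if l = k then Poly_Mapping.lookup (rvec W) l else 0)"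
      by (rule sum.cong) auto
    also have "\<dots> = Poly_Mapping.lookup (rvec W) k" using True by (simp add: sum.delta)
    finally show ?thesis using bspec[OF Z(2) W] z[OF Z(1)] by simp
  next
    case False
    then show ?thesis using funs_onD[OF rvec_in_funs_on] by metis
  qed
  moreover have "Poly_Mapping.lookup (rvec (\<lambda>_. 0)) k = 0" for k
    by (cases k) (simp add: lookup_rvec)
  ultimately have "rvec W = rvec (\<lambda>_. 0)" by (intro poly_mapping_eqI) simp
  moreover have "(\<lambda>_. 0) \<in> reps" by (simp add: reps_def)
  ultimately show ?thesis using rvec_eq_iff[OF W] b by blast
qed

lemma simple_smooth:
  assumes M: "M \<in> preproj_reps Q \<alpha>" and simple: "simple_rep (double_quiver Q) \<alpha> M"
  shows "scheme_smooth_at (preproj_coords Q \<alpha>) (preproj_ideal Q \<alpha>) (coords_of M)"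
proof -
  let ?C = "preproj_coords Q \<alpha>" and ?x = "coords_of M" and ?X = "blk M"
  have V: "M \<in> rep_space (double_quiver Q) \<alpha>" by (rule preproj_reps_rep_space[OF M])
  have X: "?X \<in> reps" and fmX: "fm_of ?x = ?X" by (rule blk_reps) (simp add: blk_eq_fm_of)
  obtain p where p: "p \<in> I" using simple_rep_nonempty[OF simple] by (meson ex_in_conv)
  define v0 where "v0 = fst p"
  have e0: "(v0, 0, 0) \<in> E" and p0: "(v0, 0) \<in> I" using p by (auto simp: v0_def E_def I_def)
  let ?e0 = "(v0, 0, 0) :: 'v \<times> nat \<times> nat"
  show ?thesis
    unfolding preproj_ideal_eq
  proof (rule smooth_if_independent[OF finite_E e0 \<phi>_relation[OF e0]])
    fix e :: "'v \<times> nat \<times> nat" assume e: "e \<in> E"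
    obtain v i j where eq: "e = (v, i, j)" by (rule prod_cases3)
    have "mu ?X = 0" using M preproj_reps_iff[OF V] by simp
    then show "poly_eval id ?x (\<phi> e) = 0" using e eval_\<phi>[of v i j ?x] by (simp add: eq fmX)
  next
    fix c :: "'v \<times> nat \<times> nat \<Rightarrow> complex"
    assume c: "\<And>z. z \<in> ?C \<Longrightarrow> (\<Sum>e\<in>E - {?e0}. c e * poly_eval id ?x (partial_deriv z (\<phi> e))) = 0"
    \<comment> \<open>A linear relation between the differentials is read, with transposed indices,
      as a block diagonal matrix whose entry at \<open>?e0\<close> is 0. The relation then says that
      tr (\<theta> dmu_X Y) = 0 for all Y.\<close>
    define \<theta> where "\<theta> = mat_on I (\<lambda>p q. if fst p = fst q \<and> (fst p, snd q, snd p) \<noteq> ?e0 then c (fst p, snd q, snd p) else 0)"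
    have ent_\<theta>: "ent \<theta> (v, j) (v, i) = (if (v, i, j) \<noteq> ?e0 then c (v, i, j) else 0)" if "(v, i, j) \<in> E" for v i j
      using that unfolding \<theta>_def ent_mat_on[OF finite_I] by (simp add: E_def I_def)
    have \<theta>: "\<theta> \<in> gl"
      unfolding gl_def mem_Collect_eq \<theta>_def ent_mat_on[OF finite_I] by (intro allI impI) (simp split: if_splits)
    have om: "omega (commr \<theta> ?X) Y = 0" if Y: "Y \<in> reps" for Y
    proof -
      let ?y = "coords_fm Y"
      have dY: "dmu ?X (fm_of ?y) = dmu ?X Y"
        using dmu_cong[of "fm_of ?y" Y ?X] fm_of_coords_fm[OF Y] by simp
      have line1: "poly.coeff (line ?x ?y (\<phi> (v, i, j))) 1 = ent (dmu ?X Y) (v, i) (v, j)" if "(v, i, j) \<in> E" for v i j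
        unfolding line_\<phi>[OF that] coeff_ent_mu fmX dY ..
      have "omega (commr \<theta> ?X) Y = tr (\<theta> * dmu ?X Y)" by (rule tr_dmu[symmetric])
      also have "\<dots> = (\<Sum>(v, i, j)\<in>E. ent \<theta> (v, j) (v, i) * ent (dmu ?X Y) (v, i) (v, j))" by (rule tr_gl_mult[OF \<theta>])
      also have "\<dots> = (\<Sum>e\<in>E. (if e \<noteq> ?e0 then c e else 0) * poly.coeff (line ?x ?y (\<phi> e)) 1)"
        by (rule sum.cong[OF refl]) (use ent_\<theta> line1 in \<open>simp add: split_paired_all\<close>)
      also have "\<dots> = (\<Sum>e\<in>E - {?e0}. c e * poly.coeff (line ?x ?y (\<phi> e)) 1)"
        by (rule sum.mono_neutral_cong_right[OF finite_E]) auto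
      also have "\<dots> = (\<Sum>e\<in>E - {?e0}. \<Sum>z\<in>?C. ?y z * (c e * poly_eval id ?x (partial_deriv z (\<phi> e))))"
      proof (rule sum.cong[OF refl])
        fix e assume "e \<in> E - {?e0}"
        then have e: "e \<in> E" by simp
        show "c e * poly.coeff (line ?x ?y (\<phi> e)) 1 = (\<Sum>z\<in>?C. ?y z * (c e * poly_eval id ?x (partial_deriv z (\<phi> e))))"
          unfolding coeff_line_1[OF finite_coords \<phi>_poly_ring[OF e]] sum_distrib_left
          by (rule sum.cong[OF refl]) (rule mult.left_commute)
      qed
      also have "\<dots> = (\<Sum>z\<in>?C. ?y z * (\<Sum>e\<in>E - {?e0}. c e * poly_eval id ?x (partial_deriv z (\<phi> e))))"
        unfolding sum_distrib_left by (rule sum.swap)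
      also have "\<dots> = 0" by (rule sum.neutral) (use c in simp)
      finally show ?thesis .
    qed
    have "commr \<theta> ?X b = 0" if "b \<in> arcs (double_quiver Q)" for b
      by (rule omega_nondegenerate[OF commr_reps[OF \<theta> X] om that])
    then have "commute \<theta> ?X" by (simp add: commute_def commr_def)
    then obtain d where d: "\<theta> = smul d (diag I)" by (rule simple_endomorphism_scalar[OF V simple \<theta>])
    \<comment> \<open>The omitted equation is a diagonal entry, so the scalar by which \<theta> acts
      can be read off there, and it is 0.\<close>
    have "ent \<theta> (v0, 0) (v0, 0) = 0" using ent_\<theta>[OF e0] by simp
    then have "d = 0" using p0 by (simp add: d ent_diag)
    then have z: "\<theta> = 0" by (simp add: d)
    show "\<forall>e\<in>E - {?e0}. c e = 0"
    proof
      fix e assume e: "e \<in> E - {?e0}"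
      obtain v i j where eq: "e = (v, i, j)" by (rule prod_cases3)
      show "c e = 0" using e ent_\<theta>[of v i j] by (simp add: eq z)
    qed
  qed
qed

end

section \<open>Invariants\<close>

context quiver_dim
begin

section \<open>Elements of GL(alpha) as block diagonal matrices\<close>

definition gfm :: "('v \<Rightarrow> 'r mat) \<Rightarrow> ('v \<times> nat, 'r::comm_ring_1) fmat" where
  "gfm g = mat_on I (\<lambda>p q. if fst p = fst q then g (fst p) $$ (snd p, snd q) else 0)"

definition gmat :: "('v \<times> nat, complex) fmat \<Rightarrow> 'v \<Rightarrow> complex mat" where
  "gmat \<theta> = (\<lambda>v\<in>verts R. mat (\<alpha> v) (\<alpha> v) (\<lambda>(i, j). ent \<theta> (v, i) (v, j)))"

lemma ent_gfm: "ent (gfm g) p q = (if p \<in> I \<and> q \<in> I \<and> fst p = fst q then g (fst p) $$ (snd p, snd q) else 0)"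
  unfolding gfm_def ent_mat_on[OF finite_I] by simp

lemma gfm_gl: "gfm g \<in> gl"
  unfolding gl_def mem_Collect_eq ent_gfm by simp

lemma gfm_gmat:
  assumes "\<theta> \<in> gl"
  shows "gfm (gmat \<theta>) = \<theta>"
proof (rule fmat_eqI)
  fix p q :: "'v \<times> nat"
  obtain v i w j where pq: "p = (v, i)" "q = (w, j)" by (cases p, cases q)
  show "ent (gfm (gmat \<theta>)) p q = ent \<theta> p q"
  proof (cases "p \<in> I \<and> q \<in> I \<and> fst p = fst q")
    case True
    then show ?thesis unfolding pq by (auto simp: ent_gfm gmat_def I_def)
  next
    case False
    then have "ent \<theta> p q = 0" using gl_ent[OF assms, of p q] by blast
    then show ?thesis unfolding ent_gfm if_not_P[OF False] by simp
  qed
qed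

lemma sum_cell: "(\<Sum>r\<in>cell v. f r) = (\<Sum>k<\<alpha> v. f (v, k))"
proof -
  have "cell v = Pair v ` {..<\<alpha> v}" by (auto simp: cell_def)
  then show ?thesis by (simp add: sum.reindex inj_on_def)
qed

lemma gfm_mult:
  assumes g: "\<And>v. v \<in> verts R \<Longrightarrow> g v \<in> carrier_mat (\<alpha> v) (\<alpha> v)" and h: "\<And>v. v \<in> verts R \<Longrightarrow> h v \<in> carrier_mat (\<alpha> v) (\<alpha> v)"
  shows "gfm g * gfm h = gfm (\<lambda>v. g v * h v)"
proof (rule fmat_eqI)
  fix p q
  show "ent (gfm g * gfm h) p q = ent (gfm (\<lambda>v. g v * h v)) p q"
  proof (cases "p \<in> I \<and> q \<in> I \<and> fst p = fst q")
    case True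
    define v where "v = fst p"
    have v: "v \<in> verts R" "snd p < \<alpha> v" "snd q < \<alpha> v" "fst q = v" using True by (auto simp: I_def v_def)
    have vk: "(v, k) \<in> I" if "k < \<alpha> v" for k using v(1) that by (simp add: I_def)
    have "ent (gfm g * gfm h) p q = (\<Sum>r\<in>cell v. ent (gfm g) p r * ent (gfm h) r q)"
      by (rule ent_mult_on) (auto simp: ent_gfm v_def in_cell_iff)
    also have "\<dots> = (\<Sum>k<\<alpha> v. g v $$ (snd p, k) * h v $$ (k, snd q))"
      unfolding sum_cell by (rule sum.cong[OF refl]) (use True vk v in \<open>simp add: ent_gfm v_def[symmetric]\<close>)
    also have "\<dots> = (g v * h v) $$ (snd p, snd q)"
      using g[OF v(1)] h[OF v(1)] v by (simp add: scalar_prod_def atLeast0LessThan)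
    finally show ?thesis using True by (simp add: ent_gfm v_def)
  next
    case False
    then have "ent (gfm g * gfm h) p q = 0" using gl_ent[OF gl_mult[OF gfm_gl gfm_gl], of g h p q] by blast
    then show ?thesis unfolding ent_gfm if_not_P[OF False] .
  qed
qed

lemma gfm_one: "gfm (\<lambda>v. 1\<^sub>m (\<alpha> v)) = diag I"
proof (rule fmat_eqI)
  fix p q
  show "ent (gfm (\<lambda>v. 1\<^sub>m (\<alpha> v))) p q = ent (diag I) p q"
    by (cases p; cases q) (auto simp: ent_gfm ent_diag I_def)
qed

lemma gfm_cong: "(\<And>v. v \<in> verts R \<Longrightarrow> g v = h v) \<Longrightarrow> gfm g = gfm h"
  by (rule fmat_eqI) (simp add: ent_gfm fst_in_verts)

lemma blk_gfm_left:
  assumes b: "b \<in> arcs R" and A: "g (head R b) \<in> carrier_mat (\<alpha> (head R b)) (\<alpha> (head R b))"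
    and V: "V b \<in> carrier_mat (\<alpha> (head R b)) (\<alpha> (tail R b))" and W: "W b = g (head R b) * V b"
  shows "blk W b = gfm g * blk V b"
proof (rule fmat_eqI)
  fix p q
  let ?h = "head R b"
  have hI: "(?h, k) \<in> I" if "k < \<alpha> ?h" for k using head_in_verts[OF b] that by (simp add: I_def)
  have "ent (gfm g * blk V b) p q = (\<Sum>r\<in>cell ?h. ent (gfm g) p r * ent (blk V b) r q)"
    by (rule ent_mult_on) (auto simp: ent_blk[OF b])
  also have "\<dots> = (\<Sum>k<\<alpha> ?h. ent (gfm g) p (?h, k) * ent (blk V b) (?h, k) q)" by (rule sum_cell)
  also have "\<dots> = ent (blk W b) p q"
  proof (cases "p \<in> cell ?h \<and> q \<in> cell (tail R b)")
    case True
    then have p: "fst p = ?h" "snd p < \<alpha> ?h" "snd q < \<alpha> (tail R b)" "p \<in> I"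
      using cell_subset_I[OF head_in_verts[OF b]] by (auto simp: cell_def)
    have "(\<Sum>k<\<alpha> ?h. ent (gfm g) p (?h, k) * ent (blk V b) (?h, k) q) = (\<Sum>k<\<alpha> ?h. g ?h $$ (snd p, k) * V b $$ (k, snd q))"
      by (rule sum.cong[OF refl]) (use True p hI A in \<open>simp add: ent_gfm ent_blk[OF b] cell_def\<close>)
    also have "\<dots> = (g ?h * V b) $$ (snd p, snd q)"
      using A V p by (simp add: scalar_prod_def atLeast0LessThan)
    finally show ?thesis using True by (simp add: ent_blk[OF b] W)
  next
    case False
    have z: "ent (gfm g) p (?h, k) * ent (blk V b) (?h, k) q = 0" for k
      using False in_cell_iff[of p ?h] by (simp add: ent_gfm ent_blk[OF b])
    show ?thesis
      unfolding ent_blk[OF b, of W] if_not_P[OF False] by (rule sum.neutral, rule ballI, rule z)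
  qed
  finally show "ent (blk W b) p q = ent (gfm g * blk V b) p q" ..
qed

lemma blk_gfm_right:
  assumes b: "b \<in> arcs R" and A: "g (tail R b) \<in> carrier_mat (\<alpha> (tail R b)) (\<alpha> (tail R b))"
    and V: "V b \<in> carrier_mat (\<alpha> (head R b)) (\<alpha> (tail R b))" and W: "W b = V b * g (tail R b)"
  shows "blk W b = blk V b * gfm g"
proof (rule fmat_eqI)
  fix p q
  let ?t = "tail R b"
  have hI: "(?t, k) \<in> I" if "k < \<alpha> ?t" for k using tail_in_verts[OF b] that by (simp add: I_def)
  have "ent (blk V b * gfm g) p q = (\<Sum>r\<in>cell ?t. ent (blk V b) p r * ent (gfm g) r q)"
    by (rule ent_mult_on) (auto simp: ent_blk[OF b])
  also have "\<dots> = (\<Sum>k<\<alpha> ?t. ent (blk V b) p (?t, k) * ent (gfm g) (?t, k) q)" by (rule sum_cell)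
  also have "\<dots> = ent (blk W b) p q"
  proof (cases "p \<in> cell (head R b) \<and> q \<in> cell ?t")
    case True
    then have q: "fst q = ?t" "snd q < \<alpha> ?t" "snd p < \<alpha> (head R b)" "q \<in> I"
      using cell_subset_I[OF tail_in_verts[OF b]] by (auto simp: cell_def)
    have "(\<Sum>k<\<alpha> ?t. ent (blk V b) p (?t, k) * ent (gfm g) (?t, k) q) = (\<Sum>k<\<alpha> ?t. V b $$ (snd p, k) * g ?t $$ (k, snd q))"
      by (rule sum.cong[OF refl]) (use True q hI A in \<open>simp add: ent_gfm ent_blk[OF b] cell_def\<close>)
    also have "\<dots> = (V b * g ?t) $$ (snd p, snd q)"
      using A V q by (simp add: scalar_prod_def atLeast0LessThan)
    finally show ?thesis using True by (simp add: ent_blk[OF b] W)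
  next
    case False
    have z: "ent (blk V b) p (?t, k) * ent (gfm g) (?t, k) q = 0" for k
      using False in_cell_iff[of q ?t] by (auto simp: ent_gfm ent_blk[OF b])
    show ?thesis
      unfolding ent_blk[OF b, of W] if_not_P[OF False] by (rule sum.neutral, rule ballI, rule z)
  qed
  finally show "ent (blk W b) p q = ent (blk V b * gfm g) p q" ..
qed

end

context preproj
begin

definition ginv :: "('v \<Rightarrow> complex mat) \<Rightarrow> 'v \<Rightarrow> complex mat" where
  "ginv g v = m_inv (ring_mat TYPE(complex) (\<alpha> v) ()) (g v)"

lemma GL_group_Units: "g \<in> GL_group Q \<alpha> \<Longrightarrow> v \<in> verts Q \<Longrightarrow> g v \<in> Units (ring_mat TYPE(complex) (\<alpha> v) ())"
  unfolding GL_group_def by (rule PiE_mem)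

lemma ring_mat_monoid: "monoid (ring_mat TYPE(complex) n ())"
  by (rule ring.is_monoid[OF ring_mat])

lemma GL_group_carrier:
  assumes g: "g \<in> GL_group Q \<alpha>" and v: "v \<in> verts Q"
  shows "g v \<in> carrier_mat (\<alpha> v) (\<alpha> v)" "ginv g v \<in> carrier_mat (\<alpha> v) (\<alpha> v)"
  using monoid.Units_closed[OF ring_mat_monoid GL_group_Units[OF g v]] monoid.Units_inv_closed[OF ring_mat_monoid GL_group_Units[OF g v]]
  by (simp_all add: ring_mat_simps ginv_def)

lemma GL_group_inverse:
  assumes g: "g \<in> GL_group Q \<alpha>"
  shows "gfm g * gfm (ginv g) = diag I" "gfm (ginv g) * gfm g = diag I"
proof -
  have m: "g v * ginv g v = 1\<^sub>m (\<alpha> v)" "ginv g v * g v = 1\<^sub>m (\<alpha> v)" if "v \<in> verts Q" for v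
    using monoid.Units_r_inv[OF ring_mat_monoid GL_group_Units[OF g that]] monoid.Units_l_inv[OF ring_mat_monoid GL_group_Units[OF g that]]
    by (simp_all add: ring_mat_simps ginv_def)
  have "gfm g * gfm (ginv g) = gfm (\<lambda>v. g v * ginv g v)" by (rule gfm_mult) (simp_all add: GL_group_carrier[OF g])
  also have "\<dots> = gfm (\<lambda>v. 1\<^sub>m (\<alpha> v))" by (rule gfm_cong) (simp add: m)
  finally show "gfm g * gfm (ginv g) = diag I" by (simp only: gfm_one)
  have "gfm (ginv g) * gfm g = gfm (\<lambda>v. ginv g v * g v)" by (rule gfm_mult) (simp_all add: GL_group_carrier[OF g])
  also have "\<dots> = gfm (\<lambda>v. 1\<^sub>m (\<alpha> v))" by (rule gfm_cong) (simp add: m)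
  finally show "gfm (ginv g) * gfm g = diag I" by (simp only: gfm_one)
qed

text \<open>\<open>GL_subst\<close> refers to the inverse in the ring of matrices at each vertex;
  uniqueness of inverses identifies it with the given \<theta>'.\<close>

lemma gmat_GL_group:
  assumes \<theta>: "\<theta> \<in> gl" "\<theta>' \<in> gl" "\<theta> * \<theta>' = diag I" "\<theta>' * \<theta> = diag I"
  shows "gmat \<theta> \<in> GL_group Q \<alpha>" "gfm (ginv (gmat \<theta>)) = \<theta>'"
proof -
  have c: "gmat \<eta> v \<in> carrier_mat (\<alpha> v) (\<alpha> v)" if "v \<in> verts Q" for v \<eta>
    using that by (simp add: gmat_def)
  have prod: "gmat \<eta> v * gmat \<eta>' v = 1\<^sub>m (\<alpha> v)"
    if v: "v \<in> verts Q" and \<eta>: "\<eta> \<in> gl" "\<eta>' \<in> gl" "\<eta> * \<eta>' = diag I" for v \<eta> \<eta>'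
  proof (rule eq_matI)
    fix i j assume "i < dim_row (1\<^sub>m (\<alpha> v) :: complex mat)" "j < dim_col (1\<^sub>m (\<alpha> v) :: complex mat)"
    then have ij: "i < \<alpha> v" "j < \<alpha> v" by simp_all
    have "gfm (\<lambda>v. gmat \<eta> v * gmat \<eta>' v) = gfm (gmat \<eta>) * gfm (gmat \<eta>')"
      by (rule gfm_mult[symmetric]) (simp_all add: c)
    then have "ent (gfm (\<lambda>v. gmat \<eta> v * gmat \<eta>' v)) (v, i) (v, j) = ent (diag I) (v, i) (v, j)"
      by (simp add: gfm_gmat \<eta>)
    then show "(gmat \<eta> v * gmat \<eta>' v) $$ (i, j) = 1\<^sub>m (\<alpha> v) $$ (i, j)"
      using v ij by (simp add: ent_gfm ent_diag I_def)
  qed (use c[OF v] in auto)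
  show GL: "gmat \<theta> \<in> GL_group Q \<alpha>"
    unfolding GL_group_def
  proof (rule PiE_I)
    fix v assume v: "v \<in> verts Q"
    show "gmat \<theta> v \<in> Units (ring_mat TYPE(complex) (\<alpha> v) ())"
      unfolding Units_def mem_Collect_eq ring_mat_simps
      using c[OF v] prod[OF v \<theta>(1,2,3)] prod[OF v \<theta>(2,1,4)] by blast
  next
    fix v assume "v \<notin> verts Q"
    then show "gmat \<theta> v = undefined" by (simp add: gmat_def)
  qed
  have "\<theta>' * (\<theta> * gfm (ginv (gmat \<theta>))) = \<theta>' * diag I"
    using GL_group_inverse(1)[OF GL] by (simp add: gfm_gmat[OF \<theta>(1)])
  then have "\<theta>' * \<theta> * gfm (ginv (gmat \<theta>)) = \<theta>' * diag I" by (simp only: mult.assoc)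
  then show "gfm (ginv (gmat \<theta>)) = \<theta>'"
    by (simp only: \<theta>(4) on_diag_left[OF finite_I gl_on[OF gfm_gl]] on_diag_right[OF finite_I gl_on[OF \<theta>(2)]])
qed

section \<open>Base change of coordinates, constancy on orbits and trace functions\<close>

definition subst_coords :: "('v \<Rightarrow> complex mat) \<Rightarrow> ('a + 'a) coord \<Rightarrow> ('a + 'a) coord cpoly" where
  "subst_coords g = coords_of (\<lambda>b.
     map_mat Const (g (head (double_quiver Q) b)) * generic_rep (double_quiver Q) \<alpha> b *
     map_mat Const (ginv g (tail (double_quiver Q) b)))"

lemma GL_subst_eq: "GL_subst (double_quiver Q) \<alpha> g = poly_eval Const (subst_coords g)"
  unfolding GL_subst_def subst_coords_def ginv_def ..

lemma map_fm_gfm: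
  assumes "\<And>v. v \<in> verts Q \<Longrightarrow> g v \<in> carrier_mat (\<alpha> v) (\<alpha> v)"
  shows "map_fm Const (gfm g) = gfm (\<lambda>v. map_mat Const (g v))"
proof (rule fmat_eqI)
  fix p q
  have C0: "Const 0 = (0 :: 'c cpoly)" by (simp add: Const_def)
  show "ent (map_fm Const (gfm g)) p q = ent (gfm (\<lambda>v. map_mat Const (g v))) p q"
  proof (cases "p \<in> I \<and> q \<in> I \<and> fst p = fst q")
    case True
    then have v: "fst p \<in> verts Q" "snd p < \<alpha> (fst p)" "snd q < \<alpha> (fst p)" by (auto simp: I_def)
    have "dim_row (g (fst p)) = \<alpha> (fst p)" "dim_col (g (fst p)) = \<alpha> (fst p)" using assms[OF v(1)] by auto
    then show ?thesis using True v by (simp add: ent_map_fm C0 ent_gfm)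
  qed (auto simp: ent_map_fm C0 ent_gfm)
qed

text \<open>Turns the substitution of polynomials in \<open>GL_subst\<close> into conjugation of the
  generic block matrices, where the calculus of terms and traces applies.\<close>

lemma fm_of_subst_coords:
  assumes g: "g \<in> GL_group Q \<alpha>" and b: "b \<in> arcs (double_quiver Q)"
  shows "fm_of (subst_coords g) b = map_fm Const (gfm g) * fm_of Var b * map_fm Const (gfm (ginv g))"
proof -
  let ?h = "head (double_quiver Q) b" and ?t = "tail (double_quiver Q) b"
  let ?A = "\<lambda>v. map_mat Const (g v) :: ('a + 'a) coord cpoly mat" and ?B = "\<lambda>v. map_mat Const (ginv g v) :: ('a + 'a) coord cpoly mat"
  let ?G = "generic_rep (double_quiver Q) \<alpha>"
  have hv: "?h \<in> verts Q" "?t \<in> verts Q" using head_in_verts[OF b] tail_in_verts[OF b] by simp_all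
  have A: "?A ?h \<in> carrier_mat (\<alpha> ?h) (\<alpha> ?h)" and B: "?B ?t \<in> carrier_mat (\<alpha> ?t) (\<alpha> ?t)"
    using GL_group_carrier(1)[OF g hv(1)] GL_group_carrier(2)[OF g hv(2)] by simp_all
  have G: "?G b \<in> carrier_mat (\<alpha> ?h) (\<alpha> ?t)" by (simp add: generic_rep_def)
  have "fm_of (subst_coords g) b = blk (\<lambda>b. ?A (head (double_quiver Q) b) * ?G b * ?B (tail (double_quiver Q) b)) b"
    unfolding subst_coords_def blk_eq_fm_of ..
  also have "\<dots> = blk (\<lambda>b. ?A (head (double_quiver Q) b) * ?G b) b * gfm ?B"
    by (rule blk_gfm_right[OF b], rule B, rule mult_carrier_mat[OF A G], rule refl)
  also have "blk (\<lambda>b. ?A (head (double_quiver Q) b) * ?G b) b = gfm ?A * blk ?G b"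
    by (rule blk_gfm_left[OF b], rule A, rule G, rule refl)
  also have "blk ?G b = fm_of Var b" by (rule blk_generic[OF b])
  also have "gfm ?A = map_fm Const (gfm g)" by (rule map_fm_gfm[symmetric]) (rule GL_group_carrier(1)[OF g])
  also have "gfm ?B = map_fm Const (gfm (ginv g))" by (rule map_fm_gfm[symmetric]) (rule GL_group_carrier(2)[OF g])
  finally show ?thesis .
qed

lemma map_fm_sig:
  fixes h :: "'r::comm_ring_1 \<Rightarrow> 's::comm_ring_1"
  assumes "comm_ring_map h"
  shows "map_fm h (sig (fm_of x) l) = sig (fm_of (\<lambda>z. h (x z))) l"
proof -
  interpret comm_ring_map h by (rule assms)
  have z: "map_fm h (0 :: ('v \<times> nat, 'r) fmat) = 0" by (rule fmat_eqI) (simp add: ent_map_fm h_0)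
  show ?thesis
  proof (cases l)
    case (Inl v)
    then show ?thesis using z map_fm_diag[OF finite_cell, of v] by (simp add: sig_def)
  next
    case (Inr b)
    show ?thesis
    proof (cases "b \<in> arcs (double_quiver Q)")
      case True
      have "sig (fm_of x) l = fm_of x b" "sig (fm_of (\<lambda>z. h (x z))) l = fm_of (\<lambda>z. h (x z)) b"
        using True by (simp_all add: Inr sig_def)
      then show ?thesis by (simp only: map_fm_fm_of[OF preproj_Q True])
    next
      case False
      then have "sig (fm_of x) l = 0" "sig (fm_of (\<lambda>z. h (x z))) l = 0"
        by (simp_all add: Inr sig_def)
      then show ?thesis by (simp only: z)
    qed
  qed
qed

lemma ideal_eval_0:
  assumes V: "V \<in> preproj_reps Q \<alpha>" and f: "f \<in> preproj_ideal Q \<alpha>"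
  shows "poly_eval id (coords_of V) f = 0"
proof (rule ideal_gen_eval_0[OF _ f[unfolded preproj_ideal_eq]])
  fix s assume "s \<in> \<phi> ` E"
  then obtain e where e: "e \<in> E" "s = \<phi> e" by blast
  obtain v i j where eq: "e = (v, i, j)" by (rule prod_cases3)
  have "mu (fm_of (coords_of V)) = 0"
    using V preproj_reps_iff[OF preproj_reps_rep_space[OF V]] by (simp add: blk_eq_fm_of)
  then show "poly_eval id (coords_of V) s = 0" using e eval_\<phi>[of v i j "coords_of V"] by (simp add: eq)
qed

text \<open>An invariant is fixed by base change only modulo the ideal. Evaluation at a
  representation of the preprojective algebra kills the ideal, so the value is constant along the
  orbit.\<close>

lemma orbit_invariant:
  assumes V: "V \<in> preproj_reps Q \<alpha>" and f: "f \<in> preproj_invariants Q \<alpha>"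
    and \<theta>: "\<theta> \<in> gl" "\<theta>' \<in> gl" "\<theta> * \<theta>' = diag I" "\<theta>' * \<theta> = diag I"
  shows "poly_eval id (coords_fm (\<lambda>b. \<theta> * blk V b * \<theta>')) f = poly_eval id (coords_of V) f"
proof -
  let ?x = "coords_of V" and ?g = "gmat \<theta>"
  let ?y = "\<lambda>z. poly_eval id ?x (subst_coords ?g z)"
  note g = gmat_GL_group[OF \<theta>]
  have "GL_subst (double_quiver Q) \<alpha> ?g f - f \<in> preproj_ideal Q \<alpha>"
    using f g(1) unfolding preproj_invariants_def by blast
  from ideal_eval_0[OF V this] have 1: "poly_eval id ?x (poly_eval Const (subst_coords ?g) f) = poly_eval id ?x f"
    by (simp add: GL_subst_eq ev.h_diff)
  have 2: "poly_eval id ?x (poly_eval Const (subst_coords ?g) f) = poly_eval id ?y f"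
    unfolding ev.comp_poly_eval by (rule arg_cong[where f = "\<lambda>h. poly_eval h ?y f"]) (simp add: fun_eq_iff poly_eval_Const)
  have C0: "poly_eval id ?x (Const c) = c" for c by (simp add: poly_eval_Const)
  have C1: "Const 0 = (0 :: ('a + 'a) coord cpoly)" by (simp add: Const_def)
  have cm: "map_fm (poly_eval id ?x) (map_fm Const X) = X" for X :: "('v \<times> nat, complex) fmat"
    by (rule fmat_eqI) (simp add: ent_map_fm C1 ev.h_0 C0)
  have y: "fm_of ?y b = \<theta> * blk V b * \<theta>'" if b: "b \<in> arcs (double_quiver Q)" for b
  proof -
    have "fm_of ?y b = map_fm (poly_eval id ?x) (fm_of (subst_coords ?g) b)"
      by (rule sym) (rule comm_ring_map.map_fm_fm_of[OF ev.comm_ring_map_axioms preproj_Q b])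
    also have "\<dots> = gfm ?g * map_fm (poly_eval id ?x) (fm_of Var b) * gfm (ginv ?g)"
      by (simp only: fm_of_subst_coords[OF g(1) b] ev.map_fm_mult cm)
    also have "map_fm (poly_eval id ?x) (fm_of Var b) = fm_of (\<lambda>z. poly_eval id ?x (Var z)) b"
      by (rule ev.map_fm_fm_of[OF preproj_Q b])
    also have "(\<lambda>z. poly_eval id ?x (Var z)) = ?x" by (simp add: fun_eq_iff poly_eval_Var)
    finally show ?thesis by (simp only: g(2) gfm_gmat[OF \<theta>(1)] blk_eq_fm_of)
  qed
  have "poly_eval id (coords_fm (\<lambda>b. \<theta> * blk V b * \<theta>')) f = poly_eval id ?y f"
  proof (rule poly_eval_cong)
    show "f \<in> poly_ring (preproj_coords Q \<alpha>)" using f by (simp add: preproj_invariants_def)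
    fix z :: "('a + 'a) coord" assume z: "z \<in> preproj_coords Q \<alpha>"
    obtain b i j where eq: "z = (b, i, j)" by (rule prod_cases3)
    let ?h = "head (double_quiver Q) b" and ?t = "tail (double_quiver Q) b"
    have b: "b \<in> arcs (double_quiver Q)" and ij: "(?h, i) \<in> cell ?h" "(?t, j) \<in> cell ?t"
      using z unfolding eq rep_coords_def cell_def by auto
    have "coords_fm (\<lambda>b. \<theta> * blk V b * \<theta>') z = ent (fm_of ?y b) (?h, i) (?t, j)"
      by (simp add: eq coords_fm_def y[OF b])
    also have "\<dots> = ?y z" using ij by (simp add: ent_fm_of[OF b] eq)
    finally show "coords_fm (\<lambda>b. \<theta> * blk V b * \<theta>') z = ?y z" .
  qed
  then show ?thesis using 1 2 by simp
qed

text \<open>Base change conjugates the value of the term at the generic matrices, so its trace is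
  fixed as a polynomial and not only modulo the ideal.\<close>

lemma trace_invariant: "tr (nev I Const (sig (fm_of Var)) t) \<in> preproj_invariants Q \<alpha>"
proof -
  let ?N = "nev I Const (sig (fm_of Var :: 'a + 'a \<Rightarrow> ('v \<times> nat, ('a + 'a) coord cpoly) fmat))"
  have D: "ent (diag J) p q \<in> poly_ring (preproj_coords Q \<alpha>)" if "finite J" for J p q
    using that by (simp add: ent_diag)
  have "ent (?N t) p q \<in> poly_ring (preproj_coords Q \<alpha>)" for p q
  proof (induction t arbitrary: p q)
    case (Gen l)
    have fm: "ent (fm_of Var b) p q \<in> poly_ring (preproj_coords Q \<alpha>)" if "b \<in> arcs (double_quiver Q)" for b
      using that unfolding ent_fm_of[OF that] by (auto simp: cell_def rep_coords_def intro!: poly_ring_Var)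
    show ?case by (cases l) (simp_all add: sig_def D fm del: double_quiver_simps)
  next
    case (Cst c)
    show ?case by (simp add: poly_ring_mult D)
  next
    case (Add s t)
    then show ?case by (simp add: poly_ring_add)
  next
    case (Mul s t)
    then show ?case
      unfolding nev.simps ent_mult_left[OF finite_idx subset_refl] by (intro poly_ring_sum poly_ring_mult)
  qed
  then have ring: "tr (?N t) \<in> poly_ring (preproj_coords Q \<alpha>)"
    unfolding tr_def by (intro poly_ring_sum)
  have "GL_subst (double_quiver Q) \<alpha> g (tr (?N t)) = tr (?N t)" if g: "g \<in> GL_group Q \<alpha>" for g
  proof -
    let ?h = "poly_eval Const (subst_coords g) :: ('a + 'a) coord cpoly \<Rightarrow> ('a + 'a) coord cpoly"
    let ?\<Theta> = "map_fm Const (gfm g) :: ('v \<times> nat, ('a + 'a) coord cpoly) fmat"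
      and ?\<Theta>' = "map_fm Const (gfm (ginv g)) :: ('v \<times> nat, ('a + 'a) coord cpoly) fmat"
    interpret C: comm_ring_map "Const :: complex \<Rightarrow> ('a + 'a) coord cpoly" by (rule comm_ring_map_Const)
    have hC: "?h (Const c) = Const c" for c by (rule poly_eval_Const) (rule C.h_0)
    have hV: "?h (Var z) = subst_coords g z" for z by (rule poly_eval_Var) (rule C.h_0 C.h_1)+
    have \<Theta>: "?\<Theta> \<in> gl" "?\<Theta>' \<in> gl"
      unfolding gl_def mem_Collect_eq ent_map_fm[of Const, OF C.h_0] ent_gfm using C.h_0 by (auto split: if_splits)
    have \<Theta>1: "?\<Theta>' * ?\<Theta> = diag I" "?\<Theta> * ?\<Theta>' = diag I"
      unfolding C.map_fm_mult[symmetric] GL_group_inverse[OF g] by (simp_all add: C.map_fm_diag)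
    have "sig (fm_of (\<lambda>z. ?h (Var z))) = sig (\<lambda>b. ?\<Theta> * fm_of Var b * ?\<Theta>')"
      unfolding hV by (rule sig_cong) (rule fm_of_subst_coords[OF g])
    then have s: "map_fm ?h (sig (fm_of Var) l) = sig (\<lambda>b. ?\<Theta> * fm_of Var b * ?\<Theta>') l" for l
      by (simp only: map_fm_sig[OF evC.comm_ring_map_axioms])
    have "?h (tr (?N t)) = tr (map_fm ?h (?N t))" by (rule evC.tr_map_fm[symmetric])
    also have "map_fm ?h (?N t) = nev I Const (sig (\<lambda>b. ?\<Theta> * fm_of Var b * ?\<Theta>')) t"
      by (simp only: evC.map_fm_nev[OF finite_I] hC s)
    also have "\<dots> = ?\<Theta> * ?N t * ?\<Theta>'" by (rule nev_conj[OF \<Theta> \<Theta>1 fm_of_reps])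
    also have "tr \<dots> = tr (?\<Theta>' * ?\<Theta> * ?N t)" by (rule tr_cyclic)
    also have "\<dots> = tr (?N t)" unfolding \<Theta>1 by (simp only: on_diag_left[OF finite_I nev_on[OF fm_of_reps]])
    finally show ?thesis by (simp only: GL_subst_eq)
  qed
  then show ?thesis
    using ring unfolding preproj_invariants_def preproj_ideal_eq by simp
qed

lemma eval_trace:
  "poly_eval id x (tr (nev I Const (sig (fm_of Var)) t)) = tr (nev I id (sig (fm_of x)) t)"
proof -
  have "poly_eval id x (tr (nev I Const (sig (fm_of Var)) t)) = tr (map_fm (poly_eval id x) (nev I Const (sig (fm_of Var)) t))"
    by (rule ev.tr_map_fm[symmetric])
  also have "map_fm (poly_eval id x) (nev I Const (sig (fm_of Var)) t) =
      nev I (\<lambda>c. poly_eval id x (Const c)) (sig (fm_of (\<lambda>z. poly_eval id x (Var z)))) t"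
    by (simp only: ev.map_fm_nev[OF finite_I] map_fm_sig[OF ev.comm_ring_map_axioms])
  also have "(\<lambda>z. poly_eval id x (Var z)) = x" by (simp add: fun_eq_iff poly_eval_Var)
  also have "(\<lambda>c. poly_eval id x (Const c)) = id" by (simp add: fun_eq_iff poly_eval_Const)
  finally show ?thesis .
qed

lemma over_simple:
  assumes V: "V \<in> preproj_reps Q \<alpha>" and M: "M \<in> preproj_reps Q \<alpha>" and simple: "simple_rep (double_quiver Q) \<alpha> M"
    and eq: "preproj_proj Q \<alpha> V = preproj_proj Q \<alpha> M"
  shows "simple_rep (double_quiver Q) \<alpha> V"
proof (rule simple_if_same_traces[OF preproj_reps_rep_space[OF V] preproj_reps_rep_space[OF M] simple])
  fix t :: "('v + ('a + 'a)) nct"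
  have "poly_eval id (coords_of V) (tr (nev I Const (sig (fm_of Var)) t)) = poly_eval id (coords_of M) (tr (nev I Const (sig (fm_of Var)) t))"
    using fun_cong[OF eq, of "tr (nev I Const (sig (fm_of Var)) t)"] trace_invariant[of t]
    by (simp add: preproj_proj_def)
  then show "tr (nev I id (sig (blk V)) t) = tr (nev I id (sig (blk M)) t)"
    by (simp only: eval_trace blk_eq_fm_of)
qed

end

section \<open>Degeneration to a semisimple representation\<close>

lemma smul_zero_right: "smul c 0 = 0"
  by (rule fmat_eqI) simp

text \<open>The hypotheses \<open>z\<close> say that \<open>A\<close> and \<open>B\<close> are block
  triangular for the pair \<open>p\<close>, \<open>r\<close>. Passing from a block triangular matrix
  to its diagonal part is multiplicative.\<close>

lemma degenerate_mult:
  fixes p r A B :: "('i, complex) fmat"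
  assumes I: "finite I" "on I A" and p: "p * p = p" "r * r = r" "p * r = 0" "r * p = 0" "p + r = diag I"
    and z: "r * A * p = 0" "r * B * p = 0"
  shows "(p * A * p + r * A * r) * (p * B * p + r * B * r) = p * (A * B) * p + r * (A * B) * r"
proof -
  have "A * B = A * (p + r) * B" unfolding p(5) on_diag_right[OF I] ..
  then have AB: "A * B = A * p * B + A * r * B" by (simp only: distrib_left distrib_right)
  have "p * A * p * (p * B * p) = p * A * (p * p) * B * p" "p * A * p * (r * B * r) = p * A * (p * r) * B * r"
    "r * A * r * (p * B * p) = r * A * (r * p) * B * p" "r * A * r * (r * B * r) = r * A * (r * r) * B * r"
    by (simp_all only: mult.assoc)
  then have "(p * A * p + r * A * r) * (p * B * p + r * B * r) = p * A * p * B * p + r * A * r * B * r"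
    by (simp add: distrib_left distrib_right p)
  moreover have "p * (A * r * B) * p = p * A * (r * B * p)" "r * (A * p * B) * r = r * A * p * B * r"
    by (simp_all only: mult.assoc)
  then have "p * (A * B) * p + r * (A * B) * r = p * A * p * B * p + r * A * r * B * r"
    unfolding AB by (simp add: distrib_left distrib_right z mult.assoc[symmetric])
  ultimately show ?thesis by simp
qed

context quiver_dim
begin

text \<open>A complete system of orthogonal idempotents in the endomorphism algebra of
  \<open>X\<close>, which encodes a direct sum decomposition as a set that can be refined. Excluding
  0 makes its cardinality the number of summands.\<close>

definition idec :: "('b \<Rightarrow> ('v \<times> nat, complex) fmat) \<Rightarrow> ('v \<times> nat, complex) fmat set \<Rightarrow> bool" where
  "idec X P \<longleftrightarrow> finite P \<and> P \<subseteq> gl \<and> 0 \<notin> P \<and> (\<forall>p\<in>P. p * p = p \<and> commute p X) \<and>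
     (\<forall>p\<in>P. \<forall>q\<in>P. p \<noteq> q \<longrightarrow> p * q = 0) \<and> \<Sum>P = diag I"

lemma idecD:
  assumes "idec X P"
  shows "finite P" "P \<subseteq> gl" "0 \<notin> P" "\<And>p. p \<in> P \<Longrightarrow> p * p = p" "\<And>p. p \<in> P \<Longrightarrow> commute p X"
    "\<And>p q. p \<in> P \<Longrightarrow> q \<in> P \<Longrightarrow> p \<noteq> q \<Longrightarrow> p * q = 0" "\<Sum>P = diag I"
  using assms unfolding idec_def by blast+

text \<open>One nonzero vector from the image of each idempotent gives an independent family, since
  applying an idempotent to a relation isolates its own term. The bound ensures that a decomposition
  of maximal length exists.\<close>

lemma idec_card:
  assumes "idec X P"
  shows "card P \<le> card I"
proof -
  note P = idecD[OF assms]
  have "\<exists>u. app p u \<noteq> 0" if p: "p \<in> P" for p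
  proof -
    have "p \<noteq> 0" using P(3) p by blast
    then obtain x y where "ent p x y \<noteq> 0" by (metis ent_0 fmat_eqI)
    then have "app p (unit_fun y) \<noteq> 0" using lookup_app_unit[of p y x] by (metis lookup_zero)
    then show ?thesis by blast
  qed
  then have "\<forall>p\<in>P. \<exists>u. app p u \<noteq> 0" by blast
  then obtain u where u: "\<forall>p\<in>P. app p (u p) \<noteq> 0" by (rule bchoice[THEN exE])
  let ?h = "\<lambda>p. app p (u p)"
  have "inj_on ?h P \<and> \<not> fdependent (?h ` P)"
  proof (rule independent_family[OF P(1)])
    fix c assume sum0: "(\<Sum>p\<in>P. fscale (c p) (?h p)) = 0"
    show "\<forall>p\<in>P. c p = 0"
    proof
      fix p assume p: "p \<in> P"
      have t: "app p (fscale (c q) (?h q)) = (if q = p then fscale (c p) (?h p) else 0)" if q: "q \<in> P" for q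
        using P(4)[OF p] P(6)[OF p q] by (auto simp: app_scale app_mult[symmetric])
      have "0 = app p (\<Sum>q\<in>P. fscale (c q) (?h q))" by (simp add: sum0)
      also have "\<dots> = (\<Sum>q\<in>P. if q = p then fscale (c p) (?h p) else 0)"
        unfolding app_sum_right by (rule sum.cong[OF refl t])
      also have "\<dots> = fscale (c p) (?h p)" using p P(1) by simp
      finally show "c p = 0" using bspec[OF u p] by (metis fs.scale_eq_0_iff)
    qed
  qed
  moreover have "?h ` P \<subseteq> funs_on I" using P(2) gl_on app_in_funs_on by blast
  ultimately show ?thesis using independent_funs_on_bound[OF finite_I, of "?h ` P"] card_image[of ?h P] by metis
qed

text \<open>The idempotent \<open>e\<close> is replaced by \<open>p\<close> and
  \<open>e - p\<close>. The diagonal part \<open>X'\<close> of \<open>X\<close> for the pair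
  \<open>p\<close>, 1 - p commutes with \<open>p\<close> by construction, and it commutes with any
  endomorphism of \<open>X\<close> that commutes with \<open>p\<close>; this covers \<open>e\<close>
  and the remaining idempotents, which are orthogonal to \<open>p\<close>.\<close>

lemma idec_split:
  fixes X X' :: "'b \<Rightarrow> ('v \<times> nat, complex) fmat"
  assumes P: "idec X P" and e: "e \<in> P" and p: "p \<in> gl" "p * p = p" "p * e = p" "e * p = p" "p \<noteq> 0" "p \<noteq> e"
    and X: "X \<in> reps" and X': "\<And>b. b \<in> arcs R \<Longrightarrow> X' b = p * X b * p + (diag I - p) * X b * (diag I - p)"
  shows "idec X' (insert p (insert (e - p) (P - {e})))" "card (insert p (insert (e - p) (P - {e}))) = Suc (card P)"
proof -
  note D = idecD[OF P]
  let ?q = "e - p" and ?r = "diag I - p" and ?P = "insert p (insert (e - p) (P - {e}))"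
  have on: "on I p" "on I e" using gl_on p(1) D(2) e by blast+
  have e2: "e * e = e" by (rule D(4)[OF e])
  have pj: "s * p = 0" "p * s = 0" if s: "s \<in> P - {e}" for s
  proof -
    have "s * p = (s * e) * p" "p * s = p * (e * s)" by (simp_all only: mult.assoc p(3,4)) (simp only: mult.assoc[symmetric] p(3))
    then show "s * p = 0" "p * s = 0" using D(6)[of s e] D(6)[of e s] s e by auto
  qed
  have qj: "s * ?q = 0" "?q * s = 0" if s: "s \<in> P - {e}" for s
    using D(6)[of s e] D(6)[of e s] s e pj[OF s] by (auto simp: left_diff_distrib right_diff_distrib)
  have pq: "p * ?q = 0" "?q * p = 0" by (simp_all add: left_diff_distrib right_diff_distrib p(2-4))
  have qq: "?q * ?q = ?q" by (simp add: left_diff_distrib right_diff_distrib p(2-4) e2)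
  have q0: "?q \<noteq> 0" using p(6) by simp
  have p_nin: "p \<notin> P - {e}" using pj(1)[of p] p(2,5) by auto
  have q_nin: "?q \<notin> P - {e}" using qj(1)[of ?q] qq q0 by auto
  have pq_ne: "p \<noteq> ?q"
  proof
    assume "p = ?q"
    with pq(1) have "p * p = 0" by simp
    then show False using p(2,5) by simp
  qed
  have fin: "finite (P - {e})" using D(1) by simp
  have n2: "p \<notin> insert ?q (P - {e})" using p_nin pq_ne by blast
  show "card ?P = Suc (card P)"
    by (simp only: card.insert[OF finite.insertI[OF fin] n2] card.insert[OF fin q_nin] card.remove[OF D(1) e])
  have pr: "p * ?r = 0" "?r * p = 0" using on(1) p(2) by (simp_all add: left_diff_distrib right_diff_distrib)
  have com: "s * X' b = X' b * s" if s: "on I s" "s * X b = X b * s" "s * p = p * s" and b: "b \<in> arcs R" for s b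
  proof -
    have sI: "s * diag I = s" "diag I * s = s" using s(1) by simp_all
    have sr: "s * ?r = ?r * s" by (simp only: left_diff_distrib right_diff_distrib sI s(3))
    have conj: "s * (y * X b * y) = y * X b * y * s" if y: "s * y = y * s" for y
    proof -
      have "s * (y * X b * y) = (s * y) * X b * y" by (simp only: mult.assoc)
      also have "\<dots> = y * (s * X b) * y" unfolding y by (simp only: mult.assoc)
      also have "\<dots> = y * X b * (s * y)" unfolding s(2) by (simp only: mult.assoc)
      also have "\<dots> = y * X b * y * s" unfolding y by (simp only: mult.assoc)
      finally show ?thesis .
    qed
    show ?thesis by (simp only: X'[OF b] distrib_left distrib_right conj[OF s(3)] conj[OF sr])
  qed
  have comp: "commute p X'"
    unfolding commute_def
  proof
    fix b assume b: "b \<in> arcs R"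
    have "p * (p * X b * p) = p * X b * p" by (simp only: mult.assoc[symmetric] p(2))
    moreover have "p * (?r * X b * ?r) = 0" by (simp only: mult.assoc[symmetric] pr mult_zero_left)
    moreover have "p * X b * p * p = p * X b * p" by (simp only: mult.assoc p(2))
    moreover have "?r * X b * ?r * p = 0" by (simp only: mult.assoc pr mult_zero_right)
    ultimately show "p * X' b = X' b * p" by (simp only: X'[OF b] distrib_left distrib_right)
  qed
  have come: "commute e X'"
    unfolding commute_def using com[OF on(2)] D(5)[OF e] p(3,4) unfolding commute_def by simp
  have comq: "commute ?q X'"
    using comp come unfolding commute_def by (simp add: left_diff_distrib right_diff_distrib)
  have coms: "commute s X'" if s: "s \<in> P - {e}" for s
  proof -
    have "on I s" using s D(2) gl_on by blast
    then show ?thesis using com[of s] D(5)[of s] s pj[OF s] unfolding commute_def by simp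
  qed
  have "\<Sum>?P = p + (?q + \<Sum>(P - {e}))" using p_nin q_nin pq_ne fin by simp
  also have "\<dots> = e + \<Sum>(P - {e})" by (simp only: add.assoc[symmetric] add_diff_cancel_left' diff_add_cancel add.commute[of p])
  also have "\<dots> = \<Sum>P" using sum.remove[OF D(1) e, of "\<lambda>x. x"] by simp
  finally have sumP: "\<Sum>?P = diag I" by (simp only: D(7))
  show "idec X' ?P"
    unfolding idec_def
  proof (intro conjI)
    show "finite ?P" using fin by simp
    show "?P \<subseteq> gl" using p(1) D(2) e gl_diff[of e p] by auto
    show "0 \<notin> ?P" using p(5) q0 D(3) by auto
    show "\<forall>s\<in>?P. s * s = s \<and> commute s X'" using p(2) qq comp comq coms D(4) by blast
    show "\<Sum>?P = diag I" by (rule sumP)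
    have "s * t = 0" if st: "s \<in> ?P" "t \<in> ?P" "s \<noteq> t" for s t
    proof -
      consider "s = p" | "s = ?q" | "s \<in> P - {e}" using st(1) by blast
      then show ?thesis
      proof cases
        case 1
        then show ?thesis using st pq(1) pj(2)[of t] by auto
      next
        case 2
        then show ?thesis using st pq(2) qj(2)[of t] by auto
      next
        case 3
        then show ?thesis using st pj(1)[of s] qj(1)[of s] D(6)[of s t] by auto
      qed
    qed
    then show "\<forall>s\<in>?P. \<forall>t\<in>?P. s \<noteq> t \<longrightarrow> s * t = 0" by blast
  qed
qed

text \<open>The part of the image of an idempotent at a vertex, described by its fixed
  vectors.\<close>

definition comp_space :: "('v \<times> nat, complex) fmat \<Rightarrow> 'v \<Rightarrow> complex vec set" where
  "comp_space p v = {x \<in> carrier_vec (\<alpha> v). emb v x \<in> {w. app p w = w}}"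

lemma comp_space_subrep:
  assumes V: "V \<in> rep_space R \<alpha>" and p: "commute p (blk V)"
  shows "subrep R \<alpha> V (comp_space p)"
proof -
  have "subrep R \<alpha> V (\<lambda>v. {x \<in> carrier_vec (\<alpha> v). emb v x \<in> {w. app p w = w}})"
  proof (rule subrep_invariant[OF V])
    show "fsubspace {w. app p w = w}"
      by (rule fs.subspaceI) (simp_all add: app_add_right app_scale)
    fix b w assume b: "b \<in> arcs R" and w: "w \<in> {w. app p w = w}"
    have "p * blk V b = blk V b * p" using p b by (simp add: commute_def)
    then have "app p (app (blk V b) w) = app (blk V b) (app p w)" by (simp only: app_mult[symmetric])
    then show "app (blk V b) w \<in> {w. app p w = w}" using w by simp
  qed
  then show ?thesis by (simp only: comp_space_def[abs_def])
qed

text \<open>The components of a vector are its images under the idempotents; applying the j-th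
  idempotent to any decomposition recovers the j-th component, which gives uniqueness.\<close>

lemma idec_direct_sum:
  assumes V: "V \<in> rep_space R \<alpha>" and P: "idec (blk V) P" and e: "bij_betw e {..<r} P"
  shows "direct_sum_decomp R \<alpha> V r (\<lambda>k. comp_space (e k))"
  unfolding direct_sum_decomp_def
proof (intro conjI allI impI ballI)
  note D = idecD[OF P]
  have eP: "e k \<in> P" if "k < r" for k using e that by (auto simp: bij_betw_def)
  have egl: "e k \<in> gl" if "k < r" for k using eP[OF that] D(2) by blast
  show "subrep R \<alpha> V (comp_space (e k))" if "k < r" for k
    by (rule comp_space_subrep[OF V D(5)[OF eP[OF that]]])
  fix v and x :: "complex vec" assume v: "v \<in> verts R" and x: "x \<in> carrier_vec (\<alpha> v)"
  have cell: "app (e k) (emb v x) \<in> funs_on (cell v)" if "k < r" for k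
    by (rule gl_app_cell[OF egl[OF that] emb_funs_on])
  let ?u = "\<lambda>k\<in>{..<r}. unemb v (app (e k) (emb v x))"
  have uemb: "emb v (?u k) = app (e k) (emb v x)" if "k < r" for k
    using that emb_unemb[OF cell[OF that]] by simp
  have uin: "?u k \<in> comp_space (e k) v" if "k < r" for k
    using that uemb[OF that] D(4)[OF eP[OF that]] by (simp add: comp_space_def app_mult[symmetric])
  have uc: "?u \<in> {..<r} \<rightarrow> carrier_vec (\<alpha> v)" by auto
  have "emb v (finsum_vec TYPE(complex) (\<alpha> v) ?u {..<r}) = (\<Sum>k<r. emb v (?u k))" by (rule emb_finsum[OF uc])
  also have "\<dots> = (\<Sum>k<r. app (e k) (emb v x))" by (rule sum.cong[OF refl]) (simp only: uemb lessThan_iff)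
  also have "\<dots> = app (\<Sum>k<r. e k) (emb v x)" by (simp only: app_sum)
  also have "(\<Sum>k<r. e k) = \<Sum>P" by (rule sum.reindex_bij_betw[OF e])
  also have "app (\<Sum>P) (emb v x) = emb v x"
    unfolding D(7) by (rule app_diag_funs_on[OF finite_I funs_on_mono[OF cell_subset_I[OF v] emb_funs_on]])
  finally have "finsum_vec TYPE(complex) (\<alpha> v) ?u {..<r} = x"
    unfolding emb_eq_iff[OF finsum_vec_closed[OF uc] x] .
  then have xu: "x = finsum_vec TYPE(complex) (\<alpha> v) ?u {..<r}" by (rule sym)
  have uPi: "?u \<in> (\<Pi>\<^sub>E k\<in>{..<r}. comp_space (e k) v)"
  proof (rule PiE_I)
    show "?u k \<in> comp_space (e k) v" if "k \<in> {..<r}" for k using uin[of k] that by (simp only: lessThan_iff)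
    show "?u k = undefined" if "k \<notin> {..<r}" for k using that by (simp only: restrict_def if_False)
  qed
  have uniq: "w = ?u" if w: "w \<in> (\<Pi>\<^sub>E k\<in>{..<r}. comp_space (e k) v)" and xw: "x = finsum_vec TYPE(complex) (\<alpha> v) w {..<r}" for w
  proof (rule PiE_ext[OF w uPi])
    fix j assume "j \<in> {..<r}"
    then have j: "j < r" by simp
    have wk: "w k \<in> carrier_vec (\<alpha> v)" "app (e k) (emb v (w k)) = emb v (w k)" if "k < r" for k
      using PiE_mem[OF w, of k] that by (simp_all add: comp_space_def)
    have "emb v x = (\<Sum>k<r. emb v (w k))" unfolding xw by (rule emb_finsum) (use wk in auto)
    then have "app (e j) (emb v x) = (\<Sum>k<r. app (e j) (emb v (w k)))" by (simp only: app_sum_right)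
    also have "\<dots> = (\<Sum>k<r. if k = j then emb v (w j) else 0)"
    proof (rule sum.cong[OF refl])
      fix k assume "k \<in> {..<r}"
      then have k: "k < r" by simp
      show "app (e j) (emb v (w k)) = (if k = j then emb v (w j) else 0)"
      proof (cases "k = j")
        case True
        then show ?thesis using wk[OF j] by simp
      next
        case False
        then have "e j \<noteq> e k" using e j k unfolding bij_betw_def inj_on_def by blast
        then have "e j * e k = 0" by (rule D(6)[OF eP[OF j] eP[OF k]])
        then have "app (e j) (app (e k) (emb v (w k))) = 0" by (simp add: app_mult[symmetric])
        then show ?thesis using wk(2)[OF k] False by simp
      qed
    qed
    also have "\<dots> = emb v (w j)" using j by simp
    finally have "emb v (w j) = emb v (?u j)" using uemb[OF j] by simp
    moreover have "?u j \<in> carrier_vec (\<alpha> v)" using j by simp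
    ultimately show "w j = ?u j" using emb_eq_iff[OF wk(1)[OF j]] by blast
  qed
  show "\<exists>!u. u \<in> (\<Pi>\<^sub>E k\<in>{..<r}. comp_space (e k) v) \<and> x = finsum_vec TYPE(complex) (\<alpha> v) u {..<r}"
    by (rule ex1I[of _ ?u], rule conjI[OF uPi xu], elim conjE, rule uniq)
qed

text \<open>The summand of \<open>e\<close> contains a proper nonzero subrepresentation
  \<open>U\<close>, and \<open>p\<close> is an idempotent below \<open>e\<close> with image
  \<open>U\<close>. It need not be an endomorphism; the last clause says just that its image is
  stable under the arrows.\<close>

lemma non_simple_component:
  assumes V: "V \<in> rep_space R \<alpha>" and P: "idec (blk V) P" and e: "e \<in> P" and ns: "\<not> simple_subrep R \<alpha> V (comp_space e)"
  obtains p where "p \<in> gl" "p * p = p" "p * e = p" "e * p = p" "p \<noteq> 0" "p \<noteq> e"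
    "\<forall>b\<in>arcs R. (diag I - p) * blk V b * p = 0"
proof -
  note D = idecD[OF P]
  have egl: "e \<in> gl" using D(2) e by blast
  have ee: "app e (app e w) = app e w" for w using D(4)[OF e] by (simp add: app_mult[symmetric])
  have sub: "subrep R \<alpha> V (comp_space e)" by (rule comp_space_subrep[OF V D(5)[OF e]])
  have nz: "\<not> zero_subrep R \<alpha> (comp_space e)"
  proof
    assume z: "zero_subrep R \<alpha> (comp_space e)"
    have "e = 0"
    proof (rule fmat_eqI_cells[OF gl_on[OF egl] on_0])
      fix v u assume v: "v \<in> verts R" and u: "u \<in> funs_on (cell v)"
      have c: "app e u \<in> funs_on (cell v)" by (rule gl_app_cell[OF egl u])
      have "unemb v (app e u) \<in> comp_space e v"
        by (simp add: comp_space_def emb_unemb[OF c] ee)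
      then have "unemb v (app e u) = 0\<^sub>v (\<alpha> v)" using z v by (simp add: zero_subrep_def)
      then have "app e u = emb v (0\<^sub>v (\<alpha> v))" using emb_unemb[OF c] by simp
      then show "app e u = app 0 u" by (simp add: emb_0)
    qed
    then show False using D(3) e by simp
  qed
  obtain U where U: "subrep R \<alpha> V U" "\<forall>v\<in>verts R. U v \<subseteq> comp_space e v" "\<not> zero_subrep R \<alpha> U"
    and Une: "\<not> (\<forall>v\<in>verts R. U v = comp_space e v)"
    using ns sub nz unfolding simple_subrep_def by blast
  obtain \<pi> where \<pi>1: "\<pi> \<in> gl" "\<forall>v\<in>verts R. \<forall>x\<in>U v. app \<pi> (emb v x) = emb v x"
    "\<forall>v\<in>verts R. \<forall>u\<in>funs_on (cell v). app \<pi> u \<in> emb v ` U v"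
  proof (rule projection_onto_subrep[OF U(1)])
    fix P assume P: "P \<in> gl" "\<And>v x. v \<in> verts R \<Longrightarrow> x \<in> U v \<Longrightarrow> app P (emb v x) = emb v x"
      "\<And>v u. v \<in> verts R \<Longrightarrow> u \<in> funs_on (cell v) \<Longrightarrow> app P u \<in> emb v ` U v"
    show thesis
    proof (rule that[OF P(1)])
      show "\<forall>v\<in>verts R. \<forall>x\<in>U v. app P (emb v x) = emb v x" by (intro ballI P(2))
      show "\<forall>v\<in>verts R. \<forall>u\<in>funs_on (cell v). app P u \<in> emb v ` U v" by (intro ballI P(3))
    qed
  qed
  note \<pi> = \<pi>1(1) \<pi>1(2)[rule_format] \<pi>1(3)[rule_format]
  have eU: "app e (emb v x) = emb v x" if "v \<in> verts R" "x \<in> U v" for v x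
    using U(2) that by (auto simp: comp_space_def)
  \<comment> \<open>The factor \<open>e\<close> on the right gives p e = p; the equation e p = p
    holds because \<open>U\<close> lies in the image of \<open>e\<close>, and p is idempotent since
    both factors fix \<open>U\<close>.\<close>
  define p where "p = \<pi> * e"
  have pgl: "p \<in> gl" unfolding p_def by (rule gl_mult[OF \<pi>(1) egl])
  have range: "app p u \<in> emb v ` U v" if "v \<in> verts R" "u \<in> funs_on (cell v)" for v u
    unfolding p_def app_mult by (rule \<pi>(3)[OF that(1) gl_app_cell[OF egl that(2)]])
  have fixp: "app p (emb v x) = emb v x" if "v \<in> verts R" "x \<in> U v" for v x
    unfolding p_def app_mult eU[OF that] by (rule \<pi>(2)[OF that])
  have pp: "p * p = p"
  proof (rule fmat_eqI_cells[OF on_mult[OF gl_on[OF pgl] gl_on[OF pgl]] gl_on[OF pgl]])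
    fix v u assume v: "v \<in> verts R" and u: "u \<in> funs_on (cell v)"
    obtain y where "y \<in> U v" "app p u = emb v y" using range[OF v u] by (elim imageE)
    then show "app (p * p) u = app p u" using fixp[OF v] by (simp add: app_mult)
  qed
  have ep: "e * p = p"
  proof (rule fmat_eqI_cells[OF on_mult[OF gl_on[OF egl] gl_on[OF pgl]] gl_on[OF pgl]])
    fix v u assume v: "v \<in> verts R" and u: "u \<in> funs_on (cell v)"
    obtain y where "y \<in> U v" "app p u = emb v y" using range[OF v u] by (elim imageE)
    then show "app (e * p) u = app p u" using eU[OF v] by (simp add: app_mult)
  qed
  have pe: "p * e = p" unfolding p_def by (simp only: mult.assoc D(4)[OF e])
  have p0: "p \<noteq> 0"
  proof
    assume p0: "p = 0"
    obtain v x where vx: "v \<in> verts R" "x \<in> U v" "x \<noteq> 0\<^sub>v (\<alpha> v)" using zero_subrep_iff[OF U(1)] U(3) by blast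
    have "emb v x = emb v (0\<^sub>v (\<alpha> v))" using fixp[OF vx(1,2)] by (simp add: p0 emb_0)
    then show False using emb_eq_iff[OF subrep_carrier[OF U(1) vx(1,2)]] vx(3) by simp
  qed
  have pne: "p \<noteq> e"
  proof
    assume pe': "p = e"
    have "U v = comp_space e v" if v: "v \<in> verts R" for v
    proof
      show "U v \<subseteq> comp_space e v" using U(2) v by blast
      show "comp_space e v \<subseteq> U v"
      proof
        fix x assume "x \<in> comp_space e v"
        then have x: "x \<in> carrier_vec (\<alpha> v)" "app p (emb v x) = emb v x" by (simp_all add: comp_space_def pe')
        obtain y where y: "y \<in> U v" "emb v x = emb v y" using range[OF v emb_funs_on, of x] x(2) by auto
        then show "x \<in> U v" using emb_eq_iff[OF x(1) subrep_carrier[OF U(1) v y(1)]] by simp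
      qed
    qed
    then show False using Une by blast
  qed
  have inv: "(diag I - p) * blk V b * p = 0" if b: "b \<in> arcs R" for b
  proof (rule fmat_eqI_cells[OF _ on_0])
    have onb: "on I (blk V b)" by (rule reps_on[OF blk_reps b])
    show "on I ((diag I - p) * blk V b * p)" using gl_on[OF pgl] onb by (intro on_mult on_diff) simp_all
    fix v u assume v: "v \<in> verts R" and u: "u \<in> funs_on (cell v)"
    obtain y where y: "y \<in> U v" "app p u = emb v y" using range[OF v u] by (elim imageE)
    have yc: "y \<in> carrier_vec (\<alpha> v)" by (rule subrep_carrier[OF U(1) v y(1)])
    have "app (diag I - p) (app (blk V b) (emb v y)) = 0"
    proof (cases "v = tail R b")
      case True
      have hv: "head R b \<in> verts R" using b by simp
      have "V b *\<^sub>v y \<in> U (head R b)" using U(1) b y(1) True unfolding subrep_def by blast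
      then have "app p (emb (head R b) (V b *\<^sub>v y)) = emb (head R b) (V b *\<^sub>v y)" by (rule fixp[OF hv])
      moreover have "app (blk V b) (emb v y) = emb (head R b) (V b *\<^sub>v y)"
        unfolding True by (rule app_blk_emb[OF V b yc[unfolded True]])
      moreover have "app (diag I) (emb (head R b) (V b *\<^sub>v y)) = emb (head R b) (V b *\<^sub>v y)"
        by (rule app_diag_funs_on[OF finite_I funs_on_mono[OF cell_subset_I[OF hv] emb_funs_on]])
      ultimately show ?thesis by (simp add: app_diff)
    next
      case False
      have "app (blk V b) (emb v y) = 0" by (rule reps_app_other[OF blk_reps b emb_funs_on False])
      then show ?thesis by simp
    qed
    then show "app ((diag I - p) * blk V b * p) u = app 0 u" by (simp add: app_mult y(2))
  qed
  show ?thesis by (rule that[OF pgl pp pe ep p0 pne ballI[OF inv]])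
qed

end

context preproj
begin

section \<open>One-parameter degenerations and semisimple representations over a point\<close>

lemma coords_unblk: "z \<in> preproj_coords Q \<alpha> \<Longrightarrow> coords_of (unblk X) z = coords_fm X z"
  by (auto simp: rep_coords_def coords_of_def coords_fm_def unblk_def)

text \<open>Conjugating by \<open>t p + (1 - p)\<close> and letting \<open>t\<close> tend to \<open>0\<close>.\<close>

lemma degeneration:
  assumes V: "V \<in> preproj_reps Q \<alpha>" and p: "p \<in> gl" "p * p = p"
    and inv: "\<And>b. b \<in> arcs (double_quiver Q) \<Longrightarrow> (diag I - p) * blk V b * p = 0"
    and X': "X' = (\<lambda>b. p * blk V b * p + (diag I - p) * blk V b * (diag I - p))"
  shows "X' \<in> reps" "unblk X' \<in> preproj_reps Q \<alpha>" "preproj_proj Q \<alpha> (unblk X') = preproj_proj Q \<alpha> V"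
proof -
  let ?r = "diag I - p" and ?X = "blk V"
  have X: "?X \<in> reps" by (rule blk_reps)
  have rgl: "?r \<in> gl" using p(1) by (intro gl_diff gl_diag) simp_all
  have onp: "on I p" by (rule gl_on[OF p(1)])
  have pr: "p * ?r = 0" "?r * p = 0" "?r * ?r = ?r" "p + ?r = diag I"
    using onp p(2) by (simp_all add: left_diff_distrib right_diff_distrib)
  show X'r: "X' \<in> reps"
    unfolding X' by (rule reps_add[OF reps_conj[OF p(1) p(1) X] reps_conj[OF rgl rgl X]])
  have mult: "X' b * X' c = p * (?X b * ?X c) * p + ?r * (?X b * ?X c) * ?r"
    if "b \<in> arcs (double_quiver Q)" "c \<in> arcs (double_quiver Q)" for b c
    unfolding X'
    by (rule degenerate_mult[OF finite_I reps_on[OF X that(1)] p(2) pr(3,1,2,4) inv[OF that(1)] inv[OF that(2)]])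
  have a: "Inl a \<in> arcs (double_quiver Q)" "Inr a \<in> arcs (double_quiver Q)" if "a \<in> arcs Q" for a using that by auto
  have "mu X' = p * mu ?X * p + ?r * mu ?X * ?r"
    unfolding mu_def sum_distrib_left sum_distrib_right sum.distrib[symmetric]
    by (rule sum.cong[OF refl])
      (simp only: mult[OF a] mult[OF a(2) a(1)] right_diff_distrib[where a = p] right_diff_distrib[where a = ?r] left_diff_distrib[where c = p] left_diff_distrib[where c = ?r] add_diff_add)
  also have "mu ?X = 0" using V preproj_reps_iff[OF preproj_reps_rep_space[OF V]] by simp
  finally have "mu X' = 0" by simp
  moreover have "mu (blk (unblk X')) = mu X'" by (rule mu_cong) (rule blk_unblk[OF X'r])
  ultimately show M: "unblk X' \<in> preproj_reps Q \<alpha>" using preproj_reps_iff[OF unblk_rep_space] by simp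
  have "poly_eval id (coords_of (unblk X')) f = poly_eval id (coords_of V) f" if f: "f \<in> preproj_invariants Q \<alpha>" for f
  proof -
    have ring: "f \<in> poly_ring (preproj_coords Q \<alpha>)" using f by (simp add: preproj_invariants_def)
    let ?Y = "\<lambda>b. p * ?X b * ?r"
    let ?l = "line (coords_fm X') (coords_fm ?Y) f" and ?c = "poly_eval id (coords_of V) f"
    have ev: "poly ?l t = ?c" if t: "t \<noteq> 0" for t
    proof -
      let ?\<theta> = "smul t p + ?r" and ?\<theta>' = "smul (1 / t) p + ?r"
      have \<theta>: "?\<theta> \<in> gl" "?\<theta>' \<in> gl" using p(1) rgl by (simp_all add: gl_add gl_smul)
      have \<theta>1: "?\<theta> * ?\<theta>' = diag I" "?\<theta>' * ?\<theta> = diag I"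
        unfolding distrib_left distrib_right smul_mult_left smul_mult_right smul_smul pr p(2)
        using t pr(4) smul_0 by (simp_all add: smul_zero_right smul_smul)
      have "coords_fm (\<lambda>b. ?\<theta> * ?X b * ?\<theta>') z = coords_fm X' z + t * coords_fm ?Y z" if z: "z \<in> preproj_coords Q \<alpha>" for z :: "('a + 'a) coord"
      proof -
        obtain b i j where eq: "z = (b, i, j)" by (rule prod_cases3)
        have b: "b \<in> arcs (double_quiver Q)" using z by (simp add: eq rep_coords_def)
        \<comment> \<open>Of the four blocks of the conjugate, only (1 - p) X p carries the factor
          1/t. It vanishes by \<open>inv\<close>, so the conjugate is a line in t without a pole at
          0.\<close>
        have "?\<theta> * ?X b * ?\<theta>' = smul (t * (1 / t)) (p * ?X b * p) + smul t (p * ?X b * ?r) + smul (1 / t) (?r * ?X b * p) + ?r * ?X b * ?r"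
          unfolding distrib_left distrib_right smul_mult_left smul_mult_right smul_smul by (simp only: smul_add smul_smul add_ac mult.commute)
        also have "\<dots> = X' b + smul t (?Y b)"
          unfolding inv[OF b] X' using t by (simp add: smul_zero_right)
        finally show ?thesis by (simp add: eq coords_fm_def)
      qed
      then have "poly ?l t = poly_eval id (coords_fm (\<lambda>b. ?\<theta> * ?X b * ?\<theta>')) f"
        unfolding poly_line by (intro poly_eval_cong[OF ring]) simp
      also have "\<dots> = ?c" by (rule orbit_invariant[OF V f \<theta> \<theta>1])
      finally show ?thesis .
    qed
    \<comment> \<open>Two polynomials in t that agree for all t other than 0 are equal; at t = 0 the
      line passes through \<open>X'\<close>.\<close>
    have "?l = [:?c:]"
    proof (rule ccontr)
      assume "?l \<noteq> [:?c:]"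
      then have "finite {t. poly (?l - [:?c:]) t = 0}" by (intro poly_roots_finite) simp
      moreover have "UNIV - {0} \<subseteq> {t. poly (?l - [:?c:]) t = 0}" using ev by auto
      ultimately have "finite (UNIV - {0 :: complex})" by (rule finite_subset[rotated])
      then show False by (simp add: infinite_UNIV_char_0)
    qed
    then have "poly ?l 0 = ?c" by simp
    then have "poly_eval id (coords_fm X') f = ?c" by (simp add: poly_line)
    moreover have "poly_eval id (coords_of (unblk X')) f = poly_eval id (coords_fm X') f"
      by (rule poly_eval_cong[OF ring coords_unblk])
    ultimately show ?thesis by simp
  qed
  then show "preproj_proj Q \<alpha> (unblk X') = preproj_proj Q \<alpha> V"
    unfolding preproj_proj_def by (intro restrict_ext) simp
qed

lemma idec_cong: "(\<And>b. b \<in> arcs (double_quiver Q) \<Longrightarrow> X b = Y b) \<Longrightarrow> idec X P = idec Y P"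
  unfolding idec_def commute_def by simp

lemma exists_semisimple_over:
  assumes V: "V \<in> preproj_reps Q \<alpha>" and ne: "I \<noteq> {}"
  obtains M where "corresponding_semisimple Q \<alpha> (preproj_proj Q \<alpha> V) M"
proof -
  let ?T = "\<lambda>x. fst x \<in> preproj_reps Q \<alpha> \<and> preproj_proj Q \<alpha> (fst x) = preproj_proj Q \<alpha> V \<and> idec (blk (fst x)) (snd x)"
  \<comment> \<open>The search starts from the decomposition with the single idempotent
    \<open>diag I\<close>. It is admissible only when \<open>diag I\<close> is nonzero, because
    \<open>idec\<close> excludes 0.\<close>
  have "diag I \<noteq> (0 :: ('v \<times> nat, complex) fmat)"
  proof
    assume z: "diag I = (0 :: ('v \<times> nat, complex) fmat)"
    obtain q where "q \<in> I" using ne by (meson ex_in_conv)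
    then have "ent (diag I :: ('v \<times> nat, complex) fmat) q q = 1" by (simp add: ent_diag)
    then show False by (simp add: z)
  qed
  moreover have "commute (diag I) (blk V)"
    unfolding commute_def
  proof
    fix b assume "b \<in> arcs (double_quiver Q)"
    then have "on I (blk V b)" by (rule reps_on[OF blk_reps])
    then show "diag I * blk V b = blk V b * diag I" by simp
  qed
  ultimately have "idec (blk V) {diag I}"
    by (simp add: idec_def diag_mult_diag)
  then have "?T (V, {diag I})" using V by simp
  moreover have "\<forall>x. ?T x \<longrightarrow> card (snd x) < Suc (card I)" using idec_card by (auto simp: less_Suc_eq_le)
  ultimately have "\<exists>x. ?T x \<and> (\<forall>y. ?T y \<longrightarrow> card (snd y) \<le> card (snd x))"
    by (rule ex_has_greatest_nat)
  then obtain x where x: "?T x" "\<And>y. ?T y \<Longrightarrow> card (snd y) \<le> card (snd x)" by blast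
  define M P where "M = fst x" and "P = snd x"
  have M: "M \<in> preproj_reps Q \<alpha>" "preproj_proj Q \<alpha> M = preproj_proj Q \<alpha> V" and P: "idec (blk M) P"
    using x(1) by (simp_all add: M_def P_def)
  have VM: "M \<in> rep_space (double_quiver Q) \<alpha>" by (rule preproj_reps_rep_space[OF M(1)])
  have simple: "simple_subrep (double_quiver Q) \<alpha> M (comp_space e)" if e: "e \<in> P" for e
  proof (rule ccontr)
    assume "\<not> ?thesis"
    then obtain p where p: "p \<in> gl" "p * p = p" "p * e = p" "e * p = p" "p \<noteq> 0" "p \<noteq> e"
      and inv: "\<forall>b\<in>arcs (double_quiver Q). (diag I - p) * blk M b * p = 0"
      by (rule non_simple_component[OF VM P e])
    define X' where "X' = (\<lambda>b. p * blk M b * p + (diag I - p) * blk M b * (diag I - p))"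
    note deg = degeneration[OF M(1) p(1,2) bspec[OF inv] X'_def]
    have X'b: "X' b = p * blk M b * p + (diag I - p) * blk M b * (diag I - p)" for b by (simp add: X'_def)
    let ?P = "insert p (insert (e - p) (P - {e}))"
    note split = idec_split[OF P e p blk_reps X'b]
    have "idec (blk (unblk X')) ?P = idec X' ?P" by (rule idec_cong) (rule blk_unblk[OF deg(1)])
    then have "?T (unblk X', ?P)" using deg(2,3) M(2) split(1) by simp
    from x(2)[OF this] show False using split(2) by (simp add: P_def)
  qed
  obtain e where e: "bij_betw e {..<card P} P"
    using ex_bij_betw_nat_finite[OF idecD(1)[OF P]] by (auto simp: atLeast0LessThan)
  have "semisimple_rep (double_quiver Q) \<alpha> M"
    unfolding semisimple_rep_def
  proof (intro exI conjI allI impI)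
    show "direct_sum_decomp (double_quiver Q) \<alpha> M (card P) (\<lambda>k. comp_space (e k))"
      by (rule idec_direct_sum[OF VM P e])
    show "simple_subrep (double_quiver Q) \<alpha> M (comp_space (e k))" if "k < card P" for k
      by (rule simple) (use e that in \<open>auto simp: bij_betw_def\<close>)
  qed
  then show ?thesis using that[of M] M by (simp add: corresponding_semisimple_def)
qed

end

theorem theorem6p3:
  fixes Q :: "('v, 'a) pre_digraph"
    and \<alpha> :: "'v \<Rightarrow> nat"
  assumes "fin_digraph Q"
    and "\<alpha> \<in> S_zero Q"
  shows "(\<forall>\<xi>\<in>preproj_iss Q \<alpha>. \<forall>M. corresponding_semisimple Q \<alpha> \<xi> M \<longrightarrow>
            (\<xi> \<in> smooth_locus Q \<alpha> \<longleftrightarrow> simple_rep (double_quiver Q) \<alpha> M))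
       \<and> smooth_locus Q \<alpha> = azumaya_locus Q \<alpha>"
proof -
  interpret preproj Q \<alpha> by (rule preproj.intro) (rule assms(1))
  obtain v where "v \<in> verts Q" "\<alpha> v \<noteq> 0" using S_zero_support[OF assms(2)] by (elim bexE)
  then have ne: "I \<noteq> {}" using nonempty_I[of v] by simp
  have part1: "\<xi> \<in> smooth_locus Q \<alpha> \<longleftrightarrow> simple_rep (double_quiver Q) \<alpha> M"
    if \<xi>: "\<xi> \<in> preproj_iss Q \<alpha>" and M: "corresponding_semisimple Q \<alpha> \<xi> M" for \<xi> M
  proof
    have M': "M \<in> preproj_reps Q \<alpha>" "semisimple_rep (double_quiver Q) \<alpha> M" "preproj_proj Q \<alpha> M = \<xi>"
      using M by (simp_all add: corresponding_semisimple_def)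
    show "simple_rep (double_quiver Q) \<alpha> M" if "\<xi> \<in> smooth_locus Q \<alpha>"
      using that M' by (intro smooth_semisimple_simple[OF assms(2) M'(1,2)]) (simp add: smooth_locus_def)
    assume simple: "simple_rep (double_quiver Q) \<alpha> M"
    show "\<xi> \<in> smooth_locus Q \<alpha>"
      unfolding smooth_locus_def
    proof (intro CollectI conjI ballI impI \<xi>)
      \<comment> \<open>Smoothness is asked for at every representation over \<xi>, not only at
        \<open>M\<close>. Each of them is simple by \<open>over_simple\<close>, and therefore a
        smooth point.\<close>
      fix V assume V: "V \<in> preproj_reps Q \<alpha>" "preproj_proj Q \<alpha> V = \<xi>"
      show "scheme_smooth_at (preproj_coords Q \<alpha>) (preproj_ideal Q \<alpha>) (coords_of V)"
        by (rule simple_smooth[OF V(1) over_simple[OF V(1) M'(1) simple]]) (simp add: V(2) M'(3))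
    qed
  qed
  moreover have "smooth_locus Q \<alpha> = azumaya_locus Q \<alpha>"
  proof
    show "smooth_locus Q \<alpha> \<subseteq> azumaya_locus Q \<alpha>"
      using part1 unfolding azumaya_locus_def by (auto simp: smooth_locus_def)
    show "azumaya_locus Q \<alpha> \<subseteq> smooth_locus Q \<alpha>"
    proof
      fix \<xi> assume \<xi>: "\<xi> \<in> azumaya_locus Q \<alpha>"
      then have iss: "\<xi> \<in> preproj_iss Q \<alpha>" by (simp add: azumaya_locus_def)
      show "\<xi> \<in> smooth_locus Q \<alpha>"
      proof (cases "\<exists>V\<in>preproj_reps Q \<alpha>. preproj_proj Q \<alpha> V = \<xi>")
        case True
        then obtain V where V: "V \<in> preproj_reps Q \<alpha>" "preproj_proj Q \<alpha> V = \<xi>" by (elim bexE)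
        obtain M where M: "corresponding_semisimple Q \<alpha> (preproj_proj Q \<alpha> V) M"
          by (rule exists_semisimple_over[OF V(1) ne])
        then have M: "corresponding_semisimple Q \<alpha> \<xi> M" by (simp only: V(2))
        then have "simple_rep (double_quiver Q) \<alpha> M" using \<xi> by (simp add: azumaya_locus_def)
        then show ?thesis using part1[OF iss M] by simp
      next
        case False
        \<comment> \<open>If no representation lies over \<xi>, the condition of
          \<open>smooth_locus\<close> is vacuous and \<xi> belongs to it.\<close>
        then show ?thesis using iss by (auto simp: smooth_locus_def)
      qed
    qed
  qed
  ultimately show ?thesis by blast
qed

end
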